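(* For $N\ge 1$ let $Q_N^{(0)}$ be the set of triples $a=(a_1,a_2,a_3)$ of positive integers with $a_j\le N$ for $j=1,2,3$, $\gcd(a_1,a_2,a_3)=1$ and $\gcd(a_1,a_3)=1$. For $a\in Q_N^{(0)}$ let $a_{12}$ be the integer with $0\le a_{12}<a_3$ and $a_{12}\equiv a_1^{-1}a_2\pmod{a_3}$ (where $a_1^{-1}$ is the inverse of $a_1$ modulo $a_3$), and put $\rho=a_{12}/a_3$, with continued fraction $\rho=[h_1,h_2,\dots,h_{s_0}]$ ($h_j\ge1$ integers), convergent denominators $q_{-1}=0$, $q_0=1$, $q_s=h_sq_{s-1}+q_{s-2}$, and let $s_1$ be the index with $q_{s_1-1}<\sqrt N<q_{s_1}$. Fix $l\ge1$ and positive integers $h_1^*,\dots,h_l^*$, and consider the uniform probability measure on the set of $a\in Q_N^{(0)}$ for which $h_j=h_j^*$ for $1\le j\le l$. Then for every fixed $k>0$, as $N\to\infty$ the joint distribution of $\big(q_{s_1}/\sqrt N,\,h_{s_1-k},\dots,h_{s_1+k}\big)$ under this conditional measure converges to the limit $\mu_k$ described in the context (the same limit as without conditioning).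
   Context: Gauss measure: the probability measure on $(0,1)$ with density $\frac{1}{\ln 2\,(1+x)}$. For $\rho\in(0,1)$ with continued fraction $\rho=[h_1,h_2,\dots]$ and denominators $q_s$, and for $R>0$, let $s(R)$ be the smallest $s$ with $q_s\ge R$. For $\rho$ distributed according to the Gauss measure, the joint distribution of $\big(q_{s(R)}/R,\,h_{s(R)-k},\dots,h_{s(R)+k}\big)$ converges as $R\to\infty$ to a limiting probability distribution, denoted $\mu_k$. *)

theory Defs
  imports "HOL-Probability.Probability" "HOL-Number_Theory.Modular_Inverse"
begin

text \<open>
  \<open>cf_digit x j\<close> is the digit \<open>h_j\<close> of \<open>x = [h_1, h_2, \<dots>]\<close>, for \<open>0 \<le> x < 1\<close>. Since \<open>1 / 0 = 0\<close>,
  the Gauss map fixes \<open>0\<close>; hence \<open>cf_digit x j = 0\<close> for \<open>j \<ge> 1\<close> holds exactly when the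
  expansion of \<open>x\<close> has fewer than \<open>j\<close> digits. For rational \<open>x\<close> the resulting expansion is the
  one produced by the Euclidean algorithm, whose last digit is at least \<open>2\<close>.
\<close>

definition gauss_map :: "real \<Rightarrow> real"
  where "gauss_map x = frac (1 / x)"

fun cf_digit :: "real \<Rightarrow> nat \<Rightarrow> nat" where
  "cf_digit x 0 = 0"
| "cf_digit x (Suc j) = nat \<lfloor>1 / (gauss_map ^^ j) x\<rfloor>"

text \<open>The second equation is the recursion with \<open>q_{-1} = 0\<close>.\<close>

fun cf_denom :: "real \<Rightarrow> nat \<Rightarrow> nat" where
  "cf_denom x 0 = 1"
| "cf_denom x (Suc 0) = cf_digit x 1"
| "cf_denom x (Suc (Suc s)) = cf_digit x (Suc (Suc s)) * cf_denom x (Suc s) + cf_denom x s"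

text \<open>
  The vector \<open>(q_s / R, h_{s-k}, \<dots>, h_{s+k})\<close>. The digits are stored as a function of the
  offset in \<open>{-k..k}\<close>, extended by \<open>0\<close>; a digit whose index is less than \<open>1\<close> or exceeds the
  length of the expansion is also recorded as \<open>0\<close>, which is never a genuine digit.
\<close>

definition cf_window :: "nat \<Rightarrow> real \<Rightarrow> nat \<Rightarrow> int \<Rightarrow> nat"
  where "cf_window k x s = (\<lambda>i. if \<bar>i\<bar> \<le> int k then cf_digit x (nat (int s + i)) else 0)"

definition cf_local :: "nat \<Rightarrow> real \<Rightarrow> real \<Rightarrow> nat \<Rightarrow> real \<times> (int \<Rightarrow> nat)"
  where "cf_local k R x s = (real (cf_denom x s) / R, cf_window k x s)"

text \<open>
  Weak convergence of Borel measures. On \<open>real \<times> (int \<Rightarrow> nat)\<close> the topology is the product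
  topology with \<open>nat\<close> discrete, so that the functions vanishing outside \<open>{-k..k}\<close> form a closed
  subspace homeomorphic to the product of the real line and \<open>2 * k + 1\<close> copies of \<open>nat\<close>.
\<close>

definition weakly_converges ::
    "('i \<Rightarrow> 'a::topological_space measure) \<Rightarrow> 'a measure \<Rightarrow> 'i filter \<Rightarrow> bool"
  where "weakly_converges Ms M F \<longleftrightarrow>
    (\<forall>f :: 'a \<Rightarrow> real. continuous_on UNIV f \<longrightarrow> bounded (range f) \<longrightarrow>
       ((\<lambda>i. integral\<^sup>L (Ms i) f) \<longlongrightarrow> integral\<^sup>L M f) F)"

definition gauss_measure :: "real measure"
  where "gauss_measure = density lborel (\<lambda>x. ennreal (indicator {0<..<1} x / (ln 2 * (1 + x))))"

definition renewal_index :: "real \<Rightarrow> real \<Rightarrow> nat"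
  where "renewal_index R x = (LEAST s. real (cf_denom x s) \<ge> R)"

definition gauss_law :: "nat \<Rightarrow> real \<Rightarrow> (real \<times> (int \<Rightarrow> nat)) measure"
  where "gauss_law k R =
    distr gauss_measure borel (\<lambda>x. cf_local k R x (renewal_index R x))"

text \<open>
  The limiting distribution \<open>\<mu>_k\<close>. Weak limits of Borel probability measures on this (Polish) space
  are unique, so the description is definite as soon as a limit exists.
\<close>

definition limit_law :: "nat \<Rightarrow> (real \<times> (int \<Rightarrow> nat)) measure"
  where "limit_law k =
    (THE M. prob_space M \<and> sets M = sets borel \<and> weakly_converges (gauss_law k) M at_top)"

definition Q0 :: "nat \<Rightarrow> (int \<times> int \<times> int) set"
  where "Q0 N = {(a1, a2, a3). a1 \<in> {1..int N} \<and> a2 \<in> {1..int N} \<and> a3 \<in> {1..int N} \<and>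
                   Gcd {a1, a2, a3} = 1 \<and> gcd a1 a3 = 1}"

fun rho :: "int \<times> int \<times> int \<Rightarrow> real" where
  "rho (a1, a2, a3) = real_of_int ((modular_inverse a3 a1 * a2) mod a3) / real_of_int a3"

text \<open>
  \<open>is_crossing R x s\<close>: the index \<open>s\<close> lies within the expansion of \<open>x\<close> and
  \<open>q_{s-1} < R < q_s\<close>. For \<open>R \<ge> 1\<close> the index \<open>s = 0\<close> is impossible because \<open>q_0 = 1\<close>.
\<close>

definition is_crossing :: "real \<Rightarrow> real \<Rightarrow> nat \<Rightarrow> bool"
  where "is_crossing R x s \<longleftrightarrow> s \<ge> 1 \<and> cf_digit x s \<ge> 1 \<and>
    real (cf_denom x (s - 1)) < R \<and> R < real (cf_denom x s)"

text \<open>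
  A crossing index need not exist (all \<open>q_s\<close> may be less than \<open>R\<close>, or some \<open>q_s\<close> may equal \<open>R\<close>); the
  value is then a vector without genuine digits.
\<close>

definition triple_local :: "nat \<Rightarrow> nat \<Rightarrow> int \<times> int \<times> int \<Rightarrow> real \<times> (int \<Rightarrow> nat)"
  where "triple_local k N a =
    (if \<exists>s. is_crossing (sqrt (real N)) (rho a) s
     then cf_local k (sqrt (real N)) (rho a) (THE s. is_crossing (sqrt (real N)) (rho a) s)
     else (0, \<lambda>_. 0))"

definition Q0_cond :: "nat \<Rightarrow> nat \<Rightarrow> (nat \<Rightarrow> nat) \<Rightarrow> (int \<times> int \<times> int) set"
  where "Q0_cond N l h = {a \<in> Q0 N. \<forall>j\<in>{1..l}. cf_digit (rho a) j = h j}"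

definition cond_law :: "nat \<Rightarrow> nat \<Rightarrow> (nat \<Rightarrow> nat) \<Rightarrow> nat \<Rightarrow> (real \<times> (int \<Rightarrow> nat)) measure"
  where "cond_law k l h N = distr (uniform_count_measure (Q0_cond N l h)) borel (triple_local k N)"

end

theory Submission
  imports Defs
begin

text \<open>
  Fix the digits \<open>w\<close> of \<open>\<rho>\<close> up to the crossing index \<open>s\<close> and put \<open>m = a\<^sub>1\<^sub>2\<close>. In the basis \<open>(q\<^sub>s, p\<^sub>s)\<close>,
  \<open>(q\<^sub>s\<^sub>-\<^sub>1, p\<^sub>s\<^sub>-\<^sub>1)\<close> of \<open>\<int>\<^sup>2\<close> the vectors \<open>(a\<^sub>3, m)\<close> and \<open>(a\<^sub>1, (a\<^sub>1 m - a\<^sub>2) / a\<^sub>3)\<close> have integer coordinates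
  \<open>(u, v)\<close> and \<open>(s, t)\<close>, and \<open>a\<^sub>2\<close> is, up to a sign given by the parity of \<open>s\<close>, their determinant. So
  an event for the triple becomes a region for the six numbers \<open>q\<^sub>s\<^sub>-\<^sub>1, q\<^sub>s, u, v, s, t\<close>, scaled by
  \<open>\<surd>N\<close>, together with the condition that \<open>a\<^sub>1\<close> and \<open>a\<^sub>3\<close> are coprime. The words \<open>w\<close> whose cylinder lies
  in an interval \<open>J\<close> have the pairs \<open>(q\<^sub>s\<^sub>-\<^sub>1, q\<^sub>s) / \<surd>N\<close> distributed with density \<open>6 / \<pi>\<^sup>2 \<cdot> |J|\<close>
  for each parity, independently of where \<open>J\<close> lies; this is the independence that makes the
  conditioning on the first digits irrelevant. Coprimality is replaced by coprimality modulo
  \<open>P!\<close>, because common divisors greater than \<open>P\<close> contribute \<open>O(N\<^sup>3 / P)\<close> triples.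

  The same count of words shows that the laws under the Gauss measure converge to an explicit
  measure. In both cases it is enough to bound every event from below: the total mass is known, so
  no event can exceed its share in the limit.
\<close>

section \<open>Lower semicontinuity and counting in boxes\<close>

text \<open>By the determinant relation, \<open>q\<^sub>s\<^sub>-\<^sub>1\<close> is up to sign the
  inverse of \<open>p\<^sub>s\<close> modulo \<open>q\<^sub>s\<close>. Its joint distribution with
  \<open>q\<^sub>s\<close> and \<open>p\<^sub>s / q\<^sub>s\<close> is thus a question about modular
  inverses, of the kind usually settled by Kloosterman sums. The elementary way taken here looks at
  the last digit \<open>h\<^sub>s\<close>. If it is at least \<open>D\<close>, the rest of the word
  is given by the coprime pair \<open>(p\<^sub>s\<^sub>-\<^sub>1, q\<^sub>s\<^sub>-\<^sub>1)\<close>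
  and a parity, and \<open>q\<^sub>s\<^sub>-\<^sub>2\<close> merely shifts the interval of
  admissible \<open>h\<^sub>s\<close>; rounding costs one digit for each of
  \<open>O((R / D)^2)\<close> pairs. If it is less than \<open>D\<close>, an area-preserving linear
  map removes it and the same question arises for the shorter word. After \<open>K\<close> removals
  a part of size \<open>(1 - 1 / D)^K\<close> is untreated and the rounding adds up to
  \<open>O(K / D^2)\<close>; both vanish for \<open>D = d^2\<close>, \<open>K = d^3\<close>. All
  losses have the same sign, hence the lower bounds and Fatou's lemma throughout. Two exact masses,
  \<open>state_measure_prob\<close> and \<open>coprime_ratio_tendsto\<close>, exclude that anything
  is lost.\<close>

lemma nn_integral_cells:
  assumes c: "c \<in> measurable M (count_space A)" and A: "countable A"
  shows "(\<integral>\<^sup>+x. w (c x) \<partial>M) = (\<integral>\<^sup>+a. w a * emeasure M (c -` {a} \<inter> space M) \<partial>count_space A)"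
proof -
  have "distr M (count_space A) c = density (count_space A) (\<lambda>a. emeasure M (c -` {a} \<inter> space M))"
    by (rule density_discrete[symmetric]) (use A c in \<open>auto simp: emeasure_distr\<close>)
  then have "(\<integral>\<^sup>+x. w (c x) \<partial>M)
      = (\<integral>\<^sup>+a. w a \<partial>density (count_space A) (\<lambda>a. emeasure M (c -` {a} \<inter> space M)))"
    using nn_integral_distr[OF c, of w] by simp
  also have "\<dots> = (\<integral>\<^sup>+a. w a * emeasure M (c -` {a} \<inter> space M) \<partial>count_space A)"
    by (subst nn_integral_density) (auto simp: mult.commute)
  finally show ?thesis .
qed

lemma liminf_cmult_ennreal_le:
  fixes w :: ennreal
  shows "w * liminf f \<le> liminf (\<lambda>i. w * f i)"
proof -
  have "w * (INF m\<in>{n..}. f m) \<le> (INF m\<in>{n..}. w * f m)" for n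
    by (intro INF_greatest mult_left_mono INF_lower) auto
  then show ?thesis
    unfolding liminf_SUP_INF by (subst SUP_mult_left_ennreal) (intro SUP_mono, auto)
qed

text \<open>On each cell \<open>f\<close> is replaced by its infimum, which turns the integral into
  a weighted sum of cell masses; Fatou's lemma over the countable set of cells gives the bound, even
  if mass escapes. Refinement makes these minorants increase, and by the last hypothesis their
  supremum dominates \<open>f\<close> almost everywhere.\<close>

proposition nn_integral_le_liminf_cells:
  fixes \<mu> :: "'a measure" and c :: "nat \<Rightarrow> 'a \<Rightarrow> 'c" and f :: "'a \<Rightarrow> ennreal"
  assumes sets: "\<And>i. sets (\<nu> i) = sets \<mu>"
    and A: "countable A" and c: "\<And>j. c j \<in> measurable \<mu> (count_space A)"
    and refine: "\<And>j x y. c (Suc j) x = c (Suc j) y \<Longrightarrow> c j x = c j y"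
    and low: "\<And>j a. a \<in> A \<Longrightarrow> emeasure \<mu> (c j -` {a} \<inter> space \<mu>)
                \<le> liminf (\<lambda>i. emeasure (\<nu> i) (c j -` {a} \<inter> space \<mu>))"
    and lsc: "AE x in \<mu>. f x \<le> (SUP j. INF y\<in>{y\<in>space \<mu>. c j y = c j x}. f y)"
  shows "(\<integral>\<^sup>+x. f x \<partial>\<mu>) \<le> liminf (\<lambda>i. \<integral>\<^sup>+x. f x \<partial>\<nu> i)"
proof -
  define w where "w j a = (INF y\<in>{y\<in>space \<mu>. c j y = a}. f y)" for j a
  have space: "space (\<nu> i) = space \<mu>" for i
    using sets by (rule sets_eq_imp_space_eq)
  have c': "c j \<in> measurable (\<nu> i) (count_space A)" for i j
    using c[of j] measurable_cong_sets[OF sets refl] by blast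
  have wc: "(\<lambda>x. w j (c j x)) \<in> borel_measurable \<mu>" for j
    using measurable_compose[OF c, of "w j" borel] by simp
  have "(\<integral>\<^sup>+x. w j (c j x) \<partial>\<mu>) \<le> liminf (\<lambda>i. \<integral>\<^sup>+x. f x \<partial>\<nu> i)" for j
  proof -
    have "(\<integral>\<^sup>+x. w j (c j x) \<partial>\<mu>) = (\<integral>\<^sup>+a. w j a * emeasure \<mu> (c j -` {a} \<inter> space \<mu>) \<partial>count_space A)"
      by (rule nn_integral_cells[OF c A])
    also have "\<dots> \<le> (\<integral>\<^sup>+a. liminf (\<lambda>i. w j a * emeasure (\<nu> i) (c j -` {a} \<inter> space \<mu>)) \<partial>count_space A)"
      by (intro nn_integral_mono order_trans[OF mult_left_mono[OF low] liminf_cmult_ennreal_le]) auto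
    also have "\<dots> \<le> liminf (\<lambda>i. \<integral>\<^sup>+a. w j a * emeasure (\<nu> i) (c j -` {a} \<inter> space \<mu>) \<partial>count_space A)"
      by (rule nn_integral_liminf) auto
    also have "\<dots> = liminf (\<lambda>i. \<integral>\<^sup>+x. w j (c j x) \<partial>\<nu> i)"
      using nn_integral_cells[OF c' A] by (simp add: space)
    also have "\<dots> \<le> liminf (\<lambda>i. \<integral>\<^sup>+x. f x \<partial>\<nu> i)"
      unfolding w_def
      by (intro Liminf_mono always_eventually allI nn_integral_mono INF_lower) (auto simp: space)
    finally show ?thesis .
  qed
  moreover have "(\<integral>\<^sup>+x. f x \<partial>\<mu>) \<le> (\<integral>\<^sup>+x. (SUP j. w j (c j x)) \<partial>\<mu>)"
    using lsc by (intro nn_integral_mono_AE) (auto simp: w_def)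
  moreover have "(\<integral>\<^sup>+x. (SUP j. w j (c j x)) \<partial>\<mu>) = (SUP j. \<integral>\<^sup>+x. w j (c j x) \<partial>\<mu>)"
  proof (rule nn_integral_monotone_convergence_SUP)
    show "incseq (\<lambda>j x. w j (c j x))"
      unfolding incseq_Suc_iff le_fun_def w_def by (intro allI INF_superset_mono) (auto dest: refine)
  qed (rule wc)
  ultimately show ?thesis
    by (metis (mono_tags, lifting) SUP_least order_trans)
qed

section \<open>Lower semicontinuous integrands and dyadic cubes\<close>

definition lsc :: "('a::topological_space \<Rightarrow> ennreal) \<Rightarrow> bool"
  where "lsc f \<longleftrightarrow> (\<forall>y x. y \<longlonglongrightarrow> x \<longrightarrow> f x \<le> liminf (\<lambda>n. f (y n)))"

text \<open>Outside \<open>U\<close> the function has its least possible value 0, so nothing has to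
  be checked at the boundary, where \<open>g\<close> may be unbounded.\<close>

lemma lsc_on_open:
  fixes g :: "'a::t2_space \<Rightarrow> real"
  assumes "open U" and g: "continuous_on U g"
  shows "lsc (\<lambda>x. indicator U x * ennreal (g x))"
  unfolding lsc_def
proof (intro allI impI)
  fix y x assume y: "y \<longlonglongrightarrow> (x::'a)"
  show "indicator U x * ennreal (g x) \<le> liminf (\<lambda>n. indicator U (y n) * ennreal (g (y n)))"
  proof (cases "x \<in> U")
    case True
    then have ev: "\<forall>\<^sub>F n in sequentially. y n \<in> U"
      using y \<open>open U\<close> by (simp add: topological_tendstoD)
    have "isCont g x"
      using g True \<open>open U\<close> by (simp add: continuous_on_eq_continuous_at)
    then have "(\<lambda>n. ennreal (g (y n))) \<longlonglongrightarrow> ennreal (g x)"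
      using y by (intro tendsto_ennrealI) (rule isCont_tendsto_compose)
    then have "(\<lambda>n. indicator U (y n) * ennreal (g (y n))) \<longlonglongrightarrow> ennreal (g x)"
      by (rule Lim_transform_eventually) (use ev in \<open>auto elim: eventually_mono\<close>)
    then have "liminf (\<lambda>n. indicator U (y n) * ennreal (g (y n))) = ennreal (g x)"
      by (intro lim_imp_Liminf) auto
    with True show ?thesis by simp
  qed auto
qed

text \<open>Fatou's lemma in the integration variable; it applies because \<open>lsc\<close> is
  phrased with sequences.\<close>

lemma lsc_nn_integral:
  fixes h :: "'a::topological_space \<Rightarrow> real \<Rightarrow> ennreal"
  assumes h: "lsc (\<lambda>(x, t). h x t)" and meas: "\<And>x. h x \<in> borel_measurable borel"
  shows "lsc (\<lambda>x. \<integral>\<^sup>+t. h x t \<partial>lborel)"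
  unfolding lsc_def
proof (intro allI impI)
  fix y x assume y: "y \<longlonglongrightarrow> (x::'a)"
  have "(\<lambda>n. (y n, t)) \<longlonglongrightarrow> (x, t)" for t :: real
    using y by (intro tendsto_intros)
  then have "h x t \<le> liminf (\<lambda>n. h (y n) t)" for t
    using h unfolding lsc_def by fastforce
  then have "(\<integral>\<^sup>+t. h x t \<partial>lborel) \<le> (\<integral>\<^sup>+t. liminf (\<lambda>n. h (y n) t) \<partial>lborel)"
    by (intro nn_integral_mono)
  also have "\<dots> \<le> liminf (\<lambda>n. \<integral>\<^sup>+t. h (y n) t \<partial>lborel)"
    using meas by (intro nn_integral_liminf) auto
  finally show "(\<integral>\<^sup>+t. h x t \<partial>lborel) \<le> liminf (\<lambda>n. \<integral>\<^sup>+t. h (y n) t \<partial>lborel)" .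
qed

text \<open>Labels the half-open dyadic cube of side \<open>2^-j\<close> that contains
  \<open>x\<close> by the integer point \<open>2^j\<close> times its lower corner.\<close>

definition dyadic_cell :: "nat \<Rightarrow> 'a::euclidean_space \<Rightarrow> 'a"
  where "dyadic_cell j x = (\<Sum>i\<in>Basis. real_of_int \<lfloor>2 ^ j * (x \<bullet> i)\<rfloor> *\<^sub>R i)"

lemma dyadic_cell_inner: "i \<in> Basis \<Longrightarrow> dyadic_cell j x \<bullet> i = real_of_int \<lfloor>2 ^ j * (x \<bullet> i)\<rfloor>"
  unfolding dyadic_cell_def by (simp add: inner_sum_left inner_Basis if_distrib cong: if_cong)

lemma dyadic_cell_eq_iff:
  "dyadic_cell j x = dyadic_cell j y \<longleftrightarrow> (\<forall>i\<in>Basis. \<lfloor>2 ^ j * (x \<bullet> i)\<rfloor> = \<lfloor>2 ^ j * (y \<bullet> i)\<rfloor>)"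
  by (simp add: euclidean_eq_iff[of "dyadic_cell j x"] dyadic_cell_inner)

lemma countable_dyadic_range: "countable (\<Union>j. range (dyadic_cell j :: 'a::euclidean_space \<Rightarrow> 'a))"
proof -
  have "range (dyadic_cell j :: 'a \<Rightarrow> 'a) \<subseteq> (\<lambda>m. \<Sum>i\<in>Basis. real_of_int (m i) *\<^sub>R i) ` (PiE Basis (\<lambda>_. UNIV))" for j
  proof safe
    fix x :: 'a
    have "dyadic_cell j x = (\<Sum>i\<in>Basis. real_of_int ((\<lambda>i\<in>Basis. \<lfloor>2 ^ j * (x \<bullet> i)\<rfloor>) i) *\<^sub>R i)"
      unfolding dyadic_cell_def by (intro sum.cong) auto
    then show "dyadic_cell j x \<in> (\<lambda>m. \<Sum>i\<in>Basis. real_of_int (m i) *\<^sub>R i) ` (PiE Basis (\<lambda>_. UNIV))"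
      by (rule image_eqI[where f = "\<lambda>m. \<Sum>i\<in>Basis. real_of_int (m i) *\<^sub>R i"])
        (simp only: restrict_PiE_iff UNIV_I Ball_def simp_thms)
  qed
  moreover have "countable (PiE (Basis::'a set) (\<lambda>_. UNIV :: int set))"
    by (intro countable_PiE) auto
  ultimately show ?thesis
    by (meson countable_UN countable_image countable_subset countableI_type)
qed

lemma floor_Suc_cong:
  fixes x y :: real
  assumes "\<lfloor>2 ^ Suc j * x\<rfloor> = \<lfloor>2 ^ Suc j * y\<rfloor>"
  shows "\<lfloor>2 ^ j * x\<rfloor> = \<lfloor>2 ^ j * y\<rfloor>"
proof -
  have "\<lfloor>2 ^ j * z\<rfloor> = \<lfloor>2 ^ Suc j * z\<rfloor> div 2" for z :: real
    using floor_divide_real_eq_div[of 2 "2 ^ Suc j * z"] by simp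
  then show ?thesis using assms by simp
qed

lemma floor_pow2_dist:
  fixes x y :: real
  assumes "\<lfloor>2 ^ j * x\<rfloor> = \<lfloor>2 ^ j * y\<rfloor>"
  shows "\<bar>x - y\<bar> \<le> (1 / 2) ^ j"
proof -
  have "\<bar>2 ^ j * x - 2 ^ j * y\<bar> \<le> 1"
    using assms by linarith
  then have "2 ^ j * \<bar>x - y\<bar> \<le> 1"
    by (simp add: abs_mult flip: right_diff_distrib)
  then show ?thesis
    by (simp add: power_one_over field_simps)
qed

text \<open>Half-open dyadic cubes serve as cells. Their faces are null for an absolutely continuous
  limit, so bounds for open boxes suffice although the cells are not open.\<close>

proposition nn_integral_le_liminf_boxes:
  fixes \<mu> :: "'a::euclidean_space measure"
  assumes [simp]: "sets \<mu> = sets borel" "\<And>i. sets (\<nu> i) = sets borel"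
    and ac: "absolutely_continuous lborel \<mu>"
    and low: "\<And>a b. emeasure \<mu> (box a b) \<le> liminf (\<lambda>i. emeasure (\<nu> i) (box a b))"
    and f: "lsc f"
  shows "(\<integral>\<^sup>+x. f x \<partial>\<mu>) \<le> liminf (\<lambda>i. \<integral>\<^sup>+x. f x \<partial>\<nu> i)"
proof (rule nn_integral_le_liminf_cells)
  let ?A = "\<Union>j. range (dyadic_cell j :: 'a \<Rightarrow> 'a)"
  have [simp]: "space \<mu> = UNIV"
    using sets_eq_imp_space_eq[of \<mu> borel] by simp
  have cell: "\<exists>a b. dyadic_cell j -` {dyadic_cell j x} \<subseteq> cbox a b \<and> box a b \<subseteq> dyadic_cell j -` {dyadic_cell j x}"
    for j and x :: 'a
  proof -
    define a where "a = (\<Sum>i\<in>Basis. (real_of_int \<lfloor>2 ^ j * (x \<bullet> i)\<rfloor> / 2 ^ j) *\<^sub>R i)"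
    define b where "b = (\<Sum>i\<in>Basis. ((real_of_int \<lfloor>2 ^ j * (x \<bullet> i)\<rfloor> + 1) / 2 ^ j) *\<^sub>R i)"
    have ab: "a \<bullet> i = real_of_int \<lfloor>2 ^ j * (x \<bullet> i)\<rfloor> / 2 ^ j"
             "b \<bullet> i = (real_of_int \<lfloor>2 ^ j * (x \<bullet> i)\<rfloor> + 1) / 2 ^ j" if "i \<in> Basis" for i
      using that unfolding a_def b_def by (simp_all add: inner_sum_left inner_Basis if_distrib cong: if_cong)
    have "y \<in> cbox a b" if "dyadic_cell j y = dyadic_cell j x" for y
    proof -
      have "a \<bullet> i \<le> y \<bullet> i \<and> y \<bullet> i \<le> b \<bullet> i" if "i \<in> Basis" for i
      proof -
        have "\<lfloor>2 ^ j * (y \<bullet> i)\<rfloor> = \<lfloor>2 ^ j * (x \<bullet> i)\<rfloor>"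
          using \<open>dyadic_cell j y = dyadic_cell j x\<close> that by (simp add: dyadic_cell_eq_iff)
        then have "real_of_int \<lfloor>2 ^ j * (x \<bullet> i)\<rfloor> \<le> 2 ^ j * (y \<bullet> i) \<and> 2 ^ j * (y \<bullet> i) \<le> real_of_int \<lfloor>2 ^ j * (x \<bullet> i)\<rfloor> + 1"
          by linarith
        then show ?thesis using that by (simp add: ab field_simps)
      qed
      then show ?thesis by (simp add: mem_box)
    qed
    moreover have "dyadic_cell j y = dyadic_cell j x" if "y \<in> box a b" for y
    proof -
      have "\<lfloor>2 ^ j * (y \<bullet> i)\<rfloor> = \<lfloor>2 ^ j * (x \<bullet> i)\<rfloor>" if "i \<in> Basis" for i
      proof -
        have "a \<bullet> i < y \<bullet> i \<and> y \<bullet> i < b \<bullet> i"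
          using \<open>y \<in> box a b\<close> that by (simp add: mem_box)
        then have "real_of_int \<lfloor>2 ^ j * (x \<bullet> i)\<rfloor> \<le> 2 ^ j * (y \<bullet> i) \<and> 2 ^ j * (y \<bullet> i) < real_of_int \<lfloor>2 ^ j * (x \<bullet> i)\<rfloor> + 1"
          using that by (simp add: ab field_simps)
        then show ?thesis by linarith
      qed
      then show ?thesis by (simp add: dyadic_cell_eq_iff)
    qed
    ultimately show ?thesis by blast
  qed
  show meas: "dyadic_cell j \<in> measurable \<mu> (count_space ?A)" for j
  proof (rule measurable_count_space_eq_countable[THEN iffD2, OF countable_dyadic_range], intro conjI ballI)
    show "dyadic_cell j \<in> space \<mu> \<rightarrow> ?A" by auto
    fix a assume "a \<in> ?A"
    have "dyadic_cell j -` {a} = (\<Inter>i\<in>Basis. {x. real_of_int \<lfloor>2 ^ j * (x \<bullet> i)\<rfloor> = a \<bullet> i})"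
      by (auto simp: euclidean_eq_iff[of _ a] dyadic_cell_inner)
    also have "\<dots> \<in> sets borel"
      by (intro sets.countable_INT'') (auto intro: countable_finite)
    finally show "dyadic_cell j -` {a} \<inter> space \<mu> \<in> sets \<mu>" by simp
  qed
  show "emeasure \<mu> (dyadic_cell j -` {a} \<inter> space \<mu>) \<le> liminf (\<lambda>i. emeasure (\<nu> i) (dyadic_cell j -` {a} \<inter> space \<mu>))"
    if "a \<in> ?A" for j a
  proof (cases "\<exists>x. a = dyadic_cell j x")
    case True
    then obtain p q where pq: "dyadic_cell j -` {a} \<subseteq> cbox p q" "box p q \<subseteq> dyadic_cell j -` {a}"
      using cell by blast
    have m: "dyadic_cell j -` {a} \<in> sets borel"
      using measurable_sets[OF meas, of "{a}" j] that by simp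
    have "emeasure lborel (cbox p q - box p q) = 0"
    proof -
      have "emeasure lborel (cbox p q - box p q) = emeasure lborel (cbox p q) - emeasure lborel (box p q)"
        by (intro emeasure_Diff) (auto simp: box_subset_cbox emeasure_lborel_box_eq)
      then show ?thesis
        by (cases "\<forall>i\<in>Basis. p \<bullet> i \<le> q \<bullet> i") (auto simp: emeasure_lborel_cbox_eq emeasure_lborel_box_eq)
    qed
    then have "cbox p q - box p q \<in> null_sets lborel"
      by (intro null_setsI) auto
    then have "emeasure \<mu> (cbox p q - box p q) = 0"
      using ac unfolding absolutely_continuous_def by auto
    moreover have "emeasure \<mu> (dyadic_cell j -` {a}) \<le> emeasure \<mu> (box p q \<union> (cbox p q - box p q))"
      using pq by (intro emeasure_mono) auto
    moreover have "\<dots> \<le> emeasure \<mu> (box p q) + emeasure \<mu> (cbox p q - box p q)"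
      by (intro emeasure_subadditive) auto
    ultimately have "emeasure \<mu> (dyadic_cell j -` {a}) \<le> emeasure \<mu> (box p q) + 0"
      by (metis order_trans)
    then have "emeasure \<mu> (dyadic_cell j -` {a}) \<le> emeasure \<mu> (box p q)"
      by (simp only: add_0_right)
    also have "\<dots> \<le> liminf (\<lambda>i. emeasure (\<nu> i) (box p q))" by (rule low)
    also have "\<dots> \<le> liminf (\<lambda>i. emeasure (\<nu> i) (dyadic_cell j -` {a}))"
      using pq m by (intro Liminf_mono always_eventually allI emeasure_mono) auto
    finally show ?thesis by simp
  next
    case False
    then have "dyadic_cell j -` {a} = {}" by auto
    then show ?thesis by simp
  qed
  show "AE x in \<mu>. f x \<le> (SUP j. INF y\<in>{y \<in> space \<mu>. dyadic_cell j y = dyadic_cell j x}. f y)"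
  proof (intro always_eventually allI)
    fix x
    let ?I = "\<lambda>j. INF y\<in>{y \<in> space \<mu>. dyadic_cell j y = dyadic_cell j x}. f y"
    show "f x \<le> (SUP j. ?I j)"
    proof (rule ccontr)
      assume "\<not> ?thesis"
      then have "(SUP j. ?I j) < f x" by (simp only: not_le)
      then obtain r where r: "(SUP j. ?I j) < r" "r < f x"
        by (rule dense[THEN exE]) blast
      \<comment> \<open>If the infima stayed below \<open>r < f x\<close>, one point from each cube
        around \<open>x\<close> would form a sequence tending to \<open>x\<close> along which
        \<open>f\<close> stays below \<open>r\<close>, against lower semicontinuity.\<close>
      have "\<exists>y. dyadic_cell j y = dyadic_cell j x \<and> f y < r" for j
      proof -
        have "?I j < r" by (rule SUP_lessD[OF r(1)]) simp
        then show ?thesis by (auto simp: INF_less_iff)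
      qed
      then obtain y where y: "\<And>j. dyadic_cell j (y j) = dyadic_cell j x" "\<And>j. f (y j) < r"
        by metis
      have "(\<lambda>j. dist (y j) x) \<longlonglongrightarrow> 0"
      proof (rule tendsto_sandwich[OF _ _ tendsto_const])
        show "\<forall>\<^sub>F j in sequentially. dist (y j) x \<le> real DIM('a) * (1 / 2) ^ j"
        proof (intro always_eventually allI)
          fix j
          have "dist (y j) x \<le> (\<Sum>i\<in>Basis. \<bar>(y j - x) \<bullet> i\<bar>)"
            unfolding dist_norm by (rule norm_le_l1)
          also have "\<dots> \<le> (\<Sum>i\<in>(Basis::'a set). (1 / 2) ^ j)"
            using y(1)[of j] by (intro sum_mono) (auto simp: dyadic_cell_eq_iff inner_diff_left intro: floor_pow2_dist)
          finally show "dist (y j) x \<le> real DIM('a) * (1 / 2) ^ j" by simp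
        qed
        show "(\<lambda>j. real DIM('a) * (1 / 2) ^ j) \<longlonglongrightarrow> 0"
          by (intro tendsto_mult_right_zero LIMSEQ_power_zero) simp
      qed auto
      then have "y \<longlonglongrightarrow> x" by (rule tendsto_dist_iff[THEN iffD2])
      then have 1: "f x \<le> liminf (\<lambda>j. f (y j))" using f unfolding lsc_def by blast
      have "liminf (\<lambda>j. f (y j)) \<le> liminf (\<lambda>j. r)"
        using y(2) by (intro Liminf_mono always_eventually) (simp add: less_imp_le)
      then have "f x \<le> r" using 1 Liminf_const[of sequentially r] by (metis order_trans trivial_limit_sequentially)
      with r(2) show False using leD by blast
    qed
  qed
next
  fix j and x y :: 'a
  assume "dyadic_cell (Suc j) x = dyadic_cell (Suc j) y"
  then show "dyadic_cell j x = dyadic_cell j y"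
    unfolding dyadic_cell_eq_iff by (metis floor_Suc_cong)
qed (simp_all only: assms countable_dyadic_range)

lemma le_liminf_ennreal:
  assumes "g \<longlonglongrightarrow> L" "\<forall>\<^sub>F i in sequentially. ennreal (g i) \<le> F i"
  shows "ennreal L \<le> liminf F"
proof -
  have "ennreal L = liminf (\<lambda>i. ennreal (g i))"
    using assms(1) by (intro lim_imp_Liminf[symmetric] tendsto_ennrealI) auto
  also have "\<dots> \<le> liminf F" by (rule Liminf_mono[OF assms(2)])
  finally show ?thesis .
qed

text \<open>Infinite sets get the value infinity, so lower bounds for word counts can be stated
  without first proving that there are finitely many words.\<close>

definition ecard :: "'a set \<Rightarrow> ennreal"
  where "ecard X = emeasure (count_space UNIV) X"

lemma ecard_finite: "finite X \<Longrightarrow> ecard X = ennreal (card X)"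
  by (simp add: ecard_def ennreal_of_nat_eq_real_of_nat)

lemma ecard_mono: "X \<subseteq> Y \<Longrightarrow> ecard X \<le> ecard Y"
  by (simp add: ecard_def emeasure_mono)

lemma ecard_Un_disjoint: "X \<inter> Y = {} \<Longrightarrow> ecard (X \<union> Y) = ecard X + ecard Y"
  unfolding ecard_def by (intro plus_emeasure[symmetric]) auto

lemma ecard_Un_le: "ecard (X \<union> Y) \<le> ecard X + ecard Y"
  unfolding ecard_def by (intro emeasure_subadditive) auto

lemma ecard_image: "inj_on f X \<Longrightarrow> ecard (f ` X) = ecard X"
  unfolding ecard_def by (cases "finite X") (auto simp: card_image finite_image_iff)

lemma ecard_UN_disjoint:
  "finite I \<Longrightarrow> disjoint_family_on X I \<Longrightarrow> ecard (\<Union>i\<in>I. X i) = (\<Sum>i\<in>I. ecard (X i))"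
  unfolding ecard_def by (intro sum_emeasure[symmetric]) auto

text \<open>Mass \<open>c\<close> at the image of every element of \<open>S\<close>, with
  multiplicity. A counting problem at scale \<open>R\<close> becomes a measure that can be compared
  with a density on Euclidean space.\<close>

definition point_measure_on :: "real \<Rightarrow> ('w \<Rightarrow> 'a::topological_space) \<Rightarrow> 'w set \<Rightarrow> 'a measure"
  where "point_measure_on c g S = scale_measure (ennreal c) (distr (count_space S) borel g)"

lemma sets_point_measure_on [simp]: "sets (point_measure_on c g S) = sets borel"
  by (simp add: point_measure_on_def)

lemma emeasure_point_measure_on:
  assumes "A \<in> sets borel"
  shows "emeasure (point_measure_on c g S) A = ennreal c * ecard {w\<in>S. g w \<in> A}"
proof -
  have "g -` A \<inter> S = {w\<in>S. g w \<in> A}" by auto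
  moreover have "emeasure (count_space S) {w\<in>S. g w \<in> A} = ecard {w\<in>S. g w \<in> A}"
    unfolding ecard_def by (cases "finite {w\<in>S. g w \<in> A}") auto
  ultimately show ?thesis
    using assms by (simp add: point_measure_on_def emeasure_distr)
qed

lemma nn_integral_point_measure_on:
  assumes "f \<in> borel_measurable borel"
  shows "(\<integral>\<^sup>+x. f x \<partial>point_measure_on c g S) = ennreal c * (\<integral>\<^sup>+w. f (g w) \<partial>count_space S)"
  using assms by (simp add: point_measure_on_def nn_integral_scale_measure nn_integral_distr)

section \<open>Integers in intervals and residue classes\<close>

lemma int_open_interval: "{k::int. x < of_int k \<and> of_int k < (y::real)} = {\<lfloor>x\<rfloor> + 1..\<lceil>y\<rceil> - 1}"
proof (intro set_eqI iffI)
  fix k assume "k \<in> {k::int. x < of_int k \<and> of_int k < y}"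
  then have "\<lfloor>x\<rfloor> < k" "k < \<lceil>y\<rceil>" by (auto simp: floor_less_iff less_ceiling_iff)
  then show "k \<in> {\<lfloor>x\<rfloor> + 1..\<lceil>y\<rceil> - 1}" by auto
next
  fix k assume "k \<in> {\<lfloor>x\<rfloor> + 1..\<lceil>y\<rceil> - 1}"
  then have "\<lfloor>x\<rfloor> < k" "k < \<lceil>y\<rceil>" by auto
  then show "k \<in> {k::int. x < of_int k \<and> of_int k < y}" by (auto simp: floor_less_iff less_ceiling_iff)
qed

lemma card_int_open_interval:
  shows "y - x - 1 \<le> real (card {k::int. x < of_int k \<and> of_int k < (y::real)})"
    and "x \<le> y \<Longrightarrow> real (card {k::int. x < of_int k \<and> of_int k < (y::real)}) \<le> y - x + 1"
    and "finite {k::int. x < of_int k \<and> of_int k < (y::real)}"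
proof -
  have c: "real (card {k::int. x < of_int k \<and> of_int k < y}) = real (nat (\<lceil>y\<rceil> - \<lfloor>x\<rfloor> - 1))"
    unfolding int_open_interval by simp
  show "y - x - 1 \<le> real (card {k::int. x < of_int k \<and> of_int k < y})"
    unfolding c by linarith
  show "real (card {k::int. x < of_int k \<and> of_int k < y}) \<le> y - x + 1" if "x \<le> y"
    unfolding c using that by linarith
  show "finite {k::int. x < of_int k \<and> of_int k < y}"
    unfolding int_open_interval by simp
qed

definition residue_class :: "real \<Rightarrow> real \<Rightarrow> nat \<Rightarrow> int \<Rightarrow> int set"
  where "residue_class A B W c = {n. A < of_int n \<and> of_int n < B \<and> n mod int W = c}"

lemma residue_class_card:
  assumes W: "0 < W" and c: "c \<in> {0..<int W}"
  shows "(B - A) / W - 1 \<le> real (card (residue_class A B W c))"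
    and "A \<le> B \<Longrightarrow> real (card (residue_class A B W c)) \<le> (B - A) / W + 1"
    and "finite (residue_class A B W c)"
proof -
  let ?K = "{k::int. (A - c) / W < of_int k \<and> of_int k < (B - c) / W}"
  have "residue_class A B W c = (\<lambda>k. c + int W * k) ` ?K"
  proof (intro set_eqI iffI)
    fix n assume "n \<in> residue_class A B W c"
    then have n: "A < of_int n" "of_int n < B" "n mod int W = c" by (auto simp: residue_class_def)
    then have e: "n = c + int W * (n div int W)" by (metis add.commute mult_div_mod_eq)
    define k where "k = n div int W"
    have "real_of_int n = c + W * real_of_int k" using e unfolding k_def by (metis of_int_add of_int_mult of_int_of_nat_eq)
    then have "k \<in> ?K" using n W by (simp add: field_simps)
    then show "n \<in> (\<lambda>k. c + int W * k) ` ?K" using e by (auto simp: k_def)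
  next
    fix n assume "n \<in> (\<lambda>k. c + int W * k) ` ?K"
    then show "n \<in> residue_class A B W c"
      using W c by (auto simp: residue_class_def field_simps)
  qed
  moreover have "inj_on (\<lambda>k. c + int W * k) ?K" using W by (auto simp: inj_on_def)
  ultimately have e: "card (residue_class A B W c) = card ?K" "finite (residue_class A B W c)"
    by (auto simp: card_image card_int_open_interval(3))
  have d: "(B - c) / W - (A - c) / W = (B - A) / W" by (simp add: diff_divide_distrib)
  show "(B - A) / W - 1 \<le> real (card (residue_class A B W c))"
    using card_int_open_interval(1)[of "(B - c) / W" "(A - c) / W"] e d by simp
  show "real (card (residue_class A B W c)) \<le> (B - A) / W + 1" if "A \<le> B"
    using card_int_open_interval(2)[of "(A - c) / W" "(B - c) / W"] e d that W by (simp add: divide_right_mono)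
  show "finite (residue_class A B W c)" by (rule e)
qed

definition good_residues :: "nat \<Rightarrow> (int \<times> int) set"
  where "good_residues W = {(a, c). a \<in> {0..<int W} \<and> c \<in> {0..<int W} \<and> gcd (gcd a c) (int W) = 1}"

lemma finite_good_residues: "finite (good_residues W)"
  by (rule finite_subset[of _ "{0..<int W} \<times> {0..<int W}"]) (auto simp: good_residues_def)

text \<open>The product of \<open>1 - 1 / p^2\<close> over the primes \<open>p\<close> dividing
  \<open>W\<close>; with \<open>W = P!\<close> it tends to \<open>6 / pi^2\<close> as
  \<open>P\<close> grows.\<close>

definition residue_density :: "nat \<Rightarrow> real"
  where "residue_density W = real (card (good_residues W)) / real W ^ 2"

lemma gcd_mod_both: "gcd (gcd (a mod W) (c mod W)) W = gcd (gcd a c) (W::int)"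
proof -
  have "gcd (gcd (a mod W) (c mod W)) W = gcd (a mod W) (gcd (c mod W) W)" by (rule gcd.assoc)
  also have "gcd (c mod W) W = gcd c W" by (metis gcd.commute gcd_red_int)
  also have "gcd (a mod W) (gcd c W) = gcd (gcd (a mod W) W) c" by (simp only: gcd.commute gcd.left_commute gcd.assoc)
  also have "gcd (a mod W) W = gcd a W" by (metis gcd.commute gcd_red_int)
  also have "gcd (gcd a W) c = gcd (gcd a c) W" by (simp only: gcd.commute gcd.left_commute gcd.assoc)
  finally show ?thesis .
qed

lemma sieve_box_eq:
  assumes "0 < W"
  shows "{(a::int, c::int). A < of_int a \<and> of_int a < B \<and> A' < of_int c \<and> of_int c < B' \<and> gcd (gcd a c) (int W) = 1}
    = (\<Union>r\<in>good_residues W. residue_class A B W (fst r) \<times> residue_class A' B' W (snd r))"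
    (is "?L = ?R")
proof (intro set_eqI iffI)
  fix x assume "x \<in> ?L"
  then obtain a c where x: "x = (a, c)" and 1: "A < of_int a" "of_int a < B" "A' < of_int c" "of_int c < B'"
    and g: "gcd (gcd a c) (int W) = 1" by auto
  have "(a mod int W, c mod int W) \<in> good_residues W"
    using assms g by (simp add: good_residues_def gcd_mod_both)
  then show "x \<in> ?R" using x 1 by (intro UN_I[of "(a mod int W, c mod int W)"]) (auto simp: residue_class_def)
next
  fix x assume "x \<in> ?R"
  then obtain r s a c where *: "(r, s) \<in> good_residues W" "x = (a, c)"
    "a \<in> residue_class A B W r" "c \<in> residue_class A' B' W s" by auto
  then have "gcd (gcd (a mod int W) (c mod int W)) (int W) = 1"
    by (simp add: good_residues_def residue_class_def)
  then have "gcd (gcd a c) (int W) = 1" unfolding gcd_mod_both .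
  with * show "x \<in> ?L" by (simp add: residue_class_def)
qed

text \<open>A residue class modulo \<open>W\<close> meets an interval in its length over
  \<open>W\<close> up to one point. The lower bound asks for sides of length at least
  \<open>W\<close>, since the factors must be nonnegative before they are multiplied.\<close>

lemma card_sieve_box:
  fixes A B A' B' :: real
  assumes W: "0 < W"
  defines "S \<equiv> {(a::int, c::int). A < of_int a \<and> of_int a < B \<and> A' < of_int c \<and> of_int c < B' \<and> gcd (gcd a c) (int W) = 1}"
  shows "finite S"
    and "1 \<le> (B - A) / W \<Longrightarrow> 1 \<le> (B' - A') / W \<Longrightarrow>
      real (card (good_residues W)) * (((B - A) / W - 1) * ((B' - A') / W - 1)) \<le> real (card S)"
    and "A \<le> B \<Longrightarrow> A' \<le> B' \<Longrightarrow>
      real (card S) \<le> real (card (good_residues W)) * (((B - A) / W + 1) * ((B' - A') / W + 1))"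
proof -
  let ?X = "\<lambda>r. residue_class A B W (fst r) \<times> residue_class A' B' W (snd r)"
  have S: "S = (\<Union>r\<in>good_residues W. ?X r)"
    unfolding S_def by (rule sieve_box_eq[OF W])
  have fin: "finite (?X r)" if "r \<in> good_residues W" for r
    using that residue_class_card(3)[OF W] by (auto simp: good_residues_def)
  show "finite S" unfolding S using fin finite_good_residues by blast
  have "card S = (\<Sum>r\<in>good_residues W. card (?X r))"
    unfolding S using fin finite_good_residues
    by (intro card_UN_disjoint) (auto simp: residue_class_def prod_eq_iff)
  then have c: "real (card S) = (\<Sum>r\<in>good_residues W. real (card (residue_class A B W (fst r))) * real (card (residue_class A' B' W (snd r))))"
    by (simp add: card_cartesian_product)
  show "real (card (good_residues W)) * (((B - A) / W - 1) * ((B' - A') / W - 1)) \<le> real (card S)"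
    if "1 \<le> (B - A) / W" "1 \<le> (B' - A') / W"
    unfolding c using that
    by (intro sum_bounded_below[where K = "((B - A) / W - 1) * ((B' - A') / W - 1)", simplified] mult_mono residue_class_card(1)[OF W])
       (auto simp: good_residues_def)
  show "real (card S) \<le> real (card (good_residues W)) * (((B - A) / W + 1) * ((B' - A') / W + 1))"
    if "A \<le> B" "A' \<le> B'"
    unfolding c using that
    by (intro sum_bounded_above[where K = "((B - A) / W + 1) * ((B' - A') / W + 1)", simplified] mult_mono residue_class_card(2)[OF W])
       (auto simp: good_residues_def)
qed

lemma le_zdiv_iff: "0 < d \<Longrightarrow> x \<le> n div d \<longleftrightarrow> d * x \<le> (n::int)"
proof
  assume d: "0 < d" and "x \<le> n div d"
  then have "d * x \<le> d * (n div d)" by simp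
  also have "\<dots> \<le> n" using d by (simp add: minus_mod_eq_mult_div[symmetric])
  finally show "d * x \<le> n" .
next
  assume d: "0 < d" and "d * x \<le> n"
  then have "(d * x) div d \<le> n div d" by (intro zdiv_mono1)
  then show "x \<le> n div d" using d by simp
qed

lemma sum_inverse_squares_tail:
  assumes "0 < P" shows "(\<Sum>g\<in>{P<..M}. 1 / real g ^ 2) \<le> 1 / real P"
proof (cases "P \<le> M")
  case True
  then have "(\<Sum>g\<in>{P<..M}. 1 / real g ^ 2) \<le> 1 / real P - 1 / real M"
  proof (induction M rule: dec_induct)
    case (step n)
    have "0 < n" using step assms by linarith
    have "{P<..Suc n} = insert (Suc n) {P<..n}" using step by auto
    then have "(\<Sum>g\<in>{P<..Suc n}. 1 / real g ^ 2) = 1 / real (Suc n) ^ 2 + (\<Sum>g\<in>{P<..n}. 1 / real g ^ 2)"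
      by simp
    also have "1 / real (Suc n) ^ 2 \<le> 1 / (real n * real (Suc n))"
      using \<open>0 < n\<close> by (intro divide_left_mono) (auto simp: power2_eq_square)
    also have "1 / (real n * real (Suc n)) = 1 / real n - 1 / real (Suc n)"
      using \<open>0 < n\<close> by (simp add: field_simps)
    finally show ?case using step.IH by simp
  qed simp
  then show ?thesis by (smt (verit) divide_nonneg_nonneg of_nat_0_le_iff)
qed (use assms in auto)

section \<open>Coprime pairs\<close>

definition coprime_pairs :: "nat \<Rightarrow> (int \<times> int) set"
  where "coprime_pairs N = {(a, c). a \<in> {1..int N} \<and> c \<in> {1..int N} \<and> coprime a c}"

lemma finite_coprime_pairs: "finite (coprime_pairs N)"
  by (rule finite_subset[of _ "{1..int N} \<times> {1..int N}"]) (auto simp: coprime_pairs_def)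

definition common_divisor_pairs :: "nat \<Rightarrow> nat \<Rightarrow> (int \<times> int) set"
  where "common_divisor_pairs P N = {(a, c). a \<in> {1..int N} \<and> c \<in> {1..int N} \<and> (\<exists>g>int P. g dvd a \<and> g dvd c)}"

text \<open>Dividing out \<open>g\<close> leaves a pair in a square of side \<open>N div g\<close>;
  the sum of \<open>(N / g)^2\<close> over \<open>g > P\<close> is at most
  \<open>N^2 / P\<close>.\<close>

lemma card_common_divisor_pairs:
  assumes "0 < P" shows "real (card (common_divisor_pairs P N)) \<le> real N ^ 2 / P"
proof -
  let ?X = "\<lambda>g. (\<lambda>(a, c). (int g * a, int g * c)) ` ({1..int (N div g)} \<times> {1..int (N div g)})"
  have "common_divisor_pairs P N \<subseteq> (\<Union>g\<in>{P<..N}. ?X g)"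
  proof
    fix x assume "x \<in> common_divisor_pairs P N"
    then obtain a c g where x: "x = (a, c)" "a \<in> {1..int N}" "c \<in> {1..int N}" and g: "int P < g" "g dvd a" "g dvd c"
      by (auto simp: common_divisor_pairs_def)
    define h where "h = nat g"
    have h: "g = int h" using g by (simp add: h_def)
    obtain a' c' where ac: "a = int h * a'" "c = int h * c'" using g h by (auto elim!: dvdE)
    have hpos: "0 < int h" using g h by linarith
    have le: "h \<le> N" using zdvd_imp_le[OF g(2)] x h by auto
    have "1 \<le> a'" "1 \<le> c'" using x ac hpos by (auto simp: zero_less_mult_iff int_one_le_iff_zero_less)
    moreover have "a' \<le> int (N div h)" "c' \<le> int (N div h)"
      using x ac hpos by (auto simp: zdiv_int le_zdiv_iff[OF hpos])
    ultimately show "x \<in> (\<Union>g\<in>{P<..N}. ?X g)" using x ac g h le by (intro UN_I[of h]) auto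
  qed
  then have "card (common_divisor_pairs P N) \<le> card (\<Union>g\<in>{P<..N}. ?X g)" by (intro card_mono) auto
  also have "\<dots> \<le> (\<Sum>g\<in>{P<..N}. card (?X g))" by (intro card_UN_le) auto
  also have "\<dots> \<le> (\<Sum>g\<in>{P<..N}. (N div g) * (N div g))"
    by (intro sum_mono order_trans[OF card_image_le]) (auto simp: card_cartesian_product)
  finally have "real (card (common_divisor_pairs P N)) \<le> (\<Sum>g\<in>{P<..N}. real (N div g) * real (N div g))"
    by (simp flip: of_nat_mult of_nat_sum)
  also have "\<dots> \<le> (\<Sum>g\<in>{P<..N}. real N ^ 2 * (1 / real g ^ 2))"
  proof (intro sum_mono)
    fix g assume "g \<in> {P<..N}"
    have "real (N div g) \<le> real N / real g" by (rule of_nat_div_le_of_nat)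
    then have "real (N div g) * real (N div g) \<le> (real N / real g) * (real N / real g)"
      by (intro mult_mono) auto
    then show "real (N div g) * real (N div g) \<le> real N ^ 2 * (1 / real g ^ 2)"
      by (simp add: power2_eq_square)
  qed
  also have "\<dots> \<le> real N ^ 2 * (1 / P)"
    unfolding sum_distrib_left[symmetric] by (intro mult_left_mono sum_inverse_squares_tail assms) auto
  finally show ?thesis by simp
qed

text \<open>The witness is the gcd itself: were it at most \<open>P\<close>, it would divide
  \<open>P!\<close> and hence be 1. This is why the sieve modulus is a factorial.\<close>

lemma not_coprime_large_divisor:
  assumes "gcd (gcd a c) (int (fact P)) = 1" "\<not> coprime a c" "a > 0"
  shows "\<exists>g>int P. g dvd a \<and> g dvd (c::int)"
proof (intro exI conjI)
  show "gcd a c dvd a" "gcd a c dvd c" by auto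
  show "int P < gcd a c"
  proof (rule ccontr)
    assume "\<not> int P < gcd a c"
    moreover have "0 < gcd a c" using assms(3) by simp
    ultimately have "nat (gcd a c) dvd fact P" by (intro dvd_fact) linarith+
    then have "gcd a c dvd int (fact P)" using \<open>0 < gcd a c\<close>
      by (metis int_dvd_int_iff int_nat_eq less_imp_le)
    then have "gcd a c dvd gcd (gcd a c) (int (fact P))" by simp
    then have "gcd a c = 1" using assms(1) by simp
    then show False using assms(2) by (simp add: coprime_iff_gcd_eq_1)
  qed
qed

lemma card_coprime_pairs_upper:
  assumes "0 < W"
  shows "real (card (coprime_pairs N)) \<le> real (card (good_residues W)) * ((real N + 1) / W + 1) ^ 2"
proof -
  let ?S = "{(a::int, c::int). 0 < real_of_int a \<and> real_of_int a < real N + 1 \<and> 0 < real_of_int c \<and> real_of_int c < real N + 1 \<and> gcd (gcd a c) (int W) = 1}"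
  have "coprime_pairs N \<subseteq> ?S"
    by (auto simp: coprime_pairs_def coprime_iff_gcd_eq_1)
  then have "card (coprime_pairs N) \<le> card ?S"
    using card_sieve_box(1)[OF assms, of 0 "real N + 1" 0 "real N + 1"] by (intro card_mono) auto
  then show ?thesis
    using card_sieve_box(3)[OF assms, of 0 "real N + 1" 0 "real N + 1"] by (simp add: power2_eq_square)
qed

lemma card_coprime_pairs_lower:
  assumes "0 < P" "fact P \<le> real N"
  shows "real (card (good_residues (fact P))) * ((real N + 1) / fact P - 1) ^ 2 - real N ^ 2 / P \<le> real (card (coprime_pairs N))"
proof -
  define W :: nat where "W = fact P"
  have W: "0 < W" by (simp add: W_def)
  let ?S = "{(a::int, c::int). 0 < real_of_int a \<and> real_of_int a < real N + 1 \<and> 0 < real_of_int c \<and> real_of_int c < real N + 1 \<and> gcd (gcd a c) (int W) = 1}"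
  have le: "a \<le> int N" if "real_of_int a < real N + 1" for a using that by linarith
  have "?S \<subseteq> coprime_pairs N \<union> common_divisor_pairs P N"
  proof
    fix x assume "x \<in> ?S"
    then obtain a c where x: "x = (a, c)" "0 < a" "0 < c" "a \<le> int N" "c \<le> int N" "gcd (gcd a c) (int W) = 1"
      using le by auto
    then show "x \<in> coprime_pairs N \<union> common_divisor_pairs P N"
      using not_coprime_large_divisor[of a c P]
      by (cases "coprime a c") (auto simp: coprime_pairs_def common_divisor_pairs_def W_def simp del: of_nat_fact)
  qed
  moreover have "finite (common_divisor_pairs P N)"
    by (rule finite_subset[of _ "{1..int N} \<times> {1..int N}"]) (auto simp: common_divisor_pairs_def)
  ultimately have "card ?S \<le> card (coprime_pairs N \<union> common_divisor_pairs P N)"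
    using finite_coprime_pairs by (intro card_mono) auto
  also have "\<dots> \<le> card (coprime_pairs N) + card (common_divisor_pairs P N)" by (rule card_Un_le)
  finally have "real (card ?S) \<le> real (card (coprime_pairs N)) + real N ^ 2 / P"
    using card_common_divisor_pairs[OF assms(1), of N] by linarith
  moreover have "real (card (good_residues W)) * (((real N + 1) / W - 1) * ((real N + 1) / W - 1)) \<le> real (card ?S)"
  proof -
    have "1 \<le> (real N + 1 - 0) / real W" using assms(2) W by (simp add: W_def)
    then show ?thesis using card_sieve_box(2)[OF W, of "real N + 1" 0 "real N + 1" 0] by simp
  qed
  ultimately show ?thesis by (simp add: power2_eq_square W_def)
qed

definition coprime_ratio :: "nat \<Rightarrow> real"
  where "coprime_ratio N = real (card (coprime_pairs N)) / real N ^ 2"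

lemma coprime_ratio_upper:
  assumes "0 < W" "e > 0"
  shows "\<forall>\<^sub>F N in sequentially. coprime_ratio N \<le> residue_density W + e"
proof -
  define G where "G = real (card (good_residues W))"
  have "(\<lambda>N. G * (((real N + 1) / real W + 1) / real N) ^ 2) \<longlonglongrightarrow> G * (1 / real W) ^ 2"
  proof (intro tendsto_mult tendsto_const tendsto_power)
    have "(\<lambda>N. 1 / real W + (1 / real W + 1) * (1 / real N)) \<longlonglongrightarrow> 1 / real W + (1 / real W + 1) * 0"
      by (intro tendsto_intros lim_1_over_n)
    then have "(\<lambda>N. 1 / real W + (1 / real W + 1) * (1 / real N)) \<longlonglongrightarrow> 1 / real W" by simp
    then show "(\<lambda>N. ((real N + 1) / real W + 1) / real N) \<longlonglongrightarrow> 1 / real W"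
      by (rule Lim_transform_eventually)
         (intro eventually_mono[OF eventually_gt_at_top[of 0]], use assms in \<open>simp add: field_simps\<close>)
  qed
  then have "\<forall>\<^sub>F N in sequentially. G * (((real N + 1) / real W + 1) / real N) ^ 2 < G * (1 / real W) ^ 2 + e"
    using assms(2) by (intro order_tendstoD) auto
  then show ?thesis
  proof (rule eventually_mono)
    fix N
    assume *: "G * (((real N + 1) / real W + 1) / real N) ^ 2 < G * (1 / real W) ^ 2 + e"
    have "coprime_ratio N \<le> G * ((real N + 1) / W + 1) ^ 2 / real N ^ 2"
      unfolding coprime_ratio_def G_def by (intro divide_right_mono card_coprime_pairs_upper assms) auto
    with * show "coprime_ratio N \<le> residue_density W + e"
      by (simp add: residue_density_def G_def power_divide)
  qed
qed

lemma coprime_ratio_lower: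
  assumes "0 < P" "e > 0"
  shows "\<forall>\<^sub>F N in sequentially. residue_density (fact P) - 1 / P - e \<le> coprime_ratio N"
proof -
  define W :: nat where "W = fact P"
  have W: "0 < W" by (simp add: W_def)
  define G where "G = real (card (good_residues W))"
  have "(\<lambda>N. G * (((real N + 1) / real W - 1) / real N) ^ 2) \<longlonglongrightarrow> G * (1 / real W) ^ 2"
  proof (intro tendsto_mult tendsto_const tendsto_power)
    have "(\<lambda>N. 1 / real W + (1 / real W - 1) * (1 / real N)) \<longlonglongrightarrow> 1 / real W + (1 / real W - 1) * 0"
      by (intro tendsto_intros lim_1_over_n)
    then have "(\<lambda>N. 1 / real W + (1 / real W - 1) * (1 / real N)) \<longlonglongrightarrow> 1 / real W" by simp
    then show "(\<lambda>N. ((real N + 1) / real W - 1) / real N) \<longlonglongrightarrow> 1 / real W"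
      by (rule Lim_transform_eventually)
         (intro eventually_mono[OF eventually_gt_at_top[of 0]], use W in \<open>simp add: field_simps\<close>)
  qed
  then have "\<forall>\<^sub>F N in sequentially. G * (1 / real W) ^ 2 - e < G * (((real N + 1) / real W - 1) / real N) ^ 2"
    using assms(2) by (intro order_tendstoD) auto
  moreover have "\<forall>\<^sub>F N in sequentially. real W \<le> real N \<and> 0 < N"
    using eventually_ge_at_top[of W] eventually_gt_at_top[of 0] by eventually_elim auto
  ultimately show ?thesis
  proof eventually_elim
    case (elim N)
    have "(G * ((real N + 1) / W - 1) ^ 2 - real N ^ 2 / P) / real N ^ 2 \<le> coprime_ratio N"
      unfolding coprime_ratio_def G_def W_def using elim
      by (intro divide_right_mono) (use card_coprime_pairs_lower[OF assms(1), of N] in \<open>auto simp: W_def\<close>)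
    moreover have "(G * X ^ 2 - real N ^ 2 / P) / real N ^ 2 = G * (X / real N) ^ 2 - 1 / P" for X
      using elim by (simp add: power_divide diff_divide_distrib)
    ultimately show ?case
      using elim by (simp add: residue_density_def G_def power_divide flip: W_def)
  qed
qed

text \<open>The sieve modulo \<open>P!\<close> encloses the ratio between two constants that differ
  by \<open>1 / P\<close> plus an arbitrarily small error. So a limit exists before its value is
  known.\<close>

lemma coprime_ratio_convergent: "convergent coprime_ratio"
  unfolding Cauchy_convergent_iff[symmetric]
proof (rule metric_CauchyI)
  fix e :: real assume "0 < e"
  obtain P :: nat where P: "1 / e * 8 < P" using reals_Archimedean2 by blast
  have "0 < 1 / e * 8" using \<open>0 < e\<close> by simp
  then have Pp: "0 < real P" using P by linarith
  have "1 * 8 < real P * e" using P \<open>0 < e\<close> by (simp add: field_simps)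
  then have P0: "0 < P" "1 / P < e / 8" using Pp by (simp_all add: field_simps)
  have "\<forall>\<^sub>F N in sequentially. coprime_ratio N \<le> residue_density (fact P) + e / 8 \<and>
      residue_density (fact P) - 1 / P - e / 8 \<le> coprime_ratio N"
    using \<open>0 < e\<close> P0 by (intro eventually_conj coprime_ratio_upper coprime_ratio_lower) auto
  then obtain N0 where N0: "\<And>N. N \<ge> N0 \<Longrightarrow> coprime_ratio N \<le> residue_density (fact P) + e / 8 \<and>
      residue_density (fact P) - 1 / P - e / 8 \<le> coprime_ratio N"
    by (auto simp: eventually_sequentially)
  show "\<exists>M. \<forall>m\<ge>M. \<forall>n\<ge>M. dist (coprime_ratio m) (coprime_ratio n) < e"
  proof (intro exI[of _ N0] allI impI)
    fix m n assume "N0 \<le> m" "N0 \<le> n"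
    then show "dist (coprime_ratio m) (coprime_ratio n) < e"
      using N0[of m] N0[of n] P0 \<open>0 < e\<close> by (simp add: dist_real_def) linarith
  qed
qed

text \<open>Every pair is its gcd \<open>d\<close> times a coprime pair in the square of side
  \<open>N div d\<close>.\<close>

lemma sum_coprime_pairs: "(\<Sum>d\<in>{1..N}. card (coprime_pairs (N div d))) = N ^ 2"
proof -
  let ?f = "\<lambda>d (a, c). (int d * a, int d * c)"
  have "{1..int N} \<times> {1..int N} = (\<Union>d\<in>{1..N}. ?f d ` coprime_pairs (N div d))"
  proof (intro set_eqI iffI)
    fix x assume "x \<in> {1..int N} \<times> {1..int N}"
    then obtain a c where x: "x = (a, c)" "a \<in> {1..int N}" "c \<in> {1..int N}" by auto
    define d where "d = nat (gcd a c)"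
    have d: "int d = gcd a c" "0 < int d" using x by (auto simp: d_def)
    define a' c' where "a' = a div int d" and "c' = c div int d"
    have ac: "a = int d * a'" "c = int d * c'"
      unfolding a'_def c'_def d(1) by simp_all
    have "int d * gcd a' c' = int d"
      using gcd_mult_distrib_int[of "int d" a' c'] unfolding ac[symmetric] d(1)[symmetric] by simp
    then have "gcd a' c' = 1" using d(2) by (metis less_irrefl mult_cancel_left2)
    then have "coprime a' c'" by (simp add: coprime_iff_gcd_eq_1)
    moreover have "0 < int d * a'" "0 < int d * c'" using x unfolding ac[symmetric] by auto
    then have "1 \<le> a'" "1 \<le> c'" using d(2) by (simp_all add: zero_less_mult_iff)
    moreover have "a' \<le> int (N div d)" "c' \<le> int (N div d)"
      using x unfolding zdiv_int le_zdiv_iff[OF d(2)] ac[symmetric] by auto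
    moreover have "int d dvd a" unfolding d(1) by simp
    then have "d \<in> {1..N}" using zdvd_imp_le[of "int d" a] x d(2) by auto
    moreover have "(a', c') \<in> coprime_pairs (N div d)" using calculation by (simp add: coprime_pairs_def)
    moreover have "x = ?f d (a', c')" using x(1) ac by simp
    ultimately show "x \<in> (\<Union>d\<in>{1..N}. ?f d ` coprime_pairs (N div d))" by blast
  next
    fix x assume "x \<in> (\<Union>d\<in>{1..N}. ?f d ` coprime_pairs (N div d))"
    then obtain d a c where d: "d \<in> {1..N}" and ac: "(a, c) \<in> coprime_pairs (N div d)" "x = (int d * a, int d * c)"
      by auto
    have "int d * a \<le> int N" "int d * c \<le> int N"
      using ac d le_zdiv_iff[of "int d" a "int N"] le_zdiv_iff[of "int d" c "int N"]
      by (auto simp: coprime_pairs_def zdiv_int)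
    then show "x \<in> {1..int N} \<times> {1..int N}"
      using ac d by (auto simp: coprime_pairs_def int_one_le_iff_zero_less)
  qed
  then have "card ({1..int N} \<times> {1..int N}) = card (\<Union>d\<in>{1..N}. ?f d ` coprime_pairs (N div d))" by (rule arg_cong)
  also have "\<dots> = (\<Sum>d\<in>{1..N}. card (?f d ` coprime_pairs (N div d)))"
  proof (rule card_UN_disjoint)
    show "\<forall>i\<in>{1..N}. \<forall>j\<in>{1..N}. i \<noteq> j \<longrightarrow> ?f i ` coprime_pairs (N div i) \<inter> ?f j ` coprime_pairs (N div j) = {}"
    proof (intro ballI impI, rule ccontr)
      fix i j assume ij: "i \<in> {1..N}" "j \<in> {1..N}" "i \<noteq> j"
        and "?f i ` coprime_pairs (N div i) \<inter> ?f j ` coprime_pairs (N div j) \<noteq> {}"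
      then obtain a c a' c' where "coprime a c" "coprime a' c'" "int i * a = int j * a'" "int i * c = int j * c'"
        by (auto simp: coprime_pairs_def)
      then have "int i * gcd a c = int j * gcd a' c'"
        using gcd_mult_distrib_int[of "int i" a c] gcd_mult_distrib_int[of "int j" a' c'] by simp
      then have "int i = int j" using \<open>coprime a c\<close> \<open>coprime a' c'\<close> by simp
      then show False using ij by simp
    qed
  qed (auto intro: finite_coprime_pairs)
  also have "\<dots> = (\<Sum>d\<in>{1..N}. card (coprime_pairs (N div d)))"
    by (intro sum.cong refl card_image) (auto simp: inj_on_def)
  finally show ?thesis by (simp add: card_cartesian_product power2_eq_square)
qed

definition \<theta> :: real where "\<theta> = 6 / pi\<^sup>2"

lemma theta_pos: "0 < \<theta>" by (simp add: \<theta>_def)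

text \<open>Divided by \<open>N^2\<close>, \<open>sum_coprime_pairs\<close> is a series in
  \<open>k = d - 1\<close> with sum 1. Its terms tend to \<open>L / (k + 1)^2\<close> and are
  dominated by \<open>1 / (k + 1)^2\<close>, so Tannery's theorem gives
  \<open>L * (pi^2 / 6) = 1\<close>.\<close>

theorem coprime_ratio_tendsto: "coprime_ratio \<longlonglongrightarrow> \<theta>"
proof -
  obtain L where L: "coprime_ratio \<longlonglongrightarrow> L" using coprime_ratio_convergent by (auto simp: convergent_def)
  define a where "a k n = real (card (coprime_pairs (n div Suc k))) / real n ^ 2" for k n
  have lim: "a k \<longlonglongrightarrow> L * (1 / real (Suc k)) ^ 2" for k
  proof -
    have d: "filterlim (\<lambda>n. n div Suc k) at_top sequentially"
      by (rule filterlim_at_top_div_const_nat) simp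
    have "(\<lambda>n. coprime_ratio (n div Suc k)) \<longlonglongrightarrow> L" by (rule filterlim_compose[OF L d])
    moreover have "(\<lambda>n. real (n div Suc k) / real n) \<longlonglongrightarrow> 1 / real (Suc k)"
    proof (rule tendsto_sandwich)
      show "\<forall>\<^sub>F n in sequentially. 1 / real (Suc k) - 1 / real n \<le> real (n div Suc k) / real n"
      proof (rule eventually_mono[OF eventually_gt_at_top[of 0]])
        fix n :: nat assume "0 < n"
        have "n < Suc (n div Suc k) * Suc k" by (rule div_less_iff_less_mult[THEN iffD1]) auto
        then have "real n < real (Suc (n div Suc k) * Suc k)" by (rule of_nat_less_iff[THEN iffD2])
        then have "real n < (real (n div Suc k) + 1) * real (Suc k)" by (simp only: of_nat_mult of_nat_Suc) (simp add: algebra_simps)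
        then have "real n / real (Suc k) < real (n div Suc k) + 1"
          by (subst pos_divide_less_eq) simp_all
        then have "(real n / real (Suc k) - 1) / real n \<le> real (n div Suc k) / real n"
          by (intro divide_right_mono) auto
        then show "1 / real (Suc k) - 1 / real n \<le> real (n div Suc k) / real n"
          using \<open>0 < n\<close> by (simp add: diff_divide_distrib)
      qed
      show "\<forall>\<^sub>F n in sequentially. real (n div Suc k) / real n \<le> 1 / real (Suc k)"
      proof (rule eventually_mono[OF eventually_gt_at_top[of 0]])
        fix n :: nat assume "0 < n"
        have "real (n div Suc k) / real n \<le> (real n / real (Suc k)) / real n"
          by (intro divide_right_mono of_nat_div_le_of_nat) auto
        then show "real (n div Suc k) / real n \<le> 1 / real (Suc k)" using \<open>0 < n\<close> by simp
      qed
      have "(\<lambda>n. 1 / real (Suc k) - 1 / real n) \<longlonglongrightarrow> 1 / real (Suc k) - 0"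
        by (intro tendsto_intros lim_1_over_n)
      then show "(\<lambda>n. 1 / real (Suc k) - 1 / real n) \<longlonglongrightarrow> 1 / real (Suc k)" by simp
    qed auto
    ultimately have "(\<lambda>n. coprime_ratio (n div Suc k) * (real (n div Suc k) / real n) ^ 2) \<longlonglongrightarrow> L * (1 / real (Suc k)) ^ 2"
      by (intro tendsto_mult tendsto_power)
    then show ?thesis
    proof (rule Lim_transform_eventually)
      show "\<forall>\<^sub>F n in sequentially. coprime_ratio (n div Suc k) * (real (n div Suc k) / real n) ^ 2 = a k n"
      proof (rule eventually_mono[OF eventually_ge_at_top[of "Suc k"]])
        fix n assume "Suc k \<le> n"
        then have "0 < n div Suc k" by (simp add: div_greater_zero_iff)
        then show "coprime_ratio (n div Suc k) * (real (n div Suc k) / real n) ^ 2 = a k n"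
          by (simp add: coprime_ratio_def a_def power_divide)
      qed
    qed
  qed
  have bound: "norm (a k n) \<le> 1 / real (Suc k) ^ 2" for k n
  proof -
    have "card (coprime_pairs (n div Suc k)) \<le> card ({1..int (n div Suc k)} \<times> {1..int (n div Suc k)})"
      by (intro card_mono) (auto simp: coprime_pairs_def)
    then have "real (card (coprime_pairs (n div Suc k))) \<le> real (n div Suc k) ^ 2"
      by (simp add: card_cartesian_product power2_eq_square flip: of_nat_mult)
    also have "\<dots> \<le> (real n / real (Suc k)) ^ 2"
      by (intro power_mono of_nat_div_le_of_nat) auto
    finally have "a k n \<le> (real n / real (Suc k)) ^ 2 / real n ^ 2"
      unfolding a_def by (intro divide_right_mono) auto
    also have "\<dots> \<le> 1 / real (Suc k) ^ 2" by (cases "n = 0") (auto simp: power_divide)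
    finally show ?thesis by (simp add: a_def)
  qed
  have sq: "(\<lambda>k. 1 / real (Suc k) ^ 2) sums (pi\<^sup>2 / 6)"
    using inverse_squares_sums by simp
  have "(\<lambda>n. suminf (\<lambda>k. a k n)) \<longlonglongrightarrow> suminf (\<lambda>k. L * (1 / real (Suc k)) ^ 2)"
  proof -
    have "\<forall>\<^sub>F (k, n) in sequentially \<times>\<^sub>F sequentially. norm (a k n) \<le> 1 / real (Suc k) ^ 2"
      using bound by (intro always_eventually) auto
    then show ?thesis
      using tannerys_theorem[where a = a and F = sequentially and M = "\<lambda>k. 1 / real (Suc k) ^ 2"
        and b = "\<lambda>k. L * (1 / real (Suc k)) ^ 2", OF lim] sq by (simp add: sums_iff)
  qed
  also have "suminf (\<lambda>k. L * (1 / real (Suc k)) ^ 2) = L * (pi\<^sup>2 / 6)"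
    using sums_mult[OF sq, of L] by (simp add: sums_iff power_divide)
  finally have 1: "(\<lambda>n. suminf (\<lambda>k. a k n)) \<longlonglongrightarrow> L * (pi\<^sup>2 / 6)" .
  have "suminf (\<lambda>k. a k n) = 1" if "0 < n" for n
  proof -
    have "suminf (\<lambda>k. a k n) = (\<Sum>k\<in>{..<n}. a k n)"
    proof (rule suminf_finite)
      fix k assume "k \<notin> {..<n}"
      then have "n div Suc k = 0" by simp
      then show "a k n = 0" by (simp add: a_def coprime_pairs_def)
    qed simp
    also have "\<dots> = (\<Sum>d\<in>{1..n}. real (card (coprime_pairs (n div d)))) / real n ^ 2"
      unfolding a_def sum_divide_distrib[symmetric]
      by (simp add: sum.atLeast1_atMost_eq)
    also have "\<dots> = 1" using that sum_coprime_pairs[of n] by (simp flip: of_nat_sum)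
    finally show ?thesis .
  qed
  then have "(\<lambda>n. suminf (\<lambda>k. a k n)) \<longlonglongrightarrow> 1"
    by (intro tendsto_eventually eventually_mono[OF eventually_gt_at_top[of 0]]) auto
  with 1 have "L * (pi\<^sup>2 / 6) = 1" by (rule LIMSEQ_unique)
  then have "L = \<theta>" by (simp add: \<theta>_def field_simps)
  with L show ?thesis by simp
qed

text \<open>Coprime pairs survive the sieve for every modulus, so the sieve density is an upper
  bound for their density.\<close>

lemma theta_le_residue_density:
  assumes "0 < W" shows "\<theta> \<le> residue_density W"
proof (rule field_le_epsilon)
  fix e :: real assume "0 < e"
  then show "\<theta> \<le> residue_density W + e"
    using coprime_ratio_upper[OF assms \<open>0 < e\<close>] by (intro tendsto_upperbound[OF coprime_ratio_tendsto]) auto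
qed

section \<open>Continued fraction words\<close>

text \<open>A word lists the digits \<open>h\<^sub>s, \<dots>, h\<^sub>1\<close> with the last one first. For it, \<open>cf_den\<close> is \<open>(q\<^sub>s\<^sub>-\<^sub>1, q\<^sub>s)\<close>, \<open>cf_num\<close>
  is \<open>(p\<^sub>s\<^sub>-\<^sub>1, p\<^sub>s)\<close>, and \<open>cf_val w z\<close> is \<open>[h\<^sub>1, \<dots>, h\<^sub>s + z]\<close>.\<close>

fun cf_den :: "nat list \<Rightarrow> nat \<times> nat" where
  "cf_den [] = (0, 1)"
| "cf_den (n # w) = (snd (cf_den w), n * snd (cf_den w) + fst (cf_den w))"

fun cf_num :: "nat list \<Rightarrow> nat \<times> nat" where
  "cf_num [] = (1, 0)"
| "cf_num (n # w) = (snd (cf_num w), n * snd (cf_num w) + fst (cf_num w))"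

fun cf_val :: "nat list \<Rightarrow> real \<Rightarrow> real" where
  "cf_val [] z = z"
| "cf_val (n # w) z = cf_val w (1 / (real n + z))"

lemma cf_den_pos: "0 \<notin> set w \<Longrightarrow> 0 < snd (cf_den w)"
  by (induction w) auto

lemma cf_den_le: "0 \<notin> set w \<Longrightarrow> fst (cf_den w) \<le> snd (cf_den w)"
proof (induction w)
  case (Cons n w)
  then have "1 * snd (cf_den w) \<le> n * snd (cf_den w)" by (intro mult_right_mono) auto
  then show ?case unfolding cf_den.simps fst_conv snd_conv by linarith
qed simp

lemma cf_det:
  "int (snd (cf_num w)) * int (fst (cf_den w)) - int (fst (cf_num w)) * int (snd (cf_den w))
     = - ((-1) ^ length w)"
  by (induction w) (simp_all add: algebra_simps)

lemma cf_val_eq: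
  fixes z :: real
  assumes "0 \<notin> set w" "0 \<le> z"
  shows "cf_val w z = (snd (cf_num w) + z * fst (cf_num w)) / (snd (cf_den w) + z * fst (cf_den w))"
  using assms
proof (induction w arbitrary: z)
  case (Cons n w)
  have n: "0 < real n" and w: "0 \<notin> set w" using Cons.prems(1) by auto
  let ?p = "real (snd (cf_num w))" and ?p' = "real (fst (cf_num w))"
  let ?q = "real (snd (cf_den w))" and ?q' = "real (fst (cf_den w))"
  have nz: "0 < n + z" using n Cons.prems(2) by simp
  have "cf_val (n # w) z = (?p + 1 / (n + z) * ?p') / (?q + 1 / (n + z) * ?q')"
    using Cons.IH[OF w, of "1 / (n + z)"] nz by simp
  also have "\<dots> = ((n + z) * (?p + 1 / (n + z) * ?p')) / ((n + z) * (?q + 1 / (n + z) * ?q'))"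
    using nz by (intro mult_divide_mult_cancel_left[symmetric]) simp
  also have "(n + z) * (?p + 1 / (n + z) * ?p') = n * ?p + ?p' + z * ?p"
    using nz by (simp add: distrib_left) (simp add: algebra_simps)
  also have "(n + z) * (?q + 1 / (n + z) * ?q') = n * ?q + ?q' + z * ?q"
    using nz by (simp add: distrib_left) (simp add: algebra_simps)
  finally show ?case by simp
qed simp

text \<open>The difference of two values of a Moebius map of determinant 1 or -1. For the two ends
  of a tail interval it is the signed length of a piece of the cylinder, the sign being the parity
  of the word.\<close>

lemma cf_val_diff:
  fixes z z' :: real
  assumes "0 \<notin> set w" "0 \<le> z" "0 \<le> z'"
  shows "cf_val w z - cf_val w z' = (-1) ^ length w * (z - z') /
    ((snd (cf_den w) + z * fst (cf_den w)) * (snd (cf_den w) + z' * fst (cf_den w)))"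
proof -
  let ?p = "real (snd (cf_num w))" and ?p' = "real (fst (cf_num w))"
  let ?q = "real (snd (cf_den w))" and ?q' = "real (fst (cf_den w))"
  have "real_of_int (int (snd (cf_num w)) * int (fst (cf_den w)) - int (fst (cf_num w)) * int (snd (cf_den w)))
     = real_of_int (- ((-1) ^ length w))"
    unfolding cf_det ..
  then have det: "?p * ?q' - ?p' * ?q = - ((-1) ^ length w)" by simp
  have pos: "0 < ?q + z * ?q'" "0 < ?q + z' * ?q'"
    using cf_den_pos[OF assms(1)] assms(2,3) by (auto intro!: add_pos_nonneg)
  have "cf_val w z - cf_val w z' = ((?p + z * ?p') * (?q + z' * ?q') - (?p + z' * ?p') * (?q + z * ?q'))
      / ((?q + z * ?q') * (?q + z' * ?q'))"
    using pos assms by (simp add: cf_val_eq diff_frac_eq)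
  also have "(?p + z * ?p') * (?q + z' * ?q') - (?p + z' * ?p') * (?q + z * ?q')
      = - (?p * ?q' - ?p' * ?q) * (z - z')"
    by (simp add: algebra_simps)
  finally show ?thesis by (simp add: det)
qed

lemma cf_val_in_unit:
  "0 \<notin> set w \<Longrightarrow> z \<in> {0..1} \<Longrightarrow> cf_val w z \<in> {0..1}"
  by (induction w arbitrary: z) (auto simp: divide_le_eq)

lemma cf_val_in_open_unit:
  "0 \<notin> set w \<Longrightarrow> z \<in> {0<..<1} \<Longrightarrow> cf_val w z \<in> {0<..<1}"
proof (induction w arbitrary: z)
  case (Cons n w)
  then have "1 / (real n + z) \<in> {0<..<1}" by (auto simp: divide_less_eq)
  with Cons show ?case by simp
qed simp

lemma cf_val_append: "cf_val (v @ w) z = cf_val w (cf_val v z)"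
  by (induction v arbitrary: z) auto

text \<open>Appending to the list puts a new first digit in front of the expansion:
  \<open>1 / (a + p / q) = q / (a * q + p)\<close>, so old denominators become numerators.\<close>

lemma cf_num_snoc: "cf_num (w @ [a]) = cf_den w"
  by (induction w) auto

lemma cf_den_snoc:
  "cf_den (w @ [a]) = (a * fst (cf_den w) + fst (cf_num w), a * snd (cf_den w) + snd (cf_num w))"
  by (induction w) (auto simp: algebra_simps)

text \<open>A rational number has two expansions, since a last digit \<open>h \<ge> 2\<close> may be split as \<open>h - 1, 1\<close>;
  their lengths have different parity.\<close>

lemma cf_word_exists:
  assumes "coprime p m" "0 < p" "p < (m::nat)"
  shows "\<exists>w. 0 \<notin> set w \<and> even (length w) = e \<and> snd (cf_num w) = p \<and> snd (cf_den w) = m"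
  using assms
proof (induction p arbitrary: m e rule: less_induct)
  case (less p)
  define a b where "a = m div p" and "b = m mod p"
  have m: "m = a * p + b" by (simp add: a_def b_def)
  have b: "b < p" using less.prems by (simp add: b_def)
  have a: "0 < a" using less.prems by (simp add: a_def div_greater_zero_iff)
  show ?case
  proof (cases "b = 0")
    case True
    then have "p = 1" using less.prems m by simp
    then have ma: "m = a" "2 \<le> a" using m True less.prems by auto
    show ?thesis
    proof (cases e)
      case False
      then show ?thesis using ma \<open>p = 1\<close> by (intro exI[of _ "[a]"]) auto
    next
      case True
      \<comment> \<open>The word lists \<open>h\<^sub>2 = 1\<close> and then
        \<open>h\<^sub>1 = a - 1\<close>, and \<open>1 / (a - 1 + 1 / 1) = 1 / a\<close>.\<close>
      then show ?thesis using ma \<open>p = 1\<close> by (intro exI[of _ "[1, a - 1]"]) auto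
    qed
  next
    case False
    have "coprime b p" using less.prems(1) unfolding b_def
      by (metis coprime_commute coprime_mod_left_iff gr_implies_not0 less.prems(2))
    \<comment> \<open>One Euclidean step: \<open>p / m = 1 / (a + b / p)\<close>. The new first
      digit \<open>a\<close> will be appended, so the word for \<open>b / p\<close> must have the
      opposite parity.\<close>
    then obtain w where w: "0 \<notin> set w" "even (length w) = (\<not> e)" "snd (cf_num w) = b" "snd (cf_den w) = p"
      using less.IH[OF b, of p "\<not> e"] False b by auto
    show ?thesis
      using w a m by (intro exI[of _ "w @ [a]"]) (auto simp: cf_num_snoc cf_den_snoc)
  qed
qed

section \<open>Digits and denominators read off from the value of a word\<close>

lemma gauss_map_inverse:
  assumes "0 < n" "z \<in> {0<..<1}"
  shows "gauss_map (1 / (real n + z)) = z" "nat \<lfloor>1 / (1 / (real n + z))\<rfloor> = n"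
proof -
  have "\<lfloor>real n + z\<rfloor> = int n" using assms by (intro floor_unique) auto
  then show "gauss_map (1 / (real n + z)) = z" "nat \<lfloor>1 / (1 / (real n + z))\<rfloor> = n"
    by (simp_all add: gauss_map_def frac_def)
qed

lemma gauss_map_cf_val:
  "0 \<notin> set w \<Longrightarrow> z \<in> {0<..<1} \<Longrightarrow> (gauss_map ^^ length w) (cf_val w z) = z"
proof (induction w arbitrary: z)
  case (Cons n w)
  have z: "1 / (real n + z) \<in> {0<..<1}" using Cons.prems by (auto simp: divide_less_eq)
  then have "(gauss_map ^^ length w) (cf_val (n # w) z) = 1 / (real n + z)"
    using Cons by simp
  then show ?case using Cons.prems by (simp add: gauss_map_inverse)
qed simp

lemma cf_digit_tail:
  assumes "0 < i" shows "cf_digit x (n + i) = cf_digit ((gauss_map ^^ n) x) i"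
  using assms by (cases i) (auto simp: funpow_add add.commute)

lemma cf_digit_cf_val_tail:
  "0 \<notin> set w \<Longrightarrow> z \<in> {0<..<1} \<Longrightarrow> 0 < i \<Longrightarrow> cf_digit (cf_val w z) (length w + i) = cf_digit z i"
  by (simp add: cf_digit_tail gauss_map_cf_val)

lemma cf_digit_cf_val:
  "0 \<notin> set w \<Longrightarrow> z \<in> {0<..<1} \<Longrightarrow> j < length w \<Longrightarrow> cf_digit (cf_val w z) (length w - j) = w ! j"
proof (induction w arbitrary: z j)
  case (Cons n w)
  have z: "1 / (real n + z) \<in> {0<..<1}" using Cons.prems by (auto simp: divide_less_eq)
  show ?case
  proof (cases j)
    case 0
    have "(gauss_map ^^ length w) (cf_val (n # w) z) = 1 / (real n + z)"
      using Cons.prems z gauss_map_cf_val[of w] by simp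
    then show ?thesis using 0 gauss_map_inverse(2)[of n z] Cons.prems by simp
  next
    case (Suc j')
    then show ?thesis using Cons z by simp
  qed
qed simp

lemma cf_digit_cf_val_rev:
  assumes "0 \<notin> set g" "z \<in> {0<..<1}" "j < length g"
  shows "cf_digit (cf_val (rev g) z) (Suc j) = g ! j"
  using cf_digit_cf_val[of "rev g" z "length g - Suc j"] assms by (simp add: rev_nth Suc_diff_Suc)

lemma cf_denom_cf_val:
  "0 \<notin> set w \<Longrightarrow> z \<in> {0<..<1} \<Longrightarrow> j \<le> length w
    \<Longrightarrow> cf_denom (cf_val w z) j = snd (cf_den (drop (length w - j) w))"
proof (induction "cf_val w z" j rule: cf_denom.induct)
  case 2
  then have "w \<noteq> []" by auto
  then have "drop (length w - 1) w = [w ! (length w - 1)]"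
    by (metis append_butlast_last_id append_eq_conv_conj last_conv_nth length_butlast)
  then show ?case
    using 2 cf_digit_cf_val[of w z "length w - 1"] by (simp del: cf_digit.simps)
next
  case (3 s)
  let ?k = "length w - Suc (Suc s)"
  have k: "?k < length w" "length w - ?k = Suc (Suc s)" using 3 by auto
  have 1: "drop ?k w = w ! ?k # drop (Suc ?k) w" "drop (Suc ?k) w = w ! Suc ?k # drop (Suc (Suc ?k)) w"
    using 3 by (auto intro!: Cons_nth_drop_Suc[symmetric])
  have 2: "length w - Suc s = Suc ?k" "length w - s = Suc (Suc ?k)" using 3 by auto
  have "cf_digit (cf_val w z) (Suc (Suc s)) = w ! ?k"
    using cf_digit_cf_val[of w z ?k] k 3 by simp
  then show ?case
    using 3 1 by (simp add: 2 del: cf_digit.simps)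
qed simp

lemma cf_denom_cf_val_last:
  assumes "0 \<notin> set w" "z \<in> {0<..<1}"
  shows "cf_denom (cf_val w z) (length w) = snd (cf_den w)"
    and "w \<noteq> [] \<Longrightarrow> cf_denom (cf_val w z) (length w - 1) = fst (cf_den w)"
proof -
  show "cf_denom (cf_val w z) (length w) = snd (cf_den w)"
    using cf_denom_cf_val[OF assms, of "length w"] by simp
  assume "w \<noteq> []"
  then show "cf_denom (cf_val w z) (length w - 1) = fst (cf_den w)"
    using cf_denom_cf_val[OF assms, of "length w - 1"] by (cases w) auto
qed

lemma gauss_map_unit: "gauss_map x \<in> {0..<1}"
  by (simp add: gauss_map_def frac_lt_1)

lemma funpow_gauss_map_unit: "x \<in> {0..<1} \<Longrightarrow> (gauss_map ^^ n) x \<in> {0..<1}"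
  using gauss_map_unit by (cases n) auto

text \<open>A digit 0 means that the orbit has reached 0, which the Gauss map fixes.\<close>

lemma cf_digit_eq_0_mono:
  assumes "x \<in> {0..<1}" "1 \<le> i" "i \<le> j" "cf_digit x i = 0"
  shows "cf_digit x j = 0"
proof -
  obtain i' where i': "i = Suc i'" using assms(2) by (cases i) auto
  define y where "y = (gauss_map ^^ i') x"
  have y: "y \<in> {0..<1}" using funpow_gauss_map_unit[OF assms(1)] by (simp add: y_def)
  have "y = 0"
  proof (rule ccontr)
    assume "y \<noteq> 0"
    then have "1 \<le> 1 / y" using y by (simp add: le_divide_eq)
    then have "1 \<le> \<lfloor>1 / y\<rfloor>" by simp
    then show False using assms(4) i' by (simp add: y_def)
  qed
  moreover have "(gauss_map ^^ n) 0 = 0" for n by (induction n) (auto simp: gauss_map_def)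
  moreover obtain d where "j = Suc (i' + d)" using assms(3) i' by (metis add_Suc le_Suc_ex)
  ultimately show ?thesis by (simp add: funpow_add add.commute[of i' d] flip: y_def)
qed

lemma cf_denom_mono:
  assumes "x \<in> {0..<1}" "1 \<le> cf_digit x j" "i \<le> j"
  shows "cf_denom x i \<le> cf_denom x j"
  using assms
proof (induction j arbitrary: i)
  case (Suc j)
  show ?case
  proof (cases "i = Suc j")
    case False
    then have ij: "i \<le> j" using Suc.prems by simp
    have step: "cf_denom x j \<le> cf_denom x (Suc j)"
    proof (cases j)
      case 0
      then show ?thesis using Suc.prems by simp
    next
      case (Suc n)
      have "1 * cf_denom x j \<le> cf_digit x (Suc j) * cf_denom x j"
        using Suc.prems(2) by (intro mult_right_mono) auto
      then show ?thesis using Suc unfolding Suc cf_denom.simps by linarith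
    qed
    show ?thesis
    proof (cases "j = 0")
      case True
      then show ?thesis using ij step by simp
    next
      case False
      then have "1 \<le> cf_digit x j"
        using cf_digit_eq_0_mono[OF Suc.prems(1), of j "Suc j"] Suc.prems(2) by fastforce
      then show ?thesis using Suc.IH[OF Suc.prems(1) _ ij] step by simp
    qed
  qed simp
qed simp

text \<open>Denominators increase weakly as long as the digits are genuine, so crossings at
  \<open>s < s'\<close> would give \<open>R < q\<^sub>s\<close> and
  \<open>q\<^sub>s <= q_(s' - 1) < R\<close>.\<close>

lemma is_crossing_unique:
  assumes "x \<in> {0..<1}" "is_crossing R x s" "is_crossing R x s'"
  shows "s = s'"
proof (rule ccontr)
  have *: False if "s < s'" "is_crossing R x s" "is_crossing R x s'" for s s'
  proof (cases "s' - 1 = s")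
    case True
    then show False using that by (auto simp: is_crossing_def)
  next
    case False
    then have "1 \<le> cf_digit x (s' - 1)"
      using cf_digit_eq_0_mono[OF assms(1), of "s' - 1" s'] that by (fastforce simp: is_crossing_def)
    then have "cf_denom x s \<le> cf_denom x (s' - 1)"
      using that by (intro cf_denom_mono[OF assms(1)]) auto
    then show False using that by (auto simp: is_crossing_def)
  qed
  assume "s \<noteq> s'"
  then show False using *[of s s'] *[of s' s] assms by linarith
qed

lemma crossing_cf_val:
  assumes "0 \<notin> set w" "w \<noteq> []" "z \<in> {0<..<1}"
    and "real (fst (cf_den w)) < R" "R < real (snd (cf_den w))"
  shows "is_crossing R (cf_val w z) (length w)" "renewal_index R (cf_val w z) = length w"
proof -
  let ?x = "cf_val w z"
  have x: "?x \<in> {0..<1}" using cf_val_in_open_unit[OF assms(1,3)] by auto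
  have d: "1 \<le> cf_digit ?x s" if "1 \<le> s" "s \<le> length w" for s
    using cf_digit_cf_val[OF assms(1,3), of "length w - s"] that assms(1) nth_mem[of "length w - s" w]
    by (metis One_nat_def Suc_leI bot_nat_0.not_eq_extremum diff_diff_cancel diff_less less_le_trans zero_less_one)
  show c: "is_crossing R ?x (length w)"
    using assms d[of "length w"] cf_denom_cf_val_last[OF assms(1,3)]
    by (auto simp: is_crossing_def Suc_le_eq simp del: cf_digit.simps)
  show "renewal_index R ?x = length w"
    unfolding renewal_index_def
  proof (rule Least_equality)
    show "R \<le> real (cf_denom ?x (length w))" using c by (simp add: is_crossing_def)
    fix s assume s: "R \<le> real (cf_denom ?x s)"
    show "length w \<le> s"
    proof (rule ccontr)
      assume "\<not> length w \<le> s"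
      then have l: "s \<le> length w - 1" by simp
      have "cf_denom ?x s \<le> cf_denom ?x (length w - 1)"
      proof (cases "s = length w - 1")
        case False
        then show ?thesis using l d by (intro cf_denom_mono[OF x]) auto
      qed simp
      then show False using s c by (simp add: is_crossing_def)
    qed
  qed
qed

text \<open>Since \<open>q\<^sub>s\<^sub>-\<^sub>1 / q\<^sub>s =
  [h\<^sub>s, \<dots>, h\<^sub>1]\<close>, its leading digits are the front of the word. A rational
  number has two expansions, but the tail \<open>z\<close> lies in the open unit interval, and this
  removes the ambiguity: the difference of two candidates for a digit is an integer strictly between
  -1 and 1.\<close>

lemma cf_den_ratio_digits:
  assumes "0 \<notin> set w" "0 \<notin> set g" "z \<in> {0<..<1}"
    and "real (fst (cf_den w)) / real (snd (cf_den w)) = cf_val (rev g) z"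
  shows "length g \<le> length w \<and> take (length g) w = g"
  using assms
proof (induction g arbitrary: w)
  case (Cons a g)
  define y where "y = cf_val (rev g) z"
  have y: "y \<in> {0<..<1}" using Cons.prems cf_val_in_open_unit[of "rev g" z] by (simp add: y_def)
  have v: "cf_val (rev (a # g)) z = 1 / (real a + y)" by (simp add: cf_val_append y_def)
  have vpos: "0 < 1 / (real a + y)" using y by (auto intro!: add_nonneg_pos)
  show ?case
  proof (cases w)
    case Nil
    then show ?thesis using Cons.prems(4) v vpos by simp
  next
    case (Cons n w')
    define r where "r = real (fst (cf_den w')) / real (snd (cf_den w'))"
    have w': "0 \<notin> set w'" using Cons Cons.prems(1) by simp
    have q: "0 < snd (cf_den w')" by (rule cf_den_pos[OF w'])
    have r: "0 \<le> r" "r \<le> 1" using cf_den_le[OF w'] q by (auto simp: r_def)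
    have "real (fst (cf_den w)) / real (snd (cf_den w)) = 1 / (real n + r)"
      using q by (simp add: Cons r_def field_simps)
    then have "1 / (real n + r) = 1 / (real a + y)"
      using Cons.prems(4) v by simp
    then have nr: "real n + r = real a + y"
      by (simp add: divide_inverse)
    have "real_of_int (int n - int a) = y - r" using nr by simp
    moreover have "y - r < 1" "-1 < y - r" using y r by auto
    ultimately have "n = a" by linarith
    then have "r = y" using nr by simp
    then have "length g \<le> length w' \<and> take (length g) w' = g"
      using Cons.IH[OF w'] Cons.prems by (simp add: r_def y_def)
    then show ?thesis using Cons \<open>n = a\<close> by simp
  qed
qed simp

text \<open>Here \<open>g\<close> lists the digits in their natural order, whereas words have the last digit first.\<close>

definition cf_cyl :: "nat list \<Rightarrow> real set"
  where "cf_cyl g = cf_val (rev g) ` {0<..<1}"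

lemma cf_val_strict_mono:
  fixes z z' :: real
  assumes "0 \<notin> set w" "0 \<le> z" "z < z'"
  shows "(if even (length w) then cf_val w z < cf_val w z' else cf_val w z' < cf_val w z)"
proof -
  define P where "P = (snd (cf_den w) + z' * fst (cf_den w)) * (snd (cf_den w) + z * fst (cf_den w))"
  have "0 < P"
    using cf_den_pos[OF assms(1)] assms(2,3) unfolding P_def by (intro mult_pos_pos add_pos_nonneg) auto
  then have "0 < (z' - z) / P" using assms(3) by simp
  moreover have "cf_val w z' - cf_val w z = (-1) ^ length w * ((z' - z) / P)"
    using cf_val_diff[of w z' z] assms by (simp add: P_def)
  ultimately have *: "0 < (z' - z) / P" "cf_val w z' - cf_val w z = (-1) ^ length w * ((z' - z) / P)"
    by blast+
  show ?thesis
  proof (cases "even (length w)")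
    case True
    then have "(-1::real) ^ length w = 1" by simp
    then have "cf_val w z' - cf_val w z = (z' - z) / P" using *(2) by (simp only: mult_1)
    with * have "cf_val w z < cf_val w z'" by linarith
    with True show ?thesis by simp
  next
    case False
    then have "(-1::real) ^ length w = -1" by simp
    then have "cf_val w z' - cf_val w z = - ((z' - z) / P)" using *(2) by (simp only: mult_minus1)
    with * have "cf_val w z' < cf_val w z" by linarith
    with False show ?thesis by simp
  qed
qed

lemma cf_val_image_interval:
  fixes a b :: real
  assumes w: "0 \<notin> set w" and ab: "0 \<le> a" "a < b"
  shows "cf_val w ` {a<..<b} = {min (cf_val w a) (cf_val w b)<..<max (cf_val w a) (cf_val w b)}"
proof
  show "cf_val w ` {a<..<b} \<subseteq> {min (cf_val w a) (cf_val w b)<..<max (cf_val w a) (cf_val w b)}"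
  proof safe
    fix z assume "z \<in> {a<..<b}"
    then show "cf_val w z \<in> {min (cf_val w a) (cf_val w b)<..<max (cf_val w a) (cf_val w b)}"
      using cf_val_strict_mono[OF w, of a z] cf_val_strict_mono[OF w, of z b] ab
      by (auto split: if_splits)
  qed
  have cont: "continuous_on {a..b} (cf_val w)"
  proof (rule continuous_on_eq)
    show "continuous_on {a..b} (\<lambda>z. (snd (cf_num w) + z * fst (cf_num w)) / (snd (cf_den w) + z * fst (cf_den w)))"
    proof (intro continuous_intros ballI)
      fix z assume "z \<in> {a..b}"
      then have "0 < real (snd (cf_den w)) + z * real (fst (cf_den w))"
        using cf_den_pos[OF w] ab by (intro add_pos_nonneg) auto
      then show "real (snd (cf_den w)) + z * real (fst (cf_den w)) \<noteq> 0" by simp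
    qed
  qed (use w ab in \<open>auto simp: cf_val_eq\<close>)
  show "{min (cf_val w a) (cf_val w b)<..<max (cf_val w a) (cf_val w b)} \<subseteq> cf_val w ` {a<..<b}"
  proof
    fix x assume x: "x \<in> {min (cf_val w a) (cf_val w b)<..<max (cf_val w a) (cf_val w b)}"
    have "\<exists>z\<ge>a. z \<le> b \<and> cf_val w z = x"
    proof (cases "cf_val w a \<le> cf_val w b")
      case True
      then show ?thesis using IVT'[of "cf_val w" a x b] x ab cont by auto
    next
      case False
      then show ?thesis using IVT2'[of "cf_val w" b x a] x ab cont by auto
    qed
    then obtain z where z: "a \<le> z" "z \<le> b" "cf_val w z = x" by blast
    then have "z \<noteq> a" "z \<noteq> b" using x by auto
    then show "x \<in> cf_val w ` {a<..<b}" using z by force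
  qed
qed

text \<open>The inclusion for tails in \<open>{0..1}\<close> is there for rational numbers whose
  expansion ends with the prescribed digits; they lie at an end of the open cylinder.\<close>

lemma cf_cyl_interval:
  assumes "0 \<notin> set g"
  obtains a b where "0 \<le> a" "a < b" "b \<le> 1" "cf_cyl g = {a<..<b}" "cf_val (rev g) ` {0..1} \<subseteq> {a..b}"
proof
  let ?a = "cf_val (rev g) 0" and ?b = "cf_val (rev g) 1"
  have g: "0 \<notin> set (rev g)" using assms by simp
  have "?a \<in> {0..1}" "?b \<in> {0..1}" by (rule cf_val_in_unit[OF g], simp)+
  then show "0 \<le> min ?a ?b" "max ?a ?b \<le> 1" by auto
  show "min ?a ?b < max ?a ?b" using cf_val_strict_mono[OF g, of 0 1] by (auto split: if_splits)
  show *: "cf_cyl g = {min ?a ?b<..<max ?a ?b}"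
    unfolding cf_cyl_def by (rule cf_val_image_interval[OF g]) auto
  show "cf_val (rev g) ` {0..1} \<subseteq> {min ?a ?b..max ?a ?b}"
  proof safe
    fix z :: real assume z: "z \<in> {0..1}"
    show "cf_val (rev g) z \<in> {min ?a ?b..max ?a ?b}"
    proof (cases "z = 0 \<or> z = 1")
      case False
      then have "cf_val (rev g) z \<in> cf_cyl g" using z by (auto simp: cf_cyl_def)
      then show ?thesis unfolding * by auto
    qed auto
  qed
qed

lemma cf_digits_imp_cf_val:
  assumes "x \<in> {0..<1}" "0 \<notin> set g" "\<And>j. j < length g \<Longrightarrow> cf_digit x (Suc j) = g ! j"
  shows "x = cf_val (rev g) ((gauss_map ^^ length g) x)"
  using assms
proof (induction g rule: rev_induct)
  case (snoc a g)
  define y where "y = (gauss_map ^^ length g) x"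
  have y: "y \<in> {0..<1}" using funpow_gauss_map_unit snoc.prems(1) by (simp add: y_def)
  have "x = cf_val (rev g) y"
    unfolding y_def using snoc.prems by (intro snoc.IH) (auto simp: nth_append)
  moreover have "cf_digit x (Suc (length g)) = a" using snoc.prems(3)[of "length g"] by simp
  then have a: "nat \<lfloor>1 / y\<rfloor> = a" by (simp add: y_def)
  have "a \<noteq> 0" using snoc.prems(2) by auto
  then have "\<lfloor>1 / y\<rfloor> = int a" using a by linarith
  then have "gauss_map y = 1 / y - a" by (simp add: gauss_map_def frac_def)
  then have "1 / (real a + gauss_map y) = y" by simp
  ultimately show ?case by (simp add: y_def)
qed simp

section \<open>Counting words\<close>

lemma ennreal_le_limit:
  assumes "g \<longlonglongrightarrow> L" "\<forall>\<^sub>F n in sequentially. ennreal (g n) \<le> X"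
  shows "ennreal L \<le> X"
  using assms by (intro tendsto_upperbound[OF tendsto_ennrealI[OF assms(1)]]) auto

lemma liminf_sum_ennreal:
  fixes f :: "'i \<Rightarrow> nat \<Rightarrow> ennreal"
  assumes "finite I"
  shows "(\<Sum>i\<in>I. liminf (f i)) \<le> liminf (\<lambda>n. \<Sum>i\<in>I. f i n)"
proof -
  have "(\<integral>\<^sup>+i. liminf (\<lambda>n. f i n) \<partial>count_space I) \<le> liminf (\<lambda>n. \<integral>\<^sup>+i. f i n \<partial>count_space I)"
    by (intro nn_integral_liminf) auto
  then show ?thesis using assms by (simp add: nn_integral_count_space_finite)
qed

lemma liminf_add_ennreal:
  fixes f g :: "nat \<Rightarrow> ennreal"
  shows "liminf f + liminf g \<le> liminf (\<lambda>n. f n + g n)"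
  using liminf_sum_ennreal[of "UNIV :: bool set" "\<lambda>b. if b then f else g"] by (simp add: UNIV_bool add.commute)

text \<open>An inequality, because \<open>ennreal\<close> sends negative reals to 0 and a bound with
  a subtracted error term may be negative.\<close>

lemma ennreal_add_le: "ennreal (x + y) \<le> ennreal x + ennreal y"
proof (cases "0 \<le> x \<and> 0 \<le> y")
  case False
  then show ?thesis
    by (cases "0 \<le> x") (auto simp: ennreal_neg intro!: ennreal_leI)
qed (simp add: ennreal_plus)

lemma ennreal_sum_le: "finite I \<Longrightarrow> ennreal (\<Sum>i\<in>I. f i) \<le> (\<Sum>i\<in>I. ennreal (f i))"
proof (induction I rule: finite_induct)
  case (insert x F)
  then show ?case using order_trans[OF ennreal_add_le add_left_mono[OF insert.IH]] by simp
qed simp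

section \<open>Equidistribution of coprime pairs\<close>

definition positive_coprime_pairs :: "(int \<times> int) set"
  where "positive_coprime_pairs = {(a, c). 0 < a \<and> 0 < c \<and> coprime a c}"

definition scaled_pair :: "real \<Rightarrow> int \<times> int \<Rightarrow> real \<times> real"
  where "scaled_pair R x = (of_int (fst x) / R, of_int (snd x) / R)"

text \<open>For fixed \<open>P\<close> the sieve modulo \<open>P!\<close> is exact up to boundary
  terms as the scale grows, and pairs with a common divisor above \<open>P\<close> cost at most
  \<open>M^2 / P\<close>, where \<open>M\<close> bounds the box. Only then does \<open>P\<close>
  tend to infinity.\<close>

lemma coprime_pairs_box:
  fixes R :: "nat \<Rightarrow> real" and a b :: "real \<times> real"
  assumes R: "filterlim R at_top sequentially"
  shows "ennreal \<theta> * emeasure lborel (box a b \<inter> {x. 0 < fst x \<and> 0 < snd x})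
    \<le> liminf (\<lambda>i. emeasure (point_measure_on (1 / R i ^ 2) (scaled_pair (R i)) positive_coprime_pairs) (box a b))"
proof -
  define a1 a2 b1 b2 where "a1 = max 0 (fst a)" and "a2 = max 0 (snd a)" and "b1 = fst b" and "b2 = snd b"
  note defs = this
  have eq: "box a b \<inter> {x. 0 < fst x \<and> 0 < snd x} = {a1<..<b1} \<times> {a2<..<b2}"
    by (auto simp: box_prod defs)
  show ?thesis
  proof (cases "a1 < b1 \<and> a2 < b2")
    case False
    then have "{a1<..<b1} = {} \<or> {a2<..<b2} = {}" by auto
    then have "{a1<..<b1} \<times> {a2<..<b2} = {}" by blast
    then show ?thesis unfolding eq by (simp only: emeasure_empty mult_zero_right zero_le)
  next
    case True
    define M where "M = max b1 b2"
    have M: "0 < M" using True by (auto simp: M_def defs)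
    let ?X = "liminf (\<lambda>i. emeasure (point_measure_on (1 / R i ^ 2) (scaled_pair (R i)) positive_coprime_pairs) (box a b))"
    have *: "ennreal (\<theta> * ((b1 - a1) * (b2 - a2)) - M ^ 2 / P) \<le> ?X" if "0 < P" for P :: nat
    proof -
      define W :: nat where "W = fact P"
      have W: "0 < W" by (simp add: W_def)
      define G where "G = real (card (good_residues W))"
      define g where "g i = G * (((b1 - a1) / W - 1 / R i) * ((b2 - a2) / W - 1 / R i)) - (M + 1 / R i) ^ 2 / P" for i
      have R0: "(\<lambda>i. 1 / R i) \<longlonglongrightarrow> 0"
        by (intro tendsto_divide_0[OF tendsto_const] filterlim_at_top_imp_at_infinity R)
      have "g \<longlonglongrightarrow> G * (((b1 - a1) / W - 0) * ((b2 - a2) / W - 0)) - (M + 0) ^ 2 / P"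
        unfolding g_def by (intro tendsto_intros R0) (use \<open>0 < P\<close> in auto)
      moreover have "\<forall>\<^sub>F i in sequentially. ennreal (g i) \<le> emeasure (point_measure_on (1 / R i ^ 2) (scaled_pair (R i)) positive_coprime_pairs) (box a b)"
      proof -
        have "\<forall>\<^sub>F i in sequentially. R i > 0 \<and> R i \<ge> W / (b1 - a1) \<and> R i \<ge> W / (b2 - a2)"
        proof (intro eventually_conj)
          show "\<forall>\<^sub>F i in sequentially. R i > 0" using R by (auto simp: filterlim_at_top_dense)
        qed (use R in \<open>auto simp: filterlim_at_top\<close>)
        then show ?thesis
        proof eventually_elim
          case (elim i)
          define r where "r = R i"
          have r: "0 < r" "W / (b1 - a1) \<le> r" "W / (b2 - a2) \<le> r" using elim by (auto simp: r_def)
          \<comment> \<open>The side of a square that contains all sieved points, for the bound on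
            large common divisors.\<close>
          define N where "N = nat \<lceil>M * r\<rceil>"
          have N: "M * r \<le> real N" "real N \<le> M * r + 1"
            using M r unfolding N_def by (auto simp: le_nat_iff of_nat_nat)
          define S where "S = {(a::int, c::int). a1 * r < of_int a \<and> of_int a < b1 * r \<and> a2 * r < of_int c \<and> of_int c < b2 * r \<and> gcd (gcd a c) (int W) = 1}"
          let ?Y = "{x\<in>positive_coprime_pairs. scaled_pair r x \<in> box a b}"
          have Y: "x \<in> ?Y \<longleftrightarrow> a1 * r < of_int (fst x) \<and> of_int (fst x) < b1 * r \<and> a2 * r < of_int (snd x) \<and> of_int (snd x) < b2 * r \<and> coprime (fst x) (snd x)" for x
          proof -
            have "max 0 y * r < of_int k \<longleftrightarrow> 0 < k \<and> y < of_int k / r" for y and k :: int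
            proof -
              have "max 0 y * r = max 0 (y * r)" using r by (simp add: max_mult_distrib_right)
              then show ?thesis using r by (auto simp: less_divide_eq)
            qed
            then show ?thesis
              using r by (cases x) (auto simp: positive_coprime_pairs_def scaled_pair_def box_prod defs divide_less_eq)
          qed
          have finS: "finite S" unfolding S_def by (rule card_sieve_box(1)[OF W])
          have finY: "finite ?Y"
          proof (rule finite_subset)
            show "?Y \<subseteq> {k. a1 * r < of_int k \<and> of_int k < b1 * r} \<times> {k. a2 * r < of_int k \<and> of_int k < b2 * r}"
              using Y by auto
          qed (intro finite_cartesian_product card_int_open_interval)
          have "S \<subseteq> ?Y \<union> common_divisor_pairs P N"
          proof
            fix x assume "x \<in> S"
            then obtain u v where x: "x = (u, v)" "a1 * r < of_int u" "of_int u < b1 * r" "a2 * r < of_int v" "of_int v < b2 * r"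
              "gcd (gcd u v) (int W) = 1" by (auto simp: S_def)
            have "0 \<le> a1 * r" "0 \<le> a2 * r" using r by (auto simp: defs)
            then have uv: "0 < u" "0 < v" using x by linarith+
            have "b1 * r \<le> M * r" "b2 * r \<le> M * r" using r by (auto simp: M_def)
            then have uN: "u \<le> int N" "v \<le> int N" using x N by linarith+
            show "x \<in> ?Y \<union> common_divisor_pairs P N"
            proof (cases "coprime u v")
              case True
              then show ?thesis using x Y[of x] by simp
            next
              case False
              then have "\<exists>g>int P. g dvd u \<and> g dvd v"
                using not_coprime_large_divisor[of u v P] x(6) uv(1) unfolding W_def by blast
              then show ?thesis using x(1) uv uN by (auto simp: common_divisor_pairs_def)
            qed
          qed
          moreover have fc: "finite (common_divisor_pairs P N)"
            by (rule finite_subset[of _ "{1..int N} \<times> {1..int N}"]) (auto simp: common_divisor_pairs_def)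
          ultimately have "card S \<le> card (?Y \<union> common_divisor_pairs P N)"
            using finY by (intro card_mono) auto
          also have "\<dots> \<le> card ?Y + card (common_divisor_pairs P N)" by (rule card_Un_le)
          finally have 1: "real (card S) - real N ^ 2 / P \<le> real (card ?Y)"
            using card_common_divisor_pairs[OF \<open>0 < P\<close>, of N] by linarith
          have h: "1 \<le> (b1 * r - a1 * r) / W" "1 \<le> (b2 * r - a2 * r) / W"
            using r True W by (simp_all add: field_simps)
          have 2: "G * (((b1 * r - a1 * r) / W - 1) * ((b2 * r - a2 * r) / W - 1)) \<le> real (card S)"
            using card_sieve_box(2)[OF W h] unfolding S_def G_def .
          have "real N ^ 2 \<le> (M * r + 1) ^ 2" using N by (intro power_mono) auto
          then have 3: "real N ^ 2 / P \<le> (M * r + 1) ^ 2 / P" by (intro divide_right_mono) auto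
          have A: "(b1 * r - a1 * r) / W - 1 = r * ((b1 - a1) / W - 1 / r)"
            "(b2 * r - a2 * r) / W - 1 = r * ((b2 - a2) / W - 1 / r)" "M * r + 1 = r * (M + 1 / r)"
            using r W by (simp_all add: field_simps)
          have "r ^ 2 * g i = G * (((b1 * r - a1 * r) / W - 1) * ((b2 * r - a2 * r) / W - 1)) - (M * r + 1) ^ 2 / P"
          proof -
            have "r ^ 2 * (G * (u * v) - w ^ 2 / P) = G * ((r * u) * (r * v)) - (r * w) ^ 2 / P" for u v w
              by (simp add: power2_eq_square algebra_simps)
            then show ?thesis unfolding A g_def r_def[symmetric] .
          qed
          then have "r ^ 2 * g i \<le> real (card ?Y)" using 1 2 3 by linarith
          then have "g i \<le> 1 / r ^ 2 * real (card ?Y)" using r by (simp add: field_simps)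
          then have "ennreal (g i) \<le> ennreal (1 / r ^ 2) * ennreal (card ?Y)"
            by (subst ennreal_mult[symmetric]) (auto intro!: ennreal_leI)
          also have "\<dots> = emeasure (point_measure_on (1 / r ^ 2) (scaled_pair r) positive_coprime_pairs) (box a b)"
            by (subst emeasure_point_measure_on) (auto simp: ecard_finite[OF finY])
          finally show ?case unfolding r_def .
        qed
      qed
      ultimately have "ennreal (G * (((b1 - a1) / W - 0) * ((b2 - a2) / W - 0)) - (M + 0) ^ 2 / P) \<le> ?X"
        by (rule le_liminf_ennreal)
      moreover have "\<theta> * ((b1 - a1) * (b2 - a2)) \<le> G * (((b1 - a1) / W - 0) * ((b2 - a2) / W - 0))"
      proof -
        have "\<theta> * ((b1 - a1) * (b2 - a2)) \<le> residue_density W * ((b1 - a1) * (b2 - a2))"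
          using theta_le_residue_density[OF W] True by (intro mult_right_mono) auto
        then show ?thesis by (simp add: residue_density_def G_def power2_eq_square)
      qed
      ultimately show ?thesis by (elim order_trans[rotated]) (auto intro!: ennreal_leI)
    qed
    have "(\<lambda>P. \<theta> * ((b1 - a1) * (b2 - a2)) - M ^ 2 * (1 / real P)) \<longlonglongrightarrow> \<theta> * ((b1 - a1) * (b2 - a2)) - M ^ 2 * 0"
      by (intro tendsto_intros lim_1_over_n)
    then have "ennreal (\<theta> * ((b1 - a1) * (b2 - a2)) - M ^ 2 * 0) \<le> ?X"
      by (rule ennreal_le_limit) (use * in \<open>auto intro!: eventually_mono[OF eventually_gt_at_top[of 0]]\<close>)
    moreover have "emeasure lborel ({a1<..<b1} \<times> {a2<..<b2}) = ennreal ((b1 - a1) * (b2 - a2))"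
      unfolding lborel_prod[symmetric] using True
      by (subst lborel.emeasure_pair_measure_Times) (auto simp: ennreal_mult)
    ultimately show ?thesis unfolding eq using theta_pos True by (simp add: ennreal_mult)
  qed
qed

lemma nn_integral_coprime_pairs:
  fixes R :: "nat \<Rightarrow> real"
  assumes R: "filterlim R at_top sequentially" and f: "lsc f" "f \<in> borel_measurable borel"
  shows "ennreal \<theta> * (\<integral>\<^sup>+x. f x * indicator {x. 0 < fst x \<and> 0 < snd x} x \<partial>lborel)
    \<le> liminf (\<lambda>i. ennreal (1 / R i ^ 2) * (\<integral>\<^sup>+x. f (scaled_pair (R i) x) \<partial>count_space positive_coprime_pairs))"
proof -
  let ?Q = "{x :: real \<times> real. 0 < fst x \<and> 0 < snd x}"
  have Q[measurable]: "?Q \<in> sets borel"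
    by (intro borel_open open_Collect_conj open_Collect_less continuous_intros)
  let ?\<mu> = "density lborel (\<lambda>x. ennreal \<theta> * indicator ?Q x)"
  have "(\<integral>\<^sup>+x. f x \<partial>?\<mu>) \<le> liminf (\<lambda>i. \<integral>\<^sup>+x. f x \<partial>point_measure_on (1 / R i ^ 2) (scaled_pair (R i)) positive_coprime_pairs)"
  proof (rule nn_integral_le_liminf_boxes)
    show "absolutely_continuous lborel ?\<mu>" by (intro absolutely_continuousI_density) measurable
    fix a b :: "real \<times> real"
    have "emeasure ?\<mu> (box a b) = ennreal \<theta> * emeasure lborel (box a b \<inter> ?Q)"
      by (simp add: emeasure_density nn_integral_cmult mult.assoc indicator_inter_arith[symmetric] Int_commute)
    then show "emeasure ?\<mu> (box a b) \<le> liminf (\<lambda>i. emeasure (point_measure_on (1 / R i ^ 2) (scaled_pair (R i)) positive_coprime_pairs) (box a b))"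
      using coprime_pairs_box[OF R, of a b] by simp
  qed (auto intro: f)
  moreover have "(\<integral>\<^sup>+x. f x \<partial>?\<mu>) = ennreal \<theta> * (\<integral>\<^sup>+x. f x * indicator ?Q x \<partial>lborel)"
    using f(2) by (subst nn_integral_density) (auto simp: nn_integral_cmult[symmetric] ac_simps)
  ultimately show ?thesis using f(2) by (simp add: nn_integral_point_measure_on)
qed

section \<open>Words with a large last digit\<close>

lemma open_convex_real_interval:
  fixes S :: "real set"
  assumes "open S" "convex S" "S \<subseteq> {l..u}"
  obtains c d where "c \<le> d" "S = {c<..<d}"
proof (cases "S = {}")
  case True
  then show ?thesis using that[of 0 0] by simp
next
  case False
  have bdd: "bdd_below S" "bdd_above S"
    using assms(3) by (meson atLeastAtMost_iff bdd_belowI subsetD, meson atLeastAtMost_iff bdd_aboveI subsetD)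
  have sub: "S \<subseteq> {Inf S<..<Sup S}"
  proof
    fix x assume "x \<in> S"
    then obtain e where e: "e > 0" "ball x e \<subseteq> S" using assms(1) by (meson openE)
    then have "x - e / 2 \<in> S" "x + e / 2 \<in> S" by (auto simp: dist_real_def subset_iff)
    then have "Inf S \<le> x - e / 2" "x + e / 2 \<le> Sup S" using bdd by (auto intro: cInf_lower cSup_upper)
    then show "x \<in> {Inf S<..<Sup S}" using e by auto
  qed
  have "{Inf S<..<Sup S} \<subseteq> S"
  proof
    fix x assume x: "x \<in> {Inf S<..<Sup S}"
    obtain y where y: "y \<in> S" "y < x" using x False bdd cInf_less_iff[of S x] by auto
    obtain z where z: "z \<in> S" "x < z" using x False bdd less_cSup_iff[of S x] by auto
    have "closed_segment y z \<subseteq> S" using y z assms(2) by (simp add: closed_segment_subset)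
    then show "x \<in> S" using y z by (auto simp: closed_segment_eq_real_ivl)
  qed
  then show ?thesis using that[of "Inf S" "Sup S"] sub False by fastforce
qed

text \<open>The closed cylinder, with the tails 0 and 1, has to lie in \<open>J\<close>. Further
  digits then keep a word in the set (\<open>words_Cons\<close>), so the last digit can be split off
  and put back.\<close>

definition words :: "bool \<Rightarrow> real set \<Rightarrow> nat list set"
  where "words e J = {w. 0 \<notin> set w \<and> even (length w) = e \<and> (\<forall>z\<in>{0..1}. cf_val w z \<in> J)}"

definition scaled_den :: "real \<Rightarrow> nat list \<Rightarrow> real \<times> real"
  where "scaled_den R w = (real (fst (cf_den w)) / R, real (snd (cf_den w)) / R)"

lemma words_Cons: "w \<in> words (\<not> e) J \<Longrightarrow> 0 < n \<Longrightarrow> n # w \<in> words e J"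
  by (auto simp: words_def divide_le_eq)

lemma emeasure_line: "emeasure lborel {x :: real \<times> real. snd x = c * fst x} = 0"
proof -
  have m: "{x :: real \<times> real. snd x = c * fst x} \<in> sets (lborel \<Otimes>\<^sub>M lborel)"
    unfolding lborel_prod sets_lborel by (intro borel_closed closed_Collect_eq continuous_intros)
  have "emeasure (lborel \<Otimes>\<^sub>M lborel) {x :: real \<times> real. snd x = c * fst x}
      = (\<integral>\<^sup>+x. emeasure lborel (Pair x -` {x. snd x = c * fst x}) \<partial>lborel)"
    using m by (rule lborel.emeasure_pair_measure_alt)
  also have "\<dots> = 0" by (simp add: vimage_def)
  finally show ?thesis by (simp add: lborel_prod)
qed

text \<open>Adding the digit \<open>c\<close> at the end of an expansion acts on
  \<open>(q\<^sub>s\<^sub>-\<^sub>1, q\<^sub>s)\<close> by a matrix of determinant -1.\<close>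

lemma emeasure_shear:
  fixes A :: "(real \<times> real) set"
  assumes A: "A \<in> sets borel"
  shows "emeasure lborel {x. (snd x, c * snd x + fst x) \<in> A} = emeasure lborel A"
proof -
  have [measurable]: "A \<in> sets (borel \<Otimes>\<^sub>M borel)" by (subst borel_prod) (rule A)
  let ?B = "{x. (snd x, c * snd x + fst x) \<in> A}"
  have "(\<lambda>x :: real \<times> real. (snd x, c * snd x + fst x)) -` A \<in> sets borel"
    using measurable_sets_borel[OF borel_measurable_continuous_onI A, of "\<lambda>x :: real \<times> real. (snd x, c * snd x + fst x)"]
    by (simp add: continuous_intros)
  then have B: "?B \<in> sets (lborel \<Otimes>\<^sub>M lborel)" unfolding lborel_prod sets_lborel by (simp add: vimage_def)
  have "emeasure lborel A = (\<integral>\<^sup>+x. emeasure lborel (Pair x -` A) \<partial>lborel)"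
    using A lborel.emeasure_pair_measure_alt[of A lborel] by (simp add: lborel_prod)
  also have "\<dots> = (\<integral>\<^sup>+x. \<integral>\<^sup>+y. indicator A (x, y) \<partial>lborel \<partial>lborel)"
    by (intro nn_integral_cong) (auto simp: nn_integral_indicator[symmetric] sets_Pair1 lborel_prod indicator_def intro!: nn_integral_cong simp del: nn_integral_indicator)
  also have "\<dots> = (\<integral>\<^sup>+x. \<integral>\<^sup>+y. indicator A (x, c * x + 1 * y) \<partial>lborel \<partial>lborel)"
  proof (rule nn_integral_cong)
    fix x :: real
    show "(\<integral>\<^sup>+y. indicator A (x, y) \<partial>lborel) = (\<integral>\<^sup>+y. indicator A (x, c * x + 1 * y) \<partial>lborel)"
      using nn_integral_real_affine[of "\<lambda>y. indicator A (x, y)" 1 "c * x"] by simp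
  qed
  also have "\<dots> = (\<integral>\<^sup>+y. \<integral>\<^sup>+x. indicator A (x, c * x + y) \<partial>lborel \<partial>lborel)"
    by (subst lborel_pair.Fubini') auto
  also have "\<dots> = (\<integral>\<^sup>+y. emeasure lborel (Pair y -` ?B) \<partial>lborel)"
    using B by (intro nn_integral_cong) (auto simp: nn_integral_indicator[symmetric] sets_Pair1 lborel_prod indicator_def intro!: nn_integral_cong simp del: nn_integral_indicator)
  also have "\<dots> = emeasure lborel ?B"
    using lborel.emeasure_pair_measure_alt[OF B] by (simp add: lborel_prod)
  finally show ?thesis by simp
qed

lemma nn_integral_slice:
  assumes A: "A \<in> sets (borel :: (real \<times> real) measure)"
  shows "emeasure lborel A = (\<integral>\<^sup>+x. emeasure lborel {t. (x, t) \<in> A} \<partial>lborel)"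
proof -
  have A': "A \<in> sets (lborel \<Otimes>\<^sub>M lborel)" unfolding lborel_prod sets_lborel by (rule A)
  show ?thesis using lborel.emeasure_pair_measure_alt[OF A'] unfolding lborel_prod vimage_def .
qed

text \<open>Write \<open>w = n # v\<close>. A coprime pair \<open>(p, m)\<close> and a parity
  provide a word \<open>v\<close> with last convergent \<open>p / m\<close>, and then
  \<open>q\<^sub>s = n * m + m'\<close> with \<open>0 <= m' <= m\<close>. The admissible
  \<open>n\<close> fill an interval whose length is \<open>R / m\<close> times that of the slice of
  \<open>V\<close> over \<open>m / R\<close>; \<open>m'\<close> shifts it without changing the
  length, so the count is right up to 1. Since \<open>m <= b * R / D\<close> and
  \<open>p < m\<close>, there are at most \<open>(b * R / D)^2\<close> pairs, which is the
  subtracted error.\<close>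

lemma big_digit_count:
  fixes R :: "nat \<Rightarrow> real" and V :: "(real \<times> real) set" and D :: nat
  assumes R: "filterlim R at_top sequentially"
    and V: "open V" "convex V" "V \<subseteq> {x. 0 < fst x \<and> real D * fst x < snd x \<and> snd x < b}"
    and D: "0 < D" and b: "0 < b" and J: "0 \<le> x1" "x1 < x2" "x2 \<le> 1"
  shows "ennreal (\<theta> * (x2 - x1) * measure lborel V - (b / D) ^ 2)
    \<le> liminf (\<lambda>i. ennreal (1 / R i ^ 2) *
        ecard {w \<in> words e {x1<..<x2}. \<exists>n v. w = n # v \<and> D \<le> n \<and> scaled_den (R i) w \<in> V})"
proof -
  let ?BD = "\<lambda>i. {w \<in> words e {x1<..<x2}. \<exists>n v. w = n # v \<and> D \<le> n \<and> scaled_den (R i) w \<in> V}"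
  let ?X = "liminf (\<lambda>i. ennreal (1 / R i ^ 2) * ecard (?BD i))"
  have Vm[measurable]: "V \<in> sets borel" using V(1) by simp
  have Vb: "V \<subseteq> cbox (0, 0) (b / D, b)"
  proof
    fix x assume "x \<in> V"
    then have x: "0 < fst x" "real D * fst x < snd x" "snd x < b" using V(3) by auto
    then have "fst x \<le> b / D" using D by (simp add: field_simps)
    moreover have "0 \<le> real D * fst x" using x by simp
    then have "0 \<le> snd x" "snd x \<le> b" using x by linarith+
    ultimately show "x \<in> cbox (0, 0) (b / D, b)" using x by (cases x) (simp add: cbox_Pair_eq)
  qed
  have Vfin: "emeasure lborel V < \<infinity>"
    using emeasure_mono[OF Vb, of lborel] emeasure_lborel_cbox_finite[of "(0, 0)" "(b / D, b)"] by (simp add: le_less_trans)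
  define l where "l c = emeasure lborel {t. (c, t) \<in> V}" for c
  have slice: "\<exists>c d. c \<le> d \<and> {t. (y, t) \<in> V} = {c<..<d}" for y
  proof -
    have "open {t. (y, t) \<in> V}"
      using open_vimage[OF V(1), of "\<lambda>t. (y, t)"] by (simp add: vimage_def continuous_intros)
    moreover have "convex {t. (y, t) \<in> V}"
    proof (rule convexI)
      fix s t u v :: real
      assume "s \<in> {t. (y, t) \<in> V}" "t \<in> {t. (y, t) \<in> V}" and uv: "0 \<le> u" "0 \<le> v" "u + v = 1"
      then have "u *\<^sub>R (y, s) + v *\<^sub>R (y, t) \<in> V" using convexD[OF V(2), of "(y, s)" "(y, t)" u v] by simp
      moreover have "u * y + v * y = y" using uv by (simp flip: distrib_right)
      ultimately show "u *\<^sub>R s + v *\<^sub>R t \<in> {t. (y, t) \<in> V}" by simp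
    qed
    moreover have "{t. (y, t) \<in> V} \<subseteq> {0..b}"
      using Vb by (auto simp: cbox_Pair_eq)
    ultimately show ?thesis by (rule open_convex_real_interval) auto
  qed
  \<comment> \<open>The margin \<delta> is used twice: \<open>p / m\<close> keeps the distance
    \<delta> from both ends of the interval, and \<open>m > \<delta> * R\<close>, so that the
    cylinder of \<open>v\<close>, of width at most \<open>1 / m\<close>, fits inside for large
    \<open>R\<close>.\<close>
  have *: "ennreal (\<theta> * (x2 - x1 - 2 * \<delta>) * measure lborel (V \<inter> {x. \<delta> < fst x}) - (b / D) ^ 2) \<le> ?X"
    if \<delta>: "0 < \<delta>" "2 * \<delta> < x2 - x1" for \<delta>
  proof -
    let ?O = "{x :: (real \<times> real) \<times> real. (snd (fst x), snd x) \<in> V \<and> \<delta> < snd (fst x) \<and>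
      (x1 + \<delta>) * snd (fst x) < fst (fst x) \<and> fst (fst x) < (x2 - \<delta>) * snd (fst x)}"
    define h where "h x t = indicator ?O (x, t) * ennreal (1 / snd x)" for x :: "real \<times> real" and t
    \<comment> \<open>At \<open>x = (p / R, m / R)\<close> in the sector this is
      \<open>R / m\<close> times the length of the slice of \<open>V\<close>, the expected number of
      digits \<open>n\<close>.\<close>
    define f where "f x = (\<integral>\<^sup>+t. h x t \<partial>lborel)" for x
    have "open ((\<lambda>x :: (real \<times> real) \<times> real. (snd (fst x), snd x)) -` V)"
      by (rule open_vimage[OF V(1)]) (intro continuous_intros)
    moreover have "open {x :: (real \<times> real) \<times> real. \<delta> < snd (fst x)}"
      "open {x :: (real \<times> real) \<times> real. (x1 + \<delta>) * snd (fst x) < fst (fst x)}"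
      "open {x :: (real \<times> real) \<times> real. fst (fst x) < (x2 - \<delta>) * snd (fst x)}"
      by (intro open_Collect_less continuous_intros)+
    ultimately have "open ((\<lambda>x :: (real \<times> real) \<times> real. (snd (fst x), snd x)) -` V \<inter> {x. \<delta> < snd (fst x)} \<inter>
      {x. (x1 + \<delta>) * snd (fst x) < fst (fst x)} \<inter> {x. fst (fst x) < (x2 - \<delta>) * snd (fst x)})"
      by (simp only: open_Int)
    moreover have "(\<lambda>x :: (real \<times> real) \<times> real. (snd (fst x), snd x)) -` V \<inter> {x. \<delta> < snd (fst x)} \<inter>
      {x. (x1 + \<delta>) * snd (fst x) < fst (fst x)} \<inter> {x. fst (fst x) < (x2 - \<delta>) * snd (fst x)} = ?O" by auto
    ultimately have O: "open ?O" by simp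
    then have Om: "?O \<in> sets borel" by simp
    have fO: "f x = indicator {x. \<delta> < snd x \<and> (x1 + \<delta>) * snd x < fst x \<and> fst x < (x2 - \<delta>) * snd x} x
        * (ennreal (1 / snd x) * l (snd x))" for x
    proof -
      have "f x = (\<integral>\<^sup>+t. (indicator {x. \<delta> < snd x \<and> (x1 + \<delta>) * snd x < fst x \<and> fst x < (x2 - \<delta>) * snd x} x
        * ennreal (1 / snd x)) * indicator {t. (snd x, t) \<in> V} t \<partial>lborel)"
        unfolding f_def h_def by (intro nn_integral_cong) (auto simp: indicator_def)
      also have "{t. (snd x, t) \<in> V} \<in> sets borel"
        using slice[of "snd x"] by auto
      then have "(\<integral>\<^sup>+t. (indicator {x. \<delta> < snd x \<and> (x1 + \<delta>) * snd x < fst x \<and> fst x < (x2 - \<delta>) * snd x} x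
        * ennreal (1 / snd x)) * indicator {t. (snd x, t) \<in> V} t \<partial>lborel) = (indicator {x. \<delta> < snd x \<and> (x1 + \<delta>) * snd x < fst x \<and> fst x < (x2 - \<delta>) * snd x} x
        * ennreal (1 / snd x)) * l (snd x)"
        unfolding l_def by (intro nn_integral_cmult_indicator) auto
      finally show ?thesis by (simp add: mult.assoc)
    qed
    have hm: "case_prod h \<in> borel_measurable borel"
      unfolding h_def case_prod_unfold prod.collapse
      by (intro borel_measurable_times_ennreal borel_measurable_indicator Om
          measurable_compose[OF _ measurable_ennreal] borel_measurable_divide borel_measurable_const
          borel_measurable_continuous_onI continuous_intros)
    have S: "sets (borel \<Otimes>\<^sub>M lborel) = sets (borel :: ((real \<times> real) \<times> real) measure)"
      unfolding borel_prod[symmetric] by (intro sets_pair_measure_cong refl sets_lborel)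
    have hm2: "case_prod h \<in> borel_measurable (borel \<Otimes>\<^sub>M lborel)"
      unfolding measurable_cong_sets[OF S refl] by (rule hm)
    have lscf: "lsc f"
      unfolding f_def
    proof (rule lsc_nn_integral)
      have "continuous_on ?O (\<lambda>x. 1 / snd (fst x))"
        using \<delta> by (intro continuous_intros) auto
      from lsc_on_open[OF O this] show "lsc (\<lambda>(x, t). h x t)"
        by (simp only: h_def case_prod_unfold prod.collapse)
      show "h x \<in> borel_measurable borel" for x
        using hm2 by measurable
    qed
    have fm: "f \<in> borel_measurable borel"
      unfolding f_def using hm2 by (intro lborel.borel_measurable_nn_integral) simp
    have int: "(\<integral>\<^sup>+x. f x * indicator {x. 0 < fst x \<and> 0 < snd x} x \<partial>lborel)
        = ennreal ((x2 - x1 - 2 * \<delta>) * measure lborel (V \<inter> {x. \<delta> < fst x}))"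
    proof -
      have "f x * indicator {x. 0 < fst x \<and> 0 < snd x} x = f x" for x
      proof (cases "\<delta> < snd x \<and> (x1 + \<delta>) * snd x < fst x")
        case True
        then have "0 < snd x" "0 < (x1 + \<delta>) * snd x" using \<delta> J by auto
        then have "0 < snd x" "0 < fst x" using True by linarith+
        then show ?thesis by simp
      qed (auto simp: fO)
      then have "(\<integral>\<^sup>+x. f x * indicator {x. 0 < fst x \<and> 0 < snd x} x \<partial>lborel) = (\<integral>\<^sup>+x. f x \<partial>(lborel \<Otimes>\<^sub>M lborel))"
        by (simp add: lborel_prod)
      also have "\<dots> = (\<integral>\<^sup>+c. \<integral>\<^sup>+a. f (a, c) \<partial>lborel \<partial>lborel)"
        using fm by (intro lborel_pair.nn_integral_snd[symmetric]) (simp add: lborel_prod)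
      \<comment> \<open>For fixed \<open>c\<close> the first coordinate runs over an interval of
        length \<open>(x2 - x1 - 2 * \<delta>) * c\<close>, which cancels the weight
        \<open>1 / c\<close>.\<close>
      also have "\<dots> = (\<integral>\<^sup>+c. ennreal (x2 - x1 - 2 * \<delta>) * emeasure lborel {t. (c, t) \<in> V \<inter> {x. \<delta> < fst x}} \<partial>lborel)"
      proof (rule nn_integral_cong)
        fix c :: real
        show "(\<integral>\<^sup>+a. f (a, c) \<partial>lborel) = ennreal (x2 - x1 - 2 * \<delta>) * emeasure lborel {t. (c, t) \<in> V \<inter> {x. \<delta> < fst x}}"
        proof (cases "\<delta> < c")
          case True
          then have c: "0 < c" "(x1 + \<delta>) * c \<le> (x2 - \<delta>) * c" using \<delta> by (auto intro!: mult_right_mono)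
          have "(\<integral>\<^sup>+a. f (a, c) \<partial>lborel) = (\<integral>\<^sup>+a. (ennreal (1 / c) * l c) * indicator {(x1 + \<delta>) * c<..<(x2 - \<delta>) * c} a \<partial>lborel)"
            unfolding fO using True by (intro nn_integral_cong) (auto simp: indicator_def)
          also have "\<dots> = (ennreal (1 / c) * l c) * ennreal ((x2 - \<delta>) * c - (x1 + \<delta>) * c)"
            using c by (simp add: nn_integral_cmult_indicator)
          also have "\<dots> = (ennreal (1 / c) * ennreal ((x2 - \<delta>) * c - (x1 + \<delta>) * c)) * l c" by (simp only: ac_simps)
          also have "ennreal (1 / c) * ennreal ((x2 - \<delta>) * c - (x1 + \<delta>) * c) = ennreal (x2 - x1 - 2 * \<delta>)"
          proof -
            have "1 / c * ((x2 - \<delta>) * c - (x1 + \<delta>) * c) = x2 - x1 - 2 * \<delta>" using c by (simp add: field_simps)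
            then show ?thesis using c by (subst ennreal_mult[symmetric]) auto
          qed
          finally show ?thesis using True by (simp add: l_def)
        qed (simp add: fO)
      qed
      also have "\<dots> = ennreal (x2 - x1 - 2 * \<delta>) * (\<integral>\<^sup>+c. emeasure lborel {t. (c, t) \<in> V \<inter> {x. \<delta> < fst x}} \<partial>lborel)"
      proof (rule nn_integral_cmult)
        have "V \<inter> {x. \<delta> < fst x} \<in> sets (borel \<Otimes>\<^sub>M lborel)"
          unfolding measurable_lborel2 sets_pair_measure_cong[OF refl sets_lborel] borel_prod
          by (intro borel_open open_Int V open_Collect_less continuous_intros)
        from lborel.measurable_emeasure_Pair[OF this]
        show "(\<lambda>c. emeasure lborel {t. (c, t) \<in> V \<inter> {x. \<delta> < fst x}}) \<in> borel_measurable lborel"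
          by (simp add: vimage_def)
      qed
      also have "(\<integral>\<^sup>+c. emeasure lborel {t. (c, t) \<in> V \<inter> {x. \<delta> < fst x}} \<partial>lborel) = emeasure lborel (V \<inter> {x. \<delta> < fst x})"
        by (intro nn_integral_slice[symmetric] borel_open open_Int V open_Collect_less continuous_intros)
      also have "\<dots> = ennreal (measure lborel (V \<inter> {x. \<delta> < fst x}))"
        using Vfin emeasure_mono[of "V \<inter> {x. \<delta> < fst x}" V lborel]
        by (intro emeasure_eq_ennreal_measure) (auto simp: top_unique)
      finally show ?thesis using \<delta> by (simp add: ennreal_mult)
    qed
    have "ennreal \<theta> * ennreal ((x2 - x1 - 2 * \<delta>) * measure lborel (V \<inter> {x. \<delta> < fst x}))
        \<le> liminf (\<lambda>i. ennreal (1 / R i ^ 2) * (\<integral>\<^sup>+x. f (scaled_pair (R i) x) \<partial>count_space positive_coprime_pairs))"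
      using nn_integral_coprime_pairs[OF R lscf fm] unfolding int .
    also have "\<dots> \<le> liminf (\<lambda>i. ennreal ((b / D) ^ 2) + ennreal (1 / R i ^ 2) * ecard (?BD i))"
    proof (rule Liminf_mono)
      \<comment> \<open>From \<open>m > \<delta> * R\<close> and \<open>R > 1 / \<delta>^2\<close>
        follows \<open>1 / m < \<delta>\<close>, the width allowed for the cylinder.\<close>
      have "\<forall>\<^sub>F i in sequentially. 0 < R i \<and> 1 / \<delta> ^ 2 < R i"
        using R by (auto simp: filterlim_at_top_dense intro!: eventually_conj)
      then show "\<forall>\<^sub>F i in sequentially. ennreal (1 / R i ^ 2) * (\<integral>\<^sup>+x. f (scaled_pair (R i) x) \<partial>count_space positive_coprime_pairs)
          \<le> ennreal ((b / D) ^ 2) + ennreal (1 / R i ^ 2) * ecard (?BD i)"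
      proof eventually_elim
        case (elim i)
        define r where "r = R i"
        have r: "0 < r" "1 / \<delta> ^ 2 < r" using elim by (auto simp: r_def)
        define S where "S = {x \<in> positive_coprime_pairs. \<delta> < of_int (snd x) / r \<and>
          (x1 + \<delta>) * (of_int (snd x) / r) < of_int (fst x) / r \<and>
          of_int (fst x) / r < (x2 - \<delta>) * (of_int (snd x) / r) \<and> (\<exists>t. (of_int (snd x) / r, t) \<in> V)}"
        define M where "M = \<lfloor>b * r / D\<rfloor>"
        have M0: "0 \<le> b * r / D" using b r D by simp
        have Sprop: "0 < p \<and> p < m \<and> m \<le> M \<and> coprime p m" if "(p, m) \<in> S" for p m
        proof -
          have 1: "0 < p" "0 < m" "coprime p m" using that by (auto simp: S_def positive_coprime_pairs_def)
          have "of_int p / r < (x2 - \<delta>) * (of_int m / r)" using that by (auto simp: S_def)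
          also have "\<dots> \<le> 1 * (of_int m / r)" using 1 r J \<delta> by (intro mult_right_mono) auto
          finally have "p < m" using r by (simp add: divide_less_cancel)
          have "\<exists>t. (of_int m / r, t) \<in> V" using that by (simp add: S_def)
          then obtain t where "(of_int m / r, t) \<in> V" by blast
          then have "of_int m / r \<le> b / D" using Vb by (auto simp: cbox_Pair_eq)
          then have "of_int m \<le> b * r / D" using r by (simp add: field_simps)
          then have "m \<le> M" unfolding M_def by (simp add: le_floor_iff)
          with 1 \<open>p < m\<close> show ?thesis by simp
        qed
        have Ssub: "S \<subseteq> {1..M} \<times> {1..M}" using Sprop by fastforce
        then have finS: "finite S" by (rule finite_subset) simp
        have "card S \<le> card ({1..M} \<times> {1..M})" using Ssub by (intro card_mono) auto
        also have "\<dots> = nat M * nat M" by (simp add: card_cartesian_product)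
        finally have "real (card S) \<le> real (nat M) * real (nat M)" by (simp flip: of_nat_mult)
        also have "\<dots> \<le> (b * r / D) * (b * r / D)"
          using M0 unfolding M_def by (intro mult_mono) auto
        finally have cS: "real (card S) \<le> (b * r / D) ^ 2" by (simp add: power2_eq_square)
        \<comment> \<open>The parity is \<open>\<not> e\<close>, since the last digit
          \<open>n\<close> is still to be added.\<close>
        define wd where "wd x = (SOME w. 0 \<notin> set w \<and> even (length w) = (\<not> e) \<and>
          snd (cf_num w) = nat (fst x) \<and> snd (cf_den w) = nat (snd x))" for x :: "int \<times> int"
        have wd: "0 \<notin> set (wd x)" "even (length (wd x)) = (\<not> e)" "int (snd (cf_num (wd x))) = fst x" "int (snd (cf_den (wd x))) = snd x"
          if "x \<in> S" for x
        proof -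
          obtain p m where x: "x = (p, m)" by (cases x)
          have pm: "0 < p" "p < m" "coprime p m" using Sprop that x by auto
          have "coprime (nat p) (nat m)" using pm by (simp add: coprime_int_iff[symmetric])
          then have "\<exists>w. 0 \<notin> set w \<and> even (length w) = (\<not> e) \<and> snd (cf_num w) = nat (fst x) \<and> snd (cf_den w) = nat (snd x)"
            using pm x by (intro cf_word_exists) auto
          from someI_ex[OF this] show "0 \<notin> set (wd x)" "even (length (wd x)) = (\<not> e)" "int (snd (cf_num (wd x))) = fst x" "int (snd (cf_den (wd x))) = snd x"
            using pm x unfolding wd_def by auto
        qed
        define Nn where "Nn x = {n. D \<le> n \<and> scaled_den r (n # wd x) \<in> V}" for x
        have wdw: "wd x \<in> words (\<not> e) {x1<..<x2}" if "x \<in> S" for x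
        proof -
          let ?w = "wd x"
          obtain p m where x: "x = (p, m)" by (cases x)
          have pm: "0 < p" "0 < m" using Sprop that x by fastforce+
          have q: "real (snd (cf_den ?w)) = of_int m" "real (snd (cf_num ?w)) = of_int p"
            using wd(3,4)[OF that] x by (metis fst_conv snd_conv of_int_of_nat_eq)+
          have v0: "cf_val ?w 0 = of_int p / of_int m" using wd(1)[OF that] q by (simp add: cf_val_eq)
          have sm: "\<delta> < of_int m / r" "(x1 + \<delta>) * (of_int m / r) < of_int p / r" "of_int p / r < (x2 - \<delta>) * (of_int m / r)"
            using that x by (auto simp: S_def)
          have v: "x1 + \<delta> < cf_val ?w 0" "cf_val ?w 0 < x2 - \<delta>"
          proof -
            have "(x1 + \<delta>) * of_int m < of_int p" "of_int p < (x2 - \<delta>) * of_int m"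
              using sm(2,3) r unfolding times_divide_eq_right by (simp_all add: divide_less_cancel)
            then show "x1 + \<delta> < cf_val ?w 0" "cf_val ?w 0 < x2 - \<delta>"
              using pm unfolding v0 by (simp_all add: less_divide_eq divide_less_eq)
          qed
          have "1 / \<delta> < of_int m"
          proof -
            have "1 / \<delta> = \<delta> * (1 / \<delta> ^ 2)" using \<delta> by (simp add: power2_eq_square)
            also have "\<dots> < \<delta> * r" using r \<delta> by (intro mult_strict_left_mono) auto
            also have "\<dots> < of_int m" using sm(1) r by (simp add: field_simps)
            finally show ?thesis .
          qed
          then have md: "1 / of_int m < \<delta>" using \<delta> pm by (simp add: field_simps)
          have "\<bar>cf_val ?w z - cf_val ?w 0\<bar> \<le> 1 / of_int m" if z: "z \<in> {0..1}" for z
          proof -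
            let ?d = "(of_int m + z * real (fst (cf_den ?w))) * of_int m"
            have m1: "1 \<le> real_of_int m" using pm by simp
            have "1 * of_int m \<le> ?d" using m1 z by (intro mult_right_mono) (auto intro: add_increasing2)
            then have "of_int m \<le> ?d" by simp
            have "\<bar>cf_val ?w z - cf_val ?w 0\<bar> = z / ?d"
              using cf_val_diff[OF wd(1)[OF \<open>x \<in> S\<close>], of z 0] z q \<open>of_int m \<le> ?d\<close> m1
              by (simp add: abs_mult power_abs)
            also have "\<dots> \<le> 1 / of_int m"
              using z m1 \<open>of_int m \<le> ?d\<close> by (intro frac_le) auto
            finally show ?thesis .
          qed
          then have "cf_val ?w z \<in> {x1<..<x2}" if "z \<in> {0..1}" for z
            using v md that by fastforce
          then show ?thesis using wd(1,2)[OF that] by (auto simp: words_def)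
        qed
        have cN: "f (scaled_pair r x) \<le> ennreal (real (card (Nn x)) + 1) \<and> finite (Nn x)" if xS: "x \<in> S" for x
        proof -
          obtain p m where x: "x = (p, m)" by (cases x)
          have pm: "0 < p" "0 < m" using Sprop xS x by fastforce+
          obtain c d where cd: "c \<le> d" "{t. (of_int m / r, t) \<in> V} = {c<..<d}" using slice by blast
          define m' where "m' = real (fst (cf_den (wd x)))"
          have q: "real (snd (cf_den (wd x))) = of_int m"
            using wd(4)[OF xS] x by (metis snd_conv of_int_of_nat_eq)
          have m': "0 \<le> m'" "m' \<le> of_int m"
            using cf_den_le[OF wd(1)[OF xS]] q unfolding m'_def by linarith+
          let ?K = "{k::int. (c * r - m') / of_int m < of_int k \<and> of_int k < (d * r - m') / of_int m}"
          have sd: "scaled_den r (n # wd x) = (of_int m / r, (real n * of_int m + m') / r)" for n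
            by (simp add: scaled_den_def q m'_def)
          have K: "(\<exists>n\<in>Nn x. k = int n) \<longleftrightarrow> k \<in> ?K" for k
          proof -
            have "k \<in> ?K \<longleftrightarrow> (of_int m / r, (of_int k * of_int m + m') / r) \<in> V"
            proof -
              have "k \<in> ?K \<longleftrightarrow> (of_int k * of_int m + m') / r \<in> {c<..<d}"
                using pm r by (auto simp: divide_less_eq less_divide_eq algebra_simps)
              then show ?thesis using cd(2) by auto
            qed
            \<comment> \<open>Every integer in the interval is an admissible digit: \<open>V\<close>
              lies above the line of slope \<open>D\<close>, so \<open>D * m < k * m + m'\<close>,
              which is at most \<open>(k + 1) * m\<close>.\<close>
            moreover have "int D \<le> k" if "(of_int m / r, (of_int k * of_int m + m') / r) \<in> V"
            proof -
              have "real D * (of_int m / r) < (of_int k * of_int m + m') / r" using V(3) that by auto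
              then have "real D * of_int m < of_int k * of_int m + m'" using r by (simp add: field_simps)
              also have "\<dots> \<le> of_int (k + 1) * of_int m" using m' by (simp add: algebra_simps)
              finally have "real D < of_int (k + 1)" using pm by simp
              then show ?thesis by linarith
            qed
            ultimately show ?thesis
              unfolding Nn_def sd by (auto intro!: exI[of _ "nat k"])
          qed
          then have "int ` Nn x = ?K" by blast
          moreover have finK: "finite ?K" by (rule card_int_open_interval(3))
          moreover have inj: "inj_on int (Nn x)" by simp
          ultimately have fin: "finite (Nn x)" "card (Nn x) = card ?K"
            using finite_imageD[OF _ inj] card_image[OF inj] by simp_all
          have "(d - c) * r / of_int m - 1 \<le> real (card (Nn x))"
            using card_int_open_interval(1)[of "(d * r - m') / of_int m" "(c * r - m') / of_int m"]
            unfolding fin(2) by (simp add: diff_divide_distrib left_diff_distrib)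
          moreover have "f (scaled_pair r x) \<le> ennreal ((d - c) * r / of_int m)"
          proof -
            have "f (scaled_pair r x) \<le> ennreal (1 / snd (scaled_pair r x)) * l (snd (scaled_pair r x))"
              unfolding fO by (auto simp: indicator_def)
            also have "\<dots> = ennreal (r / of_int m) * ennreal (d - c)"
              using cd x unfolding l_def by (simp add: scaled_pair_def)
            also have "\<dots> = ennreal ((d - c) * r / of_int m)"
              using cd r pm by (subst ennreal_mult[symmetric]) (auto simp: mult.commute)
            finally show ?thesis .
          qed
          moreover have "ennreal ((d - c) * r / of_int m) \<le> ennreal (real (card (Nn x)) + 1)"
            using calculation(1) by (intro ennreal_leI) linarith
          ultimately show ?thesis using fin(1) order_trans by blast
        qed
        have f0: "f (scaled_pair r x) = 0" if "x \<in> positive_coprime_pairs - S" for x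
        proof -
          have "l (snd (scaled_pair r x)) = 0" if "\<nexists>t. (of_int (snd x) / r, t) \<in> V"
            using that by (simp add: l_def scaled_pair_def)
          then show ?thesis
            using that unfolding fO by (auto simp: S_def scaled_pair_def indicator_def)
        qed
        have "(\<integral>\<^sup>+x. f (scaled_pair r x) \<partial>count_space positive_coprime_pairs) = (\<integral>\<^sup>+x. f (scaled_pair r x) \<partial>count_space S)"
          using f0 by (intro nn_integral_count_space_eq) (auto simp: S_def)
        also have "\<dots> = (\<Sum>x\<in>S. f (scaled_pair r x))" using finS by (rule nn_integral_count_space_finite)
        also have "\<dots> \<le> (\<Sum>x\<in>S. ennreal (real (card (Nn x)) + 1))"
          using cN by (intro sum_mono) auto
        also have "\<dots> = ennreal (real (\<Sum>x\<in>S. card (Nn x)) + real (card S))"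
          by (subst sum_ennreal) (auto simp: sum.distrib)
        also have "\<dots> = ennreal (real (card S)) + ennreal (real (\<Sum>x\<in>S. card (Nn x)))"
          by (subst add.commute, rule ennreal_plus) (auto intro: sum_nonneg)
        also have "(\<Sum>x\<in>S. card (Nn x)) = card (\<Union>x\<in>S. (\<lambda>n. n # wd x) ` Nn x)"
        proof -
          have "inj_on wd S"
          proof (rule inj_onI)
            fix x y assume "x \<in> S" "y \<in> S" "wd x = wd y"
            then show "x = y" using wd(3,4)[of x] wd(3,4)[of y] by (metis prod.collapse)
          qed
          then have "card (\<Union>x\<in>S. (\<lambda>n. n # wd x) ` Nn x) = (\<Sum>x\<in>S. card ((\<lambda>n. n # wd x) ` Nn x))"
            using finS cN by (intro card_UN_disjoint) (auto simp: inj_on_def)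
          also have "\<dots> = (\<Sum>x\<in>S. card (Nn x))" by (intro sum.cong refl card_image) (auto simp: inj_on_def)
          finally show ?thesis ..
        qed
        also have "ennreal (real (card (\<Union>x\<in>S. (\<lambda>n. n # wd x) ` Nn x))) = ecard (\<Union>x\<in>S. (\<lambda>n. n # wd x) ` Nn x)"
          using finS cN by (intro ecard_finite[symmetric]) auto
        also have "\<dots> \<le> ecard (?BD i)"
          using wdw D by (intro ecard_mono) (fastforce simp: Nn_def r_def intro!: words_Cons)
        also have "ennreal (real (card S)) \<le> ennreal ((b * r / D) ^ 2)" using cS by (rule ennreal_leI)
        finally have "(\<integral>\<^sup>+x. f (scaled_pair r x) \<partial>count_space positive_coprime_pairs) \<le> ennreal ((b * r / D) ^ 2) + ecard (?BD i)"
          by (simp add: add_mono)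
        then have "ennreal (1 / r ^ 2) * (\<integral>\<^sup>+x. f (scaled_pair r x) \<partial>count_space positive_coprime_pairs)
           \<le> ennreal (1 / r ^ 2) * (ennreal ((b * r / D) ^ 2) + ecard (?BD i))" by (intro mult_left_mono) auto
        also have "\<dots> = ennreal (1 / r ^ 2) * ennreal ((b * r / D) ^ 2) + ennreal (1 / r ^ 2) * ecard (?BD i)"
          by (rule distrib_left)
        also have "ennreal (1 / r ^ 2) * ennreal ((b * r / D) ^ 2) = ennreal ((b / D) ^ 2)"
          using r by (subst ennreal_mult[symmetric]) (auto simp: power_divide power_mult_distrib)
        finally show ?case unfolding r_def .
      qed
    qed
    also have "\<dots> = ennreal ((b / D) ^ 2) + ?X" by (rule Liminf_const_add) (auto simp: ennreal_neq_top)
    finally have fin: "ennreal (\<theta> * (x2 - x1 - 2 * \<delta>) * measure lborel (V \<inter> {x. \<delta> < fst x})) \<le> ennreal ((b / D) ^ 2) + ?X"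
      using theta_pos \<delta> by (subst (asm) ennreal_mult[symmetric]) (auto simp: mult.assoc)
    then have "ennreal (\<theta> * (x2 - x1 - 2 * \<delta>) * measure lborel (V \<inter> {x. \<delta> < fst x})) - ennreal ((b / D) ^ 2) \<le> ?X"
      by (simp add: ennreal_minus_le_iff)
    then show ?thesis by (simp add: ennreal_minus)
  qed
  define \<delta> where "\<delta> k = inverse (real (Suc k))" for k
  have d0: "\<delta> \<longlonglongrightarrow> 0" unfolding \<delta>_def by (rule LIMSEQ_inverse_real_of_nat)
  have meas: "(\<lambda>k. measure lborel (V \<inter> {x. \<delta> k < fst x})) \<longlonglongrightarrow> measure lborel (\<Union>k. V \<inter> {x. \<delta> k < fst x})"
  proof (rule Lim_measure_incseq)
    show "range (\<lambda>k. V \<inter> {x. \<delta> k < fst x}) \<subseteq> sets lborel"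
      by (auto intro!: borel_open open_Int V open_Collect_less continuous_intros)
    have "\<delta> (Suc k) \<le> \<delta> k" for k by (simp add: \<delta>_def field_simps)
    then show "incseq (\<lambda>k. V \<inter> {x. \<delta> k < fst x})"
      by (intro incseq_SucI) (auto intro: le_less_trans)
    show "emeasure lborel (\<Union>k. V \<inter> {x. \<delta> k < fst x}) \<noteq> \<infinity>"
      using Vfin emeasure_mono[of "\<Union>k. V \<inter> {x. \<delta> k < fst x}" V lborel] by (auto simp: top_unique)
  qed
  moreover have "(\<Union>k. V \<inter> {x. \<delta> k < fst x}) = V"
  proof -
    have "\<exists>k. \<delta> k < fst x" if "x \<in> V" for x
      using reals_Archimedean[of "fst x"] V(3) that unfolding \<delta>_def by auto
    then show ?thesis by auto
  qed
  ultimately have "(\<lambda>k. measure lborel (V \<inter> {x. \<delta> k < fst x})) \<longlonglongrightarrow> measure lborel V" by simp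
  then have "(\<lambda>k. \<theta> * (x2 - x1 - 2 * \<delta> k) * measure lborel (V \<inter> {x. \<delta> k < fst x}) - (b / D) ^ 2)
      \<longlonglongrightarrow> \<theta> * (x2 - x1 - 2 * 0) * measure lborel V - (b / D) ^ 2"
    by (intro tendsto_diff tendsto_mult tendsto_const d0)
  moreover have "\<forall>\<^sub>F k in sequentially. 2 * \<delta> k < x2 - x1"
    using order_tendstoD(2)[OF tendsto_mult[OF tendsto_const[of 2] d0], of "x2 - x1"] J by simp
  then have "\<forall>\<^sub>F k in sequentially. ennreal (\<theta> * (x2 - x1 - 2 * \<delta> k) * measure lborel (V \<inter> {x. \<delta> k < fst x}) - (b / D) ^ 2) \<le> ?X"
    by (rule eventually_mono) (intro *, auto simp: \<delta>_def)
  ultimately have "ennreal (\<theta> * (x2 - x1 - 2 * 0) * measure lborel V - (b / D) ^ 2) \<le> ?X"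
    by (rule ennreal_le_limit)
  then show ?thesis by simp
qed

section \<open>Induction over the small last digits\<close>

lemma theta_le_1: "\<theta> \<le> 1"
proof -
  have "3 * 3 \<le> pi * pi" using pi_gt3 by (intro mult_mono) auto
  then show ?thesis by (simp add: \<theta>_def power2_eq_square divide_le_eq)
qed

lemma sum_telescope_inverse:
  fixes x y :: real
  assumes "0 \<le> x" "0 < y" "0 < D"
  shows "(\<Sum>n\<in>{1..<D}. 1 / ((x + real n * y) * (x + real n * y + y))) = 1 / y * (1 / (x + y) - 1 / (x + real D * y))"
proof -
  have "(\<Sum>n\<in>{1..<Suc d}. 1 / ((x + real n * y) * (x + real n * y + y))) = 1 / y * (1 / (x + y) - 1 / (x + real (Suc d) * y))" for d
  proof (induction d)
    case (Suc d)
    have pos: "0 < x + real (Suc d) * y" using assms by (intro add_nonneg_pos mult_pos_pos) auto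
    then have pos': "0 < x + real (Suc d) * y + y" using assms by linarith
    have "1 / ((x + real (Suc d) * y) * (x + real (Suc d) * y + y)) = 1 / y * (1 / (x + real (Suc d) * y) - 1 / (x + real (Suc d) * y + y))"
      using pos pos' assms by (simp add: diff_frac_eq)
    moreover have "x + real (Suc (Suc d)) * y = x + real (Suc d) * y + y" by (simp add: algebra_simps)
    moreover have "{1..<Suc (Suc d)} = insert (Suc d) {1..<Suc d}" by auto
    ultimately show ?case using Suc.IH by (simp add: algebra_simps)
  qed simp
  from this[of "D - 1"] show ?thesis using assms(3) by simp
qed

text \<open>The pairs that adding the digit \<open>n\<close> moves into \<Omega>, cut down to the
  half quadrant in which the induction takes place.\<close>

definition strip :: "nat \<Rightarrow> (real \<times> real) set \<Rightarrow> (real \<times> real) set"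
  where "strip n \<Omega> = {x. 0 < fst x \<and> fst x < snd x \<and> (snd x, real n * snd x + fst x) \<in> \<Omega>}"

lemma strip_open: "open \<Omega> \<Longrightarrow> open (strip n \<Omega>)"
proof -
  assume "open \<Omega>"
  then have "open ((\<lambda>x. (snd x, real n * snd x + fst x)) -` \<Omega>)"
    by (rule open_vimage) (intro continuous_intros)
  moreover have "open {x :: real \<times> real. 0 < fst x}" "open {x :: real \<times> real. fst x < snd x}"
    by (intro open_Collect_less continuous_intros)+
  moreover have "strip n \<Omega> = (\<lambda>x. (snd x, real n * snd x + fst x)) -` \<Omega> \<inter> {x. 0 < fst x} \<inter> {x. fst x < snd x}"
    by (auto simp: strip_def)
  ultimately show ?thesis by (simp only: open_Int)
qed

lemma strip_convex:
  assumes "convex \<Omega>" shows "convex (strip n \<Omega>)"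
proof (rule convexI)
  fix a b :: "real \<times> real" and u v :: real
  assume a: "a \<in> strip n \<Omega>" and b: "b \<in> strip n \<Omega>" and uv: "0 \<le> u" "0 \<le> v" "u + v = 1"
  let ?f = "\<lambda>x :: real \<times> real. (snd x, real n * snd x + fst x)"
  have "u *\<^sub>R ?f a + v *\<^sub>R ?f b \<in> \<Omega>"
    using a b uv by (intro convexD[OF assms]) (auto simp: strip_def)
  moreover have "u *\<^sub>R ?f a + v *\<^sub>R ?f b = ?f (u *\<^sub>R a + v *\<^sub>R b)" by (simp add: algebra_simps)
  moreover have lt: "u * s + v * t < u * s' + v * t'" if "s < s'" "t < t'" for s t s' t'
  proof (cases "u = 0")
    case True
    then show ?thesis using that uv by simp
  next
    case False
    then have "u * s < u * s'" using that uv by simp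
    moreover have "v * t \<le> v * t'" using that uv by (intro mult_left_mono) auto
    ultimately show ?thesis by linarith
  qed
  moreover have "0 < u * fst a + v * fst b" using lt[of 0 "fst a" 0 "fst b"] a b by (simp add: strip_def)
  moreover have "u * fst a + v * fst b < u * snd a + v * snd b" using lt a b by (simp add: strip_def)
  ultimately show "u *\<^sub>R a + v *\<^sub>R b \<in> strip n \<Omega>" by (simp add: strip_def)
qed

text \<open>A point belongs to the digit \<open>\<lfloor>snd x / fst x\<rfloor>\<close>; the lines
  between the sectors are null, and all digits from \<open>D\<close> on are collected in one region.
  The shear carries \<open>strip n \<Omega>\<close> onto the sector of \<open>n\<close> without
  changing the area.\<close>

lemma emeasure_strips:
  assumes "open \<Omega>" and sub: "\<Omega> \<subseteq> {x. 0 < fst x \<and> fst x < snd x}" and D: "0 < (D::nat)"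
  shows "emeasure lborel \<Omega> \<le> emeasure lborel (\<Omega> \<inter> {x. real D * fst x < snd x}) + (\<Sum>n\<in>{1..<D}. emeasure lborel (strip n \<Omega>))"
proof -
  let ?f = "\<lambda>n x. (snd x, real n * snd x + fst x) :: real \<times> real"
  let ?S = "\<lambda>n. {x \<in> \<Omega>. real n * fst x < snd x \<and> snd x < (real n + 1) * fst x}"
  let ?L = "\<Union>n\<in>{1..D}. {x :: real \<times> real. snd x = real n * fst x}"
  have "open (\<Omega> \<inter> {x. real n * fst x < snd x} \<inter> {x. snd x < (real n + 1) * fst x})" for n
    by (intro open_Int assms(1) open_Collect_less continuous_intros)
  moreover have "?S n = \<Omega> \<inter> {x. real n * fst x < snd x} \<inter> {x. snd x < (real n + 1) * fst x}" for n by auto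
  ultimately have Sm: "?S n \<in> sets borel" for n by simp
  have Lm: "{x :: real \<times> real. snd x = real n * fst x} \<in> sets borel" for n
    by (intro borel_closed closed_Collect_eq continuous_intros)
  have Vm: "\<Omega> \<inter> {x. real D * fst x < snd x} \<in> sets borel"
    by (intro borel_open open_Int assms(1) open_Collect_less continuous_intros)
  have "\<Omega> \<subseteq> (\<Omega> \<inter> {x. real D * fst x < snd x}) \<union> (\<Union>n\<in>{1..<D}. ?S n) \<union> ?L"
  proof
    fix x assume x: "x \<in> \<Omega>"
    then have pos: "0 < fst x" "fst x < snd x" using sub by auto
    define n where "n = nat \<lfloor>snd x / fst x\<rfloor>"
    have "1 \<le> snd x / fst x" using pos by simp
    then have n: "1 \<le> n" "real n \<le> snd x / fst x" "snd x / fst x < real n + 1" unfolding n_def by linarith+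
    then have n': "real n * fst x \<le> snd x" "snd x < (real n + 1) * fst x" using pos by (simp_all add: field_simps)
    show "x \<in> (\<Omega> \<inter> {x. real D * fst x < snd x}) \<union> (\<Union>n\<in>{1..<D}. ?S n) \<union> ?L"
    proof (cases "D < n")
      case True
      then have "real D * fst x < real n * fst x" using pos by simp
      then show ?thesis using n' x by auto
    next
      case False
      show ?thesis
      proof (cases "snd x = real n * fst x")
        case True
        then show ?thesis using n False by auto
      next
        case neq: False
        show ?thesis
        proof (cases "n = D")
          case True
          then show ?thesis using n' neq x by auto
        next
          case F: False
          then show ?thesis using n n' neq x False by auto
        qed
      qed
    qed
  qed
  then have "emeasure lborel \<Omega> \<le> emeasure lborel ((\<Omega> \<inter> {x. real D * fst x < snd x}) \<union> (\<Union>n\<in>{1..<D}. ?S n) \<union> ?L)"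
    using Sm Lm Vm by (intro emeasure_mono) auto
  also have "\<dots> \<le> emeasure lborel ((\<Omega> \<inter> {x. real D * fst x < snd x}) \<union> (\<Union>n\<in>{1..<D}. ?S n)) + emeasure lborel ?L"
    using Sm Lm Vm by (intro emeasure_subadditive) auto
  also have "emeasure lborel ?L = 0"
  proof -
    have "emeasure lborel ?L \<le> (\<Sum>n\<in>{1..D}. emeasure lborel {x :: real \<times> real. snd x = real n * fst x})"
      using Lm by (intro emeasure_subadditive_finite) auto
    then show ?thesis by (simp add: emeasure_line)
  qed
  also have "emeasure lborel ((\<Omega> \<inter> {x. real D * fst x < snd x}) \<union> (\<Union>n\<in>{1..<D}. ?S n)) + 0
     \<le> emeasure lborel (\<Omega> \<inter> {x. real D * fst x < snd x}) + emeasure lborel (\<Union>n\<in>{1..<D}. ?S n)"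
    unfolding add_0_right using Sm Vm by (intro emeasure_subadditive) auto
  also have "emeasure lborel (\<Union>n\<in>{1..<D}. ?S n) \<le> (\<Sum>n\<in>{1..<D}. emeasure lborel (?S n))"
    using Sm by (intro emeasure_subadditive_finite) auto
  also have "(\<Sum>n\<in>{1..<D}. emeasure lborel (?S n)) = (\<Sum>n\<in>{1..<D}. emeasure lborel (strip n \<Omega>))"
  proof (intro sum.cong refl)
    fix n
    have "{x. ?f n x \<in> ?S n} = strip n \<Omega>"
      by (auto simp: strip_def algebra_simps)
    then show "emeasure lborel (?S n) = emeasure lborel (strip n \<Omega>)"
      using emeasure_shear[OF Sm, of "real n" n] by simp
  qed
  finally show ?thesis by (simp add: add_mono)
qed

text \<open>The loss of the induction: \<open>b\<^sup>2 / (y (x + y))\<close> is twice the area of the triangle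
  \<open>0 < \<alpha> < \<beta>\<close>, \<open>x \<alpha> + y \<beta> < b\<close>. Passing to the strip of first digit \<open>n\<close> replaces \<open>(x, y)\<close> by
  \<open>(y, x + n y)\<close>, and these areas telescope over \<open>n\<close>.\<close>

lemma words_count_induct:
  fixes R :: "nat \<Rightarrow> real" and D :: nat
  assumes R: "filterlim R at_top sequentially" and D: "0 < D"
    and J: "0 \<le> x1" "x1 < x2" "x2 \<le> 1"
  shows "0 \<le> x \<Longrightarrow> x \<le> y \<Longrightarrow> 0 < y \<Longrightarrow> 0 < b \<Longrightarrow> open \<Omega> \<Longrightarrow> convex \<Omega> \<Longrightarrow>
    \<Omega> \<subseteq> {v. 0 < fst v \<and> fst v < snd v \<and> x * fst v + y * snd v < b} \<Longrightarrow>
    ennreal (\<theta> * (x2 - x1) * measure lborel \<Omega> - ((1 - 1 / real D) ^ K + 2 * real K / real D ^ 2) * (b ^ 2 / (y * (x + y))))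
      \<le> liminf (\<lambda>i. ennreal (1 / R i ^ 2) * ecard {w \<in> words e {x1<..<x2}. scaled_den (R i) w \<in> \<Omega>})"
proof (induction K arbitrary: x y \<Omega> e)
  case 0
  \<comment> \<open>With no digit removed the claim is void: \<Omega> lies in a rectangle of area
    \<open>b^2 / (y * (x + y))\<close> and \<open>\<theta> * (x2 - x1) <= 1\<close>, so the
    left-hand side is \<open>ennreal\<close> of a nonpositive number.\<close>
  have "\<Omega> \<subseteq> cbox (0, 0) (b / (x + y), b / y)"
  proof
    fix v assume "v \<in> \<Omega>"
    then have v: "0 < fst v" "fst v < snd v" "x * fst v + y * snd v < b" using 0 by auto
    have "x * fst v + y * fst v \<le> x * fst v + y * snd v" using v 0 by (intro add_left_mono mult_left_mono) auto
    then have "(x + y) * fst v \<le> b" using v by (simp add: algebra_simps)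
    moreover have "0 \<le> x * fst v" using v 0 by simp
    then have "y * snd v \<le> b" using v by linarith
    ultimately have "fst v \<le> b / (x + y)" "snd v \<le> b / y" using 0 by (simp_all add: field_simps)
    then show "v \<in> cbox (0, 0) (b / (x + y), b / y)" using v by (cases v) (simp add: cbox_Pair_eq)
  qed
  moreover have "measure lborel (cbox (0, 0) (b / (x + y), b / y)) = b / (x + y) * (b / y)"
    using 0 by (subst measure_lborel_cbox_eq) (auto simp: Basis_prod_def)
  ultimately have m: "measure lborel \<Omega> \<le> b ^ 2 / (y * (x + y))"
    using 0 measure_mono_fmeasurable[of \<Omega> "cbox (0, 0) (b / (x + y), b / y)" lborel]
    by (simp add: power2_eq_square mult.commute fmeasurable_cbox)
  have "\<theta> * (x2 - x1) \<le> 1 * 1" using theta_le_1 theta_pos J by (intro mult_mono) auto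
  then have "\<theta> * (x2 - x1) * measure lborel \<Omega> \<le> 1 * measure lborel \<Omega>" by (intro mult_right_mono) auto
  then have "\<theta> * (x2 - x1) * measure lborel \<Omega> - b ^ 2 / (y * (x + y)) \<le> 0" using m by linarith
  then show ?case by (simp add: ennreal_neg)
next
  case (Suc K)
  define V where "V = \<Omega> \<inter> {v. real D * fst v < snd v}"
  define c where "c = (1 - 1 / real D) ^ K + 2 * real K / real D ^ 2"
  define en where "en n = 1 / ((x + real n * y) * (x + real n * y + y))" for n :: nat
  define E where "E = 1 / (y * (x + y))"
  have xy: "0 < x + y" using Suc.prems by simp
  let ?A = "\<lambda>i. {w \<in> words e {x1<..<x2}. \<exists>n v. w = n # v \<and> D \<le> n \<and> scaled_den (R i) w \<in> V}"
  let ?B = "\<lambda>n i. {w \<in> words (\<not> e) {x1<..<x2}. scaled_den (R i) w \<in> strip n \<Omega>}"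
  let ?W = "\<lambda>i. {w \<in> words e {x1<..<x2}. scaled_den (R i) w \<in> \<Omega>}"
  \<comment> \<open>Last digits from \<open>D\<close> on. The bound \<open>b / y\<close> for the
    second coordinate comes from dropping the nonnegative term \<open>x * fst v\<close>.\<close>
  have A: "ennreal (\<theta> * (x2 - x1) * measure lborel V - (b / y / D) ^ 2) \<le> liminf (\<lambda>i. ennreal (1 / R i ^ 2) * ecard (?A i))"
  proof (rule big_digit_count[OF R _ _ _ D _ J])
    show "open V" unfolding V_def by (intro open_Int Suc.prems open_Collect_less continuous_intros)
    have "convex {v :: real \<times> real. inner (real D, -1) v < 0}" by (rule convex_halfspace_lt)
    moreover have "{v :: real \<times> real. inner (real D, -1) v < 0} = {v. real D * fst v < snd v}" by (auto simp: inner_prod_def)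
    ultimately show "convex V" unfolding V_def using Suc.prems by (intro convex_Int) auto
    show "V \<subseteq> {x. 0 < fst x \<and> real D * fst x < snd x \<and> snd x < b / y}"
    proof
      fix v assume "v \<in> V"
      then have v: "0 < fst v" "x * fst v + y * snd v < b" "real D * fst v < snd v" using Suc.prems by (auto simp: V_def)
      have "0 \<le> x * fst v" using v Suc.prems by simp
      then have "y * snd v < b" using v by linarith
      then show "v \<in> {x. 0 < fst x \<and> real D * fst x < snd x \<and> snd x < b / y}"
        using v Suc.prems by (simp add: field_simps)
    qed
    show "0 < b / y" using Suc.prems by simp
  qed
  \<comment> \<open>Smaller last digits: the induction hypothesis for the shorter word, with the
    parity reversed and the form \<open>x * \<alpha> + y * \<beta>\<close> pulled back to
    \<open>y * \<alpha> + (x + n * y) * \<beta>\<close>. The condition \<open>x <= y\<close> is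
    inherited because \<open>n\<close> is positive.\<close>
  have B: "ennreal (\<theta> * (x2 - x1) * measure lborel (strip n \<Omega>) - c * (b ^ 2 * en n)) \<le> liminf (\<lambda>i. ennreal (1 / R i ^ 2) * ecard (?B n i))"
    if n: "n \<in> {1..<D}" for n
  proof -
    have "1 * y \<le> real n * y" using n Suc.prems by (intro mult_right_mono) auto
    then have ny: "y \<le> x + real n * y" "0 < x + real n * y" using Suc.prems by linarith+
    have "ennreal (\<theta> * (x2 - x1) * measure lborel (strip n \<Omega>) - ((1 - 1 / real D) ^ K + 2 * real K / real D ^ 2) * (b ^ 2 / ((x + real n * y) * (y + (x + real n * y)))))
      \<le> liminf (\<lambda>i. ennreal (1 / R i ^ 2) * ecard (?B n i))"
    proof (rule Suc.IH)
      show "strip n \<Omega> \<subseteq> {v. 0 < fst v \<and> fst v < snd v \<and> y * fst v + (x + real n * y) * snd v < b}"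
      proof
        fix v assume v: "v \<in> strip n \<Omega>"
        then have "x * snd v + y * (real n * snd v + fst v) < b" using Suc.prems by (force simp: strip_def)
        then show "v \<in> {v. 0 < fst v \<and> fst v < snd v \<and> y * fst v + (x + real n * y) * snd v < b}"
          using v by (auto simp: strip_def algebra_simps)
      qed
    qed (use Suc.prems ny in \<open>auto intro: strip_open strip_convex\<close>)
    then show ?thesis unfolding c_def[symmetric] en_def by (simp add: add.commute)
  qed
  have Omfin: "emeasure lborel \<Omega> < \<infinity>"
  proof -
    have "\<Omega> \<subseteq> cbox (0, 0) (b / y, b / y)"
    proof
      fix v assume "v \<in> \<Omega>"
      then have v: "0 < fst v" "fst v < snd v" "x * fst v + y * snd v < b" using Suc.prems by auto
      have "0 \<le> x * fst v" using v Suc.prems by simp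
      then have "y * snd v \<le> b" using v by linarith
      then have "snd v \<le> b / y" using Suc.prems by (simp add: field_simps)
      then show "v \<in> cbox (0, 0) (b / y, b / y)" using v by (cases v) (simp add: cbox_Pair_eq)
    qed
    from emeasure_mono[OF this, of lborel] show ?thesis
      using emeasure_lborel_cbox_finite[of "(0, 0)" "(b / y, b / y)"] by (simp add: le_less_trans)
  qed
  have stripfin: "emeasure lborel (strip n \<Omega>) < \<infinity>" for n
  proof -
    have "emeasure lborel (strip n \<Omega>) \<le> emeasure lborel {v. (snd v, real n * snd v + fst v) \<in> \<Omega>}"
    proof (rule emeasure_mono)
      have "open ((\<lambda>v. (snd v, real n * snd v + fst v)) -` \<Omega>)"
        by (rule open_vimage[OF Suc.prems(5)]) (intro continuous_intros)
      then show "{v. (snd v, real n * snd v + fst v) \<in> \<Omega>} \<in> sets lborel" by (simp add: vimage_def)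
    qed (auto simp: strip_def)
    then show ?thesis using Omfin Suc.prems(5) by (simp add: emeasure_shear le_less_trans)
  qed
  have Vfin: "emeasure lborel V < \<infinity>"
    using emeasure_mono[of V \<Omega> lborel] Omfin Suc.prems(5) by (auto simp: V_def le_less_trans)
  have meas: "measure lborel \<Omega> \<le> measure lborel V + (\<Sum>n\<in>{1..<D}. measure lborel (strip n \<Omega>))"
  proof -
    have "ennreal (measure lborel \<Omega>) \<le> ennreal (measure lborel V) + (\<Sum>n\<in>{1..<D}. ennreal (measure lborel (strip n \<Omega>)))"
      using emeasure_strips[OF Suc.prems(5) _ D] Suc.prems(7) Omfin stripfin Vfin
      by (auto simp: emeasure_eq_ennreal_measure less_top V_def[symmetric])
    then show ?thesis
      by (simp add: sum_ennreal sum_nonneg flip: ennreal_plus)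
  qed
  have c0: "0 \<le> c" using D by (simp add: c_def)
  \<comment> \<open>The telescoping sum is \<open>1 / y * (1 / (x + y) - 1 / (x + D * y))\<close>,
    and \<open>x + D * y <= D * (x + y)\<close> turns this into the factor \<open>1 - 1 / D\<close>:
    each removal of a digit shrinks the untreated part by it.\<close>
  have sumE: "(\<Sum>n\<in>{1..<D}. en n) \<le> E * (1 - 1 / real D)"
  proof -
    have "x + real D * y \<le> real D * (x + y)"
    proof -
      have "1 * x \<le> real D * x" using D Suc.prems by (intro mult_right_mono) auto
      then show ?thesis by (simp add: distrib_left)
    qed
    moreover have "0 < x + real D * y" using D Suc.prems by (intro add_nonneg_pos mult_pos_pos) auto
    ultimately have "1 / (real D * (x + y)) \<le> 1 / (x + real D * y)" by (intro divide_left_mono) (use D xy in auto)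
    then have "1 / y * (1 / (x + y) - 1 / (x + real D * y)) \<le> 1 / y * (1 / (x + y) - 1 / (real D * (x + y)))"
      using Suc.prems by (intro mult_left_mono) auto
    also have "1 / y * (1 / s - 1 / (real D * s)) = 1 / (y * s) * (1 - 1 / real D)" for s
      by (simp add: right_diff_distrib mult_ac)
    finally show ?thesis unfolding E_def en_def sum_telescope_inverse[OF Suc.prems(1,3) D] .
  qed
  \<comment> \<open>Here \<open>x <= y\<close> enters: \<open>y * (x + y) <= 2 * y^2\<close>
    expresses the loss from large digits by the same quantity \<open>E\<close> and is the origin of
    the 2 in the error term.\<close>
  have yE: "(b / y / D) ^ 2 \<le> 2 / real D ^ 2 * (b ^ 2 * E)"
  proof -
    have "1 / (y * (y + y)) \<le> E" unfolding E_def using Suc.prems xy by (intro divide_left_mono mult_left_mono mult_pos_pos) auto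
    then have "b ^ 2 * (2 / real D ^ 2 * (1 / (y * (y + y)))) \<le> b ^ 2 * (2 / real D ^ 2 * E)" by (intro mult_left_mono) auto
    moreover have "b ^ 2 * (2 / real D ^ 2 * (1 / (y * (y + y)))) = (b / y / D) ^ 2"
      using Suc.prems D by (simp add: power2_eq_square field_simps)
    ultimately show ?thesis by (simp add: mult_ac)
  qed
  have "\<theta> * (x2 - x1) * measure lborel \<Omega> - ((1 - 1 / real D) ^ Suc K + 2 * real (Suc K) / real D ^ 2) * (b ^ 2 * E)
    \<le> (\<theta> * (x2 - x1) * measure lborel V - (b / y / D) ^ 2) + (\<Sum>n\<in>{1..<D}. \<theta> * (x2 - x1) * measure lborel (strip n \<Omega>) - c * (b ^ 2 * en n))"
  proof -
    have "\<theta> * (x2 - x1) * measure lborel \<Omega> \<le> \<theta> * (x2 - x1) * (measure lborel V + (\<Sum>n\<in>{1..<D}. measure lborel (strip n \<Omega>)))"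
      using meas theta_pos J by (intro mult_left_mono) auto
    moreover have "c * (b ^ 2 * (\<Sum>n\<in>{1..<D}. en n)) \<le> c * (b ^ 2 * (E * (1 - 1 / real D)))"
      using sumE c0 by (intro mult_left_mono) auto
    moreover have "c * (b ^ 2 * (E * (1 - 1 / real D))) + 2 / real D ^ 2 * (b ^ 2 * E) \<le> ((1 - 1 / real D) ^ Suc K + 2 * real (Suc K) / real D ^ 2) * (b ^ 2 * E)"
    proof -
      have "c * (1 - 1 / real D) \<le> (1 - 1 / real D) ^ Suc K + 2 * real K / real D ^ 2"
      proof -
        have "2 * real K / real D ^ 2 * (1 - 1 / real D) \<le> 2 * real K / real D ^ 2 * 1" by (intro mult_left_mono) (use D in auto)
        then show ?thesis by (simp add: c_def distrib_right)
      qed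
      then have "(c * (1 - 1 / real D) + 2 / real D ^ 2) * (b ^ 2 * E) \<le> ((1 - 1 / real D) ^ Suc K + 2 * real K / real D ^ 2 + 2 / real D ^ 2) * (b ^ 2 * E)"
        using Suc.prems xy by (intro mult_right_mono add_right_mono) (auto simp: E_def)
      moreover have "2 * real K / real D ^ 2 + 2 / real D ^ 2 = 2 * real (Suc K) / real D ^ 2" by (simp add: add_divide_distrib)
      moreover have "c * (b ^ 2 * (E * (1 - 1 / real D))) + 2 / real D ^ 2 * (b ^ 2 * E) = (c * (1 - 1 / real D) + 2 / real D ^ 2) * (b ^ 2 * E)"
        by (simp add: algebra_simps)
      moreover have "(1 - 1 / real D) ^ Suc K + 2 * real K / real D ^ 2 + 2 / real D ^ 2 = (1 - 1 / real D) ^ Suc K + 2 * real (Suc K) / real D ^ 2"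
        using calculation(2) by linarith
      ultimately show ?thesis by metis
    qed
    moreover have "(\<Sum>n\<in>{1..<D}. T * measure lborel (strip n \<Omega>) - c * (b ^ 2 * en n))
        = T * (\<Sum>n\<in>{1..<D}. measure lborel (strip n \<Omega>)) - c * (b ^ 2 * (\<Sum>n\<in>{1..<D}. en n))" for T
      by (simp add: sum_subtractf sum_distrib_left)
    ultimately show ?thesis
      using yE unfolding distrib_left[of "\<theta> * (x2 - x1)"] by simp
  qed
  then have "ennreal (\<theta> * (x2 - x1) * measure lborel \<Omega> - ((1 - 1 / real D) ^ Suc K + 2 * real (Suc K) / real D ^ 2) * (b ^ 2 * E))
    \<le> ennreal ((\<theta> * (x2 - x1) * measure lborel V - (b / y / D) ^ 2) + (\<Sum>n\<in>{1..<D}. \<theta> * (x2 - x1) * measure lborel (strip n \<Omega>) - c * (b ^ 2 * en n)))"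
    by (rule ennreal_leI)
  also have "\<dots> \<le> ennreal (\<theta> * (x2 - x1) * measure lborel V - (b / y / D) ^ 2) + (\<Sum>n\<in>{1..<D}. ennreal (\<theta> * (x2 - x1) * measure lborel (strip n \<Omega>) - c * (b ^ 2 * en n)))"
    by (intro order_trans[OF ennreal_add_le] add_left_mono ennreal_sum_le) simp
  also have "\<dots> \<le> liminf (\<lambda>i. ennreal (1 / R i ^ 2) * ecard (?A i)) + (\<Sum>n\<in>{1..<D}. liminf (\<lambda>i. ennreal (1 / R i ^ 2) * ecard (?B n i)))"
    by (intro add_mono A sum_mono B)
  also have "\<dots> \<le> liminf (\<lambda>i. ennreal (1 / R i ^ 2) * ecard (?A i)) + liminf (\<lambda>i. \<Sum>n\<in>{1..<D}. ennreal (1 / R i ^ 2) * ecard (?B n i))"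
    by (intro add_left_mono liminf_sum_ennreal) simp
  also have "\<dots> \<le> liminf (\<lambda>i. ennreal (1 / R i ^ 2) * ecard (?A i) + (\<Sum>n\<in>{1..<D}. ennreal (1 / R i ^ 2) * ecard (?B n i)))"
    by (rule liminf_add_ennreal)
  also have "\<dots> \<le> liminf (\<lambda>i. ennreal (1 / R i ^ 2) * ecard (?W i))"
  proof (intro Liminf_mono always_eventually allI)
    fix i
    have inj: "inj_on ((#) n) X" for n :: nat and X by (auto simp: inj_on_def)
    \<comment> \<open>The letter at the head is at least \<open>D\<close> in \<open>?A\<close> and
      equal to \<open>n < D\<close> in the image for \<open>n\<close>, so all these sets of words
      are disjoint.\<close>
    have "ecard (?A i) + (\<Sum>n\<in>{1..<D}. ecard (?B n i)) = ecard (?A i) + (\<Sum>n\<in>{1..<D}. ecard ((#) n ` ?B n i))"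
      using inj by (simp add: ecard_image)
    also have "\<dots> = ecard (?A i) + ecard (\<Union>n\<in>{1..<D}. (#) n ` ?B n i)"
      by (subst ecard_UN_disjoint) (auto simp: disjoint_family_on_def)
    also have "\<dots> = ecard (?A i \<union> (\<Union>n\<in>{1..<D}. (#) n ` ?B n i))"
      by (subst ecard_Un_disjoint) auto
    also have "\<dots> \<le> ecard (?W i)"
    proof (rule ecard_mono, rule Un_least)
      show "?A i \<subseteq> ?W i" by (auto simp: V_def)
      show "(\<Union>n\<in>{1..<D}. (#) n ` ?B n i) \<subseteq> ?W i"
      proof safe
        fix n w assume n: "n \<in> {1..<D}" and w: "w \<in> words (\<not> e) {x1<..<x2}" and s: "scaled_den (R i) w \<in> strip n \<Omega>"
        show "n # w \<in> words e {x1<..<x2}" using n by (intro words_Cons w) auto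
        have "scaled_den (R i) (n # w) = (snd (scaled_den (R i) w), real n * snd (scaled_den (R i) w) + fst (scaled_den (R i) w))"
          by (simp add: scaled_den_def add_divide_distrib)
        then show "scaled_den (R i) (n # w) \<in> \<Omega>" using s by (simp add: strip_def)
      qed
    qed
    finally have "ennreal (1 / R i ^ 2) * (ecard (?A i) + (\<Sum>n\<in>{1..<D}. ecard (?B n i))) \<le> ennreal (1 / R i ^ 2) * ecard (?W i)"
      by (intro mult_left_mono) auto
    then show "ennreal (1 / R i ^ 2) * ecard (?A i) + (\<Sum>n\<in>{1..<D}. ennreal (1 / R i ^ 2) * ecard (?B n i)) \<le> ennreal (1 / R i ^ 2) * ecard (?W i)"
      by (simp add: distrib_left sum_distrib_left)
  qed
  finally show ?case unfolding E_def by simp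
qed

theorem words_count:
  fixes R :: "nat \<Rightarrow> real"
  assumes R: "filterlim R at_top sequentially" and J: "0 \<le> x1" "x1 < x2" "x2 \<le> 1"
    and \<Omega>: "open \<Omega>" "convex \<Omega>" "\<Omega> \<subseteq> {v. 0 < fst v \<and> fst v < snd v \<and> snd v < b}"
  shows "ennreal (\<theta> * (x2 - x1) * measure lborel \<Omega>)
      \<le> liminf (\<lambda>i. ennreal (1 / R i ^ 2) * ecard {w \<in> words e {x1<..<x2}. scaled_den (R i) w \<in> \<Omega>})"
proof (cases "0 < b")
  case False
  then have "\<Omega> = {}" using \<Omega>(3) by fastforce
  then show ?thesis by simp
next
  case True
  let ?X = "liminf (\<lambda>i. ennreal (1 / R i ^ 2) * ecard {w \<in> words e {x1<..<x2}. scaled_den (R i) w \<in> \<Omega>})"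
  have *: "ennreal (\<theta> * (x2 - x1) * measure lborel \<Omega> - (exp (- real d) + 2 * (1 / real d)) * b ^ 2) \<le> ?X" if d: "0 < d" for d :: nat
  proof -
    \<comment> \<open>This choice makes both parts of the loss small:
      \<open>(1 - 1 / D)^K <= exp (- d)\<close> and \<open>2 * K / D^2 = 2 / d\<close>. The linear
      form is the second coordinate, \<open>x = 0\<close> and \<open>y = 1\<close>.\<close>
    let ?D = "d ^ 2" and ?K = "d ^ 3"
    have "ennreal (\<theta> * (x2 - x1) * measure lborel \<Omega> - ((1 - 1 / real ?D) ^ ?K + 2 * real ?K / real ?D ^ 2) * (b ^ 2 / (1 * (0 + 1)))) \<le> ?X"
      using d True \<Omega> by (intro words_count_induct[OF R _ J]) auto
    moreover have "(1 - 1 / real ?D) ^ ?K \<le> exp (- real d)"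
    proof -
      have "1 - 1 / real ?D \<le> exp (- (1 / real ?D))" using exp_ge_add_one_self[of "- (1 / real ?D)"] by simp
      moreover have "0 \<le> 1 - 1 / real ?D" using d by simp
      ultimately have "(1 - 1 / real ?D) ^ ?K \<le> exp (- (1 / real ?D)) ^ ?K" by (intro power_mono)
      also have "\<dots> = exp (real ?K * - (1 / real ?D))" by (rule exp_of_nat_mult[symmetric])
      also have "real ?K * - (1 / real ?D) = - real d" using d by (simp add: power2_eq_square power3_eq_cube)
      finally show ?thesis .
    qed
    moreover have "2 * real ?K / real ?D ^ 2 = 2 * (1 / real d)" using d by (simp add: power2_eq_square power3_eq_cube)
    ultimately have le: "((1 - 1 / real ?D) ^ ?K + 2 * real ?K / real ?D ^ 2) * b ^ 2 \<le> (exp (- real d) + 2 * (1 / real d)) * b ^ 2"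
      by (intro mult_right_mono add_mono) auto
    show ?thesis
      by (rule order_trans[OF ennreal_leI \<open>ennreal _ \<le> ?X\<close>]) (use le in simp)
  qed
  have "(\<lambda>d. \<theta> * (x2 - x1) * measure lborel \<Omega> - (exp (- real d) + 2 * (1 / real d)) * b ^ 2) \<longlonglongrightarrow> \<theta> * (x2 - x1) * measure lborel \<Omega> - (0 + 2 * 0) * b ^ 2"
  proof (intro tendsto_diff tendsto_mult tendsto_add tendsto_const lim_1_over_n)
    show "(\<lambda>d. exp (- real d)) \<longlonglongrightarrow> 0"
      by (intro filterlim_compose[OF exp_at_bot] filterlim_compose[OF filterlim_uminus_at_bot_at_top] filterlim_real_sequentially)
  qed
  then have "ennreal (\<theta> * (x2 - x1) * measure lborel \<Omega> - (0 + 2 * 0) * b ^ 2) \<le> ?X"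
    by (rule ennreal_le_limit) (use * in \<open>auto intro!: eventually_mono[OF eventually_gt_at_top[of 0]]\<close>)
  then show ?thesis by simp
qed

section \<open>Weak convergence from lower bounds\<close>

text \<open>Closed sets generate the Borel sets, and the indicator of a closed set is the limit of
  the continuous functions \<open>max 0 (1 - n * infdist x C)\<close>, which are bounded by
  1.\<close>

lemma measure_eqI_bounded_continuous:
  fixes M N :: "'a::metric_space measure"
  assumes M: "prob_space M" "sets M = sets borel" and N: "prob_space N" "sets N = sets borel"
    and eq: "\<And>f :: 'a \<Rightarrow> real. continuous_on UNIV f \<Longrightarrow> bounded (range f) \<Longrightarrow> integral\<^sup>L M f = integral\<^sup>L N f"
  shows "M = N"
proof -
  have lim: "(\<lambda>n. integral\<^sup>L M (\<lambda>x. max 0 (1 - real n * infdist x C))) \<longlonglongrightarrow> measure M C"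
    if C: "closed C" "C \<noteq> {}" and M: "prob_space M" "sets M = sets borel" for C and M :: "'a measure"
  proof -
    interpret prob_space M by fact
    have "(\<lambda>n. integral\<^sup>L M (\<lambda>x. max 0 (1 - real n * infdist x C))) \<longlonglongrightarrow> integral\<^sup>L M (indicator C)"
    proof (rule integral_dominated_convergence)
      show "integrable M (\<lambda>_. 1 :: real)" by simp
      show "indicator C \<in> borel_measurable M"
        using C M by (intro borel_measurable_indicator) simp
      show "(\<lambda>x. max 0 (1 - real n * infdist x C)) \<in> borel_measurable M" for n
        using M(2) by (subst measurable_cong_sets[OF M(2) refl])
          (intro borel_measurable_continuous_onI continuous_intros)
      show "AE x in M. norm (max 0 (1 - real n * infdist x C)) \<le> 1" for n
        by (simp add: infdist_nonneg)
      show "AE x in M. (\<lambda>n. max 0 (1 - real n * infdist x C)) \<longlonglongrightarrow> indicator C x"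
      proof (intro always_eventually allI)
        fix x
        show "(\<lambda>n. max 0 (1 - real n * infdist x C)) \<longlonglongrightarrow> indicator C x"
        proof (cases "x \<in> C")
          case False
          then have d: "0 < infdist x C"
            using C in_closed_iff_infdist_zero[of C x] infdist_nonneg[of x C] by (metis less_eq_real_def)
          obtain m :: nat where m: "1 / infdist x C < m" using reals_Archimedean2 by blast
          have "max 0 (1 - real n * infdist x C) = indicator C x" if "m \<le> n" for n
          proof -
            have "1 / infdist x C < n" using m that by linarith
            then show ?thesis using d False by (simp add: field_simps)
          qed
          then show ?thesis by (intro tendsto_eventually) (auto simp: eventually_sequentially)
        qed simp
      qed
    qed
    moreover have "C \<in> sets M" using C M by simp
    ultimately show ?thesis using M by simp
  qed
  show ?thesis
  proof (rule measure_eqI_generator_eq[where E = "Collect closed" and \<Omega> = UNIV and A = "\<lambda>_. UNIV"])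
    show "Int_stable (Collect closed :: 'a set set)" by (auto intro!: Int_stableI)
    show "sets M = sigma_sets UNIV (Collect closed)" "sets N = sigma_sets UNIV (Collect closed)"
      using M N by (simp_all add: borel_eq_closed)
    show "emeasure M UNIV \<noteq> \<infinity>" for i :: nat
      using M by (simp add: prob_space.finite_measure finite_measure.emeasure_finite)
    fix C :: "'a set" assume "C \<in> Collect closed"
    then have C: "closed C" by simp
    show "emeasure M C = emeasure N C"
    proof (cases "C = {}")
      case False
      have "integral\<^sup>L M (\<lambda>x. max 0 (1 - real n * infdist x C)) = integral\<^sup>L N (\<lambda>x. max 0 (1 - real n * infdist x C))" for n
      proof (rule eq)
        show "continuous_on UNIV (\<lambda>x. max 0 (1 - real n * infdist x C))" by (intro continuous_intros)
        show "bounded (range (\<lambda>x. max 0 (1 - real n * infdist x C)))"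
          by (rule boundedI[of _ 1]) (auto simp: infdist_nonneg)
      qed
      then have "measure M C = measure N C"
        using lim[OF C False M] lim[OF C False N] by (simp add: LIMSEQ_unique)
      then show ?thesis
        using M N by (simp add: finite_measure.emeasure_eq_measure prob_space.finite_measure)
    qed simp
  qed auto
qed

text \<open>Its range consists of the windows of width \<open>2 * k + 1\<close>. There are countably
  many, so the events \<open>{b1<..<b2} \<times> {d}\<close> can be used as cells.\<close>

definition trunc :: "nat \<Rightarrow> (int \<Rightarrow> nat) \<Rightarrow> int \<Rightarrow> nat"
  where "trunc k w = (\<lambda>i. if \<bar>i\<bar> \<le> int k then w i else 0)"

lemma trunc_trunc [simp]: "trunc k (trunc k w) = trunc k w"
  by (auto simp: trunc_def)

lemma countable_trunc: "countable (range (trunc k))"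
proof -
  have "range (trunc k) \<subseteq> (\<lambda>l i. if \<bar>i\<bar> \<le> int k then l ! nat (i + int k) else 0) ` (UNIV :: nat list set)"
  proof safe
    fix w :: "int \<Rightarrow> nat"
    have "trunc k w = (\<lambda>i. if \<bar>i\<bar> \<le> int k then map (\<lambda>j. w (int j - int k)) [0..<2 * k + 1] ! nat (i + int k) else 0)"
      by (rule ext) (auto simp: trunc_def simp del: upt_Suc)
    then show "trunc k w \<in> range (\<lambda>l i. if \<bar>i\<bar> \<le> int k then l ! nat (i + int k) else 0)" by (rule image_eqI) simp
  qed
  then show ?thesis by (meson countable_image countable_subset uncountable_def countableI_type)
qed

lemma closed_trunc_eq: "closed {y :: real \<times> (int \<Rightarrow> nat). trunc k (snd y) = d}"
proof -
  have coord: "continuous_on UNIV (\<lambda>y :: real \<times> (int \<Rightarrow> nat). snd y i)" for i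
    by (rule continuous_on_compose2[OF continuous_on_product_coordinates[of i] continuous_on_snd[OF continuous_on_id]]) simp
  have "continuous_on UNIV (\<lambda>y :: real \<times> (int \<Rightarrow> nat). trunc k (snd y) i)" for i
    by (cases "\<bar>i\<bar> \<le> int k") (simp_all add: trunc_def coord)
  then have "closed {y :: real \<times> (int \<Rightarrow> nat). trunc k (snd y) i = d i}" for i
    by (intro closed_Collect_eq continuous_on_const)
  then have "closed {y :: real \<times> (int \<Rightarrow> nat). \<forall>i. trunc k (snd y) i = d i}"
    by (rule closed_Collect_all)
  then show ?thesis by (simp add: fun_eq_iff)
qed

lemma closed_snd_eq: "closed {y :: real \<times> (int \<Rightarrow> nat). snd y = d}"
proof -
  have coord: "continuous_on UNIV (\<lambda>y :: real \<times> (int \<Rightarrow> nat). snd y i)" for i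
    by (rule continuous_on_compose2[OF continuous_on_product_coordinates[of i] continuous_on_snd[OF continuous_on_id]]) simp
  have "closed {y :: real \<times> (int \<Rightarrow> nat). \<forall>i. snd y i = d i}"
    by (intro closed_Collect_all closed_Collect_eq continuous_on_const coord)
  then show ?thesis by (simp add: fun_eq_iff)
qed

lemma box_event_measurable: "{b1<..<b2} \<times> {d} \<in> sets (borel :: (real \<times> (int \<Rightarrow> nat)) measure)"
proof -
  have "{y :: real \<times> (int \<Rightarrow> nat). snd y = d} \<inter> ({b1<..<b2} \<times> UNIV) \<in> sets borel"
    by (intro sets.Int borel_closed[OF closed_snd_eq] borel_open open_Times) auto
  moreover have "{y :: real \<times> (int \<Rightarrow> nat). snd y = d} \<inter> ({b1<..<b2} \<times> UNIV) = {b1<..<b2} \<times> {d}" by auto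
  ultimately show ?thesis by simp
qed

text \<open>The counterpart of \<open>nn_integral_le_liminf_boxes\<close>, with dyadic intervals
  times single windows as cells. A cell is half open in the real coordinate, and
  \<open>noatom\<close> makes its left end null.\<close>

lemma nn_integral_le_liminf_windows:
  fixes \<mu> :: "(real \<times> (int \<Rightarrow> nat)) measure" and g :: "real \<times> (int \<Rightarrow> nat) \<Rightarrow> real"
  assumes \<mu>: "sets \<mu> = sets borel" and \<nu>: "\<And>i. sets (\<nu> i) = sets borel"
    and tr: "AE y in \<mu>. trunc k (snd y) = snd y" "\<And>i. AE y in \<nu> i. trunc k (snd y) = snd y"
    and noatom: "\<And>b. emeasure \<mu> ({b} \<times> UNIV) = 0"
    and low: "\<And>b1 b2 d. b1 < b2 \<Longrightarrow> trunc k d = d \<Longrightarrow>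
      emeasure \<mu> ({b1<..<b2} \<times> {d}) \<le> liminf (\<lambda>i. emeasure (\<nu> i) ({b1<..<b2} \<times> {d}))"
    and g: "continuous_on UNIV g"
  shows "(\<integral>\<^sup>+y. ennreal (g y) \<partial>\<mu>) \<le> liminf (\<lambda>i. \<integral>\<^sup>+y. ennreal (g y) \<partial>\<nu> i)"
proof -
  have sp: "space \<mu> = UNIV" using sets_eq_imp_space_eq[OF \<mu>] by simp
  define c where "c j y = (\<lfloor>2 ^ j * fst y\<rfloor>, trunc k (snd y))" for j :: nat and y :: "real \<times> (int \<Rightarrow> nat)"
  \<comment> \<open>After composition with \<open>trunc\<close> the integrand depends only on the
    real coordinate and on the window, which is constant on a cell. Neither side changes, as the
    windows are truncated almost everywhere.\<close>
  define h where "h y = ennreal (g (fst y, trunc k (snd y)))" for y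
  let ?A = "UNIV \<times> range (trunc k) :: (int \<times> (int \<Rightarrow> nat)) set"
  have cm: "c j -` {(n, d)} = {y. real_of_int n / 2 ^ j \<le> fst y} \<inter> {y. fst y < (real_of_int n + 1) / 2 ^ j} \<inter> {y. trunc k (snd y) = d}" for j n d
    by (auto simp: c_def floor_eq_iff field_simps)
  have cms: "c j -` {a} \<in> sets borel" for j a
    by (cases a) (simp only: cm, intro sets.Int borel_closed[OF closed_trunc_eq] borel_closed[OF closed_Collect_le] borel_open[OF open_Collect_less] continuous_intros)
  have "(\<integral>\<^sup>+y. h y \<partial>\<mu>) \<le> liminf (\<lambda>i. \<integral>\<^sup>+y. h y \<partial>\<nu> i)"
  proof (rule nn_integral_le_liminf_cells[where A = ?A and c = c])
    show "countable ?A" by (intro countable_SIGMA countable_trunc) auto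
    show "c j \<in> measurable \<mu> (count_space ?A)" for j
      by (subst measurable_count_space_eq_countable[OF countable_SIGMA[OF countableI_type countable_trunc]])
        (use cms in \<open>auto simp: c_def \<mu> sp\<close>)
    show "c j x = c j y" if "c (Suc j) x = c (Suc j) y" for j x y
      using that floor_Suc_cong[of j "fst x" "fst y"] unfolding c_def by auto
    show "emeasure \<mu> (c j -` {a} \<inter> space \<mu>) \<le> liminf (\<lambda>i. emeasure (\<nu> i) (c j -` {a} \<inter> space \<mu>))"
      if "a \<in> ?A" for j a
    proof -
      obtain n d where a: "a = (n, d)" "trunc k d = d" using \<open>a \<in> ?A\<close> by auto
      let ?b1 = "real_of_int n / 2 ^ j" and ?b2 = "(real_of_int n + 1) / 2 ^ j"
      have b: "?b1 < ?b2" by (simp add: divide_strict_right_mono)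
      have om: "{?b1<..<?b2} \<times> {d} \<in> sets borel"
        by (rule box_event_measurable)
      have am: "{?b1} \<times> UNIV \<in> sets (borel :: (real \<times> (int \<Rightarrow> nat)) measure)"
        by (intro borel_closed closed_Times) auto
      have "emeasure \<mu> (c j -` {a}) \<le> emeasure \<mu> (({?b1<..<?b2} \<times> {d}) \<union> ({?b1} \<times> UNIV))"
        using tr(1) om am by (intro emeasure_mono_AE) (auto simp: a cm \<mu> elim!: eventually_mono)
      also have "\<dots> \<le> emeasure \<mu> ({?b1<..<?b2} \<times> {d}) + emeasure \<mu> ({?b1} \<times> UNIV)"
        using om am by (intro emeasure_subadditive) (auto simp: \<mu>)
      also have "\<dots> \<le> liminf (\<lambda>i. emeasure (\<nu> i) ({?b1<..<?b2} \<times> {d}))"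
        using low[OF b a(2)] noatom by simp
      also have "\<dots> \<le> liminf (\<lambda>i. emeasure (\<nu> i) (c j -` {a}))"
      proof (intro Liminf_mono always_eventually allI emeasure_mono)
        show "{?b1<..<?b2} \<times> {d} \<subseteq> c j -` {a}" unfolding a cm using a(2) by auto
      qed (use cms in \<open>simp add: \<nu>\<close>)
      finally show ?thesis by (simp add: sp)
    qed
    show "AE x in \<mu>. h x \<le> (SUP j. INF y\<in>{y \<in> space \<mu>. c j y = c j x}. h y)"
    proof (intro always_eventually allI)
      fix x :: "real \<times> (int \<Rightarrow> nat)"
      let ?d = "trunc k (snd x)"
      show "h x \<le> (SUP j. INF y\<in>{y \<in> space \<mu>. c j y = c j x}. h y)"
      proof (rule ccontr)
        assume "\<not> ?thesis"
        then have lt: "(SUP j. INF y\<in>{y \<in> space \<mu>. c j y = c j x}. h y) < h x" by (simp only: not_le)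
        then obtain r where r: "(SUP j. INF y\<in>{y \<in> space \<mu>. c j y = c j x}. h y) < r" "r < h x"
          by (rule dense[THEN exE]) blast
        have "\<exists>y. c j y = c j x \<and> h y < r" for j
        proof -
          have "(INF y\<in>{y \<in> space \<mu>. c j y = c j x}. h y) < r" by (rule SUP_lessD[OF r(1)]) simp
          then show ?thesis by (auto simp: INF_less_iff)
        qed
        then obtain y where y: "\<And>j. c j (y j) = c j x" "\<And>j. h (y j) < r" by metis
        have d: "trunc k (snd (y j)) = ?d" for j using y(1)[of j] by (simp add: c_def)
        have "\<bar>fst (y j) - fst x\<bar> \<le> (1 / 2) ^ j" for j
          using y(1)[of j] by (intro floor_pow2_dist) (simp add: c_def)
        then have "(\<lambda>j. fst (y j) - fst x) \<longlonglongrightarrow> 0"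
          by (intro Lim_null_comparison[OF _ LIMSEQ_power_zero[of "1 / 2"]]) auto
        then have "(\<lambda>j. fst (y j)) \<longlonglongrightarrow> fst x" by (rule LIM_zero_cancel)
        then have "(\<lambda>j. (fst (y j), ?d)) \<longlonglongrightarrow> (fst x, ?d)" by (intro tendsto_Pair tendsto_const)
        then have "(\<lambda>j. ennreal (g (fst (y j), ?d))) \<longlonglongrightarrow> ennreal (g (fst x, ?d))"
          by (intro tendsto_ennrealI continuous_on_tendsto_compose[OF g]) auto
        then have "(\<lambda>j. h (y j)) \<longlonglongrightarrow> h x" by (simp only: h_def d)
        then have "h x \<le> r" using y(2) by (intro tendsto_upperbound[where f = "\<lambda>j. h (y j)"]) (auto intro: always_eventually less_imp_le)
        then show False using r(2) leD by blast
      qed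
    qed
  qed (simp add: \<mu> \<nu>)
  moreover have "(\<integral>\<^sup>+y. h y \<partial>\<mu>) = (\<integral>\<^sup>+y. ennreal (g y) \<partial>\<mu>)"
    using tr(1) by (intro nn_integral_cong_AE) (auto simp: h_def elim!: eventually_mono)
  moreover have "(\<integral>\<^sup>+y. h y \<partial>\<nu> i) = (\<integral>\<^sup>+y. ennreal (g y) \<partial>\<nu> i)" for i
    using tr(2)[of i] by (intro nn_integral_cong_AE) (auto simp: h_def elim!: eventually_mono)
  ultimately show ?thesis by simp
qed

lemma eventually_gt_liminf:
  fixes x :: "nat \<Rightarrow> real"
  assumes "ennreal a \<le> liminf (\<lambda>i. ennreal (x i))" "0 \<le> a" "\<And>i. 0 \<le> x i" "0 < e"
  shows "\<forall>\<^sub>F i in sequentially. a - e < x i"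
proof (cases "a - e < 0")
  case True
  then show ?thesis using assms(3) by (intro always_eventually allI) (meson less_le_trans)
next
  case False
  then have "ennreal (a - e) < ennreal a" using assms by (intro ennreal_lessI) auto
  then have "ennreal (a - e) < liminf (\<lambda>i. ennreal (x i))" using assms(1) by (rule less_le_trans)
  then have "\<forall>\<^sub>F i in sequentially. ennreal (a - e) < ennreal (x i)" by (rule less_LiminfD)
  then show ?thesis by (rule eventually_mono) (use False in \<open>simp add: ennreal_less_iff\<close>)
qed

text \<open>Since all total masses are 1, lower bounds for the integrals of \<open>C + f\<close> and
  of \<open>C - f\<close> bound the integral of \<open>f\<close> from both sides. This turns
  one-sided bounds for events into convergence.\<close>

lemma tendsto_integral_from_cells:
  fixes \<mu> :: "(real \<times> (int \<Rightarrow> nat)) measure" and f :: "real \<times> (int \<Rightarrow> nat) \<Rightarrow> real"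
  assumes \<mu>: "prob_space \<mu>" "sets \<mu> = sets borel"
    and \<nu>: "\<And>i. prob_space (\<nu> i)" "\<And>i. sets (\<nu> i) = sets borel"
    and tr: "AE y in \<mu>. trunc k (snd y) = snd y" "\<And>i. AE y in \<nu> i. trunc k (snd y) = snd y"
    and noatom: "\<And>b. emeasure \<mu> ({b} \<times> UNIV) = 0"
    and low: "\<And>b1 b2 d. b1 < b2 \<Longrightarrow> trunc k d = d \<Longrightarrow>
      emeasure \<mu> ({b1<..<b2} \<times> {d}) \<le> liminf (\<lambda>i. emeasure (\<nu> i) ({b1<..<b2} \<times> {d}))"
    and f: "continuous_on UNIV f" "bounded (range f)"
  shows "(\<lambda>i. integral\<^sup>L (\<nu> i) f) \<longlonglongrightarrow> integral\<^sup>L \<mu> f"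
proof -
  have main: "(\<integral>\<^sup>+y. ennreal (g y) \<partial>\<mu>) \<le> liminf (\<lambda>i. \<integral>\<^sup>+y. ennreal (g y) \<partial>\<nu> i)" if "continuous_on UNIV g" for g
    by (rule nn_integral_le_liminf_windows[OF \<mu>(2) \<nu>(2) tr noatom _ that]) (rule low)
  obtain C where C: "\<And>y. \<bar>f y\<bar> \<le> C" using f(2) by (auto simp: bounded_iff)
  have fm: "f \<in> borel_measurable borel" by (rule borel_measurable_continuous_onI[OF f(1)])
  have int: "integrable M f \<and> (\<integral>\<^sup>+y. ennreal (C + f y) \<partial>M) = ennreal (C + integral\<^sup>L M f) \<and>
     (\<integral>\<^sup>+y. ennreal (C - f y) \<partial>M) = ennreal (C - integral\<^sup>L M f)"
    if M: "prob_space M" "sets M = sets borel" for M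
  proof -
    interpret prob_space M by fact
    have "f \<in> borel_measurable M" using fm M(2) by (simp cong: measurable_cong_sets)
    then have i: "integrable M f" using C by (intro integrable_const_bound[of _ C]) auto
    have "0 \<le> C + f y" "0 \<le> C - f y" for y using C[of y] by linarith+
    then show ?thesis
      using i by (subst (1 2) nn_integral_eq_integral) (auto simp: prob_space)
  qed
  let ?a = "integral\<^sup>L \<mu> f" and ?x = "\<lambda>i. integral\<^sup>L (\<nu> i) f"
  have abs: "\<bar>integral\<^sup>L M f\<bar> \<le> C" if M: "prob_space M" "sets M = sets borel" for M
  proof -
    interpret prob_space M by fact
    have "\<bar>integral\<^sup>L M f\<bar> \<le> (\<integral>y. \<bar>f y\<bar> \<partial>M)" by (rule integral_abs_bound)
    also have "\<dots> \<le> (\<integral>y. C \<partial>M)" using int[OF M] C by (intro integral_mono) auto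
    finally show ?thesis by (simp add: prob_space)
  qed
  have g1: "continuous_on UNIV (\<lambda>y. C + f y)" "\<And>y. 0 \<le> C + f y"
    and g2: "continuous_on UNIV (\<lambda>y. C - f y)" "\<And>y. 0 \<le> C - f y"
  proof -
    show "0 \<le> C + f y" "0 \<le> C - f y" for y using C[of y] by linarith+
  qed (intro continuous_intros f)+
  have 1: "ennreal (C + ?a) \<le> liminf (\<lambda>i. ennreal (C + ?x i))"
    using main[OF g1(1)] int[OF \<mu>] int[OF \<nu>] by simp
  have 2: "ennreal (C - ?a) \<le> liminf (\<lambda>i. ennreal (C - ?x i))"
    using main[OF g2(1)] int[OF \<mu>] int[OF \<nu>] by simp
  have nn: "0 \<le> C + ?a" "0 \<le> C - ?a" "0 \<le> C + ?x i" "0 \<le> C - ?x i" for i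
    using abs[OF \<mu>] abs[OF \<nu>, of i] by linarith+
  show ?thesis
  proof (rule LIMSEQ_I)
    fix e :: real assume e: "0 < e"
    have "\<forall>\<^sub>F i in sequentially. norm (?x i - ?a) < e"
      using eventually_gt_liminf[OF 1 nn(1) nn(3) e] eventually_gt_liminf[OF 2 nn(2) nn(4) e] by eventually_elim auto
    then show "\<exists>no. \<forall>n\<ge>no. norm (?x n - ?a) < e" by (simp add: eventually_sequentially)
  qed
qed

text \<open>The digits are embedded into the reals so that distances to closed sets are at hand. The
  map back, by the floor, is merely measurable, which is enough to recover a measure from its
  image.\<close>

lemma weak_limit_unique:
  fixes M N :: "(real \<times> (int \<Rightarrow> nat)) measure"
  assumes M: "prob_space M" "sets M = sets borel" and N: "prob_space N" "sets N = sets borel"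
    and eq: "\<And>f :: real \<times> (int \<Rightarrow> nat) \<Rightarrow> real. continuous_on UNIV f \<Longrightarrow> bounded (range f) \<Longrightarrow> integral\<^sup>L M f = integral\<^sup>L N f"
  shows "M = N"
proof -
  define emb :: "real \<times> (int \<Rightarrow> nat) \<Rightarrow> real \<times> (int \<Rightarrow> real)" where "emb y = (fst y, \<lambda>i. real (snd y i))" for y
  define inv :: "real \<times> (int \<Rightarrow> real) \<Rightarrow> real \<times> (int \<Rightarrow> nat)" where "inv y = (fst y, \<lambda>i. nat \<lfloor>snd y i\<rfloor>)" for y
  have coord: "continuous_on UNIV (\<lambda>y :: real \<times> (int \<Rightarrow> nat). snd y i)" for i
    by (rule continuous_on_compose2[OF continuous_on_product_coordinates[of i] continuous_on_snd[OF continuous_on_id]]) simp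
  have coord': "continuous_on UNIV (\<lambda>y :: real \<times> (int \<Rightarrow> real). snd y i)" for i
    by (rule continuous_on_compose2[OF continuous_on_product_coordinates[of i] continuous_on_snd[OF continuous_on_id]]) simp
  have cemb: "continuous_on UNIV emb"
    unfolding emb_def
    by (intro continuous_on_Pair continuous_on_fst continuous_on_id continuous_on_coordinatewise_then_product)
      (rule continuous_on_compose2[OF _ coord, of UNIV real], simp_all)
  have memb: "emb \<in> borel_measurable borel" by (rule borel_measurable_continuous_onI[OF cemb])
  have minv: "inv \<in> borel_measurable borel"
    unfolding inv_def
  proof (intro borel_measurable_Pair measurable_coordinatewise_then_product)
    show "fst \<in> borel_measurable (borel :: (real \<times> (int \<Rightarrow> real)) measure)"
      by (intro borel_measurable_continuous_onI continuous_intros)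
    fix i
    have "(\<lambda>y :: real \<times> (int \<Rightarrow> real). snd y i) \<in> borel_measurable borel"
      by (rule borel_measurable_continuous_onI[OF coord'])
    then have "(\<lambda>y :: real \<times> (int \<Rightarrow> real). nat \<lfloor>snd y i\<rfloor>) \<in> measurable borel (count_space UNIV)" by measurable
    then show "(\<lambda>y :: real \<times> (int \<Rightarrow> real). nat \<lfloor>snd y i\<rfloor>) \<in> borel_measurable borel"
      by (simp add: measurable_count_space_eq2_countable measurable_def)
  qed
  have id: "distr (distr L borel emb) borel inv = L" if "sets L = sets borel" for L
  proof -
    have "emb \<in> measurable L borel" using memb that by (simp cong: measurable_cong_sets)
    then have "distr (distr L borel emb) borel inv = distr L borel (inv \<circ> emb)"
      using minv by (intro distr_distr)
    also have "inv \<circ> emb = (\<lambda>y. y)" by (auto simp: inv_def emb_def)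
    also have "distr L borel (\<lambda>y. y) = L" using that by (rule distr_id2[OF sym])
    finally show ?thesis .
  qed
  have "distr M borel emb = distr N borel emb"
  proof (rule measure_eqI_bounded_continuous)
    show "prob_space (distr M borel emb)" "prob_space (distr N borel emb)"
      using M N memb by (auto intro!: prob_space.prob_space_distr cong: measurable_cong_sets)
    fix f :: "real \<times> (int \<Rightarrow> real) \<Rightarrow> real"
    assume f: "continuous_on UNIV f" "bounded (range f)"
    have fm: "f \<in> borel_measurable borel" by (rule borel_measurable_continuous_onI[OF f(1)])
    have "integral\<^sup>L M (\<lambda>y. f (emb y)) = integral\<^sup>L N (\<lambda>y. f (emb y))"
    proof (rule eq)
      show "continuous_on UNIV (\<lambda>y. f (emb y))" by (rule continuous_on_compose2[OF f(1) cemb]) simp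
      show "bounded (range (\<lambda>y. f (emb y)))" by (rule bounded_subset[OF f(2)]) auto
    qed
    then show "integral\<^sup>L (distr M borel emb) f = integral\<^sup>L (distr N borel emb) f"
      using M N memb fm by (subst (1 2) integral_distr) (auto cong: measurable_cong_sets)
  qed auto
  then show ?thesis using id[OF M(2)] id[OF N(2)] by metis
qed

section \<open>The limiting distribution\<close>

text \<open>A state \<open>(a, b, z)\<close> is a limit of \<open>(q\<^sub>s\<^sub>-\<^sub>1 / R, q\<^sub>s / R, x\<^sub>s)\<close>, where \<open>x\<^sub>s\<close> is the tail of the expansion after
  \<open>s\<close> digits: the cylinder of the first \<open>s\<close> digits has density \<open>1 / (q\<^sub>s + q\<^sub>s\<^sub>-\<^sub>1 z)\<^sup>2\<close> at tail \<open>z\<close>, and each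
  parity of \<open>s\<close> contributes \<open>\<theta>\<close> states per unit area. The digits up to \<open>h\<^sub>s\<close> are read off backwards
  from \<open>q\<^sub>s\<^sub>-\<^sub>1 / q\<^sub>s = [h\<^sub>s, \<dots>, h\<^sub>1]\<close>.\<close>

definition state_space :: "(real \<times> real \<times> real) set"
  where "state_space = {(a, b, z). 0 < a \<and> a < 1 \<and> 1 < b \<and> 0 < z \<and> z < 1}"

definition state_density :: "real \<times> real \<times> real \<Rightarrow> real"
  where "state_density x = 2 * \<theta> / (fst (snd x) + fst x * snd (snd x)) ^ 2"

definition state_measure :: "(real \<times> real \<times> real) measure"
  where "state_measure = density lborel (\<lambda>x. indicator state_space x * ennreal (state_density x))"

lemma state_space_open: "open state_space"
proof -
  have "state_space = {x. 0 < fst x} \<inter> {x. fst x < 1} \<inter> {x. 1 < fst (snd x)} \<inter> {x. 0 < snd (snd x)} \<inter> {x. snd (snd x) < 1}"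
    by (auto simp: state_space_def)
  also have "open \<dots>" by (intro open_Int open_Collect_less continuous_intros)
  finally show ?thesis .
qed

lemma state_density_measurable [measurable]: "state_density \<in> borel_measurable borel"
  unfolding state_density_def
  by (intro borel_measurable_divide borel_measurable_const borel_measurable_continuous_onI continuous_intros)

text \<open>The alternating sum of the inverse squares in pairs: the full sum minus twice its even
  part, which is a quarter of the full sum.\<close>

lemma pi_squared_twelfth: "(\<lambda>j. 1 / real (2 * j + 1) ^ 2 - 1 / real (2 * j + 2) ^ 2) sums (pi\<^sup>2 / 12)"
proof -
  have s: "(\<lambda>n. 1 / real (Suc n) ^ 2) sums (pi\<^sup>2 / 6)" using inverse_squares_sums by simp
  have "(\<lambda>n. \<Sum>i\<in>{n * 2..<n * 2 + 2}. 1 / real (Suc i) ^ 2) sums (pi\<^sup>2 / 6)"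
    by (rule sums_group[OF s]) simp
  moreover have "(\<lambda>n. 1 / 2 * (1 / real (Suc n) ^ 2)) sums (1 / 2 * (pi\<^sup>2 / 6))" by (rule sums_mult[OF s])
  ultimately have "(\<lambda>n. (\<Sum>i\<in>{n * 2..<n * 2 + 2}. 1 / real (Suc i) ^ 2) - 1 / 2 * (1 / real (Suc n) ^ 2)) sums (pi\<^sup>2 / 6 - 1 / 2 * (pi\<^sup>2 / 6))"
    by (rule sums_diff)
  moreover have "(\<Sum>i\<in>{n * 2..<n * 2 + 2}. 1 / real (Suc i) ^ 2) - 1 / 2 * (1 / real (Suc n) ^ 2)
     = 1 / real (2 * n + 1) ^ 2 - 1 / real (2 * n + 2) ^ 2" for n
  proof -
    have "{n * 2..<n * 2 + 2} = {2 * n, 2 * n + 1}" by auto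
    then have "(\<Sum>i\<in>{n * 2..<n * 2 + 2}. 1 / real (Suc i) ^ 2) = 1 / real (2 * n + 1) ^ 2 + 1 / real (2 * n + 2) ^ 2" by simp
    moreover have "1 / real (2 * n + 2) ^ 2 = 1 / 4 * (1 / real (Suc n) ^ 2)"
    proof -
      have "real (2 * n + 2) = 2 * real (Suc n)" by simp
      then show ?thesis by (simp only: power_mult_distrib) simp
    qed
    ultimately show ?thesis by linarith
  qed
  ultimately show ?thesis by simp
qed

text \<open>The alternating geometric series in pairs, so that all terms are nonnegative and sum and
  integral may be exchanged.\<close>

lemma geometric_pairs:
  fixes y :: real assumes "0 \<le> y" "y < 1"
  shows "(\<Sum>j. ennreal (y ^ (2 * j) * (1 - y))) = ennreal (1 / (1 + y))"
proof -
  have y2: "y ^ 2 < 1" using assms by (simp add: power_less_one_iff abs_square_less_1)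
  have "(\<lambda>j. (y ^ 2) ^ j * (1 - y)) sums (1 / (1 - y ^ 2) * (1 - y))"
    by (intro sums_mult2 geometric_sums) (use assms y2 in auto)
  moreover have "1 / (1 - y ^ 2) * (1 - y) = 1 / (1 + y)"
  proof -
    have "1 - y ^ 2 = (1 - y) * (1 + y)" by (simp add: power2_eq_square algebra_simps)
    then show ?thesis using assms by simp
  qed
  ultimately have "(\<lambda>j. y ^ (2 * j) * (1 - y)) sums (1 / (1 + y))" by (simp add: power_mult)
  then show ?thesis using assms
    by (subst suminf_ennreal2) (auto simp: sums_iff)
qed

lemma nn_integral_power_diff:
  fixes c :: real and n :: nat
  assumes "0 \<le> c" "c \<le> d" 
  shows "(\<integral>\<^sup>+z. ennreal (d * z ^ n - c * z ^ Suc n) * indicator {0..1} z \<partial>lborel)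
    = ennreal (d / real (Suc n) - c / real (Suc (Suc n)))"
proof -
  define F where "F z = d * z ^ Suc n / real (Suc n) - c * z ^ Suc (Suc n) / real (Suc (Suc n))" for z
  have "(\<integral>\<^sup>+z. ennreal (d * z ^ n - c * z ^ Suc n) * indicator {0..1} z \<partial>lborel) = F 1 - F 0"
  proof (rule nn_integral_FTC_Icc)
    show "(\<lambda>z. d * z ^ n - c * z ^ Suc n) \<in> borel_measurable borel" by measurable
    fix z :: real assume z: "z \<in> {0..1}"
    show "(F has_real_derivative d * z ^ n - c * z ^ Suc n) (at z)"
      unfolding F_def by (auto intro!: derivative_eq_intros simp del: power_Suc of_nat_Suc)
    have "c * z ^ Suc n \<le> d * z ^ n"
      using assms z by (intro mult_mono power_decreasing) auto
    then show "0 \<le> d * z ^ n - c * z ^ Suc n" by simp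
  qed simp
  then show ?thesis by (simp add: F_def)
qed

text \<open>Integrating \<open>b\<close> from 1 to infinity leaves
  \<open>2 * \<theta> / (1 + a * z)\<close> on the unit square, and the integral of
  \<open>1 / (1 + a * z)\<close> is the alternating sum of the inverse squares, so the mass is
  \<open>2 * \<theta> * (pi^2 / 12) = 1\<close>. That it is exactly 1 lets lower bounds for events
  determine the limit.\<close>

lemma state_measure_prob: "prob_space state_measure"
proof
  let ?I = "indicator {0<..<1} :: real \<Rightarrow> ennreal" and ?J = "indicator {0..1} :: real \<Rightarrow> ennreal"
  let ?f = "\<lambda>x. indicator state_space x * ennreal (state_density x)"
  have fm[measurable]: "?f \<in> borel_measurable borel"
    using state_space_open by (intro borel_measurable_times_ennreal borel_measurable_indicator) auto
  have sp: "space state_measure = UNIV" by (simp add: state_measure_def)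
  have "emeasure state_measure (space state_measure) = (\<integral>\<^sup>+x. ?f x \<partial>lborel)"
    unfolding sp unfolding state_measure_def by (subst emeasure_density) auto
  also have "\<dots> = (\<integral>\<^sup>+x. ?f x \<partial>(lborel \<Otimes>\<^sub>M lborel))" by (simp only: lborel_prod)
  also have "\<dots> = (\<integral>\<^sup>+a. \<integral>\<^sup>+y. ?f (a, y) \<partial>lborel \<partial>lborel)"
    by (rule lborel.nn_integral_fst[symmetric]) (simp add: lborel_prod)
  also have "\<dots> = (\<integral>\<^sup>+a. \<integral>\<^sup>+z. \<integral>\<^sup>+b. ?f (a, b, z) \<partial>lborel \<partial>lborel \<partial>lborel)"
  proof (rule nn_integral_cong)
    fix a :: real
    have "(\<lambda>y. ?f (a, y)) \<in> borel_measurable borel"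
      by (rule measurable_compose[OF _ fm]) (intro borel_measurable_continuous_onI continuous_intros)
    then have "(\<lambda>y. ?f (a, y)) \<in> borel_measurable (lborel \<Otimes>\<^sub>M lborel)" by (simp add: lborel_prod)
    from lborel_pair.nn_integral_snd[OF this] show "(\<integral>\<^sup>+y. ?f (a, y) \<partial>lborel) = (\<integral>\<^sup>+z. \<integral>\<^sup>+b. ?f (a, b, z) \<partial>lborel \<partial>lborel)"
      by (simp add: lborel_prod)
  qed
  also have "\<dots> = (\<integral>\<^sup>+a. \<integral>\<^sup>+z. ?I a * ?I z * ennreal (2 * \<theta> / (1 + a * z)) \<partial>lborel \<partial>lborel)"
  proof (intro nn_integral_cong)
    fix a z :: real
    show "(\<integral>\<^sup>+b. ?f (a, b, z) \<partial>lborel) = ?I a * ?I z * ennreal (2 * \<theta> / (1 + a * z))"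
    proof (cases "0 < a \<and> a < 1 \<and> 0 < z \<and> z < 1")
      case True
      then have az: "0 < a * z" by simp
      have "(\<integral>\<^sup>+b. ?f (a, b, z) \<partial>lborel) = (\<integral>\<^sup>+b. ennreal (2 * \<theta> / (b + a * z) ^ 2) * indicator {1..} b \<partial>lborel)"
        using AE_lborel_singleton[of "1::real"] True
        by (intro nn_integral_cong_AE) (auto simp: state_space_def state_density_def indicator_def elim!: eventually_mono)
      also have "\<dots> = ennreal (0 - (- 2 * \<theta> / (1 + a * z)))"
      proof (rule nn_integral_FTC_atLeast)
        show "(\<lambda>b. 2 * \<theta> / (b + a * z) ^ 2) \<in> borel_measurable borel" by measurable
        fix b :: real assume b: "1 \<le> b"
        then have "b + a * z \<noteq> 0" using az by linarith
        then show "((\<lambda>b. - 2 * \<theta> / (b + a * z)) has_real_derivative 2 * \<theta> / (b + a * z) ^ 2) (at b)"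
          by (auto intro!: derivative_eq_intros simp: power2_eq_square)
        show "0 \<le> 2 * \<theta> / (b + a * z) ^ 2" using theta_pos by simp
      next
        have "filterlim (\<lambda>b. a * z + b) at_top at_top" by (rule filterlim_tendsto_add_at_top[OF tendsto_const filterlim_ident])
        then have "filterlim (\<lambda>b. b + a * z) at_top at_top" by (simp add: add.commute)
        then show "((\<lambda>b. - 2 * \<theta> / (b + a * z)) \<longlongrightarrow> 0) at_top"
          by (intro tendsto_divide_0[OF tendsto_const] filterlim_at_top_imp_at_infinity)
      qed
      finally show ?thesis using True by simp
    qed (auto simp: state_space_def indicator_def)
  qed
  also have "\<dots> = (\<integral>\<^sup>+a. \<integral>\<^sup>+z. (\<Sum>j. ennreal (2 * \<theta>) * (?J a * (ennreal (a ^ (2 * j) * z ^ (2 * j) - a ^ Suc (2 * j) * z ^ Suc (2 * j)) * ?J z))) \<partial>lborel \<partial>lborel)"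
  proof (rule nn_integral_cong_AE)
    show "AE a in lborel. (\<integral>\<^sup>+z. ?I a * ?I z * ennreal (2 * \<theta> / (1 + a * z)) \<partial>lborel) = (\<integral>\<^sup>+z. (\<Sum>j. ennreal (2 * \<theta>) * (?J a * (ennreal (a ^ (2 * j) * z ^ (2 * j) - a ^ Suc (2 * j) * z ^ Suc (2 * j)) * ?J z))) \<partial>lborel)"
      using AE_lborel_singleton[of "0::real"] AE_lborel_singleton[of "1::real"]
    proof eventually_elim
      case (elim a)
      show ?case
      proof (rule nn_integral_cong_AE)
        show "AE z in lborel. ?I a * ?I z * ennreal (2 * \<theta> / (1 + a * z)) = (\<Sum>j. ennreal (2 * \<theta>) * (?J a * (ennreal (a ^ (2 * j) * z ^ (2 * j) - a ^ Suc (2 * j) * z ^ Suc (2 * j)) * ?J z)))"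
          using AE_lborel_singleton[of "0::real"] AE_lborel_singleton[of "1::real"]
        proof eventually_elim
          case (elim z)
          show ?case
          proof (cases "0 < a \<and> a < 1 \<and> 0 < z \<and> z < 1")
            case True
            then have "a * z < 1 * 1" by (intro mult_strict_mono) auto
            then have "(\<Sum>j. ennreal ((a * z) ^ (2 * j) * (1 - a * z))) = ennreal (1 / (1 + a * z))"
              using True by (intro geometric_pairs) auto
            then have "(\<Sum>j. ennreal (2 * \<theta>) * ennreal ((a * z) ^ (2 * j) * (1 - a * z))) = ennreal (2 * \<theta>) * ennreal (1 / (1 + a * z))"
              by simp
            also have "\<dots> = ennreal (2 * \<theta> / (1 + a * z))" using theta_pos True by (simp add: ennreal_mult[symmetric])
            finally have G: "(\<Sum>j. ennreal (2 * \<theta>) * ennreal ((a * z) ^ (2 * j) * (1 - a * z))) = ennreal (2 * \<theta> / (1 + a * z))" .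
            have P: "(a * z) ^ (2 * j) * (1 - a * z) = a ^ (2 * j) * z ^ (2 * j) - a ^ Suc (2 * j) * z ^ Suc (2 * j)" for j
              by (simp add: power_mult_distrib algebra_simps)
            have "?I a * ?I z * ennreal (2 * \<theta> / (1 + a * z)) = ennreal (2 * \<theta> / (1 + a * z))" using True by simp
            also have "\<dots> = (\<Sum>j. ennreal (2 * \<theta>) * ennreal ((a * z) ^ (2 * j) * (1 - a * z)))" by (rule G[symmetric])
            also have "\<dots> = (\<Sum>j. ennreal (2 * \<theta>) * (?J a * (ennreal (a ^ (2 * j) * z ^ (2 * j) - a ^ Suc (2 * j) * z ^ Suc (2 * j)) * ?J z)))"
            proof (rule suminf_cong)
              have J: "?J a = 1" "?J z = 1" using True by auto
              fix j
              show "ennreal (2 * \<theta>) * ennreal ((a * z) ^ (2 * j) * (1 - a * z)) = ennreal (2 * \<theta>) * (?J a * (ennreal (a ^ (2 * j) * z ^ (2 * j) - a ^ Suc (2 * j) * z ^ Suc (2 * j)) * ?J z))"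
                by (simp only: P J mult_1 mult_1_right)
            qed
            finally show ?thesis .
          next
            case False
            then have 1: "?I a * ?I z = 0" by (auto simp: indicator_def)
            have "a \<notin> {0..1} \<or> z \<notin> {0..1}" using False elim \<open>a \<noteq> 0\<close> \<open>a \<noteq> 1\<close> by auto
            then have 2: "?J a = 0 \<or> ?J z = 0" by auto
            have "ennreal (2 * \<theta>) * (?J a * (X * ?J z)) = 0" for X using 2 by auto
            then show ?thesis by (simp only: 1 mult_zero_left suminf_zero)
          qed
        qed
      qed
    qed
  qed
  also have "\<dots> = (\<Sum>j. \<integral>\<^sup>+a. \<integral>\<^sup>+z. ennreal (2 * \<theta>) * (?J a * (ennreal (a ^ (2 * j) * z ^ (2 * j) - a ^ Suc (2 * j) * z ^ Suc (2 * j)) * ?J z)) \<partial>lborel \<partial>lborel)"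
    by (subst nn_integral_suminf, measurable, subst nn_integral_suminf, measurable)
  also have "\<dots> = (\<Sum>j. ennreal (2 * \<theta>) * ennreal (1 / real (2 * j + 1) ^ 2 - 1 / real (2 * j + 2) ^ 2))"
  proof (rule suminf_cong)
    fix j
    have "(\<integral>\<^sup>+a. \<integral>\<^sup>+z. ennreal (2 * \<theta>) * (?J a * (ennreal (a ^ (2 * j) * z ^ (2 * j) - a ^ Suc (2 * j) * z ^ Suc (2 * j)) * ?J z)) \<partial>lborel \<partial>lborel)
      = (\<integral>\<^sup>+a. ennreal (2 * \<theta>) * (ennreal (1 / real (Suc (2 * j)) * a ^ (2 * j) - 1 / real (Suc (Suc (2 * j))) * a ^ Suc (2 * j)) * ?J a) \<partial>lborel)"
    proof (rule nn_integral_cong)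
      fix a :: real
      have "(\<integral>\<^sup>+z. ennreal (2 * \<theta>) * (?J a * (ennreal (a ^ (2 * j) * z ^ (2 * j) - a ^ Suc (2 * j) * z ^ Suc (2 * j)) * ?J z)) \<partial>lborel)
        = ennreal (2 * \<theta>) * (?J a * (\<integral>\<^sup>+z. ennreal (a ^ (2 * j) * z ^ (2 * j) - a ^ Suc (2 * j) * z ^ Suc (2 * j)) * ?J z \<partial>lborel))"
        by (simp add: nn_integral_cmult)
      also have "\<dots> = ennreal (2 * \<theta>) * (ennreal (1 / real (Suc (2 * j)) * a ^ (2 * j) - 1 / real (Suc (Suc (2 * j))) * a ^ Suc (2 * j)) * ?J a)"
      proof (cases "a \<in> {0..1}")
        case True
        then have "(\<integral>\<^sup>+z. ennreal (a ^ (2 * j) * z ^ (2 * j) - a ^ Suc (2 * j) * z ^ Suc (2 * j)) * ?J z \<partial>lborel)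
           = ennreal (a ^ (2 * j) / real (Suc (2 * j)) - a ^ Suc (2 * j) / real (Suc (Suc (2 * j))))"
          by (intro nn_integral_power_diff power_decreasing zero_le_power) auto
        then show ?thesis using True by (simp add: mult.commute)
      qed simp
      finally show "(\<integral>\<^sup>+z. ennreal (2 * \<theta>) * (?J a * (ennreal (a ^ (2 * j) * z ^ (2 * j) - a ^ Suc (2 * j) * z ^ Suc (2 * j)) * ?J z)) \<partial>lborel)
        = ennreal (2 * \<theta>) * (ennreal (1 / real (Suc (2 * j)) * a ^ (2 * j) - 1 / real (Suc (Suc (2 * j))) * a ^ Suc (2 * j)) * ?J a)" .
    qed
    also have "\<dots> = ennreal (2 * \<theta>) * (\<integral>\<^sup>+a. ennreal (1 / real (Suc (2 * j)) * a ^ (2 * j) - 1 / real (Suc (Suc (2 * j))) * a ^ Suc (2 * j)) * ?J a \<partial>lborel)"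
      by (rule nn_integral_cmult) measurable
    also have "(\<integral>\<^sup>+a. ennreal (1 / real (Suc (2 * j)) * a ^ (2 * j) - 1 / real (Suc (Suc (2 * j))) * a ^ Suc (2 * j)) * ?J a \<partial>lborel)
      = ennreal (1 / real (Suc (2 * j)) / real (Suc (2 * j)) - 1 / real (Suc (Suc (2 * j))) / real (Suc (Suc (2 * j))))"
      by (rule nn_integral_power_diff) (auto intro!: divide_left_mono)
    also have "\<dots> = ennreal (1 / real (2 * j + 1) ^ 2 - 1 / real (2 * j + 2) ^ 2)"
      by (simp add: power2_eq_square)
    finally show "(\<integral>\<^sup>+a. \<integral>\<^sup>+z. ennreal (2 * \<theta>) * (?J a * (ennreal (a ^ (2 * j) * z ^ (2 * j) - a ^ Suc (2 * j) * z ^ Suc (2 * j)) * ?J z)) \<partial>lborel \<partial>lborel)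
      = ennreal (2 * \<theta>) * ennreal (1 / real (2 * j + 1) ^ 2 - 1 / real (2 * j + 2) ^ 2)" .
  qed
  also have "\<dots> = ennreal (2 * \<theta>) * ennreal (pi\<^sup>2 / 12)"
  proof -
    have "(\<Sum>j. ennreal (1 / real (2 * j + 1) ^ 2 - 1 / real (2 * j + 2) ^ 2)) = ennreal (pi\<^sup>2 / 12)"
      using pi_squared_twelfth by (intro suminf_ennreal_eq) (auto intro!: divide_left_mono power_mono)
    then show ?thesis by simp
  qed
  also have "\<dots> = 1"
    using theta_pos by (subst ennreal_mult[symmetric]) (auto simp: \<theta>_def)
  finally show "emeasure state_measure (space state_measure) = 1" .
qed

section \<open>Digits and windows as measurable functions of the state\<close>

lemma gauss_map_measurable [measurable]: "gauss_map \<in> borel_measurable borel"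
  unfolding gauss_map_def frac_def by measurable

lemma funpow_gauss_map_measurable [measurable]: "(gauss_map ^^ n) \<in> borel_measurable borel"
proof (induction n)
  case (Suc n)
  have "(\<lambda>x. gauss_map ((gauss_map ^^ n) x)) \<in> borel_measurable borel"
    by (rule measurable_compose[OF Suc.IH gauss_map_measurable])
  then show ?case by (simp add: comp_def)
qed simp

lemma cf_digit_measurable [measurable]: "(\<lambda>x. cf_digit x j) \<in> measurable borel (count_space UNIV)"
  by (cases j) simp_all

lemma cf_denom_measurable [measurable]: "(\<lambda>x. cf_denom x j) \<in> measurable borel (count_space UNIV)"
proof (induction j rule: induct_nat_012)
  case (ge2 n)
  then have [measurable]: "(\<lambda>x. cf_denom x n) \<in> measurable borel (count_space UNIV)"
    "(\<lambda>x. cf_denom x (Suc n)) \<in> measurable borel (count_space UNIV)" .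
  show ?case unfolding cf_denom.simps by measurable
qed (use cf_digit_measurable[of 1] in simp_all)

lemma irrational_funpow_gauss_map: "x \<notin> \<rat> \<Longrightarrow> (gauss_map ^^ n) x \<notin> \<rat>"
proof (induction n)
  case (Suc n)
  let ?y = "(gauss_map ^^ n) x"
  show ?case
  proof
    assume "(gauss_map ^^ Suc n) x \<in> \<rat>"
    then have "1 / ?y - of_int \<lfloor>1 / ?y\<rfloor> \<in> \<rat>" by (simp add: gauss_map_def frac_def)
    then have "(1 / ?y - of_int \<lfloor>1 / ?y\<rfloor>) + of_int \<lfloor>1 / ?y\<rfloor> \<in> \<rat>" by (intro Rats_add) auto
    then have "inverse (1 / ?y) \<in> \<rat>" by (intro Rats_inverse) simp
    then show False using Suc by simp
  qed
qed simp

lemma irrational_digit_pos: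
  assumes "x \<in> {0..<1}" "x \<notin> \<rat>" shows "0 < cf_digit x (Suc j)"
proof -
  let ?y = "(gauss_map ^^ j) x"
  have "?y \<in> {0..<1}" "?y \<notin> \<rat>" using assms funpow_gauss_map_unit irrational_funpow_gauss_map by blast+
  then have "0 < ?y" "?y < 1" by (auto simp: less_le)
  then have "1 \<le> 1 / ?y" by (simp add: le_divide_eq)
  then have "1 \<le> \<lfloor>1 / ?y\<rfloor>" by simp
  then show ?thesis by simp
qed

lemma irrational_in_cyl:
  assumes "x \<in> {0..<1}" "x \<notin> \<rat>" "0 \<notin> set g" "\<And>j. j < length g \<Longrightarrow> cf_digit x (Suc j) = g ! j"
  shows "x \<in> cf_cyl g"
proof -
  let ?y = "(gauss_map ^^ length g) x"
  have "?y \<in> {0..<1}" "?y \<notin> \<rat>" using assms funpow_gauss_map_unit irrational_funpow_gauss_map by blast+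
  then have "?y \<in> {0<..<1}" by (auto simp: less_le)
  moreover have "x = cf_val (rev g) ?y" by (rule cf_digits_imp_cf_val[OF assms(1,3,4)])
  ultimately show ?thesis unfolding cf_cyl_def by blast
qed

text \<open>Offset 0 belongs to the backward part, as \<open>h\<^sub>s\<close> is the first digit of
  \<open>q\<^sub>s\<^sub>-\<^sub>1 / q\<^sub>s\<close>; hence \<open>k + 1\<close> entries here and
  \<open>k\<close> in \<open>fwd_digits\<close>.\<close>

definition back_digits :: "nat \<Rightarrow> (int \<Rightarrow> nat) \<Rightarrow> nat list"
  where "back_digits k d = map (\<lambda>j. d (- int j)) [0..<Suc k]"

definition fwd_digits :: "nat \<Rightarrow> (int \<Rightarrow> nat) \<Rightarrow> nat list"
  where "fwd_digits k d = map (\<lambda>j. d (int j + 1)) [0..<k]"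

definition window_map :: "nat \<Rightarrow> real \<times> real \<times> real \<Rightarrow> real \<times> (int \<Rightarrow> nat)"
  where "window_map k x = (fst (snd x), \<lambda>i. if \<bar>i\<bar> \<le> int k then
     if i \<le> 0 then cf_digit (fst x / fst (snd x)) (nat (1 - i)) else cf_digit (snd (snd x)) (nat i) else 0)"

definition limit_measure :: "nat \<Rightarrow> (real \<times> (int \<Rightarrow> nat)) measure"
  where "limit_measure k = distr state_measure borel (window_map k)"

lemma measurable_nat_borel: "f \<in> measurable M (count_space UNIV) \<Longrightarrow> (f :: _ \<Rightarrow> nat) \<in> borel_measurable M"
  by (rule measurable_compose[of f M "count_space UNIV" "\<lambda>x. x" borel, simplified]) auto

lemma window_map_measurable: "window_map k \<in> borel_measurable borel"
  unfolding window_map_def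
proof (intro borel_measurable_Pair measurable_coordinatewise_then_product)
  have c: "(\<lambda>x :: real \<times> real \<times> real. fst (snd x)) \<in> borel_measurable borel" "(\<lambda>x :: real \<times> real \<times> real. fst x) \<in> borel_measurable borel"
    "(\<lambda>x :: real \<times> real \<times> real. snd (snd x)) \<in> borel_measurable borel"
    by (intro borel_measurable_continuous_onI continuous_intros)+
  then show "(\<lambda>x :: real \<times> real \<times> real. fst (snd x)) \<in> borel_measurable borel" by simp
  fix i :: int
  have "(\<lambda>x :: real \<times> real \<times> real. cf_digit (fst x / fst (snd x)) (nat (1 - i))) \<in> borel_measurable borel"
    by (intro measurable_nat_borel measurable_compose[OF borel_measurable_divide[OF c(2,1)] cf_digit_measurable])
  moreover have "(\<lambda>x :: real \<times> real \<times> real. cf_digit (snd (snd x)) (nat i)) \<in> borel_measurable borel"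
    by (intro measurable_nat_borel measurable_compose[OF c(3) cf_digit_measurable])
  ultimately show "(\<lambda>x :: real \<times> real \<times> real. if \<bar>i\<bar> \<le> int k then
     if i \<le> 0 then cf_digit (fst x / fst (snd x)) (nat (1 - i)) else cf_digit (snd (snd x)) (nat i) else 0) \<in> borel_measurable borel"
    by (cases "\<bar>i\<bar> \<le> int k"; cases "i \<le> 0") simp_all
qed

lemma sets_state_measure [simp]: "sets state_measure = sets borel" "space state_measure = UNIV"
  by (simp_all add: state_measure_def)

lemma window_map_measurable' [measurable]: "window_map k \<in> measurable state_measure borel"
  using window_map_measurable by (simp cong: measurable_cong_sets)

lemma limit_measure_prob: "prob_space (limit_measure k)" "sets (limit_measure k) = sets borel"
  unfolding limit_measure_def using state_measure_prob by (auto intro: prob_space.prob_space_distr)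

text \<open>If \<open>a / b\<close> or \<open>z\<close> is rational, the state lies on one of
  countably many hyperplanes. Off them both expansions are infinite, so every recorded digit is
  positive.\<close>

lemma AE_state_irrational:
  "AE x in state_measure. x \<in> state_space \<and> fst x / fst (snd x) \<notin> \<rat> \<and> snd (snd x) \<notin> \<rat>"
proof -
  have null: "{x :: real \<times> real \<times> real. inner a x = r} \<in> null_sets lborel" if "a \<noteq> 0" for a r
  proof -
    have "negligible {x :: real \<times> real \<times> real. inner a x = r}" using that by (intro negligible_hyperplane) auto
    moreover have "{x :: real \<times> real \<times> real. inner a x = r} \<in> sets lborel"
      unfolding sets_lborel by (intro borel_closed closed_hyperplane)
    ultimately show ?thesis by (simp add: negligible_iff_null_sets null_sets_completion_iff)
  qed
  have "(\<Union>r\<in>\<rat>. {x :: real \<times> real \<times> real. inner (1, - r, 0) x = 0} \<union> {x. inner (0, 0, 1) x = r}) \<in> null_sets lborel"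
    by (intro null_sets_UN' countable_rat null_sets.Un null) (auto simp: zero_prod_def)
  then have "AE x in lborel. x \<notin> (\<Union>r\<in>\<rat>. {x :: real \<times> real \<times> real. inner (1, - r, 0) x = 0} \<union> {x. inner (0, 0, 1) x = r})"
    by (rule AE_not_in)
  then have "AE x in lborel. 0 < indicator state_space x * ennreal (state_density x) \<longrightarrow>
     x \<in> state_space \<and> fst x / fst (snd x) \<notin> \<rat> \<and> snd (snd x) \<notin> \<rat>"
  proof (rule eventually_mono, intro impI)
    fix x :: "real \<times> real \<times> real"
    assume x: "x \<notin> (\<Union>r\<in>\<rat>. {x. inner (1, - r, 0) x = 0} \<union> {x. inner (0, 0, 1) x = r})"
      and "0 < indicator state_space x * ennreal (state_density x)"
    then have s: "x \<in> state_space" by (cases "x \<in> state_space") auto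
    moreover have "fst x / fst (snd x) \<notin> \<rat>"
    proof
      assume r: "fst x / fst (snd x) \<in> \<rat>"
      have "1 < fst (snd x)" using s by (auto simp: state_space_def)
      then have "inner (1, - (fst x / fst (snd x)), 0) x = 0" by (cases x) simp
      then show False using x r by blast
    qed
    moreover have "snd (snd x) \<notin> \<rat>"
    proof
      assume r: "snd (snd x) \<in> \<rat>"
      have "inner (0, 0, 1) x = snd (snd x)" by (cases x) simp
      then show False using x r by blast
    qed
    ultimately show "x \<in> state_space \<and> fst x / fst (snd x) \<notin> \<rat> \<and> snd (snd x) \<notin> \<rat>" by blast
  qed
  moreover have "(\<lambda>x. indicator state_space x * ennreal (state_density x)) \<in> borel_measurable borel"
    using state_space_open by (intro borel_measurable_times_ennreal borel_measurable_indicator) auto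
  ultimately show ?thesis unfolding state_measure_def by (subst AE_density) auto
qed

lemma trunc_eq_measurable: "{y :: real \<times> (int \<Rightarrow> nat). trunc k (snd y) = snd y} \<in> sets borel"
proof -
  have "{y :: real \<times> (int \<Rightarrow> nat). trunc k (snd y) = snd y} = (\<Union>d\<in>range (trunc k). {y. snd y = d})" by (auto, metis)
  also have "\<dots> \<in> sets borel"
    by (intro sets.countable_UN' countable_trunc) (auto intro: borel_closed closed_snd_eq)
  finally show ?thesis .
qed

lemma limit_measure_trunc: "AE y in limit_measure k. trunc k (snd y) = snd y"
  unfolding limit_measure_def using trunc_eq_measurable
  by (subst AE_distr_iff) (auto simp: trunc_def window_map_def fun_eq_iff)

lemma limit_measure_noatom: "emeasure (limit_measure k) ({b} \<times> UNIV) = 0"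
proof -
  have m: "{b} \<times> UNIV \<in> sets (borel :: (real \<times> (int \<Rightarrow> nat)) measure)"
    by (intro borel_closed closed_Times) auto
  have "{x :: real \<times> real \<times> real. inner (0, 1, 0) x = b} \<in> null_sets lborel"
  proof -
    have "negligible {x :: real \<times> real \<times> real. inner (0, 1, 0) x = b}" by (intro negligible_hyperplane) (auto simp: zero_prod_def)
    moreover have "{x :: real \<times> real \<times> real. inner (0, 1, 0) x = b} \<in> sets lborel"
      unfolding sets_lborel by (intro borel_closed closed_hyperplane)
    ultimately show ?thesis by (simp add: negligible_iff_null_sets null_sets_completion_iff)
  qed
  moreover have "window_map k -` ({b} \<times> UNIV) = {x. inner (0, 1, 0) x = b}"
    by (auto simp: window_map_def)
  moreover have "absolutely_continuous lborel state_measure"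
  proof -
    have "(\<lambda>x. indicator state_space x * ennreal (state_density x)) \<in> borel_measurable lborel"
      using state_space_open by (intro borel_measurable_times_ennreal borel_measurable_indicator) auto
    then show ?thesis unfolding state_measure_def by (rule absolutely_continuousI_density)
  qed
  ultimately have "window_map k -` ({b} \<times> UNIV) \<in> null_sets state_measure" by (auto simp: absolutely_continuous_def)
  then show ?thesis unfolding limit_measure_def using m by (subst emeasure_distr) auto
qed

definition cross_region :: "nat \<Rightarrow> (int \<Rightarrow> nat) \<Rightarrow> real \<Rightarrow> real \<Rightarrow> (real \<times> real) set"
  where "cross_region k d b1 b2 = {v. 0 < fst v \<and> fst v < 1 \<and> 1 < snd v \<and> b1 < snd v \<and> snd v < b2 \<and> fst v / snd v \<in> cf_cyl (back_digits k d)}"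

text \<open>For \<open>v = (q\<^sub>s\<^sub>-\<^sub>1, q\<^sub>s) / R\<close> this is
  \<open>R^2\<close> times the length of the piece of the cylinder with tail between
  \<open>z1\<close> and \<open>z2\<close>; see \<open>tail_length_scaled\<close>.\<close>

definition tail_length :: "real \<Rightarrow> real \<Rightarrow> real \<times> real \<Rightarrow> real"
  where "tail_length z1 z2 v = (z2 - z1) / ((snd v + fst v * z1) * (snd v + fst v * z2))"

lemma cross_region_open:
  assumes "0 \<notin> set (back_digits k d)" shows "open (cross_region k d b1 b2)"
proof -
  obtain a b where ab: "cf_cyl (back_digits k d) = {a<..<b}" using cf_cyl_interval[OF assms] by metis
  have "cross_region k d b1 b2 = {v. 0 < fst v} \<inter> {v. fst v < 1} \<inter> {v. 1 < snd v} \<inter> {v. b1 < snd v} \<inter> {v. snd v < b2} \<inter> {v. a * snd v < fst v} \<inter> {v. fst v < b * snd v}"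
    unfolding cross_region_def ab by (auto simp: field_simps)
  also have "open \<dots>" by (intro open_Int open_Collect_less continuous_intros)
  finally show ?thesis .
qed

lemma limit_measure_event_AE:
  assumes d: "trunc k d = d"
  shows "AE x in state_measure. window_map k x \<in> {b1<..<b2} \<times> {d} \<longrightarrow>
    x \<in> state_space \<and> 0 \<notin> set (back_digits k d) \<and> 0 \<notin> set (fwd_digits k d) \<and>
    (fst x, fst (snd x)) \<in> cross_region k d b1 b2 \<and> snd (snd x) \<in> cf_cyl (fwd_digits k d)"
  using AE_state_irrational
proof (rule eventually_mono, intro impI)
  fix x
  assume x: "x \<in> state_space \<and> fst x / fst (snd x) \<notin> \<rat> \<and> snd (snd x) \<notin> \<rat>"
    and e: "window_map k x \<in> {b1<..<b2} \<times> {d}"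
  obtain a b z where abz: "x = (a, b, z)" by (cases x)
  have s: "0 < a" "a < 1" "1 < b" "0 < z" "z < 1" using x abz by (auto simp: state_space_def)
  have t: "a / b \<in> {0..<1}" "z \<in> {0..<1}" using s by auto
  have w: "(if \<bar>i\<bar> \<le> int k then if i \<le> 0 then cf_digit (a / b) (nat (1 - i)) else cf_digit z (nat i) else 0) = d i" for i
  proof -
    have "snd (window_map k x) i = d i" using e by auto
    then show ?thesis by (simp only: window_map_def abz fst_conv snd_conv)
  qed
  have b: "cf_digit (a / b) (Suc j) = d (- int j)" if "j \<le> k" for j
    using w[of "- int j"] that by (simp add: nat_add_distrib)
  have f: "cf_digit z (Suc j) = d (int j + 1)" if "j < k" for j
    using w[of "int j + 1"] that by (simp add: nat_add_distrib)
  have "0 \<notin> set (back_digits k d)"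
  proof -
    have "0 \<noteq> d (- int j)" if "j \<le> k" for j
      using b[OF that] irrational_digit_pos[OF t(1), of j] x abz by (simp del: cf_digit.simps)
    moreover have "\<exists>j\<le>k. 0 = d (- int j)" if "0 \<in> set (back_digits k d)"
      using that by (auto simp: back_digits_def less_Suc_eq_le simp del: upt_Suc)
    ultimately show ?thesis by blast
  qed
  moreover have "0 \<notin> set (fwd_digits k d)"
  proof -
    have "0 \<noteq> d (int j + 1)" if "j < k" for j
      using f[OF that] irrational_digit_pos[OF t(2), of j] x abz by (simp del: cf_digit.simps)
    moreover have "\<exists>j<k. 0 = d (int j + 1)" if "0 \<in> set (fwd_digits k d)"
      using that by (auto simp: fwd_digits_def)
    ultimately show ?thesis by blast
  qed
  moreover have "a / b \<in> cf_cyl (back_digits k d)"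
    using b x abz by (intro irrational_in_cyl t calculation) (auto simp: back_digits_def simp del: cf_digit.simps upt_Suc)
  moreover have "z \<in> cf_cyl (fwd_digits k d)"
    using f x abz by (intro irrational_in_cyl t calculation) (auto simp: fwd_digits_def simp del: cf_digit.simps upt_Suc)
  moreover have "b1 < b" "b < b2" using e abz by (auto simp: window_map_def)
  ultimately show "x \<in> state_space \<and> 0 \<notin> set (back_digits k d) \<and> 0 \<notin> set (fwd_digits k d) \<and>
    (fst x, fst (snd x)) \<in> cross_region k d b1 b2 \<and> snd (snd x) \<in> cf_cyl (fwd_digits k d)"
    using x abz s by (simp add: cross_region_def)
qed

text \<open>The value 0 marks a missing digit, and in the limit almost surely none is missing. So
  the lower bounds for events concern windows of positive digits only.\<close>

lemma limit_measure_event_0: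
  assumes "trunc k d = d" "0 \<in> set (back_digits k d) \<or> 0 \<in> set (fwd_digits k d)"
  shows "emeasure (limit_measure k) ({b1<..<b2} \<times> {d}) = 0"
proof -
  have "AE x in state_measure. window_map k x \<notin> {b1<..<b2} \<times> {d}"
    using assms(2) by (intro eventually_mono[OF limit_measure_event_AE[OF assms(1), of b1 b2]]) auto
  then have "emeasure state_measure {x \<in> space state_measure. window_map k x \<in> {b1<..<b2} \<times> {d}} = 0"
    using measurable_sets[OF window_map_measurable' box_event_measurable, of k b1 b2 d]
    by (subst (asm) AE_iff_measurable[OF _ refl]) (auto simp: vimage_def)
  then show ?thesis
    unfolding limit_measure_def by (subst emeasure_distr) (auto simp: box_event_measurable vimage_def)
qed

lemma nn_integral_inverse_square:
  fixes a b z1 z2 c :: real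
  assumes "0 < a" "0 < b" "0 \<le> z1" "z1 < z2" "0 \<le> c"
  shows "(\<integral>\<^sup>+z. ennreal (c / (b + a * z) ^ 2) * indicator {z1<..<z2} z \<partial>lborel) = ennreal (c * tail_length z1 z2 (a, b))"
proof -
  have pos: "0 < b + a * z" if "z1 \<le> z" for z using assms that by (intro add_pos_nonneg) auto
  have "(\<integral>\<^sup>+z. ennreal (c / (b + a * z) ^ 2) * indicator {z1<..<z2} z \<partial>lborel)
      = (\<integral>\<^sup>+z. ennreal (c / (b + a * z) ^ 2) * indicator {z1..z2} z \<partial>lborel)"
    using AE_lborel_singleton[of z1] AE_lborel_singleton[of z2]
    by (intro nn_integral_cong_AE) (auto simp: indicator_def)
  also have "\<dots> = - (c / a) / (b + a * z2) - - (c / a) / (b + a * z1)"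
  proof (rule nn_integral_FTC_Icc)
    show "(\<lambda>z. c / (b + a * z) ^ 2) \<in> borel_measurable borel" by measurable
    fix z assume "z \<in> {z1..z2}"
    then have "b + a * z \<noteq> 0" using pos[of z] by simp
    then show "((\<lambda>z. - (c / a) / (b + a * z)) has_real_derivative c / (b + a * z) ^ 2) (at z)"
      using assms by (auto intro!: derivative_eq_intros simp: power2_eq_square)
    show "0 \<le> c / (b + a * z) ^ 2" using assms by simp
  qed (use assms in simp)
  also have "- (c / a) / (b + a * z2) - - (c / a) / (b + a * z1) = c * tail_length z1 z2 (a, b)"
  proof -
    define p q where "p = b + a * z1" and "q = b + a * z2"
    have "0 < p" "0 < q" using pos[of z1] pos[of z2] assms by (auto simp: p_def q_def)
    then have "1 / p - 1 / q = (q - p) / (p * q)" by (simp add: field_simps)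
    moreover have "- (c / a) / q - - (c / a) / p = (c / a) * (1 / p - 1 / q)" by (simp add: right_diff_distrib)
    ultimately have "- (c / a) / q - - (c / a) / p = (c / a) * ((q - p) / (p * q))" by simp
    also have "q - p = a * (z2 - z1)" by (simp add: p_def q_def algebra_simps)
    finally show ?thesis using assms by (simp add: tail_length_def p_def q_def)
  qed
  finally show ?thesis .
qed

lemma nn_integral_triple:
  fixes f :: "real \<times> real \<times> real \<Rightarrow> ennreal"
  assumes [measurable]: "f \<in> borel_measurable borel"
  shows "(\<integral>\<^sup>+x. f x \<partial>lborel) = (\<integral>\<^sup>+v. \<integral>\<^sup>+z. f (fst v, snd v, z) \<partial>lborel \<partial>lborel)"
proof -
  have "(\<integral>\<^sup>+x. f x \<partial>lborel) = (\<integral>\<^sup>+x. f x \<partial>(lborel \<Otimes>\<^sub>M lborel))" by (simp only: lborel_prod)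
  also have "\<dots> = (\<integral>\<^sup>+a. \<integral>\<^sup>+y. f (a, y) \<partial>lborel \<partial>lborel)"
    by (rule lborel.nn_integral_fst[symmetric]) (simp add: lborel_prod)
  also have "\<dots> = (\<integral>\<^sup>+a. \<integral>\<^sup>+b. \<integral>\<^sup>+z. f (a, b, z) \<partial>lborel \<partial>lborel \<partial>lborel)"
  proof (rule nn_integral_cong)
    fix a :: real
    have "(\<lambda>y. f (a, y)) \<in> borel_measurable borel"
      by (rule measurable_compose[OF _ assms]) (intro borel_measurable_continuous_onI continuous_intros)
    then have "(\<lambda>y. f (a, y)) \<in> borel_measurable (lborel \<Otimes>\<^sub>M lborel)" by (simp add: lborel_prod)
    from lborel.nn_integral_fst[OF this] show "(\<integral>\<^sup>+y. f (a, y) \<partial>lborel) = (\<integral>\<^sup>+b. \<integral>\<^sup>+z. f (a, b, z) \<partial>lborel \<partial>lborel)"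
      by (simp add: lborel_prod)
  qed
  also have "\<dots> = (\<integral>\<^sup>+v. \<integral>\<^sup>+z. f (fst v, snd v, z) \<partial>lborel \<partial>(lborel \<Otimes>\<^sub>M lborel))"
  proof -
    have "(\<lambda>x :: (real \<times> real) \<times> real. f (fst (fst x), snd (fst x), snd x)) \<in> borel_measurable borel"
      by (rule measurable_compose[OF _ assms]) (intro borel_measurable_continuous_onI continuous_intros)
    then have "(\<lambda>x :: (real \<times> real) \<times> real. f (fst (fst x), snd (fst x), snd x)) \<in> borel_measurable (borel \<Otimes>\<^sub>M lborel)"
      by (subst measurable_cong_sets[OF trans[OF sets_pair_measure_cong[OF refl sets_lborel] arg_cong[OF borel_prod, of sets]] refl])
    from lborel.borel_measurable_nn_integral_fst[OF this]
    have "(\<lambda>v. \<integral>\<^sup>+z. f (fst v, snd v, z) \<partial>lborel) \<in> borel_measurable (borel :: (real \<times> real) measure)" by simp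
    then have "(\<lambda>v. \<integral>\<^sup>+z. f (fst v, snd v, z) \<partial>lborel) \<in> borel_measurable (lborel \<Otimes>\<^sub>M lborel)" by (simp add: lborel_prod)
    from lborel.nn_integral_fst[OF this] show ?thesis by simp
  qed
  finally show ?thesis by (simp only: lborel_prod)
qed

lemma tail_length_cont: 
  assumes "0 \<le> z1" "0 \<le> z2"
  shows "continuous_on {v. 0 < fst v \<and> 0 < snd v} (tail_length z1 z2)"
proof -
  have "(snd v + fst v * z1) * (snd v + fst v * z2) \<noteq> 0" if "v \<in> {v. 0 < fst v \<and> 0 < snd v}" for v :: "real \<times> real"
  proof -
    have "0 < snd v + fst v * z1" "0 < snd v + fst v * z2" using that assms by (auto intro!: add_pos_nonneg)
    then show ?thesis by simp
  qed
  then show ?thesis unfolding tail_length_def by (intro continuous_intros) auto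
qed

text \<open>The tail is integrated out of the density \<open>2 * \<theta> / (b + a * z)^2\<close>,
  which leaves an integral over the pair of denominators alone. The same integral appears as a
  volume in \<open>emeasure_frame_region\<close>.\<close>

lemma limit_measure_event_le:
  assumes d: "trunc k d = d" and pos: "0 \<notin> set (back_digits k d)"
    and z: "cf_cyl (fwd_digits k d) = {z1<..<z2}" "0 \<le> z1" "z1 < z2" "z2 \<le> 1"
  shows "emeasure (limit_measure k) ({b1<..<b2} \<times> {d})
    \<le> ennreal (2 * \<theta>) * (\<integral>\<^sup>+v. indicator (cross_region k d b1 b2) v * ennreal (tail_length z1 z2 v) \<partial>lborel)"
proof -
  let ?U = "cross_region k d b1 b2"
  let ?f = "\<lambda>x :: real \<times> real \<times> real. indicator ?U (fst x, fst (snd x)) * (ennreal (state_density x) * indicator {z1<..<z2} (snd (snd x)))"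
  have U: "open ?U" by (rule cross_region_open[OF pos])
  have c: "(\<lambda>x :: real \<times> real \<times> real. (fst x, fst (snd x))) \<in> borel_measurable borel" "(\<lambda>x :: real \<times> real \<times> real. snd (snd x)) \<in> borel_measurable borel"
    by (intro borel_measurable_continuous_onI continuous_intros)+
  have fm: "?f \<in> borel_measurable borel"
  proof (intro borel_measurable_times_ennreal)
    show "(\<lambda>x :: real \<times> real \<times> real. indicator ?U (fst x, fst (snd x)) :: ennreal) \<in> borel_measurable borel"
      using U by (intro measurable_compose[OF c(1)] borel_measurable_indicator) auto
    show "(\<lambda>x :: real \<times> real \<times> real. indicator {z1<..<z2} (snd (snd x)) :: ennreal) \<in> borel_measurable borel"
      by (intro measurable_compose[OF c(2)] borel_measurable_indicator) auto
  qed measurable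
  have sm: "(\<lambda>x. indicator state_space x * ennreal (state_density x)) \<in> borel_measurable borel"
    using state_space_open by (intro borel_measurable_times_ennreal borel_measurable_indicator) auto
  let ?E = "window_map k -` ({b1<..<b2} \<times> {d})"
  have Em: "?E \<in> sets borel" using measurable_sets[OF window_map_measurable box_event_measurable, of k b1 b2 d] by simp
  have "emeasure (limit_measure k) ({b1<..<b2} \<times> {d}) = emeasure state_measure ?E"
    unfolding limit_measure_def by (subst emeasure_distr) (auto simp: box_event_measurable)
  also have "\<dots> \<le> emeasure state_measure {x. (fst x, fst (snd x)) \<in> ?U \<and> snd (snd x) \<in> {z1<..<z2} \<and> x \<in> state_space}"
  proof (rule emeasure_mono_AE)
    have "(\<lambda>x :: real \<times> real \<times> real. (fst x, fst (snd x))) -` ?U \<inter> (\<lambda>x. snd (snd x)) -` {z1<..<z2} \<inter> state_space \<in> sets borel"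
      using U state_space_open measurable_sets[OF c(1), of ?U] measurable_sets[OF c(2), of "{z1<..<z2}"] by (intro sets.Int) auto
    then show "{x. (fst x, fst (snd x)) \<in> ?U \<and> snd (snd x) \<in> {z1<..<z2} \<and> x \<in> state_space} \<in> sets state_measure"
      by (simp add: vimage_def Int_def conj_assoc)
    show "AE x in state_measure. x \<in> ?E \<longrightarrow> x \<in> {x. (fst x, fst (snd x)) \<in> ?U \<and> snd (snd x) \<in> {z1<..<z2} \<and> x \<in> state_space}"
      using limit_measure_event_AE[OF d, of b1 b2] by (rule eventually_mono) (auto simp: z(1))
  qed
  also have "\<dots> \<le> (\<integral>\<^sup>+x. ?f x \<partial>lborel)"
  proof -
    have "(\<lambda>x :: real \<times> real \<times> real. (fst x, fst (snd x))) -` ?U \<inter> (\<lambda>x. snd (snd x)) -` {z1<..<z2} \<inter> state_space \<in> sets borel"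
      using U state_space_open measurable_sets[OF c(1), of ?U] measurable_sets[OF c(2), of "{z1<..<z2}"] by (intro sets.Int) auto
    then have "{x. (fst x, fst (snd x)) \<in> ?U \<and> snd (snd x) \<in> {z1<..<z2} \<and> x \<in> state_space} \<in> sets borel"
      by (simp add: vimage_def Int_def conj_assoc)
    then show ?thesis unfolding state_measure_def using sm
      by (subst emeasure_density) (auto intro!: nn_integral_mono simp: indicator_def)
  qed
  also have "\<dots> = (\<integral>\<^sup>+v. \<integral>\<^sup>+z. ?f (fst v, snd v, z) \<partial>lborel \<partial>lborel)" by (rule nn_integral_triple[OF fm])
  also have "\<dots> = (\<integral>\<^sup>+v. ennreal (2 * \<theta>) * (indicator ?U v * ennreal (tail_length z1 z2 v)) \<partial>lborel)"
  proof (rule nn_integral_cong)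
    fix v :: "real \<times> real"
    show "(\<integral>\<^sup>+z. ?f (fst v, snd v, z) \<partial>lborel) = ennreal (2 * \<theta>) * (indicator ?U v * ennreal (tail_length z1 z2 v))"
    proof (cases "v \<in> ?U")
      case True
      then have v: "0 < fst v" "0 < snd v" by (auto simp: cross_region_def)
      have "(\<integral>\<^sup>+z. ?f (fst v, snd v, z) \<partial>lborel) = (\<integral>\<^sup>+z. ennreal (2 * \<theta> / (snd v + fst v * z) ^ 2) * indicator {z1<..<z2} z \<partial>lborel)"
        using True by (simp add: state_density_def)
      also have "\<dots> = ennreal (2 * \<theta> * tail_length z1 z2 (fst v, snd v))"
        using v z theta_pos by (intro nn_integral_inverse_square) auto
      also have "\<dots> = ennreal (2 * \<theta>) * ennreal (tail_length z1 z2 v)"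
        using theta_pos v z by (subst ennreal_mult[symmetric]) (auto simp: tail_length_def intro!: divide_nonneg_nonneg mult_nonneg_nonneg add_nonneg_nonneg)
      finally show ?thesis using True by simp
    qed simp
  qed
  also have "\<dots> = ennreal (2 * \<theta>) * (\<integral>\<^sup>+v. indicator ?U v * ennreal (tail_length z1 z2 v) \<partial>lborel)"
  proof (rule nn_integral_cmult)
    have "(\<lambda>v. indicator ?U v * ennreal (tail_length z1 z2 v)) \<in> borel_measurable borel"
      unfolding tail_length_def using U
      by (intro borel_measurable_times_ennreal borel_measurable_indicator measurable_compose[OF _ measurable_ennreal]
        borel_measurable_divide borel_measurable_const borel_measurable_continuous_onI continuous_intros) auto
    then show "(\<lambda>v. indicator ?U v * ennreal (tail_length z1 z2 v)) \<in> borel_measurable lborel" by simp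
  qed
  finally show ?thesis .
qed

text \<open>The backward digits come from the ratio of the denominators
  (\<open>cf_den_ratio_digits\<close>), which also shows that the word has more than
  \<open>k\<close> letters; the forward digits come from the tail.\<close>

lemma cf_window_cf_val:
  assumes w: "0 \<notin> set w" and d: "trunc k d = d" and pos: "0 \<notin> set (back_digits k d)" "0 \<notin> set (fwd_digits k d)"
    and r: "real (fst (cf_den w)) / real (snd (cf_den w)) \<in> cf_cyl (back_digits k d)"
    and z: "z \<in> cf_cyl (fwd_digits k d)"
  shows "cf_window k (cf_val w z) (length w) = d"
proof -
  obtain t where t: "t \<in> {0<..<1}" "real (fst (cf_den w)) / real (snd (cf_den w)) = cf_val (rev (back_digits k d)) t"
    using r by (auto simp: cf_cyl_def)
  have "length (back_digits k d) \<le> length w \<and> take (length (back_digits k d)) w = back_digits k d"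
    using cf_den_ratio_digits[OF w pos(1) t] .
  then have l: "Suc k \<le> length w" "take (Suc k) w = back_digits k d" by (auto simp: back_digits_def)
  obtain s where s: "s \<in> {0<..<1}" "z = cf_val (rev (fwd_digits k d)) s" using z by (auto simp: cf_cyl_def)
  have zu: "z \<in> {0<..<1}" unfolding s(2) using s(1) pos(2) by (intro cf_val_in_open_unit) auto
  have bk: "w ! j = d (- int j)" if "j \<le> k" for j
  proof -
    have "w ! j = take (Suc k) w ! j" using that by simp
    also have "\<dots> = d (- int j)" unfolding l(2) back_digits_def using that by (simp del: upt_Suc)
    finally show ?thesis .
  qed
  show ?thesis
  proof
    fix i :: int
    show "cf_window k (cf_val w z) (length w) i = d i"
    proof (cases "\<bar>i\<bar> \<le> int k")
      case False
      then show ?thesis using fun_cong[OF d, of i] by (simp add: cf_window_def trunc_def)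
    next
      case True
      show ?thesis
      proof (cases "i \<le> 0")
        case True': True
        define j where "j = nat (- i)"
        have j: "j \<le> k" "i = - int j" using True True' by (auto simp: j_def)
        have "nat (int (length w) + i) = length w - j" using j l by linarith
        then have "cf_window k (cf_val w z) (length w) i = cf_digit (cf_val w z) (length w - j)"
          using True by (simp add: cf_window_def del: cf_digit.simps)
        also have "\<dots> = w ! j" using j l by (intro cf_digit_cf_val w zu) auto
        finally show ?thesis using bk j by simp
      next
        case False
        define j where "j = nat i - 1"
        have j: "j < k" "i = int j + 1" using True False by (auto simp: j_def)
        have "nat (int (length w) + i) = length w + Suc j" using j by linarith
        then have "cf_window k (cf_val w z) (length w) i = cf_digit (cf_val w z) (length w + Suc j)"
          using True by (simp add: cf_window_def del: cf_digit.simps)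
        also have "\<dots> = cf_digit z (Suc j)" by (intro cf_digit_cf_val_tail w zu) simp
        also have "\<dots> = fwd_digits k d ! j"
          unfolding s(2) using j pos(2) s(1) by (intro cf_digit_cf_val_rev) (auto simp: fwd_digits_def)
        also have "\<dots> = d i" using j by (simp add: fwd_digits_def)
        finally show ?thesis .
      qed
    qed
  qed
qed

section \<open>Convergence under the Gauss measure\<close>

lemma gauss_measure_sets [simp]: "sets gauss_measure = sets borel" "space gauss_measure = UNIV"
  by (simp_all add: gauss_measure_def)

definition gauss_density :: "real \<Rightarrow> real"
  where "gauss_density x = 1 / (ln 2 * (1 + x))"

lemma emeasure_gauss_measure:
  "A \<in> sets borel \<Longrightarrow> emeasure gauss_measure A = (\<integral>\<^sup>+x. ennreal (gauss_density x) * indicator (A \<inter> {0<..<1}) x \<partial>lborel)"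
  unfolding gauss_measure_def gauss_density_def
  by (subst emeasure_density) (auto intro!: nn_integral_cong simp: indicator_def)

lemma nn_integral_gauss_density: "(\<integral>\<^sup>+x. indicator {0<..<1} x * ennreal (gauss_density x) \<partial>lborel) = 1"
proof -
  have "(\<integral>\<^sup>+x. indicator {0<..<1} x * ennreal (gauss_density x) \<partial>lborel) = (\<integral>\<^sup>+x. ennreal (gauss_density x) * indicator {0..1} x \<partial>lborel)"
  proof (rule nn_integral_cong_AE)
    show "AE x in lborel. indicator {0<..<1} x * ennreal (gauss_density x) = ennreal (gauss_density x) * indicator {0..1} x"
      using AE_lborel_singleton[of "0 :: real"] AE_lborel_singleton[of "1 :: real"]
      by eventually_elim (auto simp: indicator_def)
  qed
  also have "\<dots> = 1 / ln 2 * ln (1 + 1) - 1 / ln 2 * ln (1 + 0 :: real)"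
  proof (rule nn_integral_FTC_Icc)
    show "gauss_density \<in> borel_measurable borel" unfolding gauss_density_def by measurable
    fix x :: real assume x: "x \<in> {0..1}"
    then show "((\<lambda>x. 1 / ln 2 * ln (1 + x)) has_real_derivative gauss_density x) (at x)"
      unfolding gauss_density_def by (auto intro!: derivative_eq_intros)
    show "0 \<le> gauss_density x" using x by (simp add: gauss_density_def)
  qed simp
  finally show ?thesis by simp
qed

lemma gauss_measure_prob: "prob_space gauss_measure"
proof
  show "emeasure gauss_measure (space gauss_measure) = 1"
    using nn_integral_gauss_density by (simp add: emeasure_gauss_measure mult.commute)
qed

lemma renewal_index_measurable [measurable]: "renewal_index R \<in> measurable borel (count_space UNIV)"
  unfolding renewal_index_def by measurable

lemma cf_local_measurable: "(\<lambda>x. cf_local k R x (renewal_index R x)) \<in> borel_measurable borel"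
  unfolding cf_local_def
proof (intro borel_measurable_Pair measurable_coordinatewise_then_product)
  have "(\<lambda>x. cf_denom x (renewal_index R x)) \<in> measurable borel (count_space UNIV)"
    by (rule measurable_compose_countable[OF _ renewal_index_measurable]) measurable
  then show "(\<lambda>x. real (cf_denom x (renewal_index R x)) / R) \<in> borel_measurable borel" by measurable
  fix i :: int
  have "(\<lambda>x. cf_window k x (renewal_index R x) i) \<in> measurable borel (count_space UNIV)"
    unfolding cf_window_def
    by (rule measurable_compose_countable[OF _ renewal_index_measurable]) (cases "\<bar>i\<bar> \<le> int k"; simp)
  then show "(\<lambda>x. cf_window k x (renewal_index R x) i) \<in> borel_measurable borel" by (rule measurable_nat_borel)
qed

lemma cf_local_measurable' [measurable]: "(\<lambda>x. cf_local k R x (renewal_index R x)) \<in> measurable gauss_measure borel"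
  using cf_local_measurable by (simp cong: measurable_cong_sets)

lemma gauss_law_prob: "prob_space (gauss_law k R)" "sets (gauss_law k R) = sets borel"
  unfolding gauss_law_def using gauss_measure_prob by (auto intro: prob_space.prob_space_distr)

lemma trunc_cf_local: "trunc k (snd (cf_local k R x s)) = snd (cf_local k R x s)"
  by (auto simp: trunc_def cf_local_def cf_window_def fun_eq_iff)

lemma gauss_law_trunc: "AE y in gauss_law k R. trunc k (snd y) = snd y"
  unfolding gauss_law_def using trunc_eq_measurable by (subst AE_distr_iff) (auto simp: trunc_cf_local)

text \<open>The third coordinate is the convergent \<open>p\<^sub>s / q\<^sub>s\<close>. As
  \<open>words_count\<close> sees only the length of the interval around it, this position is
  asymptotically independent of the scaled denominators and uniform.\<close>

lemma words_box:
  fixes R :: "nat \<Rightarrow> real" and a b :: "real \<times> real \<times> real"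
  assumes R: "filterlim R at_top sequentially"
  shows "ennreal \<theta> * emeasure lborel (box a b \<inter> {x. 0 < fst x \<and> fst x < fst (snd x) \<and> snd (snd x) \<in> {0<..<1}})
    \<le> liminf (\<lambda>i. emeasure (point_measure_on (1 / R i ^ 2)
        (\<lambda>w. (fst (scaled_den (R i) w), snd (scaled_den (R i) w), cf_val w 0)) (words e {0<..<1})) (box a b))"
proof -
  define x1 x2 where "x1 = max 0 (snd (snd a))" and "x2 = min 1 (snd (snd b))"
  define \<Omega> where "\<Omega> = box (fst a, fst (snd a)) (fst b, fst (snd b)) \<inter> {v. 0 < fst v} \<inter> {v. fst v < snd v}"
  have e: "box a b \<inter> {x. 0 < fst x \<and> fst x < fst (snd x) \<and> snd (snd x) \<in> {0<..<1}}
     = {x. (fst x, fst (snd x)) \<in> \<Omega> \<and> snd (snd x) \<in> {x1<..<x2}}"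
    by (auto simp: box_prod \<Omega>_def x1_def x2_def)
  have \<Omega>o: "open \<Omega>" unfolding \<Omega>_def by (intro open_Int open_box open_Collect_less continuous_intros)
  have halfs: "{v :: real \<times> real. 0 < fst v} = {v. inner (1, 0) v > 0}" "{v :: real \<times> real. fst v < snd v} = {v. inner (1, -1) v < 0}"
    by (auto simp: inner_prod_def)
  have \<Omega>c: "convex \<Omega>" unfolding \<Omega>_def halfs by (intro convex_Int convex_box convex_halfspace_lt convex_halfspace_gt)
  have \<Omega>s: "\<Omega> \<subseteq> {v. 0 < fst v \<and> fst v < snd v \<and> snd v < fst (snd b)}" by (auto simp: \<Omega>_def box_prod)
  have "\<Omega> \<subseteq> box (fst a, fst (snd a)) (fst b, fst (snd b))" by (auto simp: \<Omega>_def)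
  then have \<Omega>f: "emeasure lborel \<Omega> < \<infinity>"
    using emeasure_mono[of \<Omega> "box (fst a, fst (snd a)) (fst b, fst (snd b))" lborel] emeasure_lborel_box_finite[of "(fst a, fst (snd a))" "(fst b, fst (snd b))"]
    by (simp add: le_less_trans)
  have m: "emeasure lborel {x :: real \<times> real \<times> real. (fst x, fst (snd x)) \<in> \<Omega> \<and> snd (snd x) \<in> {x1<..<x2}}
     = emeasure lborel \<Omega> * emeasure lborel {x1<..<x2}"
  proof -
    let ?E = "{x :: real \<times> real \<times> real. (fst x, fst (snd x)) \<in> \<Omega> \<and> snd (snd x) \<in> {x1<..<x2}}"
    have E: "?E \<in> sets borel"
    proof -
      have "open ((\<lambda>x :: real \<times> real \<times> real. (fst x, fst (snd x))) -` \<Omega>)" "open ((\<lambda>x :: real \<times> real \<times> real. snd (snd x)) -` {x1<..<x2})"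
        by (rule open_vimage[OF \<Omega>o], intro continuous_intros, rule open_vimage[OF open_greaterThanLessThan], intro continuous_intros)
      then have "open ((\<lambda>x :: real \<times> real \<times> real. (fst x, fst (snd x))) -` \<Omega> \<inter> (\<lambda>x. snd (snd x)) -` {x1<..<x2})" by (rule open_Int)
      then show ?thesis by (simp add: vimage_def Int_def)
    qed
    have "emeasure lborel ?E = (\<integral>\<^sup>+x. indicator ?E x \<partial>lborel)" using E by simp
    also have "\<dots> = (\<integral>\<^sup>+v. \<integral>\<^sup>+z. indicator ?E (fst v, snd v, z) \<partial>lborel \<partial>lborel)"
      using E by (intro nn_integral_triple) auto
    also have "\<dots> = (\<integral>\<^sup>+v. \<integral>\<^sup>+z. indicator \<Omega> v * indicator {x1<..<x2} z \<partial>lborel \<partial>lborel)"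
      by (intro nn_integral_cong) (auto simp: indicator_def)
    also have "\<dots> = (\<integral>\<^sup>+v. emeasure lborel {x1<..<x2} * indicator \<Omega> v \<partial>lborel)"
      by (intro nn_integral_cong) (simp add: nn_integral_cmult mult.commute)
    also have "\<dots> = emeasure lborel {x1<..<x2} * emeasure lborel \<Omega>"
      using \<Omega>o by (intro nn_integral_cmult_indicator) auto
    finally show ?thesis by (simp add: mult.commute)
  qed
  show ?thesis
  proof (cases "x1 < x2")
    case False
    then show ?thesis unfolding e m by simp
  next
    case True
    have J: "0 \<le> x1" "x2 \<le> 1" by (auto simp: x1_def x2_def)
    have "ennreal \<theta> * (emeasure lborel \<Omega> * emeasure lborel {x1<..<x2}) = ennreal (\<theta> * (x2 - x1) * measure lborel \<Omega>)"
      using \<Omega>f True theta_pos by (simp add: emeasure_eq_ennreal_measure less_top ennreal_mult[symmetric] mult_ac)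
    also have "\<dots> \<le> liminf (\<lambda>i. ennreal (1 / R i ^ 2) * ecard {w \<in> words e {x1<..<x2}. scaled_den (R i) w \<in> \<Omega>})"
      by (rule words_count[OF R J(1) True J(2) \<Omega>o \<Omega>c \<Omega>s])
    also have "\<dots> \<le> liminf (\<lambda>i. emeasure (point_measure_on (1 / R i ^ 2)
        (\<lambda>w. (fst (scaled_den (R i) w), snd (scaled_den (R i) w), cf_val w 0)) (words e {0<..<1})) (box a b))"
    proof (intro Liminf_mono always_eventually allI)
      fix i
      have v0: "cf_val w 0 \<in> {x1<..<x2}" if "w \<in> words e {x1<..<x2}" for w using that by (auto simp: words_def)
      have "words e {x1<..<x2} \<subseteq> words e {0<..<1}" using J by (fastforce simp: words_def)
      then have "{w \<in> words e {x1<..<x2}. scaled_den (R i) w \<in> \<Omega>}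
        \<subseteq> {w \<in> words e {0<..<1}. (fst (scaled_den (R i) w), snd (scaled_den (R i) w), cf_val w 0) \<in> box a b}"
        using v0 by (fastforce simp: \<Omega>_def box_prod x1_def x2_def)
      then have "ennreal (1 / R i ^ 2) * ecard {w \<in> words e {x1<..<x2}. scaled_den (R i) w \<in> \<Omega>} \<le> ennreal (1 / R i ^ 2) * ecard {w \<in> words e {0<..<1}. (fst (scaled_den (R i) w), snd (scaled_den (R i) w), cf_val w 0) \<in> box a b}"
        by (intro mult_left_mono ecard_mono) auto
      then show "ennreal (1 / R i ^ 2) * ecard {w \<in> words e {x1<..<x2}. scaled_den (R i) w \<in> \<Omega>} \<le> emeasure (point_measure_on (1 / R i ^ 2)
        (\<lambda>w. (fst (scaled_den (R i) w), snd (scaled_den (R i) w), cf_val w 0)) (words e {0<..<1})) (box a b)"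
        by (subst emeasure_point_measure_on) auto
    qed
    finally show ?thesis unfolding e m .
  qed
qed

lemma liminf_add_null:
  fixes X :: "nat \<Rightarrow> ennreal"
  assumes "\<delta> \<longlonglongrightarrow> 0" "L \<le> liminf (\<lambda>i. X i + ennreal (\<delta> i))"
  shows "L \<le> liminf X"
proof (rule ennreal_le_epsilon)
  fix e :: real assume e: "0 < e"
  have "\<forall>\<^sub>F i in sequentially. \<delta> i < e" using assms(1) e by (rule order_tendstoD)
  then have "\<forall>\<^sub>F i in sequentially. X i + ennreal (\<delta> i) \<le> ennreal e + X i"
    by (rule eventually_mono) (simp add: add.commute add_mono ennreal_leI)
  then have "liminf (\<lambda>i. X i + ennreal (\<delta> i)) \<le> liminf (\<lambda>i. ennreal e + X i)" by (rule Liminf_mono)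
  also have "\<dots> = ennreal e + liminf X" by (rule Liminf_const_add) auto
  finally show "L \<le> liminf X + ennreal e" using assms(2) by (simp add: add.commute)
qed

lemma tail_length_scaled:
  assumes w: "0 \<notin> set w" and R: "0 < R" and z: "0 \<le> z1" "z1 < z2"
  shows "1 / R ^ 2 * tail_length z1 z2 (scaled_den R w) = \<bar>cf_val w z2 - cf_val w z1\<bar>"
proof -
  let ?q = "real (snd (cf_den w))" and ?q' = "real (fst (cf_den w))"
  have pos: "0 < ?q + z1 * ?q'" "0 < ?q + z2 * ?q'" using cf_den_pos[OF w] z by (auto intro!: add_pos_nonneg)
  have "\<bar>cf_val w z2 - cf_val w z1\<bar> = (z2 - z1) / ((?q + z2 * ?q') * (?q + z1 * ?q'))"
    using cf_val_diff[OF w, of z2 z1] z pos by (simp add: abs_mult power_abs)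
  moreover have "snd (scaled_den R w) + fst (scaled_den R w) * z1 = (?q + z1 * ?q') / R"
    "snd (scaled_den R w) + fst (scaled_den R w) * z2 = (?q + z2 * ?q') / R"
    using R by (simp_all add: scaled_den_def field_simps)
  ultimately show ?thesis using R by (simp add: tail_length_def power2_eq_square mult.commute)
qed

text \<open>A cylinder with \<open>q\<^sub>s > R\<close> is shorter than \<open>1 / R\<close>, so on
  it \<open>1 + x\<close> exceeds \<open>1 + cf_val w 0\<close> by a factor of at most
  \<open>1 + 1 / R\<close>.\<close>

lemma gauss_measure_cylinder:
  fixes R z1 z2 :: real
  assumes w: "0 \<notin> set w" and q: "R < snd (cf_den w)" and R: "0 < R" and z: "0 \<le> z1" "z1 < z2" "z2 \<le> 1"
  shows "ennreal (gauss_density (cf_val w 0) * \<bar>cf_val w z2 - cf_val w z1\<bar>) \<le> ennreal (1 + 1 / R) * emeasure gauss_measure (cf_val w ` {z1<..<z2})"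
proof -
  let ?a = "min (cf_val w z1) (cf_val w z2)" and ?b = "max (cf_val w z1) (cf_val w z2)"
  have I: "cf_val w ` {z1<..<z2} = {?a<..<?b}" by (rule cf_val_image_interval[OF w z(1,2)])
  have sub: "cf_val w ` {z1<..<z2} \<subseteq> {0<..<1}" using cf_val_in_open_unit[OF w] z by fastforce
  have x0: "cf_val w 0 \<in> {0..1}" using cf_val_in_unit[OF w, of 0] by simp
  have dens: "gauss_density (cf_val w 0) \<le> (1 + 1 / R) * gauss_density x" if x: "x \<in> cf_val w ` {z1<..<z2}" for x
  proof -
    obtain t where t: "z1 < t" "t < z2" "x = cf_val w t" using x by auto
    let ?q = "real (snd (cf_den w))" and ?q' = "real (fst (cf_den w))"
    have q1: "1 \<le> ?q" using cf_den_pos[OF w] by linarith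
    have "1 * ?q \<le> (?q + t * ?q') * ?q" using q1 t z by (intro mult_right_mono) (auto intro: add_increasing2)
    moreover have "\<bar>x - cf_val w 0\<bar> = t / ((?q + t * ?q') * ?q)"
      using cf_val_diff[OF w, of t 0] t z q1 by (simp add: abs_mult power_abs)
    ultimately have "\<bar>x - cf_val w 0\<bar> \<le> 1 / ?q"
      using t z q1 by (auto intro!: frac_le)
    also have "\<dots> \<le> 1 / R" using q R by (intro divide_left_mono) auto
    finally have "x \<le> cf_val w 0 + 1 / R" by linarith
    moreover have "1 / R * 1 \<le> 1 / R * (1 + cf_val w 0)" using R x0 by (intro mult_left_mono) auto
    ultimately have "1 + x \<le> (1 + 1 / R) * (1 + cf_val w 0)" by (simp add: algebra_simps)
    moreover have "0 < 1 + x" using x sub by auto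
    ultimately have "1 / ((1 + 1 / R) * (1 + cf_val w 0)) \<le> 1 / (1 + x)" by (intro divide_left_mono) auto
    then have "(1 + 1 / R) / ln 2 * (1 / ((1 + 1 / R) * (1 + cf_val w 0))) \<le> (1 + 1 / R) / ln 2 * (1 / (1 + x))"
      using R by (intro mult_left_mono) auto
    moreover have "0 < 1 + 1 / R" using R by (simp add: add_pos_pos)
    ultimately show ?thesis unfolding gauss_density_def by simp
  qed
  have c: "0 \<le> gauss_density (cf_val w 0)" using x0 by (simp add: gauss_density_def)
  have "ennreal (gauss_density (cf_val w 0) * \<bar>cf_val w z2 - cf_val w z1\<bar>) = (\<integral>\<^sup>+x. ennreal (gauss_density (cf_val w 0)) * indicator {?a<..<?b} x \<partial>lborel)"
    using c by (subst nn_integral_cmult_indicator) (auto simp: ennreal_mult[symmetric] abs_real_def max_def min_def)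
  also have "\<dots> \<le> (\<integral>\<^sup>+x. ennreal (1 + 1 / R) * (ennreal (gauss_density x) * indicator ({?a<..<?b} \<inter> {0<..<1}) x) \<partial>lborel)"
  proof (rule nn_integral_mono)
    fix x
    show "ennreal (gauss_density (cf_val w 0)) * indicator {?a<..<?b} x \<le> ennreal (1 + 1 / R) * (ennreal (gauss_density x) * indicator ({?a<..<?b} \<inter> {0<..<1}) x)"
    proof (cases "x \<in> {?a<..<?b}")
      case True
      then have x: "x \<in> cf_val w ` {z1<..<z2}" unfolding I .
      then have "x \<in> {0<..<1}" using sub by blast
      moreover have "ennreal (gauss_density (cf_val w 0)) \<le> ennreal (1 + 1 / R) * ennreal (gauss_density x)"
        using dens[OF x] R \<open>x \<in> {0<..<1}\<close> by (subst ennreal_mult[symmetric]) (auto simp: gauss_density_def intro: ennreal_leI)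
      ultimately show ?thesis using True by simp
    qed simp
  qed
  also have "\<dots> = ennreal (1 + 1 / R) * (\<integral>\<^sup>+x. ennreal (gauss_density x) * indicator ({?a<..<?b} \<inter> {0<..<1}) x \<partial>lborel)"
    by (rule nn_integral_cmult) (unfold gauss_density_def, measurable)
  also have "(\<integral>\<^sup>+x. ennreal (gauss_density x) * indicator ({?a<..<?b} \<inter> {0<..<1}) x \<partial>lborel) = emeasure gauss_measure {?a<..<?b}"
    by (rule emeasure_gauss_measure[symmetric]) simp
  finally show ?thesis unfolding I .
qed

text \<open>The event contains, for each word whose scaled denominators lie in the region, the piece
  of its cylinder with tail in \<open>{z1<..<z2}\<close>. Such a piece has Gauss measure about
  \<open>gauss_density (p\<^sub>s / q\<^sub>s)\<close> times its length, and by
  \<open>words_box\<close> the position is integrated separately, where the Gauss density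
  contributes its total mass 1.\<close>

lemma gauss_law_event:
  fixes R :: "nat \<Rightarrow> real"
  assumes R: "filterlim R at_top sequentially" and d: "trunc k d = d"
  shows "emeasure (limit_measure k) ({b1<..<b2} \<times> {d}) \<le> liminf (\<lambda>i. emeasure (gauss_law k (R i)) ({b1<..<b2} \<times> {d}))"
proof (cases "0 \<in> set (back_digits k d) \<or> 0 \<in> set (fwd_digits k d)")
  case True
  then show ?thesis using limit_measure_event_0[OF d] by simp
next
  case False
  then have pos: "0 \<notin> set (back_digits k d)" "0 \<notin> set (fwd_digits k d)" by auto
  obtain z1 z2 where z: "0 \<le> z1" "z1 < z2" "z2 \<le> 1" "cf_cyl (fwd_digits k d) = {z1<..<z2}" using cf_cyl_interval[OF pos(2)] by metis
  let ?U = "cross_region k d b1 b2"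
  let ?I = "\<integral>\<^sup>+v. indicator ?U v * ennreal (tail_length z1 z2 v) \<partial>lborel"
  let ?ev = "\<lambda>i. (\<lambda>x. cf_local k (R i) x (renewal_index (R i) x)) -` ({b1<..<b2} \<times> {d})"
  have U: "open ?U" by (rule cross_region_open[OF pos(1)])
  \<comment> \<open>The parities are treated separately, each giving half of the limit; the parity
    of the renewal index keeps the two unions disjoint.\<close>
  define A where "A e i = (\<Union>w\<in>{w \<in> words e {0<..<1}. scaled_den (R i) w \<in> ?U}. cf_val w ` {z1<..<z2})" for e i
  have Am: "A e i \<in> sets borel" for e i
    unfolding A_def
  proof -
    have "cf_val w ` {z1<..<z2} \<in> sets borel" if "w \<in> {w \<in> words e {0<..<1}. scaled_den (R i) w \<in> ?U}" for w
    proof -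
      have "0 \<notin> set w" using that by (simp add: words_def)
      then show ?thesis by (simp add: cf_val_image_interval z(1,2))
    qed
    then show "(\<Union>w\<in>{w \<in> words e {0<..<1}. scaled_den (R i) w \<in> ?U}. cf_val w ` {z1<..<z2}) \<in> sets borel"
      by (intro sets.countable_UN' countableI_type) auto
  qed
  have key: "renewal_index (R i) x = length w \<and> x \<in> ?ev i"
    if "w \<in> words e {0<..<1}" "scaled_den (R i) w \<in> ?U" "t \<in> {z1<..<z2}" "x = cf_val w t" "0 < R i" for w e i t x
  proof -
    have w: "0 \<notin> set w" "w \<noteq> []" using that(1) by (auto simp: words_def)
    have t: "t \<in> {0<..<1}" using that(3) z by auto
    have q: "real (fst (cf_den w)) < R i" "R i < real (snd (cf_den w))"
      "b1 < real (snd (cf_den w)) / R i" "real (snd (cf_den w)) / R i < b2"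
      "fst (scaled_den (R i) w) / snd (scaled_den (R i) w) \<in> cf_cyl (back_digits k d)"
      using that(2,5) by (auto simp: cross_region_def scaled_den_def)
    have "fst (scaled_den (R i) w) / snd (scaled_den (R i) w) = real (fst (cf_den w)) / real (snd (cf_den w))"
      using that(5) by (simp add: scaled_den_def)
    with q have r: "real (fst (cf_den w)) / real (snd (cf_den w)) \<in> cf_cyl (back_digits k d)" by simp
    have ri: "renewal_index (R i) x = length w" unfolding that(4) by (rule crossing_cf_val(2)[OF w t q(1,2)])
    have "cf_window k x (length w) = d" unfolding that(4) using that(3) z by (intro cf_window_cf_val w d pos r) auto
    moreover have "cf_denom x (length w) = snd (cf_den w)" unfolding that(4) by (rule cf_denom_cf_val_last(1)[OF w(1) t])
    ultimately show ?thesis using ri q by (simp add: cf_local_def)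
  qed
  have half: "ennreal \<theta> * ?I \<le> liminf (\<lambda>i. emeasure gauss_measure (A e i))" for e
  proof -
    let ?P = "\<lambda>i w. (fst (scaled_den (R i) w), snd (scaled_den (R i) w), cf_val w 0)"
    let ?C = "{x :: real \<times> real \<times> real. 0 < fst x \<and> fst x < fst (snd x) \<and> snd (snd x) \<in> {0<..<1}}"
    let ?O = "{x :: real \<times> real \<times> real. (fst x, fst (snd x)) \<in> ?U \<and> snd (snd x) \<in> {0<..<1}}"
    let ?h = "\<lambda>x :: real \<times> real \<times> real. tail_length z1 z2 (fst x, fst (snd x)) * gauss_density (snd (snd x))"
    let ?f = "\<lambda>x. indicator ?O x * ennreal (?h x)"
    have C: "open ?C"
    proof -
      have "?C = {x. 0 < fst x} \<inter> {x. fst x < fst (snd x)} \<inter> {x. 0 < snd (snd x)} \<inter> {x. snd (snd x) < 1}" by auto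
      also have "open \<dots>" by (intro open_Int open_Collect_less continuous_intros)
      finally show ?thesis .
    qed
    have O: "open ?O"
    proof -
      have "open ((\<lambda>x :: real \<times> real \<times> real. (fst x, fst (snd x))) -` ?U)" "open ((\<lambda>x :: real \<times> real \<times> real. snd (snd x)) -` {0<..<1})"
        by (rule open_vimage[OF U], intro continuous_intros, rule open_vimage[OF open_greaterThanLessThan], intro continuous_intros)
      then have "open ((\<lambda>x :: real \<times> real \<times> real. (fst x, fst (snd x))) -` ?U \<inter> (\<lambda>x. snd (snd x)) -` {0<..<1})" by (rule open_Int)
      then show ?thesis by (simp add: vimage_def Int_def)
    qed
    have OC: "?O \<subseteq> ?C" by (auto simp: cross_region_def)
    have hcont: "continuous_on ?O ?h"
    proof (intro continuous_intros)
      show "continuous_on ?O (\<lambda>x. tail_length z1 z2 (fst x, fst (snd x)))"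
        by (rule continuous_on_compose2[OF tail_length_cont]) (use z in \<open>auto intro!: continuous_intros simp: cross_region_def\<close>)
      show "continuous_on ?O (\<lambda>x. gauss_density (snd (snd x)))"
        unfolding gauss_density_def by (intro continuous_intros) auto
    qed
    have lscf: "lsc ?f" by (rule lsc_on_open[OF O hcont])
    have fm: "?f \<in> borel_measurable borel"
    proof (intro borel_measurable_times_ennreal borel_measurable_indicator borel_open O measurable_compose[OF _ measurable_ennreal] borel_measurable_times)
      show "(\<lambda>x :: real \<times> real \<times> real. tail_length z1 z2 (fst x, fst (snd x))) \<in> borel_measurable borel"
        unfolding tail_length_def fst_conv snd_conv
        by (intro borel_measurable_divide borel_measurable_const borel_measurable_continuous_onI continuous_intros)
      show "(\<lambda>x :: real \<times> real \<times> real. gauss_density (snd (snd x))) \<in> borel_measurable borel"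
        unfolding gauss_density_def
        by (intro borel_measurable_divide borel_measurable_const borel_measurable_continuous_onI continuous_intros)
    qed
    let ?\<mu> = "density lborel (\<lambda>x. ennreal \<theta> * indicator ?C x)"
    have Cm: "(\<lambda>x. ennreal \<theta> * indicator ?C x) \<in> borel_measurable lborel" using C by simp
    have "(\<integral>\<^sup>+x. ?f x \<partial>?\<mu>) \<le> liminf (\<lambda>i. \<integral>\<^sup>+x. ?f x \<partial>point_measure_on (1 / R i ^ 2) (?P i) (words e {0<..<1}))"
    proof (rule nn_integral_le_liminf_boxes)
      show "absolutely_continuous lborel ?\<mu>" using Cm by (intro absolutely_continuousI_density)
      fix a b :: "real \<times> real \<times> real"
      have "emeasure ?\<mu> (box a b) = (\<integral>\<^sup>+x. ennreal \<theta> * indicator (box a b \<inter> ?C) x \<partial>lborel)"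
        using Cm by (subst emeasure_density) (auto intro!: nn_integral_cong simp: indicator_def)
      also have "\<dots> = ennreal \<theta> * emeasure lborel (box a b \<inter> ?C)"
        using borel_open[OF C] by (intro nn_integral_cmult_indicator) auto
      finally show "emeasure ?\<mu> (box a b) \<le> liminf (\<lambda>i. emeasure (point_measure_on (1 / R i ^ 2) (?P i) (words e {0<..<1})) (box a b))"
        using words_box[OF R, of a b e] by simp
      show "lsc ?f" by (rule lscf)
    qed simp_all
    also have "(\<integral>\<^sup>+x. ?f x \<partial>?\<mu>) = ennreal \<theta> * (\<integral>\<^sup>+x. ?f x \<partial>lborel)"
    proof -
      have "(\<integral>\<^sup>+x. ?f x \<partial>?\<mu>) = (\<integral>\<^sup>+x. ennreal \<theta> * ?f x \<partial>lborel)"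
      proof (subst nn_integral_density[OF Cm], use fm in simp, rule nn_integral_cong)
        fix x :: "real \<times> real \<times> real"
        show "ennreal \<theta> * indicator ?C x * ?f x = ennreal \<theta> * ?f x"
        proof (cases "x \<in> ?O")
          case True
          then have "indicator ?C x = (1 :: ennreal)" using OC by (intro indicator_simps(1)) blast
          then show ?thesis by (simp only: mult_1_right)
        next
          case False
          have "?f x = 0" unfolding indicator_simps(2)[OF False] by (rule mult_zero_left)
          then show ?thesis by (simp only: mult_zero_right)
        qed
      qed
      then show ?thesis using fm by (simp add: nn_integral_cmult)
    qed
    also have "(\<integral>\<^sup>+x. ?f x \<partial>lborel) = ?I"
    proof -
      have "(\<integral>\<^sup>+x. ?f x \<partial>lborel) = (\<integral>\<^sup>+v. \<integral>\<^sup>+x. ?f (fst v, snd v, x) \<partial>lborel \<partial>lborel)" by (rule nn_integral_triple[OF fm])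
      also have "\<dots> = ?I"
      proof (rule nn_integral_cong)
        fix v :: "real \<times> real"
        show "(\<integral>\<^sup>+x. ?f (fst v, snd v, x) \<partial>lborel) = indicator ?U v * ennreal (tail_length z1 z2 v)"
        proof (cases "v \<in> ?U")
          case True
          then have v: "0 < fst v" "0 < snd v" by (auto simp: cross_region_def)
          then have t0: "0 \<le> tail_length z1 z2 v" using z
            by (auto simp: tail_length_def intro!: divide_nonneg_nonneg mult_nonneg_nonneg add_nonneg_nonneg)
          have gd0: "0 \<le> gauss_density x" if "0 < x" for x using that by (simp add: gauss_density_def)
          have "(\<integral>\<^sup>+x. ?f (fst v, snd v, x) \<partial>lborel) = (\<integral>\<^sup>+x. ennreal (tail_length z1 z2 v) * (indicator {0<..<1} x * ennreal (gauss_density x)) \<partial>lborel)"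
            using True t0 by (intro nn_integral_cong) (auto simp: indicator_def ennreal_mult gd0)
          also have "\<dots> = ennreal (tail_length z1 z2 v) * (\<integral>\<^sup>+x. indicator {0<..<1} x * ennreal (gauss_density x) \<partial>lborel)"
            by (rule nn_integral_cmult) (unfold gauss_density_def, measurable)
          finally show ?thesis using True by (simp add: nn_integral_gauss_density)
        qed simp
      qed
      finally show ?thesis .
    qed
    \<comment> \<open>The factor \<open>1 + 1 / R\<close> from \<open>gauss_measure_cylinder\<close>
      costs at most \<open>1 / R\<close>, since the union has measure at most 1.\<close>
    also have "liminf (\<lambda>i. \<integral>\<^sup>+x. ?f x \<partial>point_measure_on (1 / R i ^ 2) (?P i) (words e {0<..<1})) \<le> liminf (\<lambda>i. emeasure gauss_measure (A e i) + ennreal (1 / R i))"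
    proof (rule Liminf_mono)
      have "\<forall>\<^sub>F i in sequentially. 0 < R i" using R by (auto simp: filterlim_at_top_dense)
      then show "\<forall>\<^sub>F i in sequentially. (\<integral>\<^sup>+x. ?f x \<partial>point_measure_on (1 / R i ^ 2) (?P i) (words e {0<..<1})) \<le> emeasure gauss_measure (A e i) + ennreal (1 / R i)"
      proof eventually_elim
        case (elim i)
        let ?S = "{w \<in> words e {0<..<1}. scaled_den (R i) w \<in> ?U}"
        have "(\<integral>\<^sup>+x. ?f x \<partial>point_measure_on (1 / R i ^ 2) (?P i) (words e {0<..<1})) = ennreal (1 / R i ^ 2) * (\<integral>\<^sup>+w. ?f (?P i w) \<partial>count_space (words e {0<..<1}))"
          by (rule nn_integral_point_measure_on[OF fm])
        also have "\<dots> = (\<integral>\<^sup>+w. ennreal (1 / R i ^ 2) * ?f (?P i w) \<partial>count_space (words e {0<..<1}))"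
          by (rule nn_integral_cmult[symmetric]) simp
        also have "\<dots> \<le> (\<integral>\<^sup>+w. ennreal (1 + 1 / R i) * (emeasure gauss_measure (cf_val w ` {z1<..<z2}) * indicator ?S w) \<partial>count_space (words e {0<..<1}))"
        proof (rule nn_integral_mono)
          fix w assume "w \<in> space (count_space (words e {0<..<1}))"
          then have w: "w \<in> words e {0<..<1}" "0 \<notin> set w" "cf_val w 0 \<in> {0<..<1}" by (auto simp: words_def)
          show "ennreal (1 / R i ^ 2) * ?f (?P i w) \<le> ennreal (1 + 1 / R i) * (emeasure gauss_measure (cf_val w ` {z1<..<z2}) * indicator ?S w)"
          proof (cases "scaled_den (R i) w \<in> ?U")
            case True
            then have "R i < real (snd (cf_den w))" using elim by (auto simp: cross_region_def scaled_den_def)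
            then have "ennreal (gauss_density (cf_val w 0) * \<bar>cf_val w z2 - cf_val w z1\<bar>) \<le> ennreal (1 + 1 / R i) * emeasure gauss_measure (cf_val w ` {z1<..<z2})"
              using elim z by (intro gauss_measure_cylinder w) auto
            moreover have "ennreal (1 / R i ^ 2) * ?f (?P i w) = ennreal (gauss_density (cf_val w 0) * \<bar>cf_val w z2 - cf_val w z1\<bar>)"
            proof -
              have "?f (?P i w) = ennreal (tail_length z1 z2 (scaled_den (R i) w) * gauss_density (cf_val w 0))"
                using True w by simp
              moreover have "1 / R i ^ 2 * (tail_length z1 z2 (scaled_den (R i) w) * gauss_density (cf_val w 0)) = gauss_density (cf_val w 0) * \<bar>cf_val w z2 - cf_val w z1\<bar>"
                unfolding tail_length_scaled[OF w(2) elim z(1,2), symmetric] by simp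
              ultimately show ?thesis by (subst \<open>?f (?P i w) = _\<close>, subst ennreal_mult'[symmetric]) auto
            qed
            ultimately show ?thesis using True w by simp
          qed simp
        qed
        also have "\<dots> = ennreal (1 + 1 / R i) * (\<integral>\<^sup>+w. emeasure gauss_measure (cf_val w ` {z1<..<z2}) * indicator ?S w \<partial>count_space (words e {0<..<1}))"
          by (rule nn_integral_cmult) simp
        also have "(\<integral>\<^sup>+w. emeasure gauss_measure (cf_val w ` {z1<..<z2}) * indicator ?S w \<partial>count_space (words e {0<..<1})) = (\<integral>\<^sup>+w. emeasure gauss_measure (cf_val w ` {z1<..<z2}) \<partial>count_space ?S)"
          by (subst nn_integral_count_space_indicator, simp, subst (2) nn_integral_count_space_indicator, simp)
             (auto intro!: nn_integral_cong simp: indicator_def)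
        also have "\<dots> = emeasure gauss_measure (A e i)"
          unfolding A_def
        proof (rule emeasure_UN_countable[symmetric])
          show "cf_val w ` {z1<..<z2} \<in> sets gauss_measure" if "w \<in> ?S" for w
          proof -
            have "0 \<notin> set w" using that by (simp add: words_def)
            then show ?thesis by (simp add: cf_val_image_interval z(1,2))
          qed
          \<comment> \<open>A common point of two pieces has one renewal index, so both words have
            the same length; its digits then determine the word.\<close>
          show "disjoint_family_on (\<lambda>w. cf_val w ` {z1<..<z2}) ?S"
            unfolding disjoint_family_on_def
          proof (intro ballI impI, rule ccontr)
            fix v w assume v: "v \<in> ?S" and w: "w \<in> ?S" and "v \<noteq> w"
              and "cf_val v ` {z1<..<z2} \<inter> cf_val w ` {z1<..<z2} \<noteq> {}"
            then obtain s t where st: "s \<in> {z1<..<z2}" "t \<in> {z1<..<z2}" "cf_val v s = cf_val w t" by blast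
            have vw: "v \<in> words e {0<..<1}" "scaled_den (R i) v \<in> ?U" "w \<in> words e {0<..<1}" "scaled_den (R i) w \<in> ?U"
              using v w by blast+
            have ri: "renewal_index (R i) (cf_val v s) = length v" "renewal_index (R i) (cf_val w t) = length w"
              by (rule conjunct1[OF key[OF vw(1,2) st(1) refl elim]], rule conjunct1[OF key[OF vw(3,4) st(2) refl elim]])
            have len: "length v = length w" using ri unfolding st(3) by (rule trans[OF sym])
            moreover have "v ! j = w ! j" if "j < length v" for j
            proof -
              have "0 \<notin> set v" "0 \<notin> set w" using vw by (auto simp: words_def)
              moreover have "s \<in> {0<..<1}" "t \<in> {0<..<1}" using st(1,2) z by auto
              moreover have "j < length w" using that len by simp
              ultimately have "cf_digit (cf_val v s) (length v - j) = v ! j" "cf_digit (cf_val w t) (length w - j) = w ! j"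
                using that by (simp_all add: cf_digit_cf_val del: cf_digit.simps)
              then show ?thesis unfolding len st(3) by (rule trans[OF sym])
            qed
            ultimately show False using \<open>v \<noteq> w\<close> by (auto simp: list_eq_iff_nth_eq)
          qed
        qed simp
        also have "ennreal (1 + 1 / R i) * emeasure gauss_measure (A e i) \<le> emeasure gauss_measure (A e i) + ennreal (1 / R i)"
        proof -
          have "emeasure gauss_measure (A e i) \<le> 1" by (rule prob_space.emeasure_le_1[OF gauss_measure_prob])
          then have "ennreal (1 / R i) * emeasure gauss_measure (A e i) \<le> ennreal (1 / R i) * 1" by (intro mult_left_mono) auto
          then show ?thesis using elim by (simp add: distrib_right add_left_mono)
        qed
        finally show ?case .
      qed
    qed
    finally have "ennreal \<theta> * ?I \<le> liminf (\<lambda>i. emeasure gauss_measure (A e i) + ennreal (1 / R i))" .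
    moreover have "(\<lambda>i. 1 / R i) \<longlonglongrightarrow> 0"
      by (intro tendsto_divide_0[OF tendsto_const] filterlim_at_top_imp_at_infinity R)
    ultimately show ?thesis by (rule liminf_add_null[rotated])
  qed
  have "emeasure (limit_measure k) ({b1<..<b2} \<times> {d}) \<le> ennreal (2 * \<theta>) * ?I"
    by (rule limit_measure_event_le[OF d pos(1) z(4) z(1,2,3)])
  also have "\<dots> = ennreal \<theta> * ?I + ennreal \<theta> * ?I"
  proof -
    have "ennreal (2 * \<theta>) = ennreal \<theta> + ennreal \<theta>" using theta_pos by (simp flip: ennreal_plus)
    then show ?thesis by (simp only: distrib_right)
  qed
  also have "\<dots> \<le> liminf (\<lambda>i. emeasure gauss_measure (A True i)) + liminf (\<lambda>i. emeasure gauss_measure (A False i))"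
    by (intro add_mono half)
  also have "\<dots> \<le> liminf (\<lambda>i. emeasure gauss_measure (A True i) + emeasure gauss_measure (A False i))" by (rule liminf_add_ennreal)
  also have "\<dots> \<le> liminf (\<lambda>i. emeasure (gauss_law k (R i)) ({b1<..<b2} \<times> {d}))"
  proof (rule Liminf_mono)
    have "\<forall>\<^sub>F i in sequentially. 0 < R i" using R by (auto simp: filterlim_at_top_dense)
    then show "\<forall>\<^sub>F i in sequentially. emeasure gauss_measure (A True i) + emeasure gauss_measure (A False i) \<le> emeasure (gauss_law k (R i)) ({b1<..<b2} \<times> {d})"
    proof eventually_elim
      case (elim i)
      have par: "even (renewal_index (R i) x) = e" "x \<in> ?ev i" if xA: "x \<in> A e i" for x e
      proof -
        obtain w t where w: "w \<in> words e {0<..<1}" "scaled_den (R i) w \<in> ?U" "t \<in> {z1<..<z2}" "x = cf_val w t"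
          using xA unfolding A_def by blast
        show "even (renewal_index (R i) x) = e" "x \<in> ?ev i" using key[OF w elim] w(1) by (auto simp: words_def)
      qed
      have "emeasure gauss_measure (A True i) + emeasure gauss_measure (A False i) = emeasure gauss_measure (A True i \<union> A False i)"
      proof (rule plus_emeasure)
        show "A True i \<inter> A False i = {}" using par(1) by (metis disjoint_iff)
      qed (use Am in simp_all)
      also have "\<dots> \<le> emeasure gauss_measure (?ev i)"
        using par(2) measurable_sets[OF cf_local_measurable' box_event_measurable, of k "R i" b1 b2 d]
        by (intro emeasure_mono) auto
      also have "\<dots> = emeasure (gauss_law k (R i)) ({b1<..<b2} \<times> {d})"
        unfolding gauss_law_def by (subst emeasure_distr) (auto simp: box_event_measurable)
      finally show ?case .
    qed
  qed
  finally show ?thesis .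
qed

theorem gauss_law_converges: "weakly_converges (gauss_law k) (limit_measure k) at_top"
  unfolding weakly_converges_def
proof (intro allI impI, rule tendsto_at_topI_sequentially)
  fix f :: "real \<times> (int \<Rightarrow> nat) \<Rightarrow> real" and R :: "nat \<Rightarrow> real"
  assume f: "continuous_on UNIV f" "bounded (range f)" and R: "filterlim R at_top sequentially"
  show "(\<lambda>n. integral\<^sup>L (gauss_law k (R n)) f) \<longlonglongrightarrow> integral\<^sup>L (limit_measure k) f"
    by (rule tendsto_integral_from_cells[OF limit_measure_prob gauss_law_prob limit_measure_trunc gauss_law_trunc limit_measure_noatom _ f])
      (rule gauss_law_event[OF R])
qed

text \<open>The description by \<open>THE\<close> gets its value: the explicit measure is a weak
  limit, and two weak limits integrate all bounded continuous functions alike.\<close>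

theorem limit_law_eq: "limit_law k = limit_measure k"
  unfolding limit_law_def
proof (rule the_equality)
  show "prob_space (limit_measure k) \<and> sets (limit_measure k) = sets borel \<and> weakly_converges (gauss_law k) (limit_measure k) at_top"
    using limit_measure_prob gauss_law_converges by blast
  fix M assume M: "prob_space M \<and> sets M = sets borel \<and> weakly_converges (gauss_law k) M at_top"
  show "M = limit_measure k"
  proof (rule weak_limit_unique)
    fix f :: "real \<times> (int \<Rightarrow> nat) \<Rightarrow> real"
    assume f: "continuous_on UNIV f" "bounded (range f)"
    have "((\<lambda>R. integral\<^sup>L (gauss_law k R) f) \<longlongrightarrow> integral\<^sup>L M f) at_top"
      "((\<lambda>R. integral\<^sup>L (gauss_law k R) f) \<longlongrightarrow> integral\<^sup>L (limit_measure k) f) at_top"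
      using M gauss_law_converges f unfolding weakly_converges_def by blast+
    then show "integral\<^sup>L M f = integral\<^sup>L (limit_measure k) f" using tendsto_unique by (metis trivial_limit_at_top_linorder)
  qed (use M limit_measure_prob in auto)
qed

section \<open>Triples as framed words\<close>

definition good_quadruples :: "nat \<Rightarrow> int \<Rightarrow> int \<Rightarrow> (int \<times> int \<times> int \<times> int) set"
  where "good_quadruples W q q' = {(u, v, s, t). u \<in> {0..<int W} \<and> v \<in> {0..<int W} \<and> s \<in> {0..<int W} \<and> t \<in> {0..<int W} \<and>
    gcd (gcd (q * s + q' * t) (q * u + q' * v)) (int W) = 1}"

lemma finite_good_quadruples: "finite (good_quadruples W q q')"
  by (rule finite_subset[of _ "{0..<int W} \<times> {0..<int W} \<times> {0..<int W} \<times> {0..<int W}"]) (auto simp: good_quadruples_def)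

text \<open>The basis change is unimodular, hence invertible modulo \<open>W\<close>, so
  \<open>(u, v)\<close> and \<open>(s, t)\<close> may be replaced by the vectors they stand for. The
  first entries of these have to form a good residue; the second entries are free and contribute
  \<open>W^2\<close>.\<close>

lemma card_good_quadruples:
  fixes p p' q q' :: int
  assumes det: "p * q' - p' * q = \<epsilon>" "\<epsilon> * \<epsilon> = 1" and W: "0 < W"
  shows "W ^ 2 * card (good_residues W) \<le> card (good_quadruples W q q')"
proof -
  \<comment> \<open>\<open>U\<close> and \<open>V\<close> invert the matrix with rows
    \<open>(q, q')\<close> and \<open>(p, p')\<close> modulo \<open>W\<close>. Its determinant is
    \<epsilon> up to sign, and \<epsilon> is its own inverse.\<close>
  define U where "U x y = (- \<epsilon> * (p' * x - q' * y)) mod int W" for x y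
  define V where "V x y = (- \<epsilon> * (q * y - p * x)) mod int W" for x y
  have x: "(q * U x y + q' * V x y) mod int W = x mod int W" for x y
  proof -
    have "(q * U x y + q' * V x y) mod int W = (q * (- \<epsilon> * (p' * x - q' * y)) + q' * (- \<epsilon> * (q * y - p * x))) mod int W"
      unfolding U_def V_def by (metis (no_types) mod_add_cong mod_mult_right_eq)
    also have "q * (- \<epsilon> * (p' * x - q' * y)) + q' * (- \<epsilon> * (q * y - p * x)) = \<epsilon> * (p * q' - p' * q) * x"
      by (simp add: algebra_simps)
    finally show ?thesis by (simp add: det)
  qed
  have y: "(p * U x y + p' * V x y) mod int W = y mod int W" for x y
  proof -
    have "(p * U x y + p' * V x y) mod int W = (p * (- \<epsilon> * (p' * x - q' * y)) + p' * (- \<epsilon> * (q * y - p * x))) mod int W"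
      unfolding U_def V_def by (metis (no_types) mod_add_cong mod_mult_right_eq)
    also have "p * (- \<epsilon> * (p' * x - q' * y)) + p' * (- \<epsilon> * (q * y - p * x)) = \<epsilon> * (p * q' - p' * q) * y"
      by (simp add: algebra_simps)
    finally show ?thesis by (simp add: det)
  qed
  let ?T = "good_residues W \<times> ({0..<int W} \<times> {0..<int W})"
  let ?h = "\<lambda>((x3, x1), (y1, y3)). (U x1 y1, V x1 y1, U x3 y3, V x3 y3)"
  have "inj_on ?h ?T"
  proof (rule inj_onI)
    fix a b assume a: "a \<in> ?T" and b: "b \<in> ?T" and eq: "?h a = ?h b"
    obtain x3 x1 y1 y3 where a': "a = ((x3, x1), (y1, y3))" by (cases a) auto
    obtain x3' x1' y1' y3' where b': "b = ((x3', x1'), (y1', y3'))" by (cases b) auto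
    have e: "U x1 y1 = U x1' y1'" "V x1 y1 = V x1' y1'" "U x3 y3 = U x3' y3'" "V x3 y3 = V x3' y3'"
      using eq a' b' by auto
    have r: "x3 \<in> {0..<int W}" "x1 \<in> {0..<int W}" "y1 \<in> {0..<int W}" "y3 \<in> {0..<int W}"
      "x3' \<in> {0..<int W}" "x1' \<in> {0..<int W}" "y1' \<in> {0..<int W}" "y3' \<in> {0..<int W}"
      using a b a' b' by (auto simp: good_residues_def)
    have "x1 mod int W = x1' mod int W" "y1 mod int W = y1' mod int W" "x3 mod int W = x3' mod int W" "y3 mod int W = y3' mod int W"
      using x[of x1 y1] x[of x1' y1'] y[of x1 y1] y[of x1' y1'] x[of x3 y3] x[of x3' y3'] y[of x3 y3] y[of x3' y3'] unfolding e by simp_all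
    then show "a = b" using r a' b' by simp
  qed
  then have "card ?T = card (?h ` ?T)" by (rule card_image[symmetric])
  also have "\<dots> \<le> card (good_quadruples W q q')"
  proof (rule card_mono[OF finite_good_quadruples])
    show "?h ` ?T \<subseteq> good_quadruples W q q'"
    proof safe
      fix x3 x1 y1 y3 assume g: "(x3, x1) \<in> good_residues W" "y1 \<in> {0..<int W}" "y3 \<in> {0..<int W}"
      have "gcd (gcd (q * U x3 y3 + q' * V x3 y3) (q * U x1 y1 + q' * V x1 y1)) (int W)
        = gcd (gcd ((q * U x3 y3 + q' * V x3 y3) mod int W) ((q * U x1 y1 + q' * V x1 y1) mod int W)) (int W)"
        by (rule gcd_mod_both[symmetric])
      also have "\<dots> = gcd (gcd x3 x1) (int W)" unfolding x by (rule gcd_mod_both)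
      also have "\<dots> = 1" using g(1) by (simp add: good_residues_def)
      finally show "(U x1 y1, V x1 y1, U x3 y3, V x3 y3) \<in> good_quadruples W q q'"
        using W by (simp add: good_quadruples_def U_def V_def)
    qed
  qed
  finally show ?thesis by (simp add: card_cartesian_product power2_eq_square mult.commute)
qed

definition quad_points :: "nat \<Rightarrow> int \<Rightarrow> int \<Rightarrow> real \<times> real \<Rightarrow> real \<times> real \<Rightarrow> real \<times> real \<Rightarrow> real \<times> real \<Rightarrow> (int \<times> int \<times> int \<times> int) set"
  where "quad_points W q q' I1 I2 I3 I4 = {(u, v, s, t).
    of_int u \<in> {fst I1<..<snd I1} \<and> of_int v \<in> {fst I2<..<snd I2} \<and> of_int s \<in> {fst I3<..<snd I3} \<and> of_int t \<in> {fst I4<..<snd I4} \<and>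
    gcd (gcd (q * s + q' * t) (q * u + q' * v)) (int W) = 1}"

lemma card_quad_points:
  fixes p p' q q' :: int
  assumes det: "p * q' - p' * q = \<epsilon>" "\<epsilon> * \<epsilon> = 1" and W: "0 < W"
    and I: "1 \<le> (snd I1 - fst I1) / W" "1 \<le> (snd I2 - fst I2) / W" "1 \<le> (snd I3 - fst I3) / W" "1 \<le> (snd I4 - fst I4) / W"
  shows "real W ^ 2 * real (card (good_residues W)) * (((snd I1 - fst I1) / W - 1) * (((snd I2 - fst I2) / W - 1) *
     (((snd I3 - fst I3) / W - 1) * ((snd I4 - fst I4) / W - 1)))) \<le> real (card (quad_points W q q' I1 I2 I3 I4))"
    and "finite (quad_points W q q' I1 I2 I3 I4)"
proof -
  let ?A = "\<lambda>I c. residue_class (fst I) (snd I) W c"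
  let ?X = "\<lambda>(u, v, s, t). ?A I1 u \<times> ?A I2 v \<times> ?A I3 s \<times> ?A I4 t"
  let ?c = "((snd I1 - fst I1) / W - 1) * (((snd I2 - fst I2) / W - 1) *
     (((snd I3 - fst I3) / W - 1) * ((snd I4 - fst I4) / W - 1)))"
  have finX: "finite (?X r)" if "r \<in> good_quadruples W q q'" for r
    using that residue_class_card(3)[OF W] by (auto simp: good_quadruples_def)
  have "quad_points W q q' I1 I2 I3 I4 \<subseteq> {k. fst I1 < of_int k \<and> of_int k < snd I1} \<times> {k. fst I2 < of_int k \<and> of_int k < snd I2} \<times>
      {k. fst I3 < of_int k \<and> of_int k < snd I3} \<times> {k. fst I4 < of_int k \<and> of_int k < snd I4}"
    by (auto simp: quad_points_def)
  then show fin: "finite (quad_points W q q' I1 I2 I3 I4)"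
    by (rule finite_subset) (intro finite_cartesian_product card_int_open_interval)
  have sub: "(\<Union>r\<in>good_quadruples W q q'. ?X r) \<subseteq> quad_points W q q' I1 I2 I3 I4"
  proof
    fix x assume "x \<in> (\<Union>r\<in>good_quadruples W q q'. ?X r)"
    then obtain u v s t a b c d where g: "(u, v, s, t) \<in> good_quadruples W q q'" and x: "x = (a, b, c, d)"
      and m: "a \<in> ?A I1 u" "b \<in> ?A I2 v" "c \<in> ?A I3 s" "d \<in> ?A I4 t" by auto
    have "gcd (gcd (q * c + q' * d) (q * a + q' * b)) (int W) = gcd (gcd ((q * c + q' * d) mod int W) ((q * a + q' * b) mod int W)) (int W)"
      by (rule gcd_mod_both[symmetric])
    also have "(q * c + q' * d) mod int W = (q * s + q' * t) mod int W"
    proof -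
      have "c mod int W = s" "d mod int W = t" using m(3,4) by (simp_all add: residue_class_def)
      then show ?thesis by (metis mod_add_cong mod_mult_right_eq)
    qed
    also have "(q * a + q' * b) mod int W = (q * u + q' * v) mod int W"
    proof -
      have "a mod int W = u" "b mod int W = v" using m(1,2) by (simp_all add: residue_class_def)
      then show ?thesis by (metis mod_add_cong mod_mult_right_eq)
    qed
    also have "gcd (gcd ((q * s + q' * t) mod int W) ((q * u + q' * v) mod int W)) (int W) = gcd (gcd (q * s + q' * t) (q * u + q' * v)) (int W)"
      by (rule gcd_mod_both)
    also have "\<dots> = 1" using g by (simp add: good_quadruples_def)
    finally show "x \<in> quad_points W q q' I1 I2 I3 I4" using x m by (simp add: quad_points_def residue_class_def)
  qed
  have "card (\<Union>r\<in>good_quadruples W q q'. ?X r) = (\<Sum>r\<in>good_quadruples W q q'. card (?X r))"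
  proof (rule card_UN_disjoint[OF finite_good_quadruples])
    show "\<forall>i\<in>good_quadruples W q q'. \<forall>j\<in>good_quadruples W q q'. i \<noteq> j \<longrightarrow> ?X i \<inter> ?X j = {}"
    proof (intro ballI impI, rule ccontr)
      fix i j :: "int \<times> int \<times> int \<times> int" assume "i \<noteq> j" "?X i \<inter> ?X j \<noteq> {}"
      moreover obtain u v s t where "i = (u, v, s, t)" by (cases i) auto
      moreover obtain u' v' s' t' where "j = (u', v', s', t')" by (cases j) auto
      ultimately show False by (auto simp: residue_class_def)
    qed
  qed (use finX in blast)
  then have c: "real (\<Sum>r\<in>good_quadruples W q q'. card (?X r)) \<le> real (card (quad_points W q q' I1 I2 I3 I4))"
    unfolding of_nat_le_iff using card_mono[OF fin sub] by (simp only:)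
  have "?c \<le> real (card (?X r))" if r: "r \<in> good_quadruples W q q'" for r
  proof -
    obtain u v s t where uv: "r = (u, v, s, t)" by (cases r) auto
    have rng: "u \<in> {0..<int W}" "v \<in> {0..<int W}" "s \<in> {0..<int W}" "t \<in> {0..<int W}" using r uv by (auto simp: good_quadruples_def)
    have "?c \<le> real (card (?A I1 u)) * (real (card (?A I2 v)) * (real (card (?A I3 s)) * real (card (?A I4 t))))"
      using I rng by (intro mult_mono residue_class_card(1)[OF W] mult_nonneg_nonneg) auto
    then show ?thesis using uv by (simp add: card_cartesian_product)
  qed
  then have 1: "real (card (good_quadruples W q q')) * ?c \<le> (\<Sum>r\<in>good_quadruples W q q'. real (card (?X r)))"
    by (rule sum_bounded_below)
  have 2: "real (W ^ 2 * card (good_residues W)) * ?c \<le> real (card (good_quadruples W q q')) * ?c"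
    using I by (intro mult_right_mono of_nat_mono card_good_quadruples[OF det W] mult_nonneg_nonneg) auto
  show "real W ^ 2 * real (card (good_residues W)) * ?c \<le> real (card (quad_points W q q' I1 I2 I3 I4))"
    using order_trans[OF 2 order_trans[OF 1 c[unfolded of_nat_sum]]] unfolding of_nat_mult of_nat_power .
qed

text \<open>All solutions \<open>m\<close> of \<open>a1 * m = a2\<close> modulo \<open>a3\<close>
  are kept: without coprimality the triple does not determine \<open>m\<close>, and distinct frames
  may share a triple.\<close>

definition bad_quadruples :: "nat \<Rightarrow> nat \<Rightarrow> (int \<times> int \<times> int \<times> int) set"
  where "bad_quadruples P N = {(a1, a2, a3, m). a1 \<in> {1..int N} \<and> a2 \<in> {1..int N} \<and> a3 \<in> {1..int N} \<and>
    m \<in> {0..<a3} \<and> a3 dvd a1 * m - a2 \<and> (\<exists>g>int P. g dvd a1 \<and> g dvd a3)}"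

lemma finite_bad_quadruples: "finite (bad_quadruples P N)"
  by (rule finite_subset[of _ "{1..int N} \<times> {1..int N} \<times> {1..int N} \<times> {0..<int N}"]) (auto simp: bad_quadruples_def)

text \<open>A common divisor \<open>g\<close> of \<open>a\<^sub>1\<close> and \<open>a\<^sub>3\<close> also divides \<open>a\<^sub>2\<close>, which saves a factor \<open>g\<^sup>3\<close>, of
  which the \<open>g\<close> lifts of \<open>m\<close> take back only one.\<close>

lemma card_bad_quadruples:
  assumes P: "0 < P" shows "real (card (bad_quadruples P N)) \<le> 3 * real N ^ 3 / P"
proof -
  define Y where "Y g = int (N div g)" for g
  let ?B = "\<lambda>g b1 b3 m. {b2. b2 \<in> {1..Y g} \<and> b3 dvd b1 * m - b2}"
  let ?X = "\<lambda>g. (\<lambda>(b1, b3, m, b2). (int g * b1, int g * b2, int g * b3, m)) `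
    (SIGMA b1:{1..Y g}. SIGMA b3:{1..Y g}. SIGMA m:{0..<int g * b3}. ?B g b1 b3 m)"
  have sub: "bad_quadruples P N \<subseteq> (\<Union>g\<in>{P<..N}. ?X g)"
  proof
    fix x assume "x \<in> bad_quadruples P N"
    then obtain a1 a2 a3 m g where x: "x = (a1, a2, a3, m)" "a1 \<in> {1..int N}" "a2 \<in> {1..int N}" "a3 \<in> {1..int N}"
      "m \<in> {0..<a3}" "a3 dvd a1 * m - a2" and g: "int P < g" "g dvd a1" "g dvd a3"
      by (auto simp: bad_quadruples_def)
    define h where "h = nat g"
    have h: "g = int h" "0 < int h" using g by (simp_all add: h_def)
    have "g dvd a1 * m - a2" using g(3) x(6) by (rule dvd_trans)
    moreover have "g dvd a1 * m" using g(2) by (rule dvd_mult2)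
    ultimately have "g dvd a1 * m - (a1 * m - a2)" by (rule dvd_diff[rotated])
    then have "g dvd a2" by simp
    define b1 b2 b3 where "b1 = a1 div g" and "b2 = a2 div g" and "b3 = a3 div g"
    have ab: "a1 = int h * b1" "a2 = int h * b2" "a3 = int h * b3"
      using g \<open>g dvd a2\<close> h by (simp_all add: b1_def b2_def b3_def)
    have b: "1 \<le> b1" "1 \<le> b2" "1 \<le> b3"
      using x(2,3,4) h(2) unfolding ab by (simp_all add: zero_less_mult_iff int_one_le_iff_zero_less)
    have bY: "b1 \<le> Y h" "b2 \<le> Y h" "b3 \<le> Y h"
      using x(2,3,4) unfolding ab Y_def zdiv_int le_zdiv_iff[OF h(2)] by auto
    have "int h * b3 dvd int h * (b1 * m - b2)" using x(6) unfolding ab by (simp add: algebra_simps)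
    then have dv: "b3 dvd b1 * m - b2" using h by simp
    have "g \<le> a1" using g(2) x(2) by (intro zdvd_imp_le) auto
    then have "h \<in> {P<..N}" using g(1) x(2) h by auto
    moreover have "(b1, b3, m, b2) \<in> (SIGMA b1:{1..Y h}. SIGMA b3:{1..Y h}. SIGMA m:{0..<int h * b3}. ?B h b1 b3 m)"
      using b bY dv x(5) unfolding ab by auto
    moreover have "x = (\<lambda>(b1, b3, m, b2). (int h * b1, int h * b2, int h * b3, m)) (b1, b3, m, b2)"
      unfolding x(1) ab by simp
    ultimately show "x \<in> (\<Union>g\<in>{P<..N}. ?X g)" by blast
  qed
  have finB: "finite (?B g b1 b3 m)" for g b1 b3 m by (rule finite_subset[of _ "{1..Y g}"]) auto
  \<comment> \<open>For fixed \<open>b1\<close>, \<open>b3\<close> and \<open>m\<close>, the number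
    \<open>b2\<close> runs through a single residue class modulo \<open>b3\<close>.\<close>
  have cB: "real (card (?B g b1 b3 m)) \<le> real_of_int (Y g) / real_of_int b3 + 1 + 1 / real_of_int b3" if "1 \<le> b3" for g b1 b3 m
  proof -
    define W where "W = nat b3"
    have W: "0 < W" "b3 = int W" using that by (auto simp: W_def)
    have "?B g b1 b3 m \<subseteq> residue_class 0 (real_of_int (Y g) + 1) W (b1 * m mod int W)"
      unfolding W(2) by (auto simp: residue_class_def mod_eq_dvd_iff[symmetric] dest: dvd_diff_commute[THEN iffD1])
    then have "card (?B g b1 b3 m) \<le> card (residue_class 0 (real_of_int (Y g) + 1) W (b1 * m mod int W))"
      using W by (intro card_mono residue_class_card(3)) auto
    also have "real \<dots> \<le> (real_of_int (Y g) + 1 - 0) / W + 1"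
      using W by (intro residue_class_card(2)) (auto simp: Y_def)
    finally show ?thesis using W by (simp add: add_divide_distrib)
  qed
  have cX: "real (card (?X g)) \<le> 3 * real N ^ 3 * (1 / real g ^ 2)" if g: "g \<in> {P<..N}" for g
  proof -
    have g0: "0 < real g" "0 < g" using g by auto
    have Y0: "0 \<le> real_of_int (Y g)" by (simp add: Y_def)
    have "card (?X g) \<le> card (SIGMA b1:{1..Y g}. SIGMA b3:{1..Y g}. SIGMA m:{0..<int g * b3}. ?B g b1 b3 m)"
      using finB by (intro card_image_le finite_SigmaI) auto
    also have "\<dots> = (\<Sum>b1\<in>{1..Y g}. \<Sum>b3\<in>{1..Y g}. \<Sum>m\<in>{0..<int g * b3}. card (?B g b1 b3 m))"
      using finB by (simp add: card_SigmaI finite_SigmaI)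
    finally have "real (card (?X g)) \<le> (\<Sum>b1\<in>{1..Y g}. \<Sum>b3\<in>{1..Y g}. \<Sum>m\<in>{0..<int g * b3}. real (card (?B g b1 b3 m)))"
      by (simp flip: of_nat_sum)
    \<comment> \<open>There are \<open>g * b3\<close> values of \<open>m\<close>, and
      \<open>b3\<close> and 1 are at most \<open>Y g\<close>. So
      \<open>Y g + b3 + 1 <= 3 * Y g\<close>, the origin of the constant 3.\<close>
    also have "\<dots> \<le> (\<Sum>b1\<in>{1..Y g}. \<Sum>b3\<in>{1..Y g}. 3 * real g * real_of_int (Y g))"
    proof (intro sum_mono)
      fix b1 b3 assume b: "b1 \<in> {1..Y g}" "b3 \<in> {1..Y g}"
      then have b': "1 \<le> real_of_int b3" "real_of_int b3 \<le> real_of_int (Y g)" "1 \<le> real_of_int (Y g)" by auto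
      have "(\<Sum>m\<in>{0..<int g * b3}. real (card (?B g b1 b3 m))) \<le> (\<Sum>m\<in>{0..<int g * b3}. real_of_int (Y g) / real_of_int b3 + 1 + 1 / real_of_int b3)"
        using b by (intro sum_mono cB) auto
      also have "\<dots> = real g * real_of_int b3 * (real_of_int (Y g) / real_of_int b3 + 1 + 1 / real_of_int b3)"
        using b g0 by (simp add: nat_mult_distrib)
      also have "\<dots> = real g * (real_of_int (Y g) + real_of_int b3 + 1)" using b' by (simp add: field_simps)
      also have "\<dots> \<le> real g * (3 * real_of_int (Y g))" using b' g0 by (intro mult_left_mono) auto
      finally show "(\<Sum>m\<in>{0..<int g * b3}. real (card (?B g b1 b3 m))) \<le> 3 * real g * real_of_int (Y g)" by simp
    qed
    also have "\<dots> = 3 * real g * real_of_int (Y g) ^ 3"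
      using Y0 by (simp add: power3_eq_cube mult_ac)
    also have "\<dots> \<le> 3 * real g * (real N / real g) ^ 3"
      using g0 Y0 by (intro mult_left_mono power_mono) (auto simp: Y_def of_nat_div_le_of_nat)
    also have "\<dots> = 3 * real N ^ 3 * (1 / real g ^ 2)" using g0 by (simp add: field_simps power3_eq_cube power2_eq_square)
    finally show ?thesis .
  qed
  have "real (card (bad_quadruples P N)) \<le> real (card (\<Union>g\<in>{P<..N}. ?X g))"
    using finB by (intro of_nat_mono card_mono sub finite_UN_I finite_imageI finite_SigmaI) auto
  also have "\<dots> \<le> (\<Sum>g\<in>{P<..N}. real (card (?X g)))"
    unfolding of_nat_sum[symmetric] by (intro of_nat_mono card_UN_le) simp
  also have "\<dots> \<le> (\<Sum>g\<in>{P<..N}. 3 * real N ^ 3 * (1 / real g ^ 2))" by (intro sum_mono cX)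
  also have "\<dots> = 3 * real N ^ 3 * (\<Sum>g\<in>{P<..N}. 1 / real g ^ 2)" by (simp add: sum_distrib_left)
  also have "\<dots> \<le> 3 * real N ^ 3 * (1 / real P)"
    using sum_inverse_squares_tail[OF P, of N] by (intro mult_left_mono) auto
  finally show ?thesis by simp
qed

section \<open>The volume of the limiting region\<close>

lemma nn_integral_real_affine_scaled:
  fixes f :: "real \<Rightarrow> ennreal"
  assumes [measurable]: "f \<in> borel_measurable borel" and c: "0 < c"
  shows "(\<integral>\<^sup>+x. f (c * x + b) \<partial>lborel) = ennreal (1 / c) * (\<integral>\<^sup>+x. f x \<partial>lborel)"
proof -
  have "(\<integral>\<^sup>+x. f x \<partial>lborel) = ennreal c * (\<integral>\<^sup>+x. f (c * x + b) \<partial>lborel)"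
    using nn_integral_real_affine[of f c b] c by (simp add: add.commute)
  then have "ennreal (1 / c) * (\<integral>\<^sup>+x. f x \<partial>lborel) = ennreal (1 / c * c) * (\<integral>\<^sup>+x. f (c * x + b) \<partial>lborel)"
    using c by (simp only: ennreal_mult mult.assoc less_imp_le divide_nonneg_nonneg zero_le_one)
  then show ?thesis using c by simp
qed

text \<open>A linear substitution of determinant \<open>y * a + x * b\<close>, done as two affine
  substitutions in one variable with the order of integration exchanged in between.\<close>

lemma nn_integral_linear_map:
  fixes f :: "real \<times> real \<Rightarrow> ennreal" and x y a b :: real
  assumes f: "f \<in> borel_measurable borel" and pos: "0 < y" "0 < y * a + x * b"
  shows "(\<integral>\<^sup>+r. f (y * fst r + x * snd r, a * snd r - b * fst r) \<partial>lborel) = ennreal (1 / (y * a + x * b)) * (\<integral>\<^sup>+r. f r \<partial>lborel)"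
proof -
  have [measurable]: "f \<in> borel_measurable (borel \<Otimes>\<^sub>M borel)" using f by (simp add: borel_prod)
  have c: "(y * a + x * b) / y > 0" using pos by simp
  have "(\<integral>\<^sup>+r. f (y * fst r + x * snd r, a * snd r - b * fst r) \<partial>lborel)
     = (\<integral>\<^sup>+r. f (y * fst r + x * snd r, a * snd r - b * fst r) \<partial>(lborel \<Otimes>\<^sub>M lborel))" by (simp only: lborel_prod)
  also have "\<dots> = (\<integral>\<^sup>+t. \<integral>\<^sup>+s. f (y * s + x * t, a * t - b * s) \<partial>lborel \<partial>lborel)"
    by (subst lborel_pair.nn_integral_snd[symmetric]) simp_all
  also have "\<dots> = (\<integral>\<^sup>+t. ennreal (1 / y) * (\<integral>\<^sup>+\<sigma>. f (\<sigma>, (y * a + x * b) / y * t - b * \<sigma> / y) \<partial>lborel) \<partial>lborel)"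
  proof (rule nn_integral_cong)
    fix t
    have "y * s + x * t = y * s + x * t \<and> a * t - b * s = (y * a + x * b) / y * t - b * (y * s + x * t) / y" for s
      using pos by (simp add: field_simps)
    then have "(\<integral>\<^sup>+s. f (y * s + x * t, a * t - b * s) \<partial>lborel)
      = (\<integral>\<^sup>+s. (\<lambda>\<sigma>. f (\<sigma>, (y * a + x * b) / y * t - b * \<sigma> / y)) (y * s + x * t) \<partial>lborel)" by simp
    also have "\<dots> = ennreal (1 / y) * (\<integral>\<^sup>+\<sigma>. f (\<sigma>, (y * a + x * b) / y * t - b * \<sigma> / y) \<partial>lborel)"
      using pos by (intro nn_integral_real_affine_scaled) simp_all
    finally show "(\<integral>\<^sup>+s. f (y * s + x * t, a * t - b * s) \<partial>lborel) = ennreal (1 / y) * (\<integral>\<^sup>+\<sigma>. f (\<sigma>, (y * a + x * b) / y * t - b * \<sigma> / y) \<partial>lborel)" .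
  qed
  also have "\<dots> = ennreal (1 / y) * (\<integral>\<^sup>+t. \<integral>\<^sup>+\<sigma>. f (\<sigma>, (y * a + x * b) / y * t - b * \<sigma> / y) \<partial>lborel \<partial>lborel)"
    by (intro nn_integral_cmult) measurable
  also have "(\<integral>\<^sup>+t. \<integral>\<^sup>+\<sigma>. f (\<sigma>, (y * a + x * b) / y * t - b * \<sigma> / y) \<partial>lborel \<partial>lborel)
     = (\<integral>\<^sup>+\<sigma>. \<integral>\<^sup>+t. f (\<sigma>, (y * a + x * b) / y * t - b * \<sigma> / y) \<partial>lborel \<partial>lborel)"
    by (subst lborel_pair.Fubini') simp_all
  also have "\<dots> = (\<integral>\<^sup>+\<sigma>. ennreal (1 / ((y * a + x * b) / y)) * (\<integral>\<^sup>+t. f (\<sigma>, t) \<partial>lborel) \<partial>lborel)"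
  proof (rule nn_integral_cong)
    fix \<sigma>
    show "(\<integral>\<^sup>+t. f (\<sigma>, (y * a + x * b) / y * t - b * \<sigma> / y) \<partial>lborel) = ennreal (1 / ((y * a + x * b) / y)) * (\<integral>\<^sup>+t. f (\<sigma>, t) \<partial>lborel)"
      using nn_integral_real_affine_scaled[of "\<lambda>t. f (\<sigma>, t)" "(y * a + x * b) / y" "- (b * \<sigma> / y)"] c by simp
  qed
  also have "\<dots> = ennreal (1 / ((y * a + x * b) / y)) * (\<integral>\<^sup>+\<sigma>. \<integral>\<^sup>+t. f (\<sigma>, t) \<partial>lborel \<partial>lborel)"
    by (intro nn_integral_cmult) measurable
  also have "(\<integral>\<^sup>+\<sigma>. \<integral>\<^sup>+t. f (\<sigma>, t) \<partial>lborel \<partial>lborel) = (\<integral>\<^sup>+r. f r \<partial>lborel)"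
    using f by (subst lborel.nn_integral_fst) (simp_all add: lborel_prod)
  also have "ennreal (1 / y) * (ennreal (1 / ((y * a + x * b) / y)) * (\<integral>\<^sup>+r. f r \<partial>lborel)) = ennreal (1 / (y * a + x * b)) * (\<integral>\<^sup>+r. f r \<partial>lborel)"
    using pos c by (subst mult.assoc[symmetric], subst ennreal_mult[symmetric]) (auto simp: field_simps)
  finally show ?thesis .
qed

text \<open>With \<open>v\<close>, \<open>c\<close> and \<open>r\<close> standing for the pairs
  \<open>(q\<^sub>s\<^sub>-\<^sub>1, q\<^sub>s)\<close>, \<open>(u, v)\<close> and
  \<open>(s, t)\<close> divided by \<open>R = \<surd>N\<close>, the two expressions are
  \<open>a\<^sub>1 / N\<close> and \<open>a\<^sub>2 / N\<close>, and \<epsilon> is the sign of the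
  parity.\<close>

definition inner_square :: "real \<Rightarrow> real \<times> real \<Rightarrow> real \<times> real \<Rightarrow> (real \<times> real) set"
  where "inner_square \<epsilon> v c = {r. 0 < snd v * fst r + fst v * snd r \<and> snd v * fst r + fst v * snd r < 1 \<and>
    0 < \<epsilon> * (fst c * snd r - snd c * fst r) \<and> \<epsilon> * (fst c * snd r - snd c * fst r) < 1}"

text \<open>The region is the preimage of a unit square under a linear map whose determinant is the
  scaled \<open>a\<^sub>3\<close>.\<close>

lemma emeasure_inner_square:
  assumes "\<epsilon> * \<epsilon> = 1" "0 < snd v" "0 < snd v * fst c + fst v * snd c"
  shows "emeasure lborel (inner_square \<epsilon> v c) = ennreal (1 / (snd v * fst c + fst v * snd c))"
proof -
  let ?B = "if \<epsilon> = 1 then box (0, 0) (1, 1) else box (0, -1) (1, 0) :: (real \<times> real) set"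
  have e: "\<epsilon> = 1 \<or> \<epsilon> = -1" using assms(1) by algebra
  then have i: "r \<in> inner_square \<epsilon> v c \<longleftrightarrow> (snd v * fst r + fst v * snd r, fst c * snd r - snd c * fst r) \<in> ?B" for r
    by (auto simp: inner_square_def box_prod)
  have o: "open (inner_square \<epsilon> v c)"
    unfolding inner_square_def by (intro open_Collect_conj open_Collect_less continuous_intros)
  have "emeasure lborel (inner_square \<epsilon> v c) = (\<integral>\<^sup>+r. indicator (inner_square \<epsilon> v c) r \<partial>lborel)"
    using o by simp
  also have "\<dots> = (\<integral>\<^sup>+r. indicator ?B (snd v * fst r + fst v * snd r, fst c * snd r - snd c * fst r) \<partial>lborel)"
    by (intro nn_integral_cong) (simp only: indicator_def i)
  also have "\<dots> = ennreal (1 / (snd v * fst c + fst v * snd c)) * (\<integral>\<^sup>+r. indicator ?B r \<partial>lborel)"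
    using assms by (intro nn_integral_linear_map) auto
  also have "(\<integral>\<^sup>+r. indicator ?B r \<partial>lborel) = 1"
    by (auto simp: emeasure_lborel_box_eq Basis_prod_def)
  finally show ?thesis by simp
qed

text \<open>The last condition is \<open>a\<^sub>3 < N\<close> after scaling, and the slope
  \<open>snd c / fst c\<close> is the tail of the expansion of \<rho> after the crossing.\<close>

definition tail_cone :: "real \<Rightarrow> real \<Rightarrow> real \<times> real \<Rightarrow> (real \<times> real) set"
  where "tail_cone z1 z2 v = {c. 0 < fst c \<and> z1 * fst c < snd c \<and> snd c < z2 * fst c \<and> snd v * fst c + fst v * snd c < 1}"

text \<open>In coordinates \<open>c = (a, a * z)\<close> the Jacobian \<open>a\<close> cancels a
  factor of the denominator. The integrand \<open>1 / (snd v + fst v * z)\<close> is then free of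
  \<open>a\<close>, which runs from 0 to this same value; what remains is its square, the density of
  the tail as in \<open>state_density\<close>.\<close>

lemma nn_integral_tail_cone:
  assumes v: "0 < fst v" "0 < snd v" and z: "0 \<le> z1" "z1 < z2"
  shows "(\<integral>\<^sup>+c. indicator (tail_cone z1 z2 v) c * ennreal (1 / (snd v * fst c + fst v * snd c)) \<partial>lborel) = ennreal (tail_length z1 z2 v)"
proof -
  let ?f = "\<lambda>c :: real \<times> real. indicator (tail_cone z1 z2 v) c * ennreal (1 / (snd v * fst c + fst v * snd c))"
  have o: "open (tail_cone z1 z2 v)"
    unfolding tail_cone_def by (intro open_Collect_conj open_Collect_less continuous_intros)
  have [measurable]: "tail_cone z1 z2 v \<in> sets (borel \<Otimes>\<^sub>M borel)" unfolding borel_prod using o by simp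
  have fm: "?f \<in> borel_measurable borel"
    unfolding borel_prod[symmetric] by measurable
  then have [measurable]: "?f \<in> borel_measurable (borel \<Otimes>\<^sub>M borel)" by (simp add: borel_prod)
  have "(\<integral>\<^sup>+c. ?f c \<partial>lborel) = (\<integral>\<^sup>+c. ?f c \<partial>(lborel \<Otimes>\<^sub>M lborel))" by (simp only: lborel_prod)
  also have "\<dots> = (\<integral>\<^sup>+a. \<integral>\<^sup>+b. ?f (a, b) \<partial>lborel \<partial>lborel)"
    by (rule lborel.nn_integral_fst[symmetric]) simp
  also have "\<dots> = (\<integral>\<^sup>+a. \<integral>\<^sup>+z. ennreal a * indicator {0<..} a * ?f (a, a * z) \<partial>lborel \<partial>lborel)"
  proof (rule nn_integral_cong)
    fix a :: real
    show "(\<integral>\<^sup>+b. ?f (a, b) \<partial>lborel) = (\<integral>\<^sup>+z. ennreal a * indicator {0<..} a * ?f (a, a * z) \<partial>lborel)"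
    proof (cases "0 < a")
      case True
      have "(\<lambda>b. ?f (a, b)) \<in> borel_measurable borel"
        by (rule measurable_compose[OF _ fm]) (intro borel_measurable_continuous_onI continuous_intros)
      then have "(\<integral>\<^sup>+b. ?f (a, b) \<partial>lborel) = ennreal \<bar>a\<bar> * (\<integral>\<^sup>+z. ?f (a, 0 + a * z) \<partial>lborel)"
        using True by (intro nn_integral_real_affine[of "\<lambda>b. ?f (a, b)" a 0]) auto
      also have "\<dots> = ennreal a * (\<integral>\<^sup>+z. ?f (a, 0 + a * z) \<partial>lborel)" using True by simp
      also have "\<dots> = (\<integral>\<^sup>+z. ennreal a * ?f (a, a * z) \<partial>lborel)"
        unfolding add_0 by (rule nn_integral_cmult[symmetric]) measurable
      finally show ?thesis using True by simp
    qed (simp add: tail_cone_def)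
  qed
  also have "\<dots> = (\<integral>\<^sup>+a. \<integral>\<^sup>+z. ennreal (1 / (snd v + fst v * z)) * indicator {z1<..<z2} z * indicator {0<..<1 / (snd v + fst v * z)} a \<partial>lborel \<partial>lborel)"
  proof (intro nn_integral_cong)
    fix a z :: real
    have "a \<noteq> 0 \<Longrightarrow> (a, a * z) \<in> tail_cone z1 z2 v \<longleftrightarrow> 0 < a \<and> z \<in> {z1<..<z2} \<and> a < 1 / (snd v + fst v * z)"
    proof -
      have "0 < snd v + fst v * z" if "z1 < z" using v z that by (intro add_pos_nonneg) auto
      then show ?thesis by (auto simp: tail_cone_def field_simps)
    qed
    moreover have "a * (1 / (snd v * a + fst v * (a * z))) = 1 / (snd v + fst v * z)" if "0 < a"
    proof -
      have "snd v * a + fst v * (a * z) = a * (snd v + fst v * z)" by (simp add: algebra_simps)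
      then show ?thesis using that by simp
    qed
    ultimately show "ennreal a * indicator {0<..} a * ?f (a, a * z)
      = ennreal (1 / (snd v + fst v * z)) * indicator {z1<..<z2} z * indicator {0<..<1 / (snd v + fst v * z)} a"
      by (cases "0 < a") (auto simp: indicator_def ennreal_mult'[symmetric])
  qed
  also have "\<dots> = (\<integral>\<^sup>+z. \<integral>\<^sup>+a. ennreal (1 / (snd v + fst v * z)) * indicator {z1<..<z2} z * indicator {0<..<1 / (snd v + fst v * z)} a \<partial>lborel \<partial>lborel)"
    by (subst lborel_pair.Fubini') (simp_all add: indicator_def[abs_def])
  also have "\<dots> = (\<integral>\<^sup>+z. ennreal (1 / (snd v + fst v * z) ^ 2) * indicator {z1<..<z2} z \<partial>lborel)"
  proof (rule nn_integral_cong)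
    fix z :: real
    show "(\<integral>\<^sup>+a. ennreal (1 / (snd v + fst v * z)) * indicator {z1<..<z2} z * indicator {0<..<1 / (snd v + fst v * z)} a \<partial>lborel)
      = ennreal (1 / (snd v + fst v * z) ^ 2) * indicator {z1<..<z2} z"
    proof (cases "z \<in> {z1<..<z2}")
      case True
      then have "0 < snd v + fst v * z" using v z by (intro add_pos_nonneg) auto
      then show ?thesis using True
        by (simp add: nn_integral_cmult_indicator ennreal_mult[symmetric] power2_eq_square)
    qed simp
  qed
  also have "\<dots> = ennreal (tail_length z1 z2 v)"
    using nn_integral_inverse_square[of "fst v" "snd v" z1 z2 1] v z by simp
  finally show ?thesis .
qed

definition frame_region :: "real \<Rightarrow> nat \<Rightarrow> (int \<Rightarrow> nat) \<Rightarrow> real \<Rightarrow> real \<Rightarrow> real \<Rightarrow> real \<Rightarrow> ((real \<times> real) \<times> (real \<times> real) \<times> (real \<times> real)) set"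
  where "frame_region \<epsilon> k d b1 b2 z1 z2 =
    {x. fst x \<in> cross_region k d b1 b2 \<and> fst (snd x) \<in> tail_cone z1 z2 (fst x) \<and> snd (snd x) \<in> inner_square \<epsilon> (fst x) (fst (snd x))}"

lemma frame_region_open:
  assumes "0 \<notin> set (back_digits k d)" shows "open (frame_region \<epsilon> k d b1 b2 z1 z2)"
proof -
  have "open (fst -` cross_region k d b1 b2 :: ((real \<times> real) \<times> (real \<times> real) \<times> (real \<times> real)) set)"
    by (intro open_vimage cross_region_open assms continuous_intros)
  moreover have "open {x :: (real \<times> real) \<times> (real \<times> real) \<times> (real \<times> real). fst (snd x) \<in> tail_cone z1 z2 (fst x)}"
    unfolding tail_cone_def mem_Collect_eq by (intro open_Collect_conj open_Collect_less continuous_intros)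
  moreover have "open {x :: (real \<times> real) \<times> (real \<times> real) \<times> (real \<times> real). snd (snd x) \<in> inner_square \<epsilon> (fst x) (fst (snd x))}"
    unfolding inner_square_def mem_Collect_eq by (intro open_Collect_conj open_Collect_less continuous_intros)
  ultimately have "open (fst -` cross_region k d b1 b2 \<inter> {x. fst (snd x) \<in> tail_cone z1 z2 (fst x)} \<inter> {x. snd (snd x) \<in> inner_square \<epsilon> (fst x) (fst (snd x))})"
    by (intro open_Int)
  also have "fst -` cross_region k d b1 b2 \<inter> {x. fst (snd x) \<in> tail_cone z1 z2 (fst x)} \<inter> {x. snd (snd x) \<in> inner_square \<epsilon> (fst x) (fst (snd x))}
     = frame_region \<epsilon> k d b1 b2 z1 z2" by (auto simp: frame_region_def)
  finally show ?thesis .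
qed

text \<open>Integrating out \<open>(s, t)\<close> gives the reciprocal of the scaled
  \<open>a\<^sub>3\<close>, and integrating out \<open>(u, v)\<close> gives
  \<open>tail_length\<close>. The Gauss measure leads to the same integral, which is why the two
  limits agree.\<close>

lemma emeasure_frame_region:
  assumes pos: "0 \<notin> set (back_digits k d)" and \<epsilon>: "\<epsilon> * \<epsilon> = 1" and z: "0 \<le> z1" "z1 < z2"
  shows "emeasure lborel (frame_region \<epsilon> k d b1 b2 z1 z2)
    = (\<integral>\<^sup>+v. indicator (cross_region k d b1 b2) v * ennreal (tail_length z1 z2 v) \<partial>lborel)"
proof -
  let ?F = "frame_region \<epsilon> k d b1 b2 z1 z2"
  have F: "?F \<in> sets borel" using frame_region_open[OF pos] by simp
  have o: "open (inner_square \<epsilon> v c)" for v c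
    unfolding inner_square_def by (intro open_Collect_conj open_Collect_less continuous_intros)
  have split3: "(\<integral>\<^sup>+x. g x \<partial>lborel) = (\<integral>\<^sup>+v. \<integral>\<^sup>+c. \<integral>\<^sup>+r. g (v, c, r) \<partial>lborel \<partial>lborel \<partial>lborel)"
    if [measurable]: "g \<in> borel_measurable borel" for g :: "(real \<times> real) \<times> (real \<times> real) \<times> (real \<times> real) \<Rightarrow> ennreal"
  proof -
    have "(\<integral>\<^sup>+x. g x \<partial>lborel) = (\<integral>\<^sup>+x. g x \<partial>(lborel \<Otimes>\<^sub>M lborel))" by (simp only: lborel_prod)
    also have "\<dots> = (\<integral>\<^sup>+v. \<integral>\<^sup>+y. g (v, y) \<partial>lborel \<partial>lborel)"
      by (rule lborel.nn_integral_fst[symmetric]) (simp add: lborel_prod)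
    also have "\<dots> = (\<integral>\<^sup>+v. \<integral>\<^sup>+c. \<integral>\<^sup>+r. g (v, c, r) \<partial>lborel \<partial>lborel \<partial>lborel)"
    proof (rule nn_integral_cong)
      fix v
      have m: "(\<lambda>y. g (v, y)) \<in> borel_measurable borel"
        by (rule measurable_compose[OF _ that]) (intro borel_measurable_continuous_onI continuous_intros)
      have "(\<integral>\<^sup>+y. g (v, y) \<partial>lborel) = (\<integral>\<^sup>+y. g (v, y) \<partial>(lborel \<Otimes>\<^sub>M lborel))" by (simp only: lborel_prod)
      also have "\<dots> = (\<integral>\<^sup>+c. \<integral>\<^sup>+r. g (v, c, r) \<partial>lborel \<partial>lborel)"
        using m by (intro lborel.nn_integral_fst[symmetric, where f="\<lambda>y. g (v, y)"]) (simp add: lborel_prod)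
      finally show "(\<integral>\<^sup>+y. g (v, y) \<partial>lborel) = (\<integral>\<^sup>+c. \<integral>\<^sup>+r. g (v, c, r) \<partial>lborel \<partial>lborel)" .
    qed
    finally show ?thesis .
  qed
  have "emeasure lborel ?F = (\<integral>\<^sup>+x. indicator ?F x \<partial>lborel)" using F by simp
  also have "\<dots> = (\<integral>\<^sup>+v. \<integral>\<^sup>+c. \<integral>\<^sup>+r. indicator ?F (v, c, r) \<partial>lborel \<partial>lborel \<partial>lborel)"
    using F by (intro split3) simp
  also have "\<dots> = (\<integral>\<^sup>+v. indicator (cross_region k d b1 b2) v * ennreal (tail_length z1 z2 v) \<partial>lborel)"
  proof (rule nn_integral_cong)
    fix v
    show "(\<integral>\<^sup>+c. \<integral>\<^sup>+r. indicator ?F (v, c, r) \<partial>lborel \<partial>lborel) = indicator (cross_region k d b1 b2) v * ennreal (tail_length z1 z2 v)"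
    proof (cases "v \<in> cross_region k d b1 b2")
      case True
      then have v: "0 < fst v" "0 < snd v" by (auto simp: cross_region_def)
      have "(\<integral>\<^sup>+c. \<integral>\<^sup>+r. indicator ?F (v, c, r) \<partial>lborel \<partial>lborel)
         = (\<integral>\<^sup>+c. indicator (tail_cone z1 z2 v) c * ennreal (1 / (snd v * fst c + fst v * snd c)) \<partial>lborel)"
      proof (rule nn_integral_cong)
        fix c
        show "(\<integral>\<^sup>+r. indicator ?F (v, c, r) \<partial>lborel) = indicator (tail_cone z1 z2 v) c * ennreal (1 / (snd v * fst c + fst v * snd c))"
        proof (cases "c \<in> tail_cone z1 z2 v")
          case c: True
          have "0 \<le> z1 * fst c" using c z by (simp add: tail_cone_def)
          then have "0 < snd c" using c by (auto simp: tail_cone_def)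
          then have p: "0 < snd v * fst c + fst v * snd c"
            using c v by (intro add_pos_pos) (auto simp: tail_cone_def)
          have "(\<integral>\<^sup>+r. indicator ?F (v, c, r) \<partial>lborel) = (\<integral>\<^sup>+r. indicator (inner_square \<epsilon> v c) r \<partial>lborel)"
            using True c by (intro nn_integral_cong) (simp add: frame_region_def indicator_def)
          also have "\<dots> = emeasure lborel (inner_square \<epsilon> v c)" using o by simp
          finally show ?thesis using c emeasure_inner_square[OF \<epsilon> v(2) p] by simp
        qed (simp add: frame_region_def)
      qed
      then show ?thesis using True nn_integral_tail_cone[OF v z] by simp
    qed (simp add: frame_region_def)
  qed
  finally show ?thesis .
qed

section \<open>Counting frames\<close>

lemma ecard_Sigma_ge:
  assumes "\<And>w. w \<in> A \<Longrightarrow> c \<le> ecard (X w)"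
  shows "c * ecard A \<le> ecard (Sigma A X)"
proof (cases "finite A")
  case True
  have "Sigma A X = (\<Union>w\<in>A. Pair w ` X w)" by auto
  also have "ecard \<dots> = (\<Sum>w\<in>A. ecard (Pair w ` X w))"
    using True by (intro ecard_UN_disjoint) (auto simp: disjoint_family_on_def)
  also have "\<dots> = (\<Sum>w\<in>A. ecard (X w))" by (intro sum.cong refl ecard_image inj_onI) auto
  finally have "ecard (Sigma A X) = (\<Sum>w\<in>A. ecard (X w))" .
  moreover have "(\<Sum>w\<in>A. c) \<le> (\<Sum>w\<in>A. ecard (X w))" using assms by (rule sum_mono)
  ultimately show ?thesis using True by (simp add: ecard_finite mult.commute ennreal_of_nat_eq_real_of_nat)
next
  case False
  show ?thesis
  proof (cases "c = 0")
    case c: False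
    have "X w \<noteq> {}" if "w \<in> A" for w using assms[OF that] c by (auto simp: ecard_def)
    then have "A = fst ` Sigma A X" by force
    then have "infinite (Sigma A X)" using False finite_imageI by metis
    then show ?thesis by (simp add: ecard_def)
  qed simp
qed

text \<open>The determinant in \<open>cf_det\<close>: -1 for words of even length and 1 for words of
  odd length.\<close>

definition cf_sign :: "nat list \<Rightarrow> int"
  where "cf_sign w = - ((-1) ^ length w)"

lemma cf_sign_square: "cf_sign w * cf_sign w = 1"
  by (simp add: cf_sign_def flip: power_add mult_2)

text \<open>Coprimality of \<open>a\<^sub>1\<close> and \<open>a\<^sub>3\<close> is imposed only
  modulo \<open>W\<close>, so that for each word the coordinates are lattice points in residue
  classes.\<close>

definition frames :: "bool \<Rightarrow> real set \<Rightarrow> nat \<Rightarrow> (nat list \<times> int \<times> int \<times> int \<times> int) set"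
  where "frames e J W = {(w, u, v, s, t). w \<in> words e J \<and>
    gcd (gcd (int (snd (cf_den w)) * s + int (fst (cf_den w)) * t) (int (snd (cf_den w)) * u + int (fst (cf_den w)) * v)) (int W) = 1}"

definition scaled_frame :: "real \<Rightarrow> nat list \<times> int \<times> int \<times> int \<times> int \<Rightarrow> (real \<times> real) \<times> (real \<times> real) \<times> (real \<times> real)"
  where "scaled_frame R = (\<lambda>(w, u, v, s, t). (scaled_den R w, (of_int u / R, of_int v / R), (of_int s / R, of_int t / R)))"

text \<open>Eventually the factors exceed \<open>c - 1 / (n + 1)\<close>; taking the supremum over
  \<open>n\<close> afterwards covers an infinite \<open>liminf y\<close> as well.\<close>

lemma liminf_mult_tendsto_ge:
  fixes y :: "nat \<Rightarrow> ennreal" and x :: "nat \<Rightarrow> real"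
  assumes x: "x \<longlonglongrightarrow> c"
  shows "ennreal c * liminf y \<le> liminf (\<lambda>i. ennreal (x i) * y i)"
proof -
  have "ennreal (c - 1 / real (Suc n)) * liminf y \<le> liminf (\<lambda>i. ennreal (x i) * y i)" for n
  proof -
    have "ennreal (c - 1 / real (Suc n)) * liminf y \<le> liminf (\<lambda>i. ennreal (c - 1 / real (Suc n)) * y i)"
      by (rule liminf_cmult_ennreal_le)
    also have "\<forall>\<^sub>F i in sequentially. c - 1 / real (Suc n) < x i" using x by (rule order_tendstoD) simp
    then have "liminf (\<lambda>i. ennreal (c - 1 / real (Suc n)) * y i) \<le> liminf (\<lambda>i. ennreal (x i) * y i)"
      by (intro Liminf_mono) (auto elim!: eventually_mono intro!: mult_right_mono ennreal_leI)
    finally show ?thesis .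
  qed
  then have "(SUP n. ennreal (c - 1 / real (Suc n)) * liminf y) \<le> liminf (\<lambda>i. ennreal (x i) * y i)"
    by (intro SUP_least) simp
  moreover have "(SUP n. ennreal (c - 1 / real (Suc n)) * liminf y) = (SUP n. ennreal (c - 1 / real (Suc n))) * liminf y"
    by (rule SUP_mult_right_ennreal[symmetric]) 
  moreover have "(SUP n. ennreal (c - 1 / real (Suc n))) = ennreal c"
  proof (rule LIMSEQ_unique[OF LIMSEQ_SUP])
    show "incseq (\<lambda>n. ennreal (c - 1 / real (Suc n)))"
      by (intro incseq_SucI ennreal_leI) (auto intro!: divide_left_mono)
    have "(\<lambda>n. c - 1 / real (Suc n)) \<longlonglongrightarrow> c - 0"
      using LIMSEQ_inverse_real_of_nat by (intro tendsto_diff tendsto_const) (simp add: inverse_eq_divide)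
    then show "(\<lambda>n. ennreal (c - 1 / real (Suc n))) \<longlonglongrightarrow> ennreal c" by (intro tendsto_ennrealI) simp
  qed
  ultimately show ?thesis by simp
qed

lemma emeasure_lborel_times_box:
  fixes \<Omega> :: "(real \<times> real) set" and a b :: "'a::euclidean_space"
  assumes "\<Omega> \<in> sets borel"
  shows "emeasure lborel (\<Omega> \<times> box a b) = emeasure lborel \<Omega> * emeasure lborel (box a b)"
  using assms by (subst lborel_prod[symmetric], subst lborel.emeasure_pair_measure_Times) auto

text \<open>The words contribute \<open>R^2\<close>, and over every word the lattice points
  contribute \<open>R^4\<close>, with one lower bound for all words because that of
  \<open>card_good_quadruples\<close> is the same for every basis. Hence the exponent 6.\<close>

lemma frames_box:
  fixes R :: "nat \<Rightarrow> real" and a b :: "(real \<times> real) \<times> (real \<times> real) \<times> (real \<times> real)"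
  assumes R: "filterlim R at_top sequentially" and W: "0 < W" and J: "0 \<le> x1" "x1 < x2" "x2 \<le> 1"
  shows "ennreal (\<theta> * (x2 - x1) * residue_density W) * emeasure lborel (box a b \<inter> {x. 0 < fst (fst x) \<and> fst (fst x) < snd (fst x)})
    \<le> liminf (\<lambda>i. emeasure (point_measure_on (1 / R i ^ 6) (scaled_frame (R i)) (frames e {x1<..<x2} W)) (box a b))"
proof -
  define \<Omega> where "\<Omega> = box (fst a) (fst b) \<inter> {v. 0 < fst v} \<inter> {v. fst v < snd v}"
  obtain u1 v1 s1 t1 where a2: "snd a = ((u1, v1), (s1, t1))" by (metis surj_pair)
  obtain u2 v2 s2 t2 where b2: "snd b = ((u2, v2), (s2, t2))" by (metis surj_pair)
  have e: "box a b \<inter> {x. 0 < fst (fst x) \<and> fst (fst x) < snd (fst x)} = \<Omega> \<times> box (snd a) (snd b)"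
    by (subst box_prod) (auto simp: \<Omega>_def)
  have \<Omega>o: "open \<Omega>" unfolding \<Omega>_def by (intro open_Int open_box open_Collect_less continuous_intros)
  have halfs: "{v :: real \<times> real. 0 < fst v} = {v. inner (1, 0) v > 0}" "{v :: real \<times> real. fst v < snd v} = {v. inner (1, -1) v < 0}"
    by (auto simp: inner_prod_def)
  have \<Omega>c: "convex \<Omega>" unfolding \<Omega>_def halfs by (intro convex_Int convex_box convex_halfspace_lt convex_halfspace_gt)
  have \<Omega>s: "\<Omega> \<subseteq> {v. 0 < fst v \<and> fst v < snd v \<and> snd v < snd (fst b)}"
    by (auto simp: \<Omega>_def box_prod[of "fst a" "fst b"])
  have "\<Omega> \<subseteq> box (fst a) (fst b)" by (auto simp: \<Omega>_def)
  then have \<Omega>f: "emeasure lborel \<Omega> < \<infinity>"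
    using emeasure_mono[of \<Omega> "box (fst a) (fst b)" lborel] emeasure_lborel_box_finite[of "fst a" "fst b"]
    by (simp add: le_less_trans)
  show ?thesis
  proof (cases "u1 < u2 \<and> v1 < v2 \<and> s1 < s2 \<and> t1 < t2")
    case False
    then have "box (snd a) (snd b) = {}" unfolding a2 b2 by (auto simp: box_prod)
    then show ?thesis unfolding e by simp
  next
    case True
    define L where "L = (u2 - u1) * ((v2 - v1) * ((s2 - s1) * (t2 - t1)))"
    have L0: "0 \<le> L" unfolding L_def using True by (intro mult_nonneg_nonneg) auto
    have rect: "emeasure lborel (box (p, q) (p', q')) = ennreal ((p' - p) * (q' - q))" if "p < p'" "q < q'" for p q p' q' :: real
      using that by (subst emeasure_lborel_box_eq) (auto simp: Basis_prod_def inner_prod_def mult.commute)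
    have "box (snd a) (snd b) = box (u1, v1) (u2, v2) \<times> box (s1, t1) (s2, t2)"
      unfolding a2 b2 by (subst box_prod) simp
    then have Lb: "emeasure lborel (box (snd a) (snd b)) = ennreal L"
      using True by (simp only: emeasure_lborel_times_box[OF borel_open[OF open_box]] rect L_def)
        (simp add: ennreal_mult[symmetric] mult_ac)
    \<comment> \<open>The lower bound for the number of good residue quadruples, valid for every
      word.\<close>
    define n where "n = real W ^ 2 * real (card (good_residues W))"
    define x where "x i = n * (((u2 - u1) / W - 1 / R i) * (((v2 - v1) / W - 1 / R i) * (((s2 - s1) / W - 1 / R i) * ((t2 - t1) / W - 1 / R i))))" for i
    have lim0: "(\<lambda>i. 1 / R i) \<longlonglongrightarrow> 0"
      using tendsto_inverse_0_at_top[OF R] by (simp add: inverse_eq_divide)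
    have "x \<longlonglongrightarrow> n * (((u2 - u1) / W - 0) * (((v2 - v1) / W - 0) * (((s2 - s1) / W - 0) * ((t2 - t1) / W - 0))))"
      unfolding x_def by (intro tendsto_mult tendsto_diff tendsto_const lim0)
    also have "n * (((u2 - u1) / W - 0) * (((v2 - v1) / W - 0) * (((s2 - s1) / W - 0) * ((t2 - t1) / W - 0)))) = residue_density W * L"
      using W by (simp add: n_def residue_density_def L_def field_simps power2_eq_square)
    finally have xlim: "x \<longlonglongrightarrow> residue_density W * L" .
    define A where "A i = {w \<in> words e {x1<..<x2}. scaled_den (R i) w \<in> \<Omega>}" for i
    have rd: "0 \<le> residue_density W" by (simp add: residue_density_def)
    have "ennreal (\<theta> * (x2 - x1) * residue_density W) * emeasure lborel (\<Omega> \<times> box (snd a) (snd b))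
       = ennreal (residue_density W * L) * ennreal (\<theta> * (x2 - x1) * measure lborel \<Omega>)"
      using \<Omega>f \<Omega>o J theta_pos rd L0 Lb emeasure_lborel_times_box[of \<Omega> "snd a" "snd b"]
      by (simp add: emeasure_eq_ennreal_measure less_top ennreal_mult[symmetric] mult_ac)
    also have "\<dots> \<le> ennreal (residue_density W * L) * liminf (\<lambda>i. ennreal (1 / R i ^ 2) * ecard (A i))"
      unfolding A_def by (intro mult_left_mono words_count[OF R J \<Omega>o \<Omega>c \<Omega>s]) auto
    also have "\<dots> \<le> liminf (\<lambda>i. ennreal (x i) * (ennreal (1 / R i ^ 2) * ecard (A i)))"
      by (rule liminf_mult_tendsto_ge[OF xlim])
    also have "\<dots> \<le> liminf (\<lambda>i. emeasure (point_measure_on (1 / R i ^ 6) (scaled_frame (R i)) (frames e {x1<..<x2} W)) (box a b))"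
    proof (rule Liminf_mono)
      have "\<forall>\<^sub>F i in sequentially. 1 / R i < (u2 - u1) / W" "\<forall>\<^sub>F i in sequentially. 1 / R i < (v2 - v1) / W"
        "\<forall>\<^sub>F i in sequentially. 1 / R i < (s2 - s1) / W" "\<forall>\<^sub>F i in sequentially. 1 / R i < (t2 - t1) / W"
        using True W by (intro order_tendstoD(2)[OF lim0]; simp)+
      moreover have "\<forall>\<^sub>F i in sequentially. 0 < R i" using R by (simp add: filterlim_at_top_dense)
      ultimately show "\<forall>\<^sub>F i in sequentially. ennreal (x i) * (ennreal (1 / R i ^ 2) * ecard (A i))
        \<le> emeasure (point_measure_on (1 / R i ^ 6) (scaled_frame (R i)) (frames e {x1<..<x2} W)) (box a b)"
      proof eventually_elim
        case (elim i)
        let ?Q = "\<lambda>w. quad_points W (int (snd (cf_den w))) (int (fst (cf_den w))) (R i * u1, R i * u2) (R i * v1, R i * v2) (R i * s1, R i * s2) (R i * t1, R i * t2)"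
        have sub: "Sigma (A i) ?Q \<subseteq> {f \<in> frames e {x1<..<x2} W. scaled_frame (R i) f \<in> box a b}"
        proof
          fix f assume "f \<in> Sigma (A i) ?Q"
          then obtain w u v s t where f: "f = (w, u, v, s, t)" "w \<in> A i" "(u, v, s, t) \<in> ?Q w" by auto
          have "(scaled_den (R i) w, ((of_int u / R i, of_int v / R i), (of_int s / R i, of_int t / R i))) \<in> box (fst a, snd a) (fst b, snd b)"
            using f(2,3) elim(5) unfolding box_prod[of "(fst a, _)"] a2 b2
            by (auto simp: A_def \<Omega>_def quad_points_def field_simps box_prod[of "((_, _), (_, _))"] box_prod[of "(_ :: real, _ :: real)"])
          then show "f \<in> {f \<in> frames e {x1<..<x2} W. scaled_frame (R i) f \<in> box a b}"
            using f by (auto simp: A_def quad_points_def frames_def scaled_frame_def)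
        qed
        have c: "ennreal (R i ^ 4 * x i) \<le> ecard (?Q w)" if w: "w \<in> A i" for w
        proof -
          have I: "1 \<le> (snd (R i * p, R i * q) - fst (R i * p, R i * q)) / W" if "1 / R i < (q - p) / W" for p q
            using that elim(5) W by (simp add: field_simps)
          have det: "int (snd (cf_num w)) * int (fst (cf_den w)) - int (fst (cf_num w)) * int (snd (cf_den w)) = cf_sign w"
            unfolding cf_sign_def by (rule cf_det)
          note q = card_quad_points[OF det cf_sign_square W I[OF elim(1)] I[OF elim(2)] I[OF elim(3)] I[OF elim(4)]]
          have r: "(snd (R i * p, R i * q) - fst (R i * p, R i * q)) / W - 1 = R i * ((q - p) / W - 1 / R i)" for p q
            
          proof -
            have "R i * ((q - p) / W - 1 / R i) = R i * ((q - p) / W) - R i * (1 / R i)" by (rule right_diff_distrib)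
            then show ?thesis using elim(5) by (simp add: right_diff_distrib)
          qed
          have "R i ^ 4 * x i = n * (R i * ((u2 - u1) / W - 1 / R i) * (R i * ((v2 - v1) / W - 1 / R i) * (R i * ((s2 - s1) / W - 1 / R i) * (R i * ((t2 - t1) / W - 1 / R i)))))"
            unfolding x_def by (simp only: power4_eq_xxxx mult_ac)
          also have "\<dots> \<le> real (card (?Q w))" using q(1) unfolding r n_def .
          finally show ?thesis using q(2) by (simp add: ecard_finite ennreal_leI)
        qed
        have x0: "0 \<le> x i" unfolding x_def n_def using elim by (intro mult_nonneg_nonneg) auto
        have "ennreal (x i) * (ennreal (1 / R i ^ 2) * ecard (A i)) = ennreal (1 / R i ^ 6) * (ennreal (R i ^ 4 * x i) * ecard (A i))"
        proof -
          have "x i * (1 / R i ^ 2) = 1 / R i ^ 6 * (R i ^ 4 * x i)" using elim(5) by (simp add: field_simps flip: power_add)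
          then show ?thesis using elim(5) x0 by (simp only: mult.assoc[symmetric] ennreal_mult[symmetric] less_imp_le divide_nonneg_nonneg zero_le_power zero_le_one mult_nonneg_nonneg)
        qed
        also have "\<dots> \<le> ennreal (1 / R i ^ 6) * ecard (Sigma (A i) ?Q)"
          using c by (intro mult_left_mono ecard_Sigma_ge) auto
        also have "\<dots> \<le> ennreal (1 / R i ^ 6) * ecard {f \<in> frames e {x1<..<x2} W. scaled_frame (R i) f \<in> box a b}"
          by (intro mult_left_mono ecard_mono sub) auto
        also have "\<dots> = emeasure (point_measure_on (1 / R i ^ 6) (scaled_frame (R i)) (frames e {x1<..<x2} W)) (box a b)"
          by (rule emeasure_point_measure_on[symmetric]) simp
        finally show ?case .
      qed
    qed
    finally show ?thesis unfolding e .
  qed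
qed

text \<open>One factor \<theta> comes from counting words, the other from
  \<open>theta_le_residue_density\<close>. The latter bound is uniform in \<open>W\<close>, so that
  \<open>W = P!\<close> may grow afterwards.\<close>

lemma frames_region_count:
  fixes R :: "nat \<Rightarrow> real"
  assumes R: "filterlim R at_top sequentially" and W: "0 < W" and J: "0 \<le> x1" "x1 < x2" "x2 \<le> 1"
    and pos: "0 \<notin> set (back_digits k d)" and \<epsilon>: "\<epsilon> * \<epsilon> = 1" and z: "0 \<le> z1" "z1 < z2"
  shows "ennreal (\<theta> * (x2 - x1) * \<theta>) * (\<integral>\<^sup>+v. indicator (cross_region k d b1 b2) v * ennreal (tail_length z1 z2 v) \<partial>lborel)
    \<le> liminf (\<lambda>i. ennreal (1 / R i ^ 6) * ecard {f \<in> frames e {x1<..<x2} W. scaled_frame (R i) f \<in> frame_region \<epsilon> k d b1 b2 z1 z2})"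
proof -
  let ?U = "frame_region \<epsilon> k d b1 b2 z1 z2"
  let ?D = "{x :: (real \<times> real) \<times> (real \<times> real) \<times> (real \<times> real). 0 < fst (fst x) \<and> fst (fst x) < snd (fst x)}"
  let ?K = "ennreal (\<theta> * (x2 - x1) * residue_density W)"
  let ?\<nu> = "\<lambda>i. point_measure_on (1 / R i ^ 6) (scaled_frame (R i)) (frames e {x1<..<x2} W)"
  define \<mu> where "\<mu> = density lborel (\<lambda>x. ?K * indicator ?D x)"
  have D[measurable]: "?D \<in> sets borel"
    by (intro borel_open open_Collect_conj open_Collect_less continuous_intros)
  have em: "emeasure \<mu> A = ?K * emeasure lborel (A \<inter> ?D)" if [measurable]: "A \<in> sets borel" for A
  proof -
    have "emeasure \<mu> A = (\<integral>\<^sup>+x. ?K * indicator (A \<inter> ?D) x \<partial>lborel)"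
      unfolding \<mu>_def using D that
      by (subst emeasure_density) (auto simp: indicator_inter_arith mult_ac intro!: nn_integral_cong)
    also have "\<dots> = ?K * emeasure lborel (A \<inter> ?D)"
      using D that by (intro nn_integral_cmult_indicator) (simp add: sets.Int)
    finally show ?thesis .
  qed
  have U: "open ?U" by (rule frame_region_open[OF pos])
  have UD: "?U \<inter> ?D = ?U" by (auto simp: frame_region_def cross_region_def)
  have "ennreal (\<theta> * (x2 - x1) * \<theta>) * emeasure lborel ?U \<le> ?K * emeasure lborel ?U"
    using theta_le_residue_density[OF W] theta_pos J by (intro mult_right_mono ennreal_leI mult_left_mono) auto
  also have "\<dots> = (\<integral>\<^sup>+x. indicator ?U x \<partial>\<mu>)"
    using U em[of ?U] by (simp add: UD nn_integral_indicator \<mu>_def)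
  also have "\<dots> \<le> liminf (\<lambda>i. \<integral>\<^sup>+x. indicator ?U x \<partial>?\<nu> i)"
  proof (rule nn_integral_le_liminf_boxes)
    show "sets \<mu> = sets borel" by (simp add: \<mu>_def)
    show "absolutely_continuous lborel \<mu>"
      unfolding \<mu>_def using D by (intro absolutely_continuousI_density) simp
    show "emeasure \<mu> (box a b) \<le> liminf (\<lambda>i. emeasure (?\<nu> i) (box a b))" for a b
      using frames_box[OF R W J, of a b e] em[of "box a b"] by simp
    show "lsc (indicator ?U :: _ \<Rightarrow> ennreal)"
      using lsc_on_open[OF U, of "\<lambda>_. 1"] by simp
  qed simp
  also have "\<dots> = liminf (\<lambda>i. ennreal (1 / R i ^ 6) * ecard {f \<in> frames e {x1<..<x2} W. scaled_frame (R i) f \<in> ?U})"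
    using U by (simp add: emeasure_point_measure_on)
  finally show ?thesis unfolding emeasure_frame_region[OF pos \<epsilon> z] .
qed

section \<open>From frames back to triples\<close>

definition frame_quadruple :: "nat list \<times> int \<times> int \<times> int \<times> int \<Rightarrow> int \<times> int \<times> int \<times> int"
  where "frame_quadruple = (\<lambda>(w, u, v, s, t).
    (int (snd (cf_den w)) * s + int (fst (cf_den w)) * t,
     cf_sign w * (u * t - v * s),
     int (snd (cf_den w)) * u + int (fst (cf_den w)) * v,
     int (snd (cf_num w)) * u + int (fst (cf_num w)) * v))"

lemma frame_quadruple_facts:
  assumes f: "frame_quadruple (w, u, v, s, t) = (a1, a2, a3, m)"
    and w: "0 \<notin> set w" and R: "1 \<le> R" and z: "0 \<le> z1" "z2 \<le> 1"
    and reg: "scaled_frame R (w, u, v, s, t) \<in> frame_region (of_int (cf_sign w)) k d b1 b2 z1 z2"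
  shows "w \<noteq> []" "real (fst (cf_den w)) < R" "R < real (snd (cf_den w))"
    and "b1 < real (snd (cf_den w)) / R" "real (snd (cf_den w)) / R < b2"
    and "real (fst (cf_den w)) / real (snd (cf_den w)) \<in> cf_cyl (back_digits k d)"
    and "of_int v / of_int u \<in> {z1<..<z2}" "of_int v / of_int u \<in> {0 :: real<..<1}"
    and "0 < a1" "of_int a1 < R ^ 2" "0 < a2" "of_int a2 < R ^ 2" "0 < a3" "of_int a3 < R ^ 2"
    and "of_int m / of_int a3 = cf_val w (of_int v / of_int u)" "m \<in> {0..<a3}" "a3 dvd a1 * m - a2"
proof -
  let ?q = "real (snd (cf_den w))" and ?q' = "real (fst (cf_den w))"
  let ?p = "real (snd (cf_num w))" and ?p' = "real (fst (cf_num w))"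
  have R0: "0 < R" using R by simp
  have cr: "0 < ?q' / R" "?q' / R < 1" "1 < ?q / R" "b1 < ?q / R" "?q / R < b2" "(?q' / R) / (?q / R) \<in> cf_cyl (back_digits k d)"
    and tc: "0 < of_int u / R" "z1 * (of_int u / R) < of_int v / R" "of_int v / R < z2 * (of_int u / R)"
      "?q / R * (of_int u / R) + ?q' / R * (of_int v / R) < 1"
    and sq: "0 < ?q / R * (of_int s / R) + ?q' / R * (of_int t / R)" "?q / R * (of_int s / R) + ?q' / R * (of_int t / R) < 1"
      "0 < of_int (cf_sign w) * (of_int u / R * (of_int t / R) - of_int v / R * (of_int s / R))"
      "of_int (cf_sign w) * (of_int u / R * (of_int t / R) - of_int v / R * (of_int s / R)) < 1"
    using reg by (auto simp: frame_region_def scaled_frame_def scaled_den_def cross_region_def tail_cone_def inner_square_def)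
  show q'R: "?q' < R" and qR: "R < ?q" using cr R0 by (simp_all add: field_simps)
  show "b1 < ?q / R" "?q / R < b2" by (fact cr)+
  show "?q' / ?q \<in> cf_cyl (back_digits k d)" using cr(6) R0 by simp
  show "w \<noteq> []" using qR R by auto
  have u0: "0 < real_of_int u" using tc(1) R0 by (simp add: zero_less_divide_iff)
  have vu: "z1 * of_int u < real_of_int v" "real_of_int v < z2 * of_int u"
    using tc(2,3) R0 by (simp_all add: field_simps)
  show z12: "of_int v / of_int u \<in> {z1<..<z2}" using vu u0 by (simp add: field_simps)
  then show z01: "of_int v / of_int u \<in> {0 :: real<..<1}" using z by auto
  then have v0: "0 < real_of_int v" using u0 by (simp add: zero_less_divide_iff)
  have a: "a1 = int (snd (cf_den w)) * s + int (fst (cf_den w)) * t" "a2 = cf_sign w * (u * t - v * s)"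
    "a3 = int (snd (cf_den w)) * u + int (fst (cf_den w)) * v" "m = int (snd (cf_num w)) * u + int (fst (cf_num w)) * v"
    using f by (simp_all add: frame_quadruple_def)
  have RR: "x / R * (y / R) = x * y / R ^ 2" for x y :: real by (simp add: power2_eq_square)
  have "real_of_int a1 / R ^ 2 = ?q / R * (of_int s / R) + ?q' / R * (of_int t / R)"
    unfolding a RR by (simp add: add_divide_distrib)
  then have 1: "0 < real_of_int a1 / R ^ 2" "real_of_int a1 / R ^ 2 < 1" using sq(1,2) by simp_all
  have "real_of_int a2 / R ^ 2 = of_int (cf_sign w) * (of_int u / R * (of_int t / R) - of_int v / R * (of_int s / R))"
    unfolding a RR by (simp add: diff_divide_distrib right_diff_distrib)
  then have 2: "0 < real_of_int a2 / R ^ 2" "real_of_int a2 / R ^ 2 < 1" using sq(3,4) by simp_all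
  have "real_of_int a3 / R ^ 2 = ?q / R * (of_int u / R) + ?q' / R * (of_int v / R)"
    unfolding a RR by (simp add: add_divide_distrib)
  then have 3: "real_of_int a3 / R ^ 2 < 1" using tc(4) by simp
  show a3: "0 < a3"
  proof -
    have "0 < ?q * of_int u + ?q' * of_int v" using u0 v0 qR R0 by (intro add_pos_nonneg) auto
    also have "?q * of_int u + ?q' * of_int v = of_int a3" unfolding a by simp
    finally show ?thesis by (simp only: of_int_0_less_iff)
  qed
  show "0 < a1" "of_int a1 < R ^ 2" "0 < a2" "of_int a2 < R ^ 2" "of_int a3 < R ^ 2"
    using 1 2 3 R0 by (simp_all add: zero_less_divide_iff divide_less_eq)
  show val: "of_int m / of_int a3 = cf_val w (of_int v / of_int u)"
  proof -
    have "cf_val w (of_int v / of_int u) = (?p + of_int v / of_int u * ?p') / (?q + of_int v / of_int u * ?q')"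
      using z01 by (intro cf_val_eq w) auto
    also have "\<dots> = ((?p + of_int v / of_int u * ?p') * of_int u) / ((?q + of_int v / of_int u * ?q') * of_int u)"
      using u0 by simp
    also have "(?p + of_int v / of_int u * ?p') * of_int u = of_int m"
      unfolding a using u0 by (simp add: field_simps)
    also have "(?q + of_int v / of_int u * ?q') * of_int u = of_int a3"
      unfolding a using u0 by (simp add: field_simps)
    finally show ?thesis ..
  qed
  have "of_int m / of_int a3 \<in> {0 :: real<..<1}" unfolding val by (rule cf_val_in_open_unit[OF w z01])
  then show "m \<in> {0..<a3}" using a3 by (auto simp: zero_less_divide_iff divide_less_eq)
  define p p' q q' where "p = int (snd (cf_num w))" "p' = int (fst (cf_num w))" "q = int (snd (cf_den w))" "q' = int (fst (cf_den w))"
  have det: "cf_sign w = p * q' - p' * q" unfolding cf_sign_def p_p'_q_q'_def using cf_det[of w] by simp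
  \<comment> \<open>The cofactor is the second entry of the vector with coordinates
    \<open>(s, t)\<close>.\<close>
  have "a1 * m - a2 = a3 * (p * s + p' * t)"
    unfolding a p_p'_q_q'_def[symmetric] det by (simp add: algebra_simps)
  then show "a3 dvd a1 * m - a2" by simp
qed

text \<open>The fraction \<open>m / a3\<close> has a unique crossing index, so its digits give back
  the word. In the basis thus known \<open>(a3, m)\<close> determines \<open>(u, v)\<close>, and
  then \<open>a1\<close> and \<open>a2\<close> are two linear equations for \<open>(s, t)\<close>
  with determinant \<open>a3\<close> up to sign, which is not 0.\<close>

lemma frame_quadruple_inj:
  assumes f: "frame_quadruple (w, u, v, s, t) = frame_quadruple (w', u', v', s', t')"
    and w: "0 \<notin> set w" "0 \<notin> set w'" and R: "1 \<le> R" and z: "0 \<le> z1" "z2 \<le> 1"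
    and reg: "scaled_frame R (w, u, v, s, t) \<in> frame_region (of_int (cf_sign w)) k d b1 b2 z1 z2"
      "scaled_frame R (w', u', v', s', t') \<in> frame_region (of_int (cf_sign w')) k d b1 b2 z1 z2"
  shows "(w, u, v, s, t) = (w', u', v', s', t')"
proof -
  obtain a1 a2 a3 m where a: "frame_quadruple (w, u, v, s, t) = (a1, a2, a3, m)" by (metis surj_pair)
  then have a': "frame_quadruple (w', u', v', s', t') = (a1, a2, a3, m)" using f by simp
  note F = frame_quadruple_facts[OF a w(1) R z reg(1)]
  note F' = frame_quadruple_facts[OF a' w(2) R z reg(2)]
  let ?x = "of_int m / of_int a3 :: real"
  have cross: "is_crossing R ?x (length w)" "is_crossing R ?x (length w')"
    using crossing_cf_val(1)[OF w(1) F(1) F(8) F(2,3)] crossing_cf_val(1)[OF w(2) F'(1) F'(8) F'(2,3)] F(15) F'(15) by simp_all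
  have "?x \<in> {0<..<1}" unfolding F(15) by (rule cf_val_in_open_unit[OF w(1) F(8)])
  then have len: "length w = length w'" using cross by (intro is_crossing_unique[of ?x R]) auto
  have ww: "w = w'"
  proof (rule nth_equalityI[OF len])
    fix j assume j: "j < length w"
    have "w ! j = cf_digit ?x (length w - j)" unfolding F(15) using j by (intro cf_digit_cf_val[symmetric] w F(8))
    also have "\<dots> = w' ! j" unfolding F'(15) len using j len by (intro cf_digit_cf_val w F'(8)) auto
    finally show "w ! j = w' ! j" .
  qed
  define p p' q q' where "p = int (snd (cf_num w))" "p' = int (fst (cf_num w))" "q = int (snd (cf_den w))" "q' = int (fst (cf_den w))"
  note c = p_p'_q_q'_def
  have det: "cf_sign w = p * q' - p' * q" unfolding cf_sign_def c using cf_det[of w] by simp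
  have e: "a1 = q * s + q' * t" "a2 = cf_sign w * (u * t - v * s)" "a3 = q * u + q' * v" "m = p * u + p' * v"
    using a by (simp_all add: frame_quadruple_def c)
  have e': "a1 = q * s' + q' * t'" "a2 = cf_sign w * (u' * t' - v' * s')" "a3 = q * u' + q' * v'" "m = p * u' + p' * v'"
    using a' by (simp_all add: frame_quadruple_def c ww)
  have "q' * m - p' * a3 = cf_sign w * u" "p * a3 - q * m = cf_sign w * v" unfolding e det by (simp_all add: algebra_simps)
  moreover have "q' * m - p' * a3 = cf_sign w * u'" "p * a3 - q * m = cf_sign w * v'" unfolding e'(3,4) det by (simp_all add: algebra_simps)
  moreover have s0: "cf_sign w \<noteq> 0" by (simp add: cf_sign_def)
  ultimately have uv: "u = u'" "v = v'" by (metis mult_left_cancel)+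
  have "cf_sign w * (u * t - v * s) = cf_sign w * (u * t' - v * s')" using e(2) e'(2) unfolding uv by (rule trans[OF sym])
  then have d: "u * t - v * s = u * t' - v * s'" using s0 by simp
  have "a3 * s = u * a1 - q' * (u * t - v * s)" "a3 * t = v * a1 + q * (u * t - v * s)"
    unfolding e by (simp_all add: algebra_simps)
  moreover have "a3 * s' = u * a1 - q' * (u * t' - v * s')" "a3 * t' = v * a1 + q * (u * t' - v * s')"
    unfolding e'(1) e(3) by (simp_all add: algebra_simps)
  ultimately have "a3 * s = a3 * s'" "a3 * t = a3 * t'" using d by simp_all
  then have "s = s'" "t = t'" using F(13) by simp_all
  then show ?thesis using ww uv by simp
qed

text \<open>Recording \<open>a\<^sub>1\<^sub>2\<close> as a fourth entry makes triples comparable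
  with the values of \<open>frame_quadruple\<close>.\<close>

definition lift_triple :: "int \<times> int \<times> int \<Rightarrow> int \<times> int \<times> int \<times> int"
  where "lift_triple = (\<lambda>(a1, a2, a3). (a1, a2, a3, (modular_inverse a3 a1 * a2) mod a3))"

lemma finite_Q0: "finite (Q0 N)"
  by (rule finite_subset[of _ "{1..int N} \<times> {1..int N} \<times> {1..int N}"]) (auto simp: Q0_def)

lemma rho_frame:
  assumes f: "frame_quadruple (w, u, v, s, t) = (a1, a2, a3, m)" and N: "1 \<le> N"
    and w: "w \<in> words e J" and z: "0 \<le> z1" "z2 \<le> 1"
    and d: "trunc k d = d" and pos: "0 \<notin> set (back_digits k d)" "0 \<notin> set (fwd_digits k d)" and fwd: "cf_cyl (fwd_digits k d) = {z1<..<z2}"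
    and reg: "scaled_frame (sqrt (real N)) (w, u, v, s, t) \<in> frame_region (of_int (cf_sign w)) k d b1 b2 z1 z2"
    and cop: "coprime a1 a3"
  shows "(a1, a2, a3, m) \<in> lift_triple ` {a \<in> Q0 N. rho a \<in> J \<and> triple_local k N a \<in> {b1<..<b2} \<times> {d}}"
proof -
  have w0: "0 \<notin> set w" using w by (simp add: words_def)
  have R: "1 \<le> sqrt (real N)" using N by simp
  note F = frame_quadruple_facts[OF f w0 R z reg]
  let ?x = "cf_val w (of_int v / of_int u)"
  have bd: "real_of_int a1 < real N" "real_of_int a2 < real N" "real_of_int a3 < real N" using F(10,12,14) by simp_all
  have "a1 < int N" "a2 < int N" "a3 < int N"
    using bd by linarith+
  moreover have g: "gcd a1 a3 = 1" using cop by simp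
  moreover have "gcd a1 (gcd a2 a3) = gcd a2 (gcd a1 a3)" by (rule gcd.left_commute)
  then have "gcd a1 (gcd a2 a3) = 1" unfolding g by simp
  ultimately have Q: "(a1, a2, a3) \<in> Q0 N" using F(9,11,13) unfolding Q0_def by simp
  \<comment> \<open>Coprimality enters here: the congruence determines \<open>m\<close> modulo
    \<open>a3\<close>, and as \<open>m\<close> lies in \<open>{0..<a3}\<close> it is
    \<open>a\<^sub>1\<^sub>2\<close>.\<close>
  have "[a1 * m = a2] (mod a3)" using F(17) by (simp add: cong_iff_dvd_diff)
  then have "[modular_inverse a3 a1 * (a1 * m) = modular_inverse a3 a1 * a2] (mod a3)" by (intro cong_mult cong_refl)
  moreover have "[modular_inverse a3 a1 * a1 * m = 1 * m] (mod a3)" by (intro cong_mult cong_refl cong_modular_inverse2 cop)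
  ultimately have "[modular_inverse a3 a1 * a2 = m] (mod a3)"
    by (metis cong_sym cong_trans mult.assoc mult_1)
  then have m: "(modular_inverse a3 a1 * a2) mod a3 = m" using F(16) by (simp add: cong_def)
  then have rho: "rho (a1, a2, a3) = ?x" using F(15) by simp
  have cross: "is_crossing (sqrt (real N)) ?x (length w)"
    by (rule crossing_cf_val(1)[OF w0 F(1) F(8) F(2,3)])
  have "?x \<in> {0<..<1}" by (rule cf_val_in_open_unit[OF w0 F(8)])
  then have "(THE s. is_crossing (sqrt (real N)) ?x s) = length w"
    using cross by (intro the_equality is_crossing_unique[of ?x "sqrt (real N)"]) auto
  then have "triple_local k N (a1, a2, a3) = cf_local k (sqrt (real N)) ?x (length w)"
    unfolding triple_local_def rho using cross by auto
  moreover have "cf_denom ?x (length w) = snd (cf_den w)" by (rule cf_denom_cf_val_last(1)[OF w0 F(8)])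
  moreover have "cf_window k ?x (length w) = d"
    using F(7) by (intro cf_window_cf_val w0 d pos F(6)) (simp add: fwd)
  ultimately have "triple_local k N (a1, a2, a3) \<in> {b1<..<b2} \<times> {d}"
    using F(4,5) by (simp add: cf_local_def)
  moreover have "rho (a1, a2, a3) \<in> J" unfolding rho using w F(8) by (auto simp: words_def)
  ultimately show ?thesis using Q m by (intro image_eqI[of _ _ "(a1, a2, a3)"]) (auto simp: lift_triple_def)
qed

text \<open>Frames inject into quadruples. If \<open>a1\<close> and \<open>a3\<close> are coprime,
  the image is the lift of a triple of the event. Otherwise their gcd is prime to \<open>P!\<close>
  without being 1, so it exceeds \<open>P\<close> and the image is a bad quadruple.\<close>

lemma frames_le_triples:
  assumes N: "1 \<le> N" and z: "0 \<le> z1" "z2 \<le> 1"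
    and d: "trunc k d = d" and pos: "0 \<notin> set (back_digits k d)" "0 \<notin> set (fwd_digits k d)" and fwd: "cf_cyl (fwd_digits k d) = {z1<..<z2}"
  shows "(\<Sum>e\<in>UNIV. ecard {f \<in> frames e J (fact P). scaled_frame (sqrt (real N)) f \<in> frame_region (if e then -1 else 1) k d b1 b2 z1 z2})
    \<le> ecard {a \<in> Q0 N. rho a \<in> J \<and> triple_local k N a \<in> {b1<..<b2} \<times> {d}} + ecard (bad_quadruples P N)"
proof -
  define F where "F e = {f \<in> frames e J (fact P). scaled_frame (sqrt (real N)) f \<in> frame_region (if e then -1 else 1) k d b1 b2 z1 z2}" for e
  let ?G = "{a \<in> Q0 N. rho a \<in> J \<and> triple_local k N a \<in> {b1<..<b2} \<times> {d}}"
  have R: "1 \<le> sqrt (real N)" using N by simp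
  have F_D: "w \<in> words (even (length w)) J \<and> 0 \<notin> set w \<and> even (length w) = e \<and>
      scaled_frame (sqrt (real N)) (w, u, v, s, t) \<in> frame_region (of_int (cf_sign w)) k d b1 b2 z1 z2"
    if f: "(w, u, v, s, t) \<in> F e" for w u v s t e
  proof -
    have w: "w \<in> words e J" using f by (simp add: F_def frames_def)
    then have "even (length w) = e" "0 \<notin> set w" by (simp_all add: words_def)
    moreover have "of_int (cf_sign w) = (if e then -1 else 1 :: real)" using \<open>even (length w) = e\<close> by (auto simp: cf_sign_def)
    ultimately show ?thesis using f w by (auto simp: F_def)
  qed
  have inj: "inj_on frame_quadruple (F True \<union> F False)"
  proof (rule inj_onI)
    fix f f' assume ff: "f \<in> F True \<union> F False" "f' \<in> F True \<union> F False" and eq: "frame_quadruple f = frame_quadruple f'"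
    obtain w u v s t where f: "f = (w, u, v, s, t)" by (metis surj_pair)
    obtain w' u' v' s' t' where f': "f' = (w', u', v', s', t')" by (metis surj_pair)
    obtain e e' where e: "(w, u, v, s, t) \<in> F e" "(w', u', v', s', t') \<in> F e'" using ff f f' by auto
    show "f = f'" unfolding f f'
      using frame_quadruple_inj[OF eq[unfolded f f'] _ _ R z] F_D[OF e(1)] F_D[OF e(2)] by blast
  qed
  have sub: "frame_quadruple ` (F True \<union> F False) \<subseteq> lift_triple ` ?G \<union> bad_quadruples P N"
  proof
    fix x assume "x \<in> frame_quadruple ` (F True \<union> F False)"
    then obtain w u v s t e where f: "(w, u, v, s, t) \<in> F e" and x: "x = frame_quadruple (w, u, v, s, t)" by auto
    obtain a1 a2 a3 m where a: "x = (a1, a2, a3, m)" by (metis surj_pair)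
    note q = x[unfolded a, symmetric]
    have w: "w \<in> words (even (length w)) J" "0 \<notin> set w"
      and reg: "scaled_frame (sqrt (real N)) (w, u, v, s, t) \<in> frame_region (of_int (cf_sign w)) k d b1 b2 z1 z2"
      using F_D[OF f] by auto
    note Fs = frame_quadruple_facts[OF q w(2) R z reg]
    show "x \<in> lift_triple ` ?G \<union> bad_quadruples P N"
    proof (cases "coprime a1 a3")
      case True
      show ?thesis unfolding a using rho_frame[OF q N w(1) z d pos fwd reg True] by blast
    next
      case False
      have "gcd (gcd a1 a3) (int (fact P)) = 1" using f q by (simp add: F_def frames_def frame_quadruple_def)
      then obtain g where "int P < g" "g dvd a1" "g dvd a3"
        using not_coprime_large_divisor[OF _ False Fs(9)] by metis
      moreover have "real_of_int a1 < real N" "real_of_int a2 < real N" "real_of_int a3 < real N" using Fs(10,12,14) by simp_all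
      ultimately have "x \<in> bad_quadruples P N"
        unfolding a bad_quadruples_def using Fs(9,11,13,16,17) by auto
      then show ?thesis by blast
    qed
  qed
  have "F True \<inter> F False = {}" by (auto simp: F_def frames_def words_def)
  then have "(\<Sum>e\<in>UNIV. ecard (F e)) = ecard (F True \<union> F False)"
    by (simp add: UNIV_bool ecard_Un_disjoint add.commute)
  also have "\<dots> = ecard (frame_quadruple ` (F True \<union> F False))" by (rule ecard_image[OF inj, symmetric])
  also have "\<dots> \<le> ecard (lift_triple ` ?G \<union> bad_quadruples P N)" by (rule ecard_mono[OF sub])
  also have "\<dots> \<le> ecard (lift_triple ` ?G) + ecard (bad_quadruples P N)" by (rule ecard_Un_le)
  also have "ecard (lift_triple ` ?G) = ecard ?G" by (rule ecard_image) (auto simp: inj_on_def lift_triple_def)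
  finally show ?thesis unfolding F_def .
qed

text \<open>The two parities add up to \<open>2 * \<theta>^2 * (x2 - x1)\<close> times the common
  integral, of which the limit law carries \<open>2 * \<theta>\<close>; the remaining
  \<open>\<theta> * (x2 - x1)\<close> is the density of the triples with \<rho> in the interval. Bad
  quadruples cost \<open>3 / P\<close> with \<open>P\<close> arbitrary.\<close>

lemma triples_event:
  assumes d: "trunc k d = d" and J: "0 \<le> x1" "x1 < x2" "x2 \<le> 1"
  shows "ennreal (\<theta> * (x2 - x1)) * emeasure (limit_measure k) ({b1<..<b2} \<times> {d})
    \<le> liminf (\<lambda>N. ennreal (real (card {a \<in> Q0 N. rho a \<in> {x1<..<x2} \<and> triple_local k N a \<in> {b1<..<b2} \<times> {d}}) / real N ^ 3))"
proof (cases "0 \<in> set (back_digits k d) \<or> 0 \<in> set (fwd_digits k d)")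
  case True
  then show ?thesis using limit_measure_event_0[OF d] by simp
next
  case False
  then have pos: "0 \<notin> set (back_digits k d)" "0 \<notin> set (fwd_digits k d)" by auto
  obtain z1 z2 where z: "0 \<le> z1" "z1 < z2" "z2 \<le> 1" and fwd: "cf_cyl (fwd_digits k d) = {z1<..<z2}"
    using cf_cyl_interval[OF pos(2)] by metis
  let ?I = "\<integral>\<^sup>+v. indicator (cross_region k d b1 b2) v * ennreal (tail_length z1 z2 v) \<partial>lborel"
  let ?G = "\<lambda>N. {a \<in> Q0 N. rho a \<in> {x1<..<x2} \<and> triple_local k N a \<in> {b1<..<b2} \<times> {d}}"
  let ?F = "\<lambda>P e N. {f \<in> frames e {x1<..<x2} (fact P). scaled_frame (sqrt (real N)) f \<in> frame_region (if e then -1 else 1) k d b1 b2 z1 z2}"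
  let ?L = "ennreal (\<theta> * (x2 - x1)) * emeasure (limit_measure k) ({b1<..<b2} \<times> {d})"
  have R: "filterlim (\<lambda>N. sqrt (real N)) at_top sequentially"
    by (rule filterlim_compose[OF sqrt_at_top filterlim_real_sequentially])
  have finG: "finite (?G N)" for N by (rule finite_subset[OF _ finite_Q0]) auto
  have low: "?L \<le> liminf (\<lambda>N. ennreal (real (card (?G N)) / real N ^ 3)) + ennreal (3 / real P)" if P: "0 < P" for P
  proof -
    have "?L \<le> ennreal (\<theta> * (x2 - x1)) * (ennreal (2 * \<theta>) * ?I)"
      by (intro mult_left_mono limit_measure_event_le[OF d pos(1) fwd z]) auto
    also have "\<dots> = (\<Sum>e\<in>(UNIV :: bool set). ennreal (\<theta> * (x2 - x1) * \<theta>) * ?I)"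
    proof -
      have "ennreal (\<theta> * (x2 - x1)) * ennreal (2 * \<theta>) = ennreal (\<theta> * (x2 - x1) * (2 * \<theta>))"
        using theta_pos J by (intro ennreal_mult[symmetric]) auto
      also have "\<theta> * (x2 - x1) * (2 * \<theta>) = \<theta> * (x2 - x1) * \<theta> + \<theta> * (x2 - x1) * \<theta>" by simp
      also have "ennreal \<dots> = ennreal (\<theta> * (x2 - x1) * \<theta>) + ennreal (\<theta> * (x2 - x1) * \<theta>)"
        using theta_pos J by (intro ennreal_plus) auto
      finally have A: "ennreal (\<theta> * (x2 - x1)) * ennreal (2 * \<theta>) = ennreal (\<theta> * (x2 - x1) * \<theta>) + ennreal (\<theta> * (x2 - x1) * \<theta>)" .
      have "X * (Y * Z) = (\<Sum>e\<in>(UNIV :: bool set). K * Z)" if "X * Y = K + K" for X Y Z K :: ennreal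
        unfolding mult.assoc[symmetric] that by (simp add: distrib_right mult_2)
      then show ?thesis using A .
    qed
    also have "\<dots> \<le> (\<Sum>e\<in>(UNIV :: bool set). liminf (\<lambda>N. ennreal (1 / sqrt (real N) ^ 6) * ecard (?F P e N)))"
    proof (rule sum_mono)
      fix e :: bool
      show "ennreal (\<theta> * (x2 - x1) * \<theta>) * ?I \<le> liminf (\<lambda>N. ennreal (1 / sqrt (real N) ^ 6) * ecard (?F P e N))"
        by (rule frames_region_count[OF R _ J pos(1) _ z(1,2)]) auto
    qed
    also have "\<dots> \<le> liminf (\<lambda>N. \<Sum>e\<in>(UNIV :: bool set). ennreal (1 / sqrt (real N) ^ 6) * ecard (?F P e N))"
      by (rule liminf_sum_ennreal) simp
    also have "\<dots> \<le> liminf (\<lambda>N. ennreal (3 / real P) + ennreal (real (card (?G N)) / real N ^ 3))"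
    proof (rule Liminf_mono, rule eventually_mono[OF eventually_ge_at_top[of 1]])
      fix N :: nat assume N: "1 \<le> N"
      have s6: "sqrt (real N) ^ 6 = real N ^ 3" using power_mult[of "sqrt (real N)" 2 3] by simp
      have "(\<Sum>e\<in>(UNIV :: bool set). ennreal (1 / sqrt (real N) ^ 6) * ecard (?F P e N))
        = ennreal (1 / real N ^ 3) * (\<Sum>e\<in>(UNIV :: bool set). ecard (?F P e N))"
        by (simp only: s6 sum_distrib_left)
      also have "\<dots> \<le> ennreal (1 / real N ^ 3) * (ecard (?G N) + ecard (bad_quadruples P N))"
        by (intro mult_left_mono frames_le_triples N z d pos fwd) auto
      also have "\<dots> = ennreal (1 / real N ^ 3) * ennreal (real (card (?G N)) + real (card (bad_quadruples P N)))"
        by (simp only: ecard_finite[OF finG] ecard_finite[OF finite_bad_quadruples] ennreal_plus of_nat_0_le_iff)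
      also have "\<dots> = ennreal (1 / real N ^ 3 * (real (card (?G N)) + real (card (bad_quadruples P N))))"
        by (rule ennreal_mult[symmetric]) auto
      also have "\<dots> \<le> ennreal (3 / real P + real (card (?G N)) / real N ^ 3)"
      proof (rule ennreal_leI)
        have "real (card (bad_quadruples P N)) / real N ^ 3 \<le> 3 / real P"
          using card_bad_quadruples[OF P, of N] N by (simp add: field_simps)
        then show "1 / real N ^ 3 * (real (card (?G N)) + real (card (bad_quadruples P N))) \<le> 3 / real P + real (card (?G N)) / real N ^ 3"
          by (simp add: add_divide_distrib)
      qed
      also have "\<dots> = ennreal (3 / real P) + ennreal (real (card (?G N)) / real N ^ 3)"
        by (rule ennreal_plus) auto
      finally show "(\<Sum>e\<in>(UNIV :: bool set). ennreal (1 / sqrt (real N) ^ 6) * ecard (?F P e N)) \<le> ennreal (3 / real P) + ennreal (real (card (?G N)) / real N ^ 3)" .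
    qed
    also have "\<dots> = ennreal (3 / real P) + liminf (\<lambda>N. ennreal (real (card (?G N)) / real N ^ 3))"
      by (rule Liminf_const_add) auto
    finally show ?thesis by (simp add: add.commute)
  qed
  show ?thesis
  proof (rule ennreal_le_epsilon)
    fix e :: real assume e: "0 < e"
    obtain P where P: "3 / e < real P" using reals_Archimedean2 by blast
    moreover have "0 < 3 / e" using e by simp
    ultimately have P0: "0 < P" by (cases P) auto
    have "3 / real P \<le> e" using P e P0 by (simp add: field_simps)
    then show "?L \<le> liminf (\<lambda>N. ennreal (real (card (?G N)) / real N ^ 3)) + ennreal e"
      using low[OF P0] by (meson add_left_mono ennreal_leI order_trans)
  qed
qed

section \<open>Conditioning on the first digits\<close>

lemma trunc_triple_local: "trunc k (snd (triple_local k N a)) = snd (triple_local k N a)"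
  by (auto simp: triple_local_def trunc_cf_local) (auto simp: trunc_def)

text \<open>Coprimality of \<open>a1\<close> and \<open>a3\<close> already makes the gcd of the
  triple 1, so \<open>a2\<close> is free.\<close>

lemma card_Q0: "card (Q0 N) = N * card (coprime_pairs N)"
proof -
  have "bij_betw (\<lambda>(a1, a2, a3). (a2, (a1, a3))) (Q0 N) ({1..int N} \<times> coprime_pairs N)"
  proof (rule bij_betw_byWitness[of _ "\<lambda>(a2, (a1, a3)). (a1, a2, a3)"])
    show "(\<lambda>(a1, a2, a3). (a2, (a1, a3))) ` Q0 N \<subseteq> {1..int N} \<times> coprime_pairs N"
      by (auto simp: Q0_def coprime_pairs_def)
    show "(\<lambda>(a2, (a1, a3)). (a1, a2, a3)) ` ({1..int N} \<times> coprime_pairs N) \<subseteq> Q0 N"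
    proof safe
      fix a1 a2 a3 assume a: "a2 \<in> {1..int N}" "(a1, a3) \<in> coprime_pairs N"
      then have g: "gcd a1 a3 = 1" by (simp add: coprime_pairs_def)
      have "gcd a1 (gcd a2 a3) = gcd a2 (gcd a1 a3)" by (rule gcd.left_commute)
      then have "gcd a1 (gcd a2 a3) = 1" unfolding g by simp
      then show "(a1, a2, a3) \<in> Q0 N" using a g unfolding Q0_def coprime_pairs_def by simp
    qed
  qed auto
  then show ?thesis by (simp add: bij_betw_same_card card_cartesian_product)
qed

text \<open>The bounds of \<open>triples_event\<close> are added over all events by taking the
  integrand 1 in \<open>nn_integral_le_liminf_windows\<close>, with windows of width 1. As the limit
  law has mass 1, the sum is the full \<open>\<theta> * (x2 - x1)\<close>.\<close>

lemma triples_interval: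
  assumes J: "0 \<le> x1" "x1 \<le> x2" "x2 \<le> 1"
  shows "ennreal (\<theta> * (x2 - x1)) \<le> liminf (\<lambda>N. ennreal (real (card {a \<in> Q0 N. rho a \<in> {x1<..<x2}}) / real N ^ 3))"
proof (cases "x1 = x2")
  case True
  then show ?thesis by simp
next
  case False
  define c where "c = \<theta> * (x2 - x1)"
  have x12: "x1 < x2" using False J by simp
  have c: "0 < c" unfolding c_def using theta_pos x12 by simp
  let ?\<nu> = "\<lambda>N. point_measure_on (1 / (c * real N ^ 3)) (triple_local 0 N) {a \<in> Q0 N. rho a \<in> {x1<..<x2}}"
  have fin: "finite {a \<in> {a \<in> Q0 N. rho a \<in> {x1<..<x2}}. Q a}" for N Q by (rule finite_subset[OF _ finite_Q0]) auto
  have em: "emeasure (?\<nu> N) A = ennreal (1 / c) * ennreal (real (card {a \<in> {a \<in> Q0 N. rho a \<in> {x1<..<x2}}. triple_local 0 N a \<in> A}) / real N ^ 3)"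
    if "A \<in> sets borel" for A N
    using c by (simp only: emeasure_point_measure_on[OF that] ecard_finite[OF fin]) (simp add: ennreal_mult[symmetric])
  have tr: "AE y in ?\<nu> N. trunc 0 (snd y) = snd y" for N
  proof (rule AE_I[of _ _ "- {y. trunc 0 (snd y) = snd y}"])
    show m: "- {y. trunc 0 (snd y) = snd y} \<in> sets (?\<nu> N)"
      unfolding sets_point_measure_on using trunc_eq_measurable by (rule borel_comp)
    show "emeasure (?\<nu> N) (- {y. trunc 0 (snd y) = snd y}) = 0"
      using m by (subst em) (simp_all add: trunc_triple_local)
  qed auto
  have "(\<integral>\<^sup>+y. ennreal ((\<lambda>_. 1) y) \<partial>limit_measure 0) \<le> liminf (\<lambda>N. \<integral>\<^sup>+y. ennreal ((\<lambda>_. 1) y) \<partial>?\<nu> N)"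
  proof (rule nn_integral_le_liminf_windows[OF _ _ limit_measure_trunc tr limit_measure_noatom])
    fix b1 b2 :: real and d assume "b1 < b2" and d: "trunc 0 d = d"
    have "emeasure (limit_measure 0) ({b1<..<b2} \<times> {d}) = ennreal (1 / c) * (ennreal c * emeasure (limit_measure 0) ({b1<..<b2} \<times> {d}))"
      using c by (simp add: mult.assoc[symmetric] ennreal_mult[symmetric])
    also have "\<dots> \<le> ennreal (1 / c) * liminf (\<lambda>N. ennreal (real (card {a \<in> Q0 N. rho a \<in> {x1<..<x2} \<and> triple_local 0 N a \<in> {b1<..<b2} \<times> {d}}) / real N ^ 3))"
      unfolding c_def by (intro mult_left_mono triples_event d J x12) auto
    also have "\<dots> \<le> liminf (\<lambda>N. ennreal (1 / c) * ennreal (real (card {a \<in> Q0 N. rho a \<in> {x1<..<x2} \<and> triple_local 0 N a \<in> {b1<..<b2} \<times> {d}}) / real N ^ 3))"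
      by (rule liminf_cmult_ennreal_le)
    finally show "emeasure (limit_measure 0) ({b1<..<b2} \<times> {d}) \<le> liminf (\<lambda>N. emeasure (?\<nu> N) ({b1<..<b2} \<times> {d}))"
      by (subst em[OF box_event_measurable]) simp
  qed (use limit_measure_prob in auto)
  moreover have "emeasure (limit_measure 0) (space (limit_measure 0)) = 1"
    using limit_measure_prob by (intro prob_space.emeasure_space_1) auto
  moreover have "emeasure (?\<nu> N) (space (?\<nu> N)) = ennreal (1 / c) * ennreal (real (card {a \<in> Q0 N. rho a \<in> {x1<..<x2}}) / real N ^ 3)" for N
    using em[of UNIV N] by (simp add: sets_eq_imp_space_eq[OF sets_point_measure_on])
  ultimately have "1 \<le> liminf (\<lambda>N. ennreal (1 / c) * ennreal (real (card {a \<in> Q0 N. rho a \<in> {x1<..<x2}}) / real N ^ 3))"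
    by simp
  then have "ennreal c * 1 \<le> ennreal c * liminf (\<lambda>N. ennreal (1 / c) * ennreal (real (card {a \<in> Q0 N. rho a \<in> {x1<..<x2}}) / real N ^ 3))"
    by (rule mult_left_mono) simp
  also have "\<dots> \<le> liminf (\<lambda>N. ennreal c * (ennreal (1 / c) * ennreal (real (card {a \<in> Q0 N. rho a \<in> {x1<..<x2}}) / real N ^ 3)))"
    by (rule liminf_cmult_ennreal_le)
  also have "\<dots> = liminf (\<lambda>N. ennreal (real (card {a \<in> Q0 N. rho a \<in> {x1<..<x2}}) / real N ^ 3))"
    using c by (simp add: mult.assoc[symmetric] ennreal_mult[symmetric])
  finally show ?thesis unfolding c_def by simp
qed

lemma rho_unit: "a \<in> Q0 N \<Longrightarrow> rho a \<in> {0..<1}"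
  by (cases a) (auto simp: Q0_def divide_less_eq)

lemma finite_Q0_cond: "finite (Q0_cond N l h)"
  by (rule finite_subset[OF _ finite_Q0]) (auto simp: Q0_cond_def)

text \<open>A tail strictly between 0 and 1 yields the prescribed digits; conversely these digits
  also allow the tail 0, where \<rho> is an end point. Hence the open interval in one inclusion and
  the closed one in the other.\<close>

lemma Q0_cond_interval:
  assumes h: "\<And>j. j \<in> {1..l} \<Longrightarrow> h j \<ge> 1"
  obtains x1 x2 where "0 \<le> x1" "x1 < x2" "x2 \<le> 1"
    "\<forall>N. {a \<in> Q0 N. rho a \<in> {x1<..<x2}} \<subseteq> Q0_cond N l h"
    "\<forall>N. \<forall>a\<in>Q0_cond N l h. rho a \<in> {x1..x2}"
proof -
  define g where "g = map h [1..<Suc l]"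
  have g0: "0 \<notin> set g" using h by (fastforce simp: g_def)
  have gn: "length g = l" "\<And>j. j < l \<Longrightarrow> g ! j = h (Suc j)" by (simp_all add: g_def del: upt_Suc)
  obtain x1 x2 where x: "0 \<le> x1" "x1 < x2" "x2 \<le> 1" and cyl: "cf_cyl g = {x1<..<x2}" and im: "cf_val (rev g) ` {0..1} \<subseteq> {x1..x2}"
    using cf_cyl_interval[OF g0] by metis
  show ?thesis
  proof (rule that[OF x]; intro allI ballI)
    fix N
    show "{a \<in> Q0 N. rho a \<in> {x1<..<x2}} \<subseteq> Q0_cond N l h"
    proof safe
      fix a1 a2 a3 assume a: "(a1, a2, a3) \<in> Q0 N" and r: "rho (a1, a2, a3) \<in> {x1<..<x2}"
      then obtain z where z: "z \<in> {0<..<1}" "rho (a1, a2, a3) = cf_val (rev g) z" unfolding cyl[symmetric] cf_cyl_def by auto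
      have "cf_digit (rho (a1, a2, a3)) j = h j" if j: "j \<in> {1..l}" for j
      proof -
        obtain i where i: "j = Suc i" "i < l" using j by (cases j) auto
        show ?thesis unfolding i(1) z(2) gn(2)[OF i(2), symmetric] using i gn by (intro cf_digit_cf_val_rev g0 z(1)) simp
      qed
      then show "(a1, a2, a3) \<in> Q0_cond N l h" using a by (simp add: Q0_cond_def del: rho.simps)
    qed
  next
    fix N a assume a: "a \<in> Q0_cond N l h"
    then have u: "rho a \<in> {0..<1}" using rho_unit unfolding Q0_cond_def by blast
    have "rho a = cf_val (rev g) ((gauss_map ^^ length g) (rho a))"
    proof (rule cf_digits_imp_cf_val[OF u g0])
      fix j assume "j < length g"
      then show "cf_digit (rho a) (Suc j) = g ! j" using a gn by (simp add: Q0_cond_def del: cf_digit.simps)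
    qed
    moreover have "(gauss_map ^^ length g) (rho a) \<in> {0..1}" using funpow_gauss_map_unit[OF u, of "length g"] by auto
    ultimately show "rho a \<in> {x1..x2}" using im by (metis image_subset_iff)
  qed
qed

text \<open>\<open>triples_interval\<close> bounds the count from below. The upper bound comes from
  the complement: \<open>{0<..<x1}\<close> and \<open>{x2<..<1}\<close> receive at least their
  shares, and by \<open>card_Q0\<close> and \<open>coprime_ratio_tendsto\<close> the total is
  \<theta> in units of \<open>N^3\<close>.\<close>

lemma Q0_cond_density:
  assumes x: "0 \<le> x1" "x1 < x2" "x2 \<le> 1"
    and sub: "\<And>N. {a \<in> Q0 N. rho a \<in> {x1<..<x2}} \<subseteq> Q0_cond N l h"
    and sup: "\<And>N a. a \<in> Q0_cond N l h \<Longrightarrow> rho a \<in> {x1..x2}"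
  shows "(\<lambda>N. real (card (Q0_cond N l h)) / real N ^ 3) \<longlonglongrightarrow> \<theta> * (x2 - x1)"
proof (rule order_tendstoI)
  define X where "X y1 y2 N = real (card {a \<in> Q0 N. rho a \<in> {y1<..<y2}}) / real N ^ 3" for y1 y2 :: real and N
  have ev: "\<forall>\<^sub>F N in sequentially. \<theta> * (y2 - y1) - e < X y1 y2 N" if y: "0 \<le> y1" "y1 \<le> y2" "y2 \<le> 1" and e: "0 < e" for y1 y2 e
    unfolding X_def using theta_pos y e by (intro eventually_gt_liminf triples_interval) auto
  {
    fix c assume c: "c < \<theta> * (x2 - x1)"
    show "\<forall>\<^sub>F N in sequentially. c < real (card (Q0_cond N l h)) / real N ^ 3"
    proof (rule eventually_mono[OF ev[of x1 x2 "\<theta> * (x2 - x1) - c"]])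
      fix N assume "\<theta> * (x2 - x1) - (\<theta> * (x2 - x1) - c) < X x1 x2 N"
      also have "X x1 x2 N \<le> real (card (Q0_cond N l h)) / real N ^ 3"
        unfolding X_def by (intro divide_right_mono of_nat_mono card_mono finite_Q0_cond sub) auto
      finally show "c < real (card (Q0_cond N l h)) / real N ^ 3" by simp
    qed (use x c in auto)
  next
    fix c assume c: "\<theta> * (x2 - x1) < c"
    \<comment> \<open>Three errors add up: one for each of the two side intervals and one for the
      total.\<close>
    define e where "e = (c - \<theta> * (x2 - x1)) / 3"
    have e: "0 < e" using c by (simp add: e_def)
    have "\<forall>\<^sub>F N in sequentially. \<theta> * (x1 - 0) - e < X 0 x1 N" "\<forall>\<^sub>F N in sequentially. \<theta> * (1 - x2) - e < X x2 1 N"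
      using x e by (intro ev; simp)+
    moreover have "\<forall>\<^sub>F N in sequentially. coprime_ratio N < \<theta> + e"
      using coprime_ratio_tendsto e by (intro order_tendstoD(2)) auto
    ultimately show "\<forall>\<^sub>F N in sequentially. real (card (Q0_cond N l h)) / real N ^ 3 < c"
      using eventually_gt_at_top[of 0]
    proof eventually_elim
      case (elim N)
      let ?A = "{a \<in> Q0 N. rho a \<in> {0<..<x1}}" and ?B = "{a \<in> Q0 N. rho a \<in> {x2<..<1}}"
      have fin: "finite ?A" "finite ?B" by (rule finite_subset[OF _ finite_Q0], auto)+
      have AB: "?A \<inter> ?B = {}" using x by auto
      have CAB: "Q0_cond N l h \<inter> (?A \<union> ?B) = {}" using sup by fastforce
      have "card (Q0_cond N l h) + (card ?A + card ?B) = card (Q0_cond N l h \<union> (?A \<union> ?B))"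
        unfolding card_Un_disjoint[OF fin AB, symmetric]
        by (rule card_Un_disjoint[OF finite_Q0_cond finite_UnI[OF fin] CAB, symmetric])
      also have "\<dots> \<le> card (Q0 N)" by (intro card_mono finite_Q0) (auto simp: Q0_cond_def)
      finally have "real (card (Q0_cond N l h) + (card ?A + card ?B)) \<le> real (card (Q0 N))" by (rule of_nat_mono)
      then have le: "real (card (Q0_cond N l h)) + (real (card ?A) + real (card ?B)) \<le> real (card (Q0 N))"
        unfolding of_nat_add .
      have "real (card (Q0_cond N l h)) / real N ^ 3 + (X 0 x1 N + X x2 1 N) \<le> real (card (Q0 N)) / real N ^ 3"
        unfolding X_def add_divide_distrib[symmetric] using le by (rule divide_right_mono) simp
      also have "\<dots> = coprime_ratio N"
        using elim(4) by (simp add: card_Q0 coprime_ratio_def power3_eq_cube power2_eq_square)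
      finally have "real (card (Q0_cond N l h)) / real N ^ 3 < (\<theta> + e) - (\<theta> * (x1 - 0) - e) - (\<theta> * (1 - x2) - e)"
        using elim by linarith
      also have "\<dots> = c" by (simp add: e_def field_simps)
      finally show ?case .
    qed
  }
qed

lemma cond_law_prob:
  assumes "Q0_cond N l h \<noteq> {}"
  shows "prob_space (cond_law k l h N)"
  unfolding cond_law_def
  by (intro prob_space.prob_space_distr prob_space_uniform_count_measure finite_Q0_cond assms) simp

lemma emeasure_cond_law:
  assumes "A \<in> sets borel"
  shows "emeasure (cond_law k l h N) A
    = ennreal (real (card {a \<in> Q0_cond N l h. triple_local k N a \<in> A}) / real (card (Q0_cond N l h)))"
proof -
  have "emeasure (cond_law k l h N) A = emeasure (uniform_count_measure (Q0_cond N l h)) (triple_local k N -` A \<inter> Q0_cond N l h)"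
    using assms unfolding cond_law_def by (subst emeasure_distr) (auto simp: space_uniform_count_measure)
  also have "triple_local k N -` A \<inter> Q0_cond N l h = {a \<in> Q0_cond N l h. triple_local k N a \<in> A}" by auto
  finally show ?thesis by (simp add: emeasure_uniform_count_measure finite_Q0_cond)
qed

theorem theorem4:
  fixes k l :: nat and h :: "nat \<Rightarrow> nat"
  assumes "k > 0" and "l \<ge> 1" and "\<And>j. j \<in> {1..l} \<Longrightarrow> h j \<ge> 1"
  shows "weakly_converges (cond_law k l h) (limit_law k) sequentially"
proof -
  obtain x1 x2 where x: "0 \<le> x1" "x1 < x2" "x2 \<le> 1"
    and sub': "\<forall>N. {a \<in> Q0 N. rho a \<in> {x1<..<x2}} \<subseteq> Q0_cond N l h"
    and sup': "\<forall>N. \<forall>a\<in>Q0_cond N l h. rho a \<in> {x1..x2}"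
    by (rule Q0_cond_interval[of l h]) (erule assms(3), rule that)
  note sub = sub'[rule_format] and sup = sup'[rule_format]
  define c where "c = \<theta> * (x2 - x1)"
  have c: "0 < c" unfolding c_def using theta_pos x by simp
  have dens: "(\<lambda>N. real (card (Q0_cond N l h)) / real N ^ 3) \<longlonglongrightarrow> c"
    unfolding c_def by (rule Q0_cond_density[OF x sub sup])
  have ne: "\<forall>\<^sub>F N in sequentially. Q0_cond N l h \<noteq> {}"
    using order_tendstoD(1)[OF dens c] by (rule eventually_mono) auto
  \<comment> \<open>For finitely many \<open>N\<close> the conditioning set may be empty, and
    \<open>cond_law\<close> is then not a probability measure; the limit law takes its
    place.\<close>
  define \<nu> where "\<nu> N = (if Q0_cond N l h = {} then limit_measure k else cond_law k l h N)" for N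
  have sets_cond: "sets (cond_law k l h N) = sets borel" for N by (simp add: cond_law_def)
  have low: "emeasure (limit_measure k) ({b1<..<b2} \<times> {d}) \<le> liminf (\<lambda>N. emeasure (\<nu> N) ({b1<..<b2} \<times> {d}))"
    if d: "trunc k d = d" for b1 b2 d
  proof -
    let ?E = "{b1<..<b2} \<times> {d}"
    let ?X = "\<lambda>N. ennreal (real (card {a \<in> Q0 N. rho a \<in> {x1<..<x2} \<and> triple_local k N a \<in> ?E}) / real N ^ 3)"
    \<comment> \<open>Passing from the normalisation \<open>N^3\<close> to the size of the
      conditioning set contributes the factor \<open>1 / c\<close>, which cancels the
      \<open>c\<close> in \<open>triples_event\<close>. At this point the prescribed digits drop
      out.\<close>
    have "(\<lambda>N. inverse (real (card (Q0_cond N l h)) / real N ^ 3)) \<longlonglongrightarrow> inverse c"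
      using dens c by (intro tendsto_inverse) auto
    then have y: "(\<lambda>N. real N ^ 3 / real (card (Q0_cond N l h))) \<longlonglongrightarrow> 1 / c" by (simp add: inverse_eq_divide)
    have "emeasure (limit_measure k) ?E = ennreal (1 / c) * (ennreal c * emeasure (limit_measure k) ?E)"
      using c by (simp add: mult.assoc[symmetric] ennreal_mult[symmetric])
    also have "\<dots> \<le> ennreal (1 / c) * liminf ?X"
      unfolding c_def by (intro mult_left_mono triples_event d x) auto
    also have "\<dots> \<le> liminf (\<lambda>N. ennreal (real N ^ 3 / real (card (Q0_cond N l h))) * ?X N)"
      by (rule liminf_mult_tendsto_ge[OF y])
    also have "\<dots> \<le> liminf (\<lambda>N. emeasure (\<nu> N) ?E)"
    proof (rule Liminf_mono, use ne eventually_gt_at_top[of 0] in eventually_elim)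
      case (elim N)
      have "ennreal (real N ^ 3 / real (card (Q0_cond N l h))) * ?X N
        = ennreal (real (card {a \<in> Q0 N. rho a \<in> {x1<..<x2} \<and> triple_local k N a \<in> ?E}) / real (card (Q0_cond N l h)))"
        using elim(2) by (simp add: ennreal_mult[symmetric])
      also have "\<dots> \<le> ennreal (real (card {a \<in> Q0_cond N l h. triple_local k N a \<in> ?E}) / real (card (Q0_cond N l h)))"
        using sub[of N] by (intro ennreal_leI divide_right_mono of_nat_mono card_mono) (auto simp: finite_Q0_cond)
      also have "\<dots> = emeasure (\<nu> N) ?E"
        using elim(1) by (simp add: \<nu>_def emeasure_cond_law[OF box_event_measurable])
      finally show ?case .
    qed
    finally show ?thesis .
  qed
  have tr: "AE y in \<nu> N. trunc k (snd y) = snd y" for N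
  proof (cases "Q0_cond N l h = {}")
    case False
    have "triple_local k N \<in> measurable (uniform_count_measure (Q0_cond N l h)) borel" by simp
    then have "AE y in cond_law k l h N. trunc k (snd y) = snd y"
      unfolding cond_law_def using trunc_eq_measurable by (subst AE_distr_iff) (auto simp: trunc_triple_local)
    moreover have "\<nu> N = cond_law k l h N" using False by (simp add: \<nu>_def)
    ultimately show ?thesis by (simp only:)
  next
    case True
    then have "\<nu> N = limit_measure k" by (simp add: \<nu>_def)
    then show ?thesis using limit_measure_trunc[of k] by (simp only:)
  qed
  show ?thesis
    unfolding weakly_converges_def limit_law_eq
  proof (intro allI impI)
    fix f :: "real \<times> (int \<Rightarrow> nat) \<Rightarrow> real"
    assume f: "continuous_on UNIV f" "bounded (range f)"
    have "(\<lambda>N. integral\<^sup>L (\<nu> N) f) \<longlonglongrightarrow> integral\<^sup>L (limit_measure k) f"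
    proof (rule tendsto_integral_from_cells[OF _ _ _ _ limit_measure_trunc tr limit_measure_noatom low f])
      show "prob_space (\<nu> N)" "sets (\<nu> N) = sets borel" for N
        using limit_measure_prob cond_law_prob sets_cond by (auto simp: \<nu>_def)
    qed (use limit_measure_prob in auto)
    then show "(\<lambda>N. integral\<^sup>L (cond_law k l h N) f) \<longlonglongrightarrow> integral\<^sup>L (limit_measure k) f"
    proof (rule Lim_transform_eventually)
      show "\<forall>\<^sub>F N in sequentially. integral\<^sup>L (\<nu> N) f = integral\<^sup>L (cond_law k l h N) f"
        using ne by (rule eventually_mono) (simp add: \<nu>_def)
    qed
  qed
qed

end
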